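(* Let $s:(N,\mathcal{F})\to M$ be a locally trivial fiber bundle of foliations with connected fibers. The following conditions are equivalent. (i) The bundle $s:(N,\mathcal{F})\to M$ is developable. (ii) The foliation $\Pi^{s}(\mathcal{F})$ of $\Pi^{s}(N)$ is strictly simple. (iii) For any open subset $U$ of $M$ with a section $\sigma: U\to N$ of $s$, the restriction of the foliation $\Pi^{s}(\mathcal{F})$ to $\Pi^{s}_{\sigma}(N)$ is strictly simple.
   Context: A locally trivial fiber bundle of foliations $s:(N,\mathcal{F})\to M$ is a surjective submersion $s:N\to M$ together with a foliation $\mathcal{F}$ of $N$ whose leaves lie in the fibers of $s$, such that for all $x_0,x\in M$ there are an open neighbourhood $U$ of $x$ and a diffeomorphism $s^{-1}(U)\to N_{x_0}\times U$ over $U$ mapping $\mathcal{F}|_{s^{-1}(U)}$ to $\mathcal{F}_{x_0}\times 0$ (leaves $L\times\{u\}$, $L$ a leaf of $\mathcal{F}_{x_0}$). Here $N_x=s^{-1}(x)$ and $\mathcal{F}_x=\mathcal{F}|_{N_x}$. A foliation $\mathcal{F}$ of $N$ is strictly simple if the leaf space $N/\mathcal{F}$ has a structure of a Hausdorff manifold such that $N\to N/\mathcal{F}$ is a submersion. A foliation of a manifold is developable if its pull-back to the universal covering space is strictly simple. The bundle $s:(N,\mathcal{F})\to M$ is developable if the foliation $(N_x,\mathcal{F}_x)$ is developable for every $x\in M$. $\Pi^s(N)$ is the monodromy groupoid of the foliation of $N$ by the fibers of $s$ (the fiberwise fundamental groupoid): a Lie groupoid over $N$ whose arrows are homotopy classes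 (with fixed end-points, inside a fiber) of paths in the fibers of $s$. The map $(\mathrm{t},\mathrm{s}):\Pi^s(N)\to N\times_M N$ (target, source) is a covering projection, and $\Pi^s(\mathcal{F})=(\mathrm{t},\mathrm{s})^*(\mathcal{F}\times 0)$ is the pull-back of the foliation $\mathcal{F}\times 0$ of $N\times_M N$ with leaves $L\times\{y\}$ ($L$ a leaf of $\mathcal{F}$ in the same $s$-fiber as $y$). For a local section $\sigma:U\to N$ of $s$, $U\subset M$ open, $\Pi^s_\sigma(N)$ is the pull-back of $\mathrm{s}:\Pi^s(N)\to N$ along $\sigma$, i.e. the space of homotopy classes of paths in $s$-fibers starting at points of $\sigma(U)$; the restriction of $\Pi^s(\mathcal{F})$ to it equals the pull-back of $\mathcal{F}|_{s^{-1}(U)}$ along the target map $\mathrm{t}:\Pi^s_\sigma(N)\to s^{-1}(U)$. *)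

theory Defs
  imports "HOL-Analysis.Analysis"
begin

section \<open>Smooth functions on open subsets of Euclidean space\<close>

text \<open>
  Manifolds of all dimensions (including 0) occur, also under quantifiers, so the model space is
  the library's \<^const>\<open>Euclidean_space\<close> \<open>n\<close>, i.e. the sequences vanishing from
  index \<open>n\<close> on. This lives in a function type without a norm; \<open>C\<^sup>k\<close> therefore means: all
  partial derivatives of order at most \<open>k\<close> exist and are continuous.
\<close>

definition partial_deriv :: "nat \<Rightarrow> ((nat \<Rightarrow> real) \<Rightarrow> real) \<Rightarrow> (nat \<Rightarrow> real) \<Rightarrow> real" where
  "partial_deriv i f x = deriv (\<lambda>t. f (x(i := t))) (x i)"

primrec Ck_on :: "nat \<Rightarrow> nat \<Rightarrow> (nat \<Rightarrow> real) set \<Rightarrow> ((nat \<Rightarrow> real) \<Rightarrow> real) \<Rightarrow> bool" where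
  "Ck_on 0 n U f \<longleftrightarrow> continuous_on U f"
| "Ck_on (Suc k) n U f \<longleftrightarrow> continuous_on U f \<and>
     (\<forall>i<n. (\<forall>x\<in>U. (\<lambda>t. f (x(i := t))) field_differentiable (at (x i))) \<and>
            Ck_on k n U (partial_deriv i f))"

definition smooth_into ::
    "nat \<Rightarrow> nat \<Rightarrow> (nat \<Rightarrow> real) set \<Rightarrow> ((nat \<Rightarrow> real) \<Rightarrow> nat \<Rightarrow> real) \<Rightarrow> bool" where
  "smooth_into n m U f \<longleftrightarrow> (\<forall>i<m. \<forall>k. Ck_on k n U (\<lambda>x. f x i))"

definition jacobian_surj ::
    "nat \<Rightarrow> nat \<Rightarrow> ((nat \<Rightarrow> real) \<Rightarrow> nat \<Rightarrow> real) \<Rightarrow> (nat \<Rightarrow> real) \<Rightarrow> bool" where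
  "jacobian_surj n m f x \<longleftrightarrow>
     (\<forall>w :: nat \<Rightarrow> real. \<exists>v :: nat \<Rightarrow> real.
        \<forall>i<m. (\<Sum>j<n. partial_deriv j (\<lambda>z. f z i) x * v j) = w i)"


section \<open>Smooth manifolds\<close>

type_synonym 'a chart = "'a set \<times> ('a \<Rightarrow> nat \<Rightarrow> real)"

record 'a mfd =
  mdim :: nat
  mtop :: "'a topology"
  atlas :: "'a chart set"

definition is_chart :: "nat \<Rightarrow> 'a topology \<Rightarrow> 'a chart \<Rightarrow> bool" where
  "is_chart n X = (\<lambda>(U, \<phi>).
     openin X U \<and> openin (Euclidean_space n) (\<phi> ` U) \<and>
     homeomorphic_map (subtopology X U) (subtopology (Euclidean_space n) (\<phi> ` U)) \<phi>)"

definition compatible :: "nat \<Rightarrow> 'a chart \<Rightarrow> 'a chart \<Rightarrow> bool" where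
  "compatible n = (\<lambda>(U, \<phi>) (V, \<psi>).
     smooth_into n n (\<phi> ` (U \<inter> V)) (\<psi> \<circ> inv_into U \<phi>) \<and>
     smooth_into n n (\<psi> ` (U \<inter> V)) (\<phi> \<circ> inv_into V \<psi>))"

text \<open>
  Separation and countability are not included here, as is usual for the total space of a Lie
  groupoid; they are imposed separately where they are meant.
\<close>

definition manifold :: "'a mfd \<Rightarrow> bool" where
  "manifold X \<longleftrightarrow>
     (\<forall>c\<in>atlas X. is_chart (mdim X) (mtop X) c) \<and>
     \<Union>(fst ` atlas X) = topspace (mtop X) \<and>
     (\<forall>c\<in>atlas X. \<forall>d\<in>atlas X. compatible (mdim X) c d)"

definition max_atlas :: "'a mfd \<Rightarrow> 'a chart set" where
  "max_atlas X =
     {c. is_chart (mdim X) (mtop X) c \<and> (\<forall>d\<in>atlas X. compatible (mdim X) c d)}"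

definition smooth_map :: "'a mfd \<Rightarrow> 'b mfd \<Rightarrow> ('a \<Rightarrow> 'b) \<Rightarrow> bool" where
  "smooth_map X Y f \<longleftrightarrow> continuous_map (mtop X) (mtop Y) f \<and>
     (\<forall>(U, \<phi>)\<in>atlas X. \<forall>(V, \<psi>)\<in>atlas Y.
        smooth_into (mdim X) (mdim Y) (\<phi> ` {x\<in>U. f x \<in> V}) (\<psi> \<circ> f \<circ> inv_into U \<phi>))"

definition submersion :: "'a mfd \<Rightarrow> 'b mfd \<Rightarrow> ('a \<Rightarrow> 'b) \<Rightarrow> bool" where
  "submersion X Y f \<longleftrightarrow> smooth_map X Y f \<and>
     (\<forall>(U, \<phi>)\<in>atlas X. \<forall>(V, \<psi>)\<in>atlas Y. \<forall>x\<in>U. f x \<in> V \<longrightarrow>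
        jacobian_surj (mdim X) (mdim Y) (\<psi> \<circ> f \<circ> inv_into U \<phi>) (\<phi> x))"

definition diffeomorphism :: "'a mfd \<Rightarrow> 'b mfd \<Rightarrow> ('a \<Rightarrow> 'b) \<Rightarrow> bool" where
  "diffeomorphism X Y f \<longleftrightarrow> smooth_map X Y f \<and>
     (\<exists>g. homeomorphic_maps (mtop X) (mtop Y) f g \<and> smooth_map Y X g)"

definition prod_mfd :: "'a mfd \<Rightarrow> 'b mfd \<Rightarrow> ('a \<times> 'b) mfd" where
  "prod_mfd X Y =
     \<lparr>mdim = mdim X + mdim Y,
      mtop = prod_topology (mtop X) (mtop Y),
      atlas = {(U \<times> V, \<lambda>(x, y) i. if i < mdim X then \<phi> x i else \<psi> y (i - mdim X)) | U \<phi> V \<psi>.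
                 (U, \<phi>) \<in> atlas X \<and> (V, \<psi>) \<in> atlas Y}\<rparr>"

text \<open>
  The structure induced on an embedded submanifold \<open>S\<close> of dimension \<open>k\<close>: subspace topology and
  restrictions of slice charts. For \<open>S\<close> open and \<open>k = mdim X\<close> this is the open submanifold.
\<close>

definition submfd :: "nat \<Rightarrow> 'a mfd \<Rightarrow> 'a set \<Rightarrow> 'a mfd" where
  "submfd k X S =
     \<lparr>mdim = k,
      mtop = subtopology (mtop X) S,
      atlas = {(W \<inter> S, \<phi>) | W \<phi>. (W, \<phi>) \<in> max_atlas X \<and>
                 \<phi> ` (W \<inter> S) = \<phi> ` W \<inter> {z. \<forall>i\<in>{k..<mdim X}. z i = 0}}\<rparr>"

text \<open>The smooth structure on a space \<open>E\<close> pulled back along a local homeomorphism \<open>\<pi>\<close>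
  (in particular a covering projection) into a manifold:\<close>

definition pullback_mfd :: "'e topology \<Rightarrow> 'a mfd \<Rightarrow> ('e \<Rightarrow> 'a) \<Rightarrow> 'e mfd" where
  "pullback_mfd E X \<pi> =
     \<lparr>mdim = mdim X,
      mtop = E,
      atlas = {(W, \<phi> \<circ> \<pi>) | W U \<phi>. (U, \<phi>) \<in> atlas X \<and> openin E W \<and>
                 openin (mtop X) (\<pi> ` W) \<and> \<pi> ` W \<subseteq> U \<and>
                 homeomorphic_map (subtopology E W) (subtopology (mtop X) (\<pi> ` W)) \<pi>}\<rparr>"


section \<open>Foliations\<close>

text \<open>
  A foliation is represented by its leaf topology: the finer topology on the underlying set for
  which every foliation chart is a homeomorphism to an open set of \<open>\<real>\<^sup>p \<times> \<real>\<^sup>n\<^sup>-\<^sup>p\<close>, the second factor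
  being discrete. The leaves are its connected components. Specifying this topology
  is the same as specifying a maximal foliation atlas: the atlas consists of the charts that are
  homeomorphisms in this sense, and a transition map between two of these preserves the plaques,
  i.e. locally has the form \<open>(x, y) \<mapsto> (g(x, y), h(y))\<close>. Conversely the open subsets of the
  plaques of a foliation atlas form a basis of its leaf topology.
\<close>

definition leaf_model :: "nat \<Rightarrow> nat \<Rightarrow> (nat \<Rightarrow> real) topology" where
  "leaf_model p n = topology_generated_by
     {W \<inter> {z. \<forall>i\<in>{p..<n}. z i = c i} | W c. openin (Euclidean_space n) W}"

definition foliation :: "'a mfd \<Rightarrow> 'a topology \<Rightarrow> bool" where
  "foliation X F \<longleftrightarrow> topspace F = topspace (mtop X) \<and>
     (\<exists>p\<le>mdim X. \<forall>x\<in>topspace (mtop X). \<exists>(U, \<phi>)\<in>max_atlas X. x \<in> U \<and> openin F U \<and>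
        homeomorphic_map (subtopology F U) (subtopology (leaf_model p (mdim X)) (\<phi> ` U)) \<phi>)"

abbreviation leaves :: "'a topology \<Rightarrow> 'a set set" where
  "leaves F \<equiv> connected_components_of F"

abbreviation leaf_of :: "'a topology \<Rightarrow> 'a \<Rightarrow> 'a set" where
  "leaf_of F x \<equiv> connected_component_of_set F x"

text \<open>
  The restriction of \<open>F\<close> to a saturated subset is \<^term>\<open>subtopology F S\<close>, and the foliation
  \<open>F \<times> 0\<close>, with leaves \<open>L \<times> {y}\<close>, is \<^term>\<open>prod_topology F (discrete_topology Y)\<close>. A plaque in the
  pull-back along a local homeomorphism is the part of the preimage of a plaque in a small open set:
\<close>

definition pullback_fol :: "'e topology \<Rightarrow> 'a topology \<Rightarrow> ('e \<Rightarrow> 'a) \<Rightarrow> 'e topology" where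
  "pullback_fol E F \<pi> = topology_generated_by
     ({W. openin E W} \<union> {{e\<in>topspace E. \<pi> e \<in> V} | V. openin F V})"

text \<open>
  The leaf space carries the quotient topology. Its second countability, which is part of
  some conventions for manifolds, is inherited from \<open>X\<close> because the projection is open.
\<close>

definition strictly_simple :: "'a mfd \<Rightarrow> 'a topology \<Rightarrow> bool" where
  "strictly_simple X F \<longleftrightarrow>
     (\<exists>Y :: 'a set mfd. manifold Y \<and> Hausdorff_space (mtop Y) \<and>
        topspace (mtop Y) = leaves F \<and>
        quotient_map (mtop X) (mtop Y) (leaf_of F) \<and>
        submersion X Y (leaf_of F))"


section \<open>Coverings and developability\<close>

definition covering_map :: "'e topology \<Rightarrow> 'a topology \<Rightarrow> ('e \<Rightarrow> 'a) \<Rightarrow> bool" where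
  "covering_map E X \<pi> \<longleftrightarrow> continuous_map E X \<pi> \<and> \<pi> ` topspace E = topspace X \<and>
     (\<forall>x\<in>topspace X. \<exists>V. x \<in> V \<and> openin X V \<and>
        (\<exists>\<W>. \<Union>\<W> = {e\<in>topspace E. \<pi> e \<in> V} \<and> pairwise disjnt \<W> \<and>
           (\<forall>W\<in>\<W>. openin E W \<and>
              homeomorphic_map (subtopology E W) (subtopology X V) \<pi>)))"

definition path_homotopic :: "'a topology \<Rightarrow> (real \<Rightarrow> 'a) \<Rightarrow> (real \<Rightarrow> 'a) \<Rightarrow> bool" where
  "path_homotopic X p q \<longleftrightarrow>
     homotopic_with (\<lambda>h. h 0 = p 0 \<and> h 1 = p 1) (top_of_set {0..1}) X p q"

definition simply_connected_top :: "'a topology \<Rightarrow> bool" where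
  "simply_connected_top X \<longleftrightarrow> path_connected_space X \<and>
     (\<forall>\<gamma>. pathin X \<gamma> \<and> \<gamma> 0 = \<gamma> 1 \<longrightarrow> path_homotopic X \<gamma> (\<lambda>_. \<gamma> 0))"

definition universal_covering :: "'e topology \<Rightarrow> 'a topology \<Rightarrow> ('e \<Rightarrow> 'a) \<Rightarrow> bool" where
  "universal_covering E X \<pi> \<longleftrightarrow> covering_map E X \<pi> \<and> simply_connected_top E"

text \<open>
  A universal covering is unique up to isomorphism, and exists on a subset of the
  type \<^typ>\<open>(real \<Rightarrow> 'a) set\<close> (homotopy classes of paths with fixed origin), so nothing is lost by
  fixing this type and asking for one universal covering.
\<close>

definition developable :: "'a mfd \<Rightarrow> 'a topology \<Rightarrow> bool" where
  "developable X F \<longleftrightarrow>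
     (\<exists>(E :: (real \<Rightarrow> 'a) set topology) \<pi>. universal_covering E (mtop X) \<pi> \<and>
        strictly_simple (pullback_mfd E X \<pi>) (pullback_fol E F \<pi>))"


section \<open>Bundles of foliations\<close>

definition preim :: "'a mfd \<Rightarrow> ('a \<Rightarrow> 'b) \<Rightarrow> 'b set \<Rightarrow> 'a set" where
  "preim N s U = {y\<in>topspace (mtop N). s y \<in> U}"

abbreviation fiber :: "'a mfd \<Rightarrow> ('a \<Rightarrow> 'b) \<Rightarrow> 'b \<Rightarrow> 'a set" where
  "fiber N s x \<equiv> preim N s {x}"

definition fiber_mfd :: "'a mfd \<Rightarrow> 'b mfd \<Rightarrow> ('a \<Rightarrow> 'b) \<Rightarrow> 'b \<Rightarrow> 'a mfd" where
  "fiber_mfd N M s x = submfd (mdim N - mdim M) N (fiber N s x)"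

definition fiber_fol :: "'a mfd \<Rightarrow> 'a topology \<Rightarrow> ('a \<Rightarrow> 'b) \<Rightarrow> 'b \<Rightarrow> 'a topology" where
  "fiber_fol N F s x = subtopology F (fiber N s x)"

definition locally_trivial_foliation_bundle ::
    "'a mfd \<Rightarrow> 'a topology \<Rightarrow> 'b mfd \<Rightarrow> ('a \<Rightarrow> 'b) \<Rightarrow> bool" where
  "locally_trivial_foliation_bundle N F M s \<longleftrightarrow>
     manifold N \<and> Hausdorff_space (mtop N) \<and> second_countable (mtop N) \<and>
     manifold M \<and> Hausdorff_space (mtop M) \<and> second_countable (mtop M) \<and>
     submersion N M s \<and> s ` topspace (mtop N) = topspace (mtop M) \<and>
     foliation N F \<and>
     (\<forall>L\<in>leaves F. \<exists>x\<in>topspace (mtop M). L \<subseteq> fiber N s x) \<and>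
     (\<forall>x0\<in>topspace (mtop M). \<forall>x\<in>topspace (mtop M). \<exists>U h.
        openin (mtop M) U \<and> x \<in> U \<and>
        diffeomorphism (submfd (mdim N) N (preim N s U))
          (prod_mfd (fiber_mfd N M s x0) (submfd (mdim M) M U)) h \<and>
        (\<forall>y\<in>preim N s U. snd (h y) = s y) \<and>
        homeomorphic_map (subtopology F (preim N s U))
          (prod_topology (fiber_fol N F s x0) (discrete_topology U)) h)"

definition developable_bundle ::
    "'a mfd \<Rightarrow> 'a topology \<Rightarrow> 'b mfd \<Rightarrow> ('a \<Rightarrow> 'b) \<Rightarrow> bool" where
  "developable_bundle N F M s \<longleftrightarrow>
     (\<forall>x\<in>topspace (mtop M). developable (fiber_mfd N M s x) (fiber_fol N F s x))"


section \<open>The fiberwise fundamental groupoid\<close>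

definition fiber_paths :: "'a mfd \<Rightarrow> ('a \<Rightarrow> 'b) \<Rightarrow> (real \<Rightarrow> 'a) set" where
  "fiber_paths N s = {\<gamma>. pathin (mtop N) \<gamma> \<and> (\<forall>t\<in>{0..1}. s (\<gamma> t) = s (\<gamma> 0))}"

definition arrow_of :: "'a mfd \<Rightarrow> ('a \<Rightarrow> 'b) \<Rightarrow> (real \<Rightarrow> 'a) \<Rightarrow> (real \<Rightarrow> 'a) set" where
  "arrow_of N s \<gamma> =
     {\<delta>. path_homotopic (subtopology (mtop N) (fiber N s (s (\<gamma> 0)))) \<gamma> \<delta>}"

definition arrow_src :: "(real \<Rightarrow> 'a) set \<Rightarrow> 'a" where
  "arrow_src g = (SOME \<gamma>. \<gamma> \<in> g) 0"

definition arrow_tgt :: "(real \<Rightarrow> 'a) set \<Rightarrow> 'a" where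
  "arrow_tgt g = (SOME \<gamma>. \<gamma> \<in> g) 1"

definition fiber_paths_top :: "'a mfd \<Rightarrow> ('a \<Rightarrow> 'b) \<Rightarrow> (real \<Rightarrow> 'a) topology" where
  \<comment> \<open>compact-open topology\<close>
  "fiber_paths_top N s = topology_generated_by
     {{\<gamma>\<in>fiber_paths N s. \<gamma> ` K \<subseteq> V} | K V. compact K \<and> K \<subseteq> {0..1} \<and> openin (mtop N) V}"

definition quotient_top :: "'a topology \<Rightarrow> ('a \<Rightarrow> 'b) \<Rightarrow> 'b topology" where
  "quotient_top X f =
     topology (\<lambda>W. W \<subseteq> f ` topspace X \<and> openin X {x\<in>topspace X. f x \<in> W})"

lemma openin_quotient_top:
  "openin (quotient_top X f) W \<longleftrightarrow>
     W \<subseteq> f ` topspace X \<and> openin X {x\<in>topspace X. f x \<in> W}"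
proof -
  let ?P = "\<lambda>W. W \<subseteq> f ` topspace X \<and> openin X {x\<in>topspace X. f x \<in> W}"
  have "istopology ?P"
    unfolding istopology_def
  proof (intro conjI allI impI)
    fix S T assume "?P S" "?P T"
    moreover have "{x\<in>topspace X. f x \<in> S \<inter> T} =
        {x\<in>topspace X. f x \<in> S} \<inter> {x\<in>topspace X. f x \<in> T}" by blast
    ultimately show "S \<inter> T \<subseteq> f ` topspace X" "openin X {x\<in>topspace X. f x \<in> S \<inter> T}"
      by auto
  next
    fix \<K> assume K: "\<forall>K\<in>\<K>. ?P K"
    have "{x\<in>topspace X. f x \<in> \<Union>\<K>} = \<Union>((\<lambda>K. {x\<in>topspace X. f x \<in> K}) ` \<K>)" by blast
    then show "\<Union>\<K> \<subseteq> f ` topspace X" "openin X {x\<in>topspace X. f x \<in> \<Union>\<K>}"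
      using K by auto
  qed
  then show ?thesis
    unfolding quotient_top_def by simp
qed

lemma quotient_map_quotient_top: "quotient_map X (quotient_top X f) f"
proof -
  have "topspace (quotient_top X f) = f ` topspace X"
  proof
    show "topspace (quotient_top X f) \<subseteq> f ` topspace X"
      using openin_quotient_top[of X f "topspace (quotient_top X f)"] by simp
    have "{x\<in>topspace X. f x \<in> f ` topspace X} = topspace X" by blast
    then have "openin (quotient_top X f) (f ` topspace X)"
      by (simp add: openin_quotient_top)
    then show "f ` topspace X \<subseteq> topspace (quotient_top X f)"
      by (rule openin_subset)
  qed
  then show ?thesis
    by (auto simp: quotient_map_def openin_quotient_top)
qed

definition Pi_top :: "'a mfd \<Rightarrow> ('a \<Rightarrow> 'b) \<Rightarrow> (real \<Rightarrow> 'a) set topology" where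
  "Pi_top N s = quotient_top (fiber_paths_top N s) (arrow_of N s)"

definition fiber_product :: "'a mfd \<Rightarrow> ('a \<Rightarrow> 'b) \<Rightarrow> ('a \<times> 'a) set" where
  "fiber_product N s =
     {(y, z). y \<in> topspace (mtop N) \<and> z \<in> topspace (mtop N) \<and> s y = s z}"

definition fiber_product_mfd :: "'a mfd \<Rightarrow> 'b mfd \<Rightarrow> ('a \<Rightarrow> 'b) \<Rightarrow> ('a \<times> 'a) mfd" where
  "fiber_product_mfd N M s =
     submfd (2 * mdim N - mdim M) (prod_mfd N N) (fiber_product N s)"

definition fiber_product_fol :: "'a mfd \<Rightarrow> 'a topology \<Rightarrow> ('a \<Rightarrow> 'b) \<Rightarrow> ('a \<times> 'a) topology" where
  "fiber_product_fol N F s =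
     subtopology (prod_topology F (discrete_topology (topspace (mtop N)))) (fiber_product N s)"

definition Pi_mfd :: "'a mfd \<Rightarrow> 'b mfd \<Rightarrow> ('a \<Rightarrow> 'b) \<Rightarrow> (real \<Rightarrow> 'a) set mfd" where
  "Pi_mfd N M s =
     pullback_mfd (Pi_top N s) (fiber_product_mfd N M s) (\<lambda>g. (arrow_tgt g, arrow_src g))"

definition Pi_fol :: "'a mfd \<Rightarrow> 'a topology \<Rightarrow> ('a \<Rightarrow> 'b) \<Rightarrow> (real \<Rightarrow> 'a) set topology" where
  "Pi_fol N F s =
     pullback_fol (Pi_top N s) (fiber_product_fol N F s) (\<lambda>g. (arrow_tgt g, arrow_src g))"

definition local_section ::
    "'a mfd \<Rightarrow> 'b mfd \<Rightarrow> ('a \<Rightarrow> 'b) \<Rightarrow> 'b set \<Rightarrow> ('b \<Rightarrow> 'a) \<Rightarrow> bool" where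
  "local_section N M s U \<sigma> \<longleftrightarrow> openin (mtop M) U \<and>
     smooth_map (submfd (mdim M) M U) N \<sigma> \<and> (\<forall>u\<in>U. s (\<sigma> u) = u)"

text \<open>
  Since \<open>\<sigma>\<close> is injective, the pull-back of the source map along \<open>\<sigma>\<close> is the subset of arrows
  starting in \<open>\<sigma>(U)\<close>; its dimension is \<open>(2 dim N - dim M) - (dim N - dim M) = dim N\<close>.
\<close>

definition Pi_sigma :: "'a mfd \<Rightarrow> ('a \<Rightarrow> 'b) \<Rightarrow> 'b set \<Rightarrow> ('b \<Rightarrow> 'a) \<Rightarrow> (real \<Rightarrow> 'a) set set" where
  "Pi_sigma N s U \<sigma> = {g\<in>topspace (Pi_top N s). arrow_src g \<in> \<sigma> ` U}"

definition Pi_sigma_mfd ::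
    "'a mfd \<Rightarrow> 'b mfd \<Rightarrow> ('a \<Rightarrow> 'b) \<Rightarrow> 'b set \<Rightarrow> ('b \<Rightarrow> 'a) \<Rightarrow> (real \<Rightarrow> 'a) set mfd" where
  "Pi_sigma_mfd N M s U \<sigma> = submfd (mdim N) (Pi_mfd N M s) (Pi_sigma N s U \<sigma>)"

definition Pi_sigma_fol ::
    "'a mfd \<Rightarrow> 'a topology \<Rightarrow> ('a \<Rightarrow> 'b) \<Rightarrow> 'b set \<Rightarrow> ('b \<Rightarrow> 'a) \<Rightarrow> (real \<Rightarrow> 'a) set topology" where
  "Pi_sigma_fol N F s U \<sigma> = subtopology (Pi_fol N F s) (Pi_sigma N s U \<sigma>)"

end

theory Submission
 imports Defs
begin

text \<open>
 Strict simplicity has an intrinsic form: every point has a saturated open neighbourhood with a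
 submersion to some \<open>\<real>\<^sup>q\<close> whose fibers are the leaves, and distinct leaves are
 separated by saturated open sets. In this form it is inherited by submanifolds that are locally cut out
 by a submersion constant along the leaves. The arrows starting on a section are cut out in this
 way from all arrows, and the arrows starting at one point \<open>y\<close> from the arrows starting on a section
 through \<open>y\<close>; the latter form the universal covering of the fiber through \<open>y\<close>. This gives
 that (ii) implies (iii) and (iii) implies (i).

 To see that (i) implies (ii), fix the universal covering \<open>E\<close> of one fiber. Over a trivialization, the end points
 of lifts of arrows define a map \<open>Phi\<close> from an open set of arrows to \<open>E\<close>. Two arrows lie in one leaf
 iff they have the same source and their values under \<open>Phi\<close> lie in one leaf; so submersions on \<open>E\<close>
 that separate the leaves, paired with charts at the source, separate the leaves of the groupoid.
\<close>

section \<open>Differential calculus on Euclidean spaces\<close>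

text \<open>The obstacle is that spaces of paths carry no smooth structure: arrows are classes in a
  quotient of the compact-open topology. Each arrow is therefore compared with its image in a model
  fiber, by homotopies whose ends may move inside small sets in which points are joined by canonical
  paths. The classes under these homotopies are the sheets of the end point map, and smoothness
  enters only through the end points. A submersion is taken to be a smooth map with a local section
  through every point, since sections can be lifted along coverings and restricted; the rank
  condition serves only to pass to and from charts. The leaf relations on arrows and on the covering
  are compared by maps that are continuous for the leaf topologies: \<open>Phi\<close> in one
  direction and, for each source, a map \<open>Psi\<close> in the other, which exists because the
  covering is simply connected. A single model fiber works over the whole base, because local
  triviality is stated for every choice of \<open>x0\<close>. The source then adds
  \<open>mdim N\<close> coordinates to the \<open>q\<close> coordinates of the leaf space of the
  developed fiber.\<close>

abbreviation "EN \<equiv> Euclidean_space"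

section \<open>Coordinate cubes as neighbourhood bases of the model spaces, whose sequence type has
  no norm\<close>

definition cube :: "nat => (nat => real) => real => (nat => real) set" where
 "cube n x r = {y. (\<forall>i<n. \<bar>y i - x i\<bar> < r) & (\<forall>i\<ge>n. y i = 0)}"

lemma Euclidean_space_eq_top_of_set: "EN n = top_of_set {x. \<forall>i\<ge>n. x i = 0}"
 by (simp add: Euclidean_space_def euclidean_product_topology)

lemma open_coordinate_box: "open {y :: nat => real. \<forall>i<n. \<bar>y i - x i\<bar> < r}"
proof -
 have "open {y :: nat => real. \<bar>y i - x i\<bar> < r}" for i
  by (intro open_Collect_less continuous_intros continuous_on_coordinatewise_then_product
    continuous_on_product_coordinates)
 then have "open (\<Inter>i\<in>{..<n}. {y :: nat => real. \<bar>y i - x i\<bar> < r})"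
  by (intro open_INT) auto
 moreover have "(\<Inter>i\<in>{..<n}. {y :: nat => real. \<bar>y i - x i\<bar> < r}) = {y. \<forall>i<n. \<bar>y i - x i\<bar> < r}"
  by auto
 ultimately show ?thesis by simp
qed

lemma openin_cube: "openin (EN n) (cube n x r)"
proof -
 have "cube n x r = {x. \<forall>i\<ge>n. x i = 0} \<inter> {y. \<forall>i<n. \<bar>y i - x i\<bar> < r}"
  by (auto simp: cube_def)
 then show ?thesis
  unfolding Euclidean_space_eq_top_of_set using open_coordinate_box openin_open by blast
qed

lemma cube_mono: "r \<le> r' ==> cube n x r \<subseteq> cube n x r'"
 by (force simp: cube_def)

lemma center_in_cube: "[|0 < r; \<forall>i\<ge>n. x i = 0|] ==> x \<in> cube n x r"
 by (simp add: cube_def)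

lemma openin_Euclidean_zero_tail: "[|openin (EN n) U; x \<in> U; n \<le> i|] ==> x i = 0"
 using openin_subset by (fastforce simp: topspace_Euclidean_space)

lemma openin_Euclidean_cube:
 "openin (EN n) U \<longleftrightarrow>
   U \<subseteq> {x. \<forall>i\<ge>n. x i = 0} & (\<forall>x\<in>U. \<exists>r>0. cube n x r \<subseteq> U)" (is "?L \<longleftrightarrow> ?R")
proof
 assume L: ?L
 have sub: "U \<subseteq> {x. \<forall>i\<ge>n. x i = 0}"
  using openin_Euclidean_zero_tail[OF L] by blast
 obtain T where T: "openin (powertop_real UNIV) T" "U = T \<inter> {x. \<forall>i\<ge>n. x i = 0}"
  using L unfolding Euclidean_space_def openin_subtopology by blast
 have "\<exists>r>0. cube n x r \<subseteq> U" if "x \<in> U" for x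
 proof -
  have "x \<in> T" using that T by blast
  then obtain V where V: "\<forall>i. openin euclideanreal (V i)" "x \<in> Pi\<^sub>E UNIV V" "Pi\<^sub>E UNIV V \<subseteq> T"
   using T(1) unfolding openin_product_topology_alt by (metis UNIV_I)
  have "\<forall>i. \<exists>e>0. ball (x i) e \<subseteq> V i"
   using V by (simp add: open_contains_ball PiE_def Pi_def)
  then obtain e where e: "!!i. e i > 0" "!!i. ball (x i) (e i) \<subseteq> V i" by metis
  \<comment> \<open>Only the first \<open>n\<close> radii matter, as points of \<open>U\<close> have
    zero tail; the element 1 keeps the set nonempty for \<open>n = 0\<close>.\<close>
  define r where "r = Min (insert 1 (e ` {..<n}))"
  have r: "r > 0" "!!i. i < n ==> r \<le> e i"
   unfolding r_def using e(1) by (auto intro: Min_le)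
  have "cube n x r \<subseteq> U"
  proof
   fix y assume y: "y \<in> cube n x r"
   have "y i \<in> V i" for i
   proof (cases "i < n")
    case True
    then have "\<bar>y i - x i\<bar> < e i" using y r(2)[OF True] by (fastforce simp: cube_def)
    then have "y i \<in> ball (x i) (e i)" by (simp add: dist_real_def abs_minus_commute)
    then show ?thesis using e(2) by blast
   next
    case False
    then have "y i = x i" using y sub that by (auto simp: cube_def)
    then show ?thesis using V(2) by (auto simp: PiE_def Pi_def)
   qed
   then have "y \<in> T" using V(3) by (auto simp: PiE_def Pi_def)
   then show "y \<in> U" using y T(2) by (auto simp: cube_def)
  qed
  then show ?thesis using r(1) by blast
 qed
 then show ?R using sub by blast
next
 assume R: ?R
 show ?L
  unfolding openin_subopen[of "EN n" U]
 proof
  fix x assume x: "x \<in> U"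
  then obtain r where "r > 0" "cube n x r \<subseteq> U" using R by blast
  moreover have "x \<in> cube n x r" using x R \<open>r > 0\<close> by (intro center_in_cube) auto
  ultimately show "\<exists>T. openin (EN n) T & x \<in> T & T \<subseteq> U"
   by (intro exI[of _ "cube n x r"]) (simp add: openin_cube)
 qed
qed

lemma openin_Euclidean_cubeE:
 assumes "openin (EN n) U" "x \<in> U"
 obtains r where "r > 0" "cube n x r \<subseteq> U"
 using assms openin_Euclidean_cube by blast

text \<open>The epsilon-delta form of continuity, with distances read off the first \<open>n\<close>
  coordinates; the estimates below use continuity of partial derivatives in this form.\<close>

lemma continuous_on_cube:
 fixes f :: "(nat => real) => real"
 assumes U: "U \<subseteq> {x. \<forall>i\<ge>n. x i = 0}"
 shows "continuous_on U f \<longleftrightarrow>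
  (\<forall>x\<in>U. \<forall>e>0. \<exists>d>0. \<forall>y\<in>U. (\<forall>i<n. \<bar>y i - x i\<bar> < d) --> \<bar>f y - f x\<bar> < e)" (is "?L \<longleftrightarrow> ?R")
proof
 assume L: ?L
 show ?R
 proof (intro ballI allI impI)
  fix x and e :: real assume x: "x \<in> U" and e: "e > 0"
  obtain A where A: "open A" "x \<in> A" "\<forall>y\<in>U. y \<in> A --> f y \<in> ball (f x) e"
   using L[unfolded continuous_on_topological] x e by (metis centre_in_ball open_ball)
  have "openin (EN n) ({x. \<forall>i\<ge>n. x i = 0} \<inter> A)"
   unfolding Euclidean_space_eq_top_of_set using A(1) openin_open by blast
  then obtain d where d: "d > 0" "cube n x d \<subseteq> {x. \<forall>i\<ge>n. x i = 0} \<inter> A"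
   using openin_Euclidean_cubeE[of n _ x] A(2) x U by blast
  have "\<bar>f y - f x\<bar> < e" if "y \<in> U" "\<forall>i<n. \<bar>y i - x i\<bar> < d" for y
  proof -
   have "y \<in> cube n x d" using that U by (auto simp: cube_def)
   then have "f y \<in> ball (f x) e" using d(2) A(3) that(1) by blast
   then show ?thesis by (simp add: dist_real_def abs_minus_commute)
  qed
  then show "\<exists>d>0. \<forall>y\<in>U. (\<forall>i<n. \<bar>y i - x i\<bar> < d) --> \<bar>f y - f x\<bar> < e" using d(1) by blast
 qed
next
 assume R: ?R
 show ?L
  unfolding continuous_on_topological
 proof (intro ballI allI impI)
  fix x B assume x: "x \<in> U" and B: "open B" "f x \<in> B"
  then obtain e where e: "e > 0" "ball (f x) e \<subseteq> B" by (meson open_contains_ball)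
  obtain d where d: "d > 0" "\<forall>y\<in>U. (\<forall>i<n. \<bar>y i - x i\<bar> < d) --> \<bar>f y - f x\<bar> < e"
   using R x e(1) by blast
  have "\<forall>y\<in>U. y \<in> {y. \<forall>i<n. \<bar>y i - x i\<bar> < d} --> f y \<in> B"
   using d(2) e(2) by (auto simp: subset_iff dist_real_def abs_minus_commute)
  then show "\<exists>A. open A & x \<in> A & (\<forall>y\<in>U. y \<in> A --> f y \<in> B)"
   using open_coordinate_box[of n x d] d(1) by (intro exI[of _ "{y. \<forall>i<n. \<bar>y i - x i\<bar> < d}"]) auto
 qed
qed

lemma openin_Euclidean_subset: "openin (EN n) U ==> U \<subseteq> {x. \<forall>i\<ge>n. x i = 0}"
 by (simp add: openin_Euclidean_cube)

lemma eventually_line_in_open: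
 assumes "openin (EN n) U" "x \<in> U" "i < n"
 shows "eventually (%t. x(i := t) \<in> U) (nhds (x i))"
proof -
 obtain r where r: "r > 0" "cube n x r \<subseteq> U" using assms openin_Euclidean_cubeE by blast
 have "x(i := t) \<in> U" if "dist t (x i) < r" for t
 proof -
  have "x(i := t) \<in> cube n x r"
   using that r(1) assms openin_Euclidean_zero_tail[OF assms(1,2)]
   by (auto simp: cube_def dist_real_def)
  then show ?thesis using r(2) by blast
 qed
 then show ?thesis unfolding eventually_nhds_metric using r(1) by blast
qed

section \<open>Functions of class \<open>Ck_on\<close>: locality and algebraic closure\<close>

lemma Ck_on_imp_continuous: "Ck_on k n U f ==> continuous_on U f"
 by (cases k) auto

lemma Ck_on_imp_C1: "Ck_on (Suc k) n U f ==> Ck_on (Suc 0) n U f"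
 using Ck_on_imp_continuous by auto

lemma Ck_on_subset: "[|Ck_on k n U f; V \<subseteq> U|] ==> Ck_on k n V f"
 by (induction k arbitrary: f) (auto intro: continuous_on_subset)

lemma Ck_on_fewer_variables: "[|Ck_on k n U f; m \<le> n|] ==> Ck_on k m U f"
 by (induction k arbitrary: f) auto

lemma Ck_on_SucD1: "Ck_on (Suc k) n U f ==> Ck_on k n U f"
 by (induction k arbitrary: f) auto

lemma Ck_on_partial_has_derivative:
 assumes "Ck_on (Suc k) n U f" "x \<in> U" "i < n"
 shows "((%t. f (x(i := t))) has_real_derivative partial_deriv i f x) (at (x i))"
 using assms by (auto simp: partial_deriv_def field_differentiable_derivI)

text \<open>Openness in \<open>EN n\<close> is what makes this true: a partial derivative evaluates
  \<open>f\<close> at \<open>x(i := t)\<close>, which stays in \<open>U\<close> for \<open>t\<close>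
  near \<open>x i\<close>, so values outside \<open>U\<close> do not enter.\<close>

lemma Ck_on_cong:
 assumes U: "openin (EN n) U" and "!!x. x \<in> U ==> f x = g x" "Ck_on k n U f"
 shows "Ck_on k n U g"
 using assms(2,3)
proof (induction k arbitrary: f g)
 case 0
 then show ?case using continuous_on_cong[of U U f g] by simp
next
 case (Suc k)
 have ev: "eventually (%t. f (x(i := t)) = g (x(i := t))) (nhds (x i))" if "x \<in> U" "i < n" for x i
  using eventually_line_in_open[OF U that] by (rule eventually_mono) (rule Suc.prems(1))
 have "partial_deriv i f x = partial_deriv i g x" if "x \<in> U" "i < n" for x i
  unfolding partial_deriv_def by (rule deriv_cong_ev[OF ev[OF that]]) simp
 then have "Ck_on k n U (partial_deriv i g)" if "i < n" for i
  using Suc.IH[of "partial_deriv i f" "partial_deriv i g"] that Suc.prems(2) by auto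
 moreover have "(%t. g (x(i := t))) field_differentiable (at (x i))" if "x \<in> U" "i < n" for x i
  using Ck_on_partial_has_derivative[OF Suc.prems(2) that] DERIV_cong_ev[OF refl ev[OF that] refl]
  by (auto simp: field_differentiable_def fun_upd_def)
 moreover have "continuous_on U g"
  using Suc.prems continuous_on_cong[of U U f g] by auto
 ultimately show ?case by auto
qed

text \<open>Uniqueness of derivatives identifies the candidate \<open>D\<close> with
  \<open>partial_deriv\<close> on the open set \<open>U\<close>, and congruence transfers its
  smoothness. All closure properties below are obtained by writing down \<open>D\<close>.\<close>

lemma Ck_on_SucI:
 assumes U: "openin (EN n) U" and "continuous_on U f"
  and D: "!!i x. [|i < n; x \<in> U|] ==> ((%t. f (x(i := t))) has_real_derivative D i x) (at (x i))"
  and "!!i. i < n ==> Ck_on k n U (D i)"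
 shows "Ck_on (Suc k) n U f"
proof -
 have "partial_deriv i f x = D i x" if "i < n" "x \<in> U" for i x
  unfolding partial_deriv_def using D[OF that] by (rule DERIV_imp_deriv)
 then have "Ck_on k n U (partial_deriv i f)" if "i < n" for i
  using Ck_on_cong[OF U, of "D i"] assms(4) that by auto
 then show ?thesis using assms by (auto simp: field_differentiable_def)
qed

lemma Ck_on_const: "openin (EN n) U ==> Ck_on k n U (%_. c)"
proof (induction k arbitrary: c)
 case (Suc k)
 show ?case by (rule Ck_on_SucI[where D = "%_ _. 0"]) (use Suc in auto)
qed auto

lemma continuous_on_coordinate: "continuous_on U (%x :: nat => real. x j)"
 by (rule continuous_on_subset[OF continuous_on_product_coordinates]) auto

lemma Ck_on_coordinate: "openin (EN n) U ==> Ck_on k n U (%x. x j)"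
proof (cases k)
 case (Suc k')
 assume U: "openin (EN n) U"
 have "Ck_on (Suc k') n U (%x. x j)"
  by (rule Ck_on_SucI[where D = "%i _. if i = j then 1 else 0"])
   (use U in "auto intro!: derivative_eq_intros Ck_on_const simp: continuous_on_coordinate")
 then show ?thesis using Suc by simp
qed (simp add: continuous_on_coordinate)

lemma Ck_on_add:
 assumes U: "openin (EN n) U"
 shows "[|Ck_on k n U f; Ck_on k n U g|] ==> Ck_on k n U (%x. f x + g x)"
proof (induction k arbitrary: f g)
 case 0 then show ?case by (simp add: continuous_intros)
next
 case (Suc k)
 show ?case
 proof (rule Ck_on_SucI[OF U, where D = "%i x. partial_deriv i f x + partial_deriv i g x"])
  show "continuous_on U (%x. f x + g x)"
   using Suc.prems by (auto intro: continuous_intros)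
  show "((%t. f (x(i := t)) + g (x(i := t))) has_real_derivative
    partial_deriv i f x + partial_deriv i g x) (at (x i))" if "i < n" "x \<in> U" for i x
   using Ck_on_partial_has_derivative[OF Suc.prems(1) that(2,1)]
    Ck_on_partial_has_derivative[OF Suc.prems(2) that(2,1)] by (rule DERIV_add)
 qed (use Suc in auto)
qed

lemma Ck_on_mult:
 assumes U: "openin (EN n) U"
 shows "[|Ck_on k n U f; Ck_on k n U g|] ==> Ck_on k n U (%x. f x * g x)"
proof (induction k arbitrary: f g)
 case 0 then show ?case by (simp add: continuous_intros)
next
 case (Suc k)
 show ?case
 proof (rule Ck_on_SucI[OF U, where D = "%i x. partial_deriv i f x * g x + partial_deriv i g x * f x"])
  show "continuous_on U (%x. f x * g x)"
   using Suc.prems by (auto intro: continuous_intros)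
  show "((%t. f (x(i := t)) * g (x(i := t))) has_real_derivative
    partial_deriv i f x * g x + partial_deriv i g x * f x) (at (x i))" if "i < n" "x \<in> U" for i x
   using DERIV_mult[OF Ck_on_partial_has_derivative[OF Suc.prems(1) that(2,1)]
    Ck_on_partial_has_derivative[OF Suc.prems(2) that(2,1)]] by (simp add: fun_upd_def)
  show "Ck_on k n U (%x. partial_deriv i f x * g x + partial_deriv i g x * f x)" if "i < n" for i
   using Suc.prems that by (intro Ck_on_add[OF U] Suc.IH) (auto intro: Ck_on_SucD1)
 qed
qed

lemma Ck_on_sum:
 assumes U: "openin (EN n) U" and "!!j. j \<in> S ==> Ck_on k n U (f j)"
 shows "Ck_on k n U (%x. \<Sum>j\<in>S. f j x)"
 using assms(2)
proof (induction S rule: infinite_finite_induct)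
 case (insert j S)
 then show ?case by (auto intro: Ck_on_add[OF U])
qed (auto intro: Ck_on_const[OF U])

lemma Ck_on_diff:
 assumes U: "openin (EN n) U" and f: "Ck_on k n U f" and g: "Ck_on k n U g"
 shows "Ck_on k n U (%x. f x - g x)"
 using Ck_on_add[OF U f Ck_on_mult[OF U Ck_on_const[OF U, of k "-1"] g]] by simp

lemma Ck_on_inverse:
 assumes U: "openin (EN n) U" and nz: "!!x. x \<in> U ==> f x \<noteq> 0"
 shows "Ck_on k n U f ==> Ck_on k n U (%x. inverse (f x))"
proof (induction k)
 case 0 then show ?case using nz by (auto intro: continuous_intros)
next
 case (Suc k)
 note IH = Suc.IH[OF Ck_on_SucD1[OF Suc.prems]]
 show ?case
 proof (rule Ck_on_SucI[OF U, where D = "%i x. (-1) * (partial_deriv i f x * (inverse (f x) * inverse (f x)))"])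
  show "continuous_on U (%x. inverse (f x))"
   using Suc.prems nz by (auto intro: continuous_intros)
  show "((%t. inverse (f (x(i := t)))) has_real_derivative
    (-1) * (partial_deriv i f x * (inverse (f x) * inverse (f x)))) (at (x i))" if "i < n" "x \<in> U" for i x
   using DERIV_inverse_fun[OF Ck_on_partial_has_derivative[OF Suc.prems that(2,1)]] nz[OF that(2)]
   by (simp add: mult_ac power2_eq_square fun_upd_def)
  show "Ck_on k n U (%x. (-1) * (partial_deriv i f x * (inverse (f x) * inverse (f x))))" if "i < n" for i
   using Suc.prems that IH by (intro Ck_on_mult[OF U] Ck_on_const[OF U]) auto
 qed
qed

text \<open>All clauses of \<open>Ck_on\<close> are local: differentiability at \<open>x\<close>
  does not mention the domain, and continuity on \<open>U\<close> may be tested on relative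
  neighbourhoods. This permits verification chart by chart.\<close>

lemma Ck_on_local:
 assumes U: "openin (EN n) U"
  and loc: "!!x. x \<in> U ==> \<exists>V. openin (EN n) V & x \<in> V & Ck_on k n (U \<inter> V) f"
 shows "Ck_on k n U f"
 using loc
proof (induction k arbitrary: f)
 case (0 f)
 have "continuous (at x within U) f" if x: "x \<in> U" for x
 proof -
  obtain V where V: "openin (EN n) V" "x \<in> V" "continuous_on (U \<inter> V) f" using 0 x by auto
  obtain T where T: "open T" "V = {x. \<forall>i\<ge>n. x i = 0} \<inter> T"
   using V(1) unfolding Euclidean_space_eq_top_of_set openin_open by blast
  have "U \<inter> V = U \<inter> T" using T(2) openin_Euclidean_subset[OF U] by blast
  then have "at x within U = at x within U \<inter> V"
   using T V(2) by (intro at_within_nhd[of x T]) auto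
  then show ?thesis using V(2,3) x by (simp add: continuous_on_eq_continuous_within)
 qed
 then show ?case by (simp add: continuous_on_eq_continuous_within)
next
 case (Suc k f)
 have "Ck_on k n U f"
 proof (rule Suc.IH)
  fix x assume "x \<in> U"
  from Suc.prems[OF this]
  show "\<exists>V. openin (EN n) V & x \<in> V & Ck_on k n (U \<inter> V) f"
   by (meson Ck_on_SucD1)
 qed
 moreover have "Ck_on k n U (partial_deriv i f)" if "i < n" for i
 proof (rule Suc.IH)
  fix x assume "x \<in> U"
  from Suc.prems[OF this] that
  show "\<exists>V. openin (EN n) V & x \<in> V & Ck_on k n (U \<inter> V) (partial_deriv i f)"
   by auto
 qed
 moreover have "(%t. f (x(i := t))) field_differentiable (at (x i))" if "x \<in> U" "i < n" for x i
  using Suc.prems[OF that(1)] that by auto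
 ultimately show ?case by (auto intro: Ck_on_imp_continuous)
qed

section \<open>Mean value theorem, Caratheodory coefficients and the chain rule\<close>

lemma mean_value_any_order:
 fixes g :: "real => real"
 assumes "!!t. [|min a b \<le> t; t \<le> max a b|] ==> (g has_real_derivative g' t) (at t)"
 shows "\<exists>\<xi>. min a b \<le> \<xi> & \<xi> \<le> max a b & g b - g a = (b - a) * g' \<xi>"
proof (cases a b rule: linorder_cases)
 case less
 then obtain z where "a < z" "z < b" "g b - g a = (b - a) * g' z"
  using MVT2[of a b g g'] assms by auto
 then show ?thesis using less by (intro exI[of _ z]) auto
next
 case greater
 then obtain z where "b < z" "z < a" "g a - g b = (a - b) * g' z"
  using MVT2[of b a g g'] assms by auto
 then show ?thesis using greater by (intro exI[of _ z]) (auto simp: algebra_simps)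
qed auto

text \<open>Caratheodory's form of differentiability: it turns the chain rule and the
 implicit differentiation below into limits of products.\<close>

lemma caratheodory_decomposition:
 assumes V: "openin (EN m) V" and f: "Ck_on (Suc 0) m V f" and x: "x \<in> V"
 obtains r a where "r > 0" "cube m x r \<subseteq> V"
  "!!y. y \<in> cube m x r ==> f y - f x = (\<Sum>j<m. a j y * (y j - x j))"
  "!!e. e > 0 ==> \<exists>d>0. \<forall>j<m. \<forall>y\<in>cube m x d. \<bar>a j y - partial_deriv j f x\<bar> < e"
proof -
 have x0: "\<forall>i\<ge>m. x i = 0" using openin_Euclidean_subset[OF V] x by blast
 obtain r where r: "r > 0" "cube m x r \<subseteq> V" using V x openin_Euclidean_cubeE by blast
 \<comment> \<open>\<open>mix y j\<close> has the coordinates of \<open>y\<close> below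
   \<open>j\<close> and those of \<open>x\<close> from \<open>j\<close> on, so that \<open>x\<close>
   is changed into \<open>y\<close> one coordinate at a time.\<close>
 define mix where "mix = (%y j i. if i < (j::nat) then (y i :: real) else x i)"
 \<comment> \<open>A divided difference in coordinate \<open>j\<close>. Where its denominator
   vanishes the limit value is taken; the telescoping identity holds there because both sides of its
   term are zero.\<close>
 define a where "a = (%j y. if y j = x j then partial_deriv j f x
   else (f (mix y (Suc j)) - f (mix y j)) / (y j - x j))"
 have mixS: "mix y (Suc j) = (mix y j)(j := y j)" "mix y j = (mix y j)(j := x j)" for y j
  by (auto simp: mix_def fun_eq_iff less_Suc_eq)
 have eq: "f y - f x = (\<Sum>j<m. a j y * (y j - x j))" if "y \<in> cube m x r" for y
 proof -
  have "mix y m = y" "mix y 0 = x"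
   using that x0 by (auto simp: mix_def cube_def fun_eq_iff)
  then have "f y - f x = (\<Sum>j<m. f (mix y (Suc j)) - f (mix y j))"
   using sum_lessThan_telescope[of "%j. f (mix y j)" m] by simp
  also have "\<dots> = (\<Sum>j<m. a j y * (y j - x j))"
  proof (rule sum.cong[OF refl])
   fix j
   show "f (mix y (Suc j)) - f (mix y j) = a j y * (y j - x j)"
    using mixS[where y = y and j = j] by (auto simp: a_def)
  qed
  finally show ?thesis .
 qed
 have lim: "\<exists>d>0. \<forall>y\<in>cube m x d. \<bar>a j y - partial_deriv j f x\<bar> < e" if e: "e > 0" and j: "j < m" for e j
 proof -
  have "continuous_on V (partial_deriv j f)" using f j by simp
  then obtain d where d: "d > 0"
   "\<forall>y\<in>V. (\<forall>i<m. \<bar>y i - x i\<bar> < d) --> \<bar>partial_deriv j f y - partial_deriv j f x\<bar> < e"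
   using continuous_on_cube[OF openin_Euclidean_subset[OF V]] x e by metis
  have "\<bar>a j y - partial_deriv j f x\<bar> < e" if y: "y \<in> cube m x (min d r)" for y
  proof (cases "y j = x j")
   case True then show ?thesis using e by (simp add: a_def)
  next
   case False
   \<comment> \<open>The coordinates of the intermediate points lie between those of
     \<open>x\<close> and \<open>y\<close>, so the mean value theorem is applied inside the
     cube.\<close>
   have inc: "(mix y j)(j := t) \<in> cube m x (min d r)"
    if "min (x j) (y j) \<le> t" "t \<le> max (x j) (y j)" for t
   proof -
    have yx: "\<bar>y i - x i\<bar> < min d r" if "i < m" for i using y that by (simp add: cube_def)
    have "\<bar>t - x j\<bar> < min d r" using yx[OF j] that by linarith
    moreover have "\<bar>mix y j i - x i\<bar> < min d r" if "i < m" for i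
     using yx[OF that] d(1) r(1) by (simp add: mix_def)
    moreover have "mix y j i = 0" if "m \<le> i" for i
     using j that x0 by (simp add: mix_def)
    ultimately show ?thesis using j by (simp add: cube_def)
   qed
   have der: "((%t. f ((mix y j)(j := t))) has_real_derivative partial_deriv j f ((mix y j)(j := t))) (at t)"
    if "min (x j) (y j) \<le> t" "t \<le> max (x j) (y j)" for t
   proof -
    have "(mix y j)(j := t) \<in> V" using inc[OF that] r(2) cube_mono[of "min d r" r m x] by auto
    then show ?thesis using Ck_on_partial_has_derivative[OF f _ j] by fastforce
   qed
   obtain \<xi> where \<xi>: "min (x j) (y j) \<le> \<xi>" "\<xi> \<le> max (x j) (y j)"
    "f ((mix y j)(j := y j)) - f ((mix y j)(j := x j)) = (y j - x j) * partial_deriv j f ((mix y j)(j := \<xi>))"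
    using mean_value_any_order[OF der] by blast
   then have a: "a j y = partial_deriv j f ((mix y j)(j := \<xi>))"
    using False mixS[where y = y and j = j] by (simp add: a_def)
   have "(mix y j)(j := \<xi>) \<in> V" "\<forall>i<m. \<bar>((mix y j)(j := \<xi>)) i - x i\<bar> < d"
    using inc[OF \<xi>(1,2)] r(2) cube_mono[of "min d r" r m x] by (auto simp: cube_def)
   then show ?thesis using d(2) a by simp
  qed
  then show ?thesis using d(1) r(1) by (intro exI[of _ "min d r"]) auto
 qed
 have "\<exists>d>0. \<forall>j<m. \<forall>y\<in>cube m x d. \<bar>a j y - partial_deriv j f x\<bar> < e" if e: "e > 0" for e
 proof -
  obtain d where d: "!!j. j < m ==> d j > 0 & (\<forall>y\<in>cube m x (d j). \<bar>a j y - partial_deriv j f x\<bar> < e)"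
   using lim[OF e] by metis
  define D where "D = Min (insert 1 (d ` {..<m}))"
  have "D > 0" "!!j. j < m ==> D \<le> d j" unfolding D_def using d by (auto intro: Min_le)
  then show ?thesis using d cube_mono by (intro exI[of _ D]) blast
 qed
 then show thesis using that[of r a] r eq by blast
qed

lemma eventually_curve_in_cube:
 assumes \<gamma>: "eventually (%t. \<gamma> t \<in> {x. \<forall>i\<ge>m. x i = 0}) G" "!!i. i < m ==> ((%t. \<gamma> t i) \<longlongrightarrow> (x i :: real)) G"
  and d: "d > 0"
 shows "eventually (%t. \<gamma> t \<in> cube m x d) G"
proof -
 have "eventually (%t. \<forall>i\<in>{..<m}. dist (\<gamma> t i) (x i) < d) G"
  using \<gamma>(2) d by (intro eventually_ball_finite) (auto intro: tendstoD)
 with \<gamma>(1) show ?thesis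
  by (rule eventually_elim2) (auto simp: cube_def dist_real_def)
qed

lemma tendsto_caratheodory_coefficient:
 assumes lim: "!!e. e > 0 ==> \<exists>d>0. \<forall>j<m. \<forall>y\<in>cube m x d. \<bar>a j y - (l j :: real)\<bar> < e"
  and \<gamma>: "eventually (%t. \<gamma> t \<in> {x. \<forall>i\<ge>m. x i = 0}) G" "!!i. i < m ==> ((%t. \<gamma> t i) \<longlongrightarrow> x i) G"
  and j: "j < m"
 shows "((%t. a j (\<gamma> t)) \<longlongrightarrow> l j) G"
proof (rule tendstoI)
 fix e :: real assume "e > 0"
 then obtain d where d: "d > 0" "\<forall>j<m. \<forall>y\<in>cube m x d. \<bar>a j y - l j\<bar> < e" using lim by blast
 from eventually_curve_in_cube[OF \<gamma> d(1)] show "eventually (%t. dist (a j (\<gamma> t)) (l j) < e) G"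
  by (rule eventually_mono) (use d(2) j in "auto simp: dist_real_def")
qed

text \<open>The difference quotient of \<open>f (\<gamma> t)\<close> is a sum of Caratheodory
  coefficients, which converge to the partial derivatives, times the difference quotients of the
  components of \<open>\<gamma>\<close>.\<close>

lemma chain_rule_along_curve:
 assumes V: "openin (EN m) V" and f: "Ck_on (Suc 0) m V f" and x: "\<gamma> t0 \<in> V"
  and ev: "eventually (%t. \<gamma> t \<in> V) (nhds t0)"
  and d: "!!j. j < m ==> ((%t. \<gamma> t j) has_real_derivative d j) (at t0)"
 shows "((%t. f (\<gamma> t)) has_real_derivative (\<Sum>j<m. partial_deriv j f (\<gamma> t0) * d j)) (at t0)"
proof -
 obtain r a where ra: "r > 0" "cube m (\<gamma> t0) r \<subseteq> V"
  "!!y. y \<in> cube m (\<gamma> t0) r ==> f y - f (\<gamma> t0) = (\<Sum>j<m. a j y * (y j - \<gamma> t0 j))"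
  "!!e. e > 0 ==> \<exists>d>0. \<forall>j<m. \<forall>y\<in>cube m (\<gamma> t0) d. \<bar>a j y - partial_deriv j f (\<gamma> t0)\<bar> < e"
  using caratheodory_decomposition[OF V f x] by blast
 have ev': "eventually (%t. \<gamma> t \<in> {x. \<forall>i\<ge>m. x i = 0}) (at t0)"
  using ev openin_Euclidean_subset[OF V] by (auto simp: eventually_nhds_conv_at elim!: eventually_mono)
 have cont: "((%t. \<gamma> t j) \<longlongrightarrow> \<gamma> t0 j) (at t0)" if "j < m" for j
  using DERIV_isCont[OF d[OF that]] by (simp add: isCont_def)
 have cub: "eventually (%t. \<gamma> t \<in> cube m (\<gamma> t0) r) (at t0)"
  by (rule eventually_curve_in_cube[OF ev' cont ra(1)])
 have "((%t. \<Sum>j<m. a j (\<gamma> t) * ((\<gamma> t j - \<gamma> t0 j) / (t - t0))) \<longlongrightarrow>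
   (\<Sum>j<m. partial_deriv j f (\<gamma> t0) * d j)) (at t0)"
 proof (intro tendsto_sum tendsto_mult)
  fix j assume "j \<in> {..<m}"
  then show "((%t. a j (\<gamma> t)) \<longlongrightarrow> partial_deriv j f (\<gamma> t0)) (at t0)"
   by (intro tendsto_caratheodory_coefficient[OF ra(4) ev' cont]) auto
  show "((%t. (\<gamma> t j - \<gamma> t0 j) / (t - t0)) \<longlongrightarrow> d j) (at t0)"
   using d \<open>j \<in> {..<m}\<close> by (simp add: has_field_derivative_iff)
 qed
 moreover have "eventually (%t. (\<Sum>j<m. a j (\<gamma> t) * ((\<gamma> t j - \<gamma> t0 j) / (t - t0))) =
   (f (\<gamma> t) - f (\<gamma> t0)) / (t - t0)) (at t0)"
  using cub by (rule eventually_mono) (simp add: ra(3) sum_divide_distrib)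
 ultimately show ?thesis
  unfolding has_field_derivative_iff by (rule Lim_transform_eventually)
qed

lemma continuous_on_coordinatewise:
 assumes "!!i. i < (m :: nat) ==> continuous_on U (%x. f x i :: real)" "!!x i. [|x \<in> U; m \<le> i|] ==> f x i = 0"
 shows "continuous_on U f"
proof (rule continuous_on_coordinatewise_then_product)
 fix i
 have "continuous_on U (%x. f x i) = continuous_on U (%_. 0 :: real)" if "m \<le> i"
  by (rule continuous_on_cong[OF refl]) (rule assms(2)[OF _ that])
 then show "continuous_on U (%x. f x i)" using assms(1) by (cases "i < m") (auto simp: not_less)
qed

lemma partial_has_derivative_compose:
 assumes U: "openin (EN n) U" and V: "openin (EN m) V"
  and gV: "!!x. x \<in> U ==> g x \<in> V" and g: "!!j. j < m ==> Ck_on (Suc 0) n U (%x. g x j)"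
  and f: "Ck_on (Suc 0) m V f" and x: "x \<in> U" and i: "i < n"
 shows "((%t. f (g (x(i := t)))) has_real_derivative
   (\<Sum>j<m. partial_deriv j f (g x) * partial_deriv i (%x. g x j) x)) (at (x i))"
proof -
 have "((%t. f (g (x(i := t)))) has_real_derivative
    (\<Sum>j<m. partial_deriv j f (g (x(i := x i))) * partial_deriv i (%x. g x j) x)) (at (x i))"
 proof (rule chain_rule_along_curve[OF V f])
  show "eventually (%t. g (x(i := t)) \<in> V) (nhds (x i))"
   using eventually_line_in_open[OF U x i] by (rule eventually_mono) (rule gV)
  show "((%t. g (x(i := t)) j) has_real_derivative partial_deriv i (%x. g x j) x) (at (x i))" if "j < m" for j
   using Ck_on_partial_has_derivative[OF g[OF that] x i] .
 qed (use gV x in auto)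
 then show ?thesis by simp
qed

text \<open>The chain rule writes a partial derivative of the composite as a sum of products in
  which one factor is again a composite with the same \<open>g\<close>; hence the induction on
  \<open>k\<close> generalises over \<open>f\<close> alone.\<close>

lemma Ck_on_compose:
 assumes U: "openin (EN n) U" and V: "openin (EN m) V"
  and "!!x. x \<in> U ==> g x \<in> V" "!!j. j < m ==> Ck_on k n U (%x. g x j)" "Ck_on k m V f"
 shows "Ck_on k n U (%x. f (g x))"
 using assms(3-)
proof (induction k arbitrary: f)
 case (0 f)
 have "continuous_on U g"
  using 0 openin_Euclidean_subset[OF V] by (intro continuous_on_coordinatewise[where m = m]) auto
 then show ?case using 0 by (auto intro: continuous_on_compose2[of V f])
next
 case (Suc k f)
 have g': "!!j. j < m ==> Ck_on k n U (%x. g x j)" using Suc.prems(2) Ck_on_SucD1 by blast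
 have C1: "Ck_on (Suc 0) m V f" by (rule Ck_on_imp_C1[OF Suc.prems(3)])
 show ?case
 proof (rule Ck_on_SucI[OF U, where D = "%i x. \<Sum>j<m. partial_deriv j f (g x) * partial_deriv i (%x. g x j) x"])
  show "continuous_on U (%x. f (g x))"
   using Suc.IH[OF Suc.prems(1) g' Ck_on_SucD1[OF Suc.prems(3)]] by (rule Ck_on_imp_continuous)
  show "((%t. f (g (x(i := t)))) has_real_derivative
    (\<Sum>j<m. partial_deriv j f (g x) * partial_deriv i (%x. g x j) x)) (at (x i))" if "i < n" "x \<in> U" for i x
   by (rule partial_has_derivative_compose[OF U V Suc.prems(1) Ck_on_imp_C1[OF Suc.prems(2)] C1 that(2,1)])
  show "Ck_on k n U (%x. \<Sum>j<m. partial_deriv j f (g x) * partial_deriv i (%x. g x j) x)" if "i < n" for i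
  proof (intro Ck_on_sum[OF U] Ck_on_mult[OF U])
   fix j assume "j \<in> {..<m}"
   then show "Ck_on k n U (%x. partial_deriv j f (g x))"
    using Suc.prems(3) by (intro Suc.IH[OF Suc.prems(1) g']) auto
   show "Ck_on k n U (partial_deriv i (%x. g x j))"
    using Suc.prems(2) \<open>j \<in> {..<m}\<close> that by auto
  qed
 qed
qed

lemma partial_deriv_cong:
 assumes "openin (EN n) U" "x \<in> U" "i < n" "!!y. y \<in> U ==> f y = g y"
 shows "partial_deriv i f x = partial_deriv i g x"
 unfolding partial_deriv_def
proof (rule deriv_cong_ev)
 show "eventually (%t. f (x(i := t)) = g (x(i := t))) (nhds (x i))"
  using eventually_line_in_open[OF assms(1-3)] by (rule eventually_mono) (rule assms(4))
qed simp

lemma partial_deriv_coordinate: "partial_deriv i (%x. x j) x = (if i = j then 1 else 0)"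
 unfolding partial_deriv_def by (rule DERIV_imp_deriv) auto

lemma partial_deriv_compose:
 assumes U: "openin (EN n) U" and V: "openin (EN m) V"
  and "!!x. x \<in> U ==> g x \<in> V" and g: "!!j. j < m ==> Ck_on (Suc 0) n U (%x. g x j)"
  and f: "Ck_on (Suc 0) m V f" and x: "x \<in> U" and i: "i < n"
 shows "partial_deriv i (%x. f (g x)) x = (\<Sum>j<m. partial_deriv j f (g x) * partial_deriv i (%x. g x j) x)"
 unfolding partial_deriv_def[of i "%x. f (g x)"]
 by (rule DERIV_imp_deriv[OF partial_has_derivative_compose[OF assms]])

lemma smooth_intoD: "smooth_into n m U f ==> i < m ==> Ck_on k n U (%x. f x i)"
 by (simp add: smooth_into_def)

lemma smooth_into_subset: "smooth_into n m U f ==> V \<subseteq> U ==> smooth_into n m V f"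
 unfolding smooth_into_def using Ck_on_subset by blast

lemma smooth_into_cong:
 assumes "openin (EN n) U" "!!x i. x \<in> U ==> i < m ==> f x i = g x i" "smooth_into n m U f"
 shows "smooth_into n m U g"
 unfolding smooth_into_def
proof (intro allI impI)
 fix i k assume "i < m"
 then show "Ck_on k n U (%x. g x i)"
  using Ck_on_cong[OF assms(1), of "%x. f x i" "%x. g x i"] assms(2) smooth_intoD[OF assms(3)] by blast
qed

lemma smooth_into_local:
 assumes "openin (EN n) U"
  and "!!x. x \<in> U ==> \<exists>V. openin (EN n) V & x \<in> V & smooth_into n m (U \<inter> V) f"
 shows "smooth_into n m U f"
 unfolding smooth_into_def
proof (intro allI impI)
 fix i k assume i: "i < m"
 show "Ck_on k n U (%x. f x i)"
 proof (rule Ck_on_local[OF assms(1)])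
  fix x assume "x \<in> U"
  then obtain V where "openin (EN n) V" "x \<in> V" "smooth_into n m (U \<inter> V) f"
   using assms(2) by blast
  then show "\<exists>V. openin (EN n) V & x \<in> V & Ck_on k n (U \<inter> V) (%x. f x i)"
   using smooth_intoD[OF _ i] by blast
 qed
qed

lemma smooth_into_compose:
 assumes "openin (EN n) U" "openin (EN m) V"
  and "!!x. x \<in> U ==> g x \<in> V" "smooth_into n m U g" "smooth_into m l V f"
 shows "smooth_into n l U (%x. f (g x))"
 unfolding smooth_into_def
proof (intro allI impI)
 fix i k assume "i < l"
 then show "Ck_on k n U (%x. f (g x) i)"
  using Ck_on_compose[OF assms(1-3), where k = k and f = "%y. f y i"] assms(4,5)
  by (simp add: smooth_into_def)
qed

lemma openin_continuous_preimage:
 assumes U: "openin (EN n) U" and V: "openin (EN m) V"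
  and c: "!!i. i < m ==> continuous_on U (%x. f x i)" and z: "!!x i. x \<in> U ==> i \<ge> m ==> f x i = 0"
 shows "openin (EN n) {x\<in>U. f x \<in> V}"
proof -
 obtain T where T: "open T" "V = {x. \<forall>i\<ge>m. x i = 0} \<inter> T"
  using V unfolding Euclidean_space_eq_top_of_set openin_open by blast
 have "continuous_on U f" by (rule continuous_on_coordinatewise[OF c z])
 then have "openin (top_of_set U) (U \<inter> f -` T)" using T(1) by (rule continuous_openin_preimage_gen)
 then have "openin (EN n) (U \<inter> f -` T)"
  using U unfolding Euclidean_space_eq_top_of_set by (rule openin_trans)
 moreover have "U \<inter> f -` T = {x\<in>U. f x \<in> V}" using z T(2) by auto
 ultimately show ?thesis by simp
qed

lemma openin_smooth_preimage:
 assumes "openin (EN n) U" "openin (EN m) V" "smooth_into n m U f"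
  and "!!x i. x \<in> U ==> i \<ge> m ==> f x i = 0"
 shows "openin (EN n) {x\<in>U. f x \<in> V}"
 using assms by (intro openin_continuous_preimage) (auto dest: smooth_intoD[where k = 0])

text \<open>The inverse function theorem for a map that alters only coordinate \<open>j\<close>.
  Along lines in this direction \<open>g\<close> is strictly monotone, so the intermediate value
  theorem inverts the map and no fixed point argument is involved. The general case is composed of
  such maps in \<open>straightening\<close>.\<close>

lemma elementary_diffeo:
 assumes U: "openin (EN n) U" and g: "!!k. Ck_on k n U g" and x: "x \<in> U" and j: "j < n"
  and nz: "partial_deriv j g x \<noteq> 0"
 obtains D G where "openin (EN n) D" "x \<in> D" "D \<subseteq> U"
  "openin (EN n) ((%y. y(j := g y)) ` D)" "!!y. y \<in> D ==> G (y(j := g y)) = y j"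
  "!!k. Ck_on k n ((%y. y(j := g y)) ` D) G"
proof -
 note subU = openin_Euclidean_subset[OF U]
 note C1 = g[of "Suc 0"]
 \<comment> \<open>Multiplication by this sign makes \<open>g\<close> increasing in coordinate
   \<open>j\<close>, whatever the sign of its derivative.\<close>
 define \<sigma> where "\<sigma> = sgn (partial_deriv j g x)"
 have \<sigma>: "\<bar>\<sigma>\<bar> = 1" "\<sigma> * \<sigma> = 1" using nz by (auto simp: \<sigma>_def sgn_if)
 obtain r where r: "r > 0" "cube n x r \<subseteq> U" "!!y. y \<in> cube n x r ==> \<sigma> * partial_deriv j g y > 0"
 proof -
  obtain r1 where r1: "r1 > 0" "cube n x r1 \<subseteq> U" using U x openin_Euclidean_cubeE by blast
  have "continuous_on U (partial_deriv j g)" using C1 j by simp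
  then obtain d where d: "d > 0" "\<forall>y\<in>U. (\<forall>i<n. \<bar>y i - x i\<bar> < d) -->
    \<bar>partial_deriv j g y - partial_deriv j g x\<bar> < \<bar>partial_deriv j g x\<bar>"
   using continuous_on_cube[OF subU] x nz by (metis zero_less_abs_iff)
  have "\<sigma> * partial_deriv j g y > 0" if "y \<in> cube n x (min d r1)" for y
  proof -
   have "y \<in> U" "\<forall>i<n. \<bar>y i - x i\<bar> < d" using that r1(2) by (auto simp: cube_def)
   then have "\<bar>partial_deriv j g y - partial_deriv j g x\<bar> < \<bar>partial_deriv j g x\<bar>" using d(2) by blast
   then show ?thesis unfolding \<sigma>_def using nz by (auto simp: sgn_if split: if_splits)
  qed
  then show thesis using that[of "min d r1"] d(1) r1 cube_mono[of "min d r1" r1 n x] by auto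
 qed
 define D where "D = cube n x r"
 let ?\<epsilon> = "%y. y(j := g y)"
 define R where "R = ?\<epsilon> ` D"
 have openD: "openin (EN n) D" by (simp add: D_def openin_cube)
 note subD = openin_Euclidean_subset[OF openD]
 have DU: "D \<subseteq> U" using r(2) D_def by simp
 have updD: "y(j := t) \<in> D" if "y \<in> D" "\<bar>t - x j\<bar> < r" for y t
  using that j by (auto simp: D_def cube_def)
 have Dj: "\<bar>y j - x j\<bar> < r" if "y \<in> D" for y using that j by (auto simp: D_def cube_def)
 have line: "((%t. g (y(j := t))) has_real_derivative partial_deriv j g (y(j := t))) (at t)" if "y(j := t) \<in> D" for y t
  using Ck_on_partial_has_derivative[OF C1, of "y(j := t)" j] that DU j by auto
 have mono: "\<sigma> * g (y(j := a)) < \<sigma> * g (y(j := b))"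
  if "y \<in> D" "a < b" "\<bar>a - x j\<bar> < r" "\<bar>b - x j\<bar> < r" for y a b
 proof (rule DERIV_pos_imp_increasing[OF that(2)])
  fix t assume "a \<le> t" "t \<le> b"
  then have "y(j := t) \<in> D" using that by (intro updD) auto
  then show "\<exists>l. ((%t. \<sigma> * g (y(j := t))) has_real_derivative l) (at t) & l > 0"
   using DERIV_cmult[OF line] r(3) D_def by blast
 qed
 have inj: "a = b" if "y \<in> D" "\<bar>a - x j\<bar> < r" "\<bar>b - x j\<bar> < r" "g (y(j := a)) = g (y(j := b))" for y a b
  using mono[OF that(1), of a b] mono[OF that(1), of b a] that by (cases a b rule: linorder_cases) auto
 define G where "G = (%z. SOME t. \<bar>t - x j\<bar> < r & g (z(j := t)) = z j)"
 have G: "G (?\<epsilon> y) = y j" if "y \<in> D" for y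
  unfolding G_def
 proof (rule some_equality)
  show "\<bar>y j - x j\<bar> < r & g ((?\<epsilon> y)(j := y j)) = (?\<epsilon> y) j" using Dj[OF that] by simp
  show "t = y j" if "\<bar>t - x j\<bar> < r & g ((?\<epsilon> y)(j := t)) = (?\<epsilon> y) j" for t
   using inj[OF \<open>y \<in> D\<close>, of t "y j"] Dj[OF \<open>y \<in> D\<close>] that by simp
 qed
 \<comment> \<open>Every \<open>z\<close> near the image of \<open>y\<close> is attained at a point
   \<open>y'\<close> whose coordinate \<open>j\<close> is close to that of \<open>y\<close>. This
   gives at once that the image is open and that the inverse is continuous.\<close>
 have local_solve: "\<exists>d>0. \<forall>z\<in>cube n (?\<epsilon> y) d. \<exists>y'\<in>D. ?\<epsilon> y' = z & \<bar>y' j - y j\<bar> < e"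
  if y: "y \<in> D" and e: "e > 0" for y e
 proof -
  \<comment> \<open>At most half of \<open>e\<close> and half of the distance of \<open>y j\<close>
    to the ends of the admissible interval, so that \<open>y j - h\<close> and
    \<open>y j + h\<close> stay admissible and closer than \<open>e\<close>.\<close>
  define h where "h = min (e/2) ((r - \<bar>y j - x j\<bar>)/2)"
  have h: "h > 0" "h < e" "\<bar>y j - h - x j\<bar> < r" "\<bar>y j + h - x j\<bar> < r"
   using e Dj[OF y] by (auto simp: h_def min_def field_simps)
  define lo hi where "lo = y j - h" and "hi = y j + h"
  have lh: "lo < y j" "y j < hi" "lo < hi" "\<bar>lo - x j\<bar> < r" "\<bar>hi - x j\<bar> < r" using h by (auto simp: lo_def hi_def)
  have "\<sigma> * g (y(j := lo)) < \<sigma> * g (y(j := y j))" "\<sigma> * g (y(j := y j)) < \<sigma> * g (y(j := hi))"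
   using mono[OF y lh(1)] mono[OF y lh(2)] lh Dj[OF y] by auto
  then have gap0: "\<sigma> * g (y(j := lo)) < \<sigma> * g y" "\<sigma> * g y < \<sigma> * g (y(j := hi))" by auto
  \<comment> \<open>Half of the smaller increment: \<open>g\<close> at the perturbed points and the
    prescribed value \<open>z j\<close> may each deviate by less than \<open>gap\<close> without
    reversing the inequalities at \<open>lo\<close> and \<open>hi\<close>.\<close>
  define gap where "gap = min (\<sigma> * g y - \<sigma> * g (y(j := lo))) (\<sigma> * g (y(j := hi)) - \<sigma> * g y) / 2"
  have gap: "gap > 0" "\<sigma> * g (y(j := lo)) + gap \<le> \<sigma> * g y - gap" "\<sigma> * g y + gap \<le> \<sigma> * g (y(j := hi)) - gap"
   using gap0 by (auto simp: gap_def min_def field_simps)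
  have loD: "y(j := lo) \<in> U" "y(j := hi) \<in> U" using updD[OF y] lh DU by blast+
  have cg: "continuous_on U g" using g[of 0] by simp
  obtain d1 where d1: "d1 > 0" "\<forall>u\<in>U. (\<forall>i<n. \<bar>u i - (y(j := lo)) i\<bar> < d1) --> \<bar>g u - g (y(j := lo))\<bar> < gap"
   using cg[unfolded continuous_on_cube[OF subU]] loD(1) gap(1) by blast
  obtain d2 where d2: "d2 > 0" "\<forall>u\<in>U. (\<forall>i<n. \<bar>u i - (y(j := hi)) i\<bar> < d2) --> \<bar>g u - g (y(j := hi))\<bar> < gap"
   using cg[unfolded continuous_on_cube[OF subU]] loD(2) gap(1) by blast
  obtain d3 where d3: "d3 > 0" "cube n y d3 \<subseteq> D" using openD y openin_Euclidean_cubeE by blast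
  define d where "d = min (min d1 d2) (min d3 gap)"
  have d: "d > 0" "d \<le> d1" "d \<le> d2" "d \<le> d3" "d \<le> gap" using d1 d2 d3 gap by (auto simp: d_def)
  have "\<exists>y'\<in>D. ?\<epsilon> y' = z & \<bar>y' j - y j\<bar> < e" if z: "z \<in> cube n (?\<epsilon> y) d" for z
  proof -
   have zi: "\<bar>z i - y i\<bar> < d" if "i < n" "i \<noteq> j" for i using z that by (auto simp: cube_def)
   have zj: "\<bar>z j - g y\<bar> < gap" using z j d(5) by (fastforce simp: cube_def)
   have z0: "\<forall>i\<ge>n. z i = 0" using z by (simp add: cube_def)
   have zy: "z(j := y j) \<in> D"
   proof -
    have "z(j := y j) \<in> cube n y d3"
     using zi d z0 j d3(1) unfolding cube_def by (auto intro: less_le_trans)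
    then show ?thesis using d3(2) by blast
   qed
   have zD: "z(j := t) \<in> D" if "\<bar>t - x j\<bar> < r" for t using updD[OF zy that] by simp
   have sg: "\<bar>\<sigma> * a - \<sigma> * b\<bar> < gap" if "\<bar>a - b\<bar> < gap" for a b
    using \<sigma>(1) that by (metis abs_mult mult_1 right_diff_distrib)
   have "\<forall>i<n. \<bar>(z(j := lo)) i - (y(j := lo)) i\<bar> < d1"
    using zi d(2) d1(1) by (auto intro: less_le_trans)
   then have "\<bar>g (z(j := lo)) - g (y(j := lo))\<bar> < gap" using d1(2) zD[OF lh(4)] DU by blast
   then have le1: "\<sigma> * g (z(j := lo)) \<le> \<sigma> * z j"
    using sg[OF zj] sg[of "g (z(j := lo))"] gap(2) by (smt (verit))
   have "\<forall>i<n. \<bar>(z(j := hi)) i - (y(j := hi)) i\<bar> < d2"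
    using zi d(3) d2(1) by (auto intro: less_le_trans)
   then have "\<bar>g (z(j := hi)) - g (y(j := hi))\<bar> < gap" using d2(2) zD[OF lh(5)] DU by blast
   then have "\<sigma> * z j \<le> \<sigma> * g (z(j := hi))"
    using sg[OF zj] sg[of "g (z(j := hi))"] gap(3) by (smt (verit))
   note le1 this
   moreover have "continuous_on {lo..hi} (%t. \<sigma> * g (z(j := t)))"
   proof (intro continuous_at_imp_continuous_on ballI)
    fix t assume "t \<in> {lo..hi}"
    then have "z(j := t) \<in> D" using lh by (intro zD) auto
    then show "isCont (%t. \<sigma> * g (z(j := t))) t"
     using DERIV_cmult[OF line] DERIV_isCont by blast
   qed
   ultimately obtain t where t: "lo \<le> t" "t \<le> hi" "\<sigma> * g (z(j := t)) = \<sigma> * z j"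
    using IVT'[of "%t. \<sigma> * g (z(j := t))" lo "\<sigma> * z j" hi] lh by auto
   then have "g (z(j := t)) = z j" using \<sigma> by auto
   moreover have "z(j := t) \<in> D" using t lh by (intro zD) auto
   moreover have "\<bar>t - y j\<bar> < e" using t h by (auto simp: lo_def hi_def)
   ultimately show ?thesis by (intro bexI[of _ "z(j := t)"]) auto
  qed
  then show ?thesis using d(1) by blast
 qed
 have openR: "openin (EN n) R"
  unfolding openin_Euclidean_cube
 proof (intro conjI ballI)
  show "R \<subseteq> {x. \<forall>i\<ge>n. x i = 0}" using subD j by (auto simp: R_def)
  fix z assume "z \<in> R"
  then obtain y where y: "y \<in> D" "z = ?\<epsilon> y" by (auto simp: R_def)
  then obtain d where d: "d > 0" "\<forall>u\<in>cube n z d. \<exists>y'\<in>D. ?\<epsilon> y' = u & \<bar>y' j - y j\<bar> < 1"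
   using local_solve[OF y(1) zero_less_one] by blast
  have "u \<in> R" if "u \<in> cube n z d" for u
   using bspec[OF d(2) that] by (auto simp: R_def)
  then show "\<exists>r>0. cube n z r \<subseteq> R" using d(1) by blast
 qed
 note subR = openin_Euclidean_subset[OF openR]
 have contG: "continuous_on R G"
  unfolding continuous_on_cube[OF subR]
 proof (intro ballI allI impI)
  fix z and e :: real assume "z \<in> R" "e > 0"
  then obtain y where y: "y \<in> D" "z = ?\<epsilon> y" by (auto simp: R_def)
  obtain d where d: "d > 0" "\<forall>u\<in>cube n z d. \<exists>y'\<in>D. ?\<epsilon> y' = u & \<bar>y' j - y j\<bar> < e"
   using local_solve[OF y(1) \<open>e > 0\<close>] y(2) by blast
  have "\<bar>G u - G z\<bar> < e" if "u \<in> R" "\<forall>i<n. \<bar>u i - z i\<bar> < d" for u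
  proof -
   have "u \<in> cube n z d" using that subR by (auto simp: cube_def)
   then obtain y' where "y' \<in> D" "?\<epsilon> y' = u" "\<bar>y' j - y j\<bar> < e" using d(2) by blast
   then show ?thesis using G y by metis
  qed
  then show "\<exists>d>0. \<forall>u\<in>R. (\<forall>i<n. \<bar>u i - z i\<bar> < d) --> \<bar>G u - G z\<bar> < e" using d(1) by blast
 qed
 have inv: "z(j := G z) \<in> D" "g (z(j := G z)) = z j" if "z \<in> R" for z
 proof -
  obtain y where y: "y \<in> D" "z = ?\<epsilon> y" using \<open>z \<in> R\<close> by (auto simp: R_def)
  then have "z(j := G z) = y" using G[OF y(1)] by auto
  then show "z(j := G z) \<in> D" "g (z(j := G z)) = z j" using y by auto
 qed
 \<comment> \<open>Implicit differentiation of \<open>g (z(j := G z)) = z j\<close>. The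
   Caratheodory coefficients of \<open>g\<close> express the difference quotient of \<open>G\<close>
   exactly, so only their limits are taken; the case distinction records whether the varied
   coordinate is the prescribed value itself.\<close>
 have derG: "((%t. G (z(i := t))) has_real_derivative
   (if i = j then 1 else - partial_deriv i g (z(j := G z))) * inverse (partial_deriv j g (z(j := G z)))) (at (z i))"
  if i: "i < n" and z: "z \<in> R" for i z
 proof -
  define y where "y = z(j := G z)"
  have yD: "y \<in> D" "g y = z j" "y \<in> U" using inv[OF z] DU by (auto simp: y_def)
  have nzy: "partial_deriv j g y \<noteq> 0" using r(3) yD(1) by (force simp: D_def)
  obtain \<rho> a where a: "\<rho> > 0" "cube n y \<rho> \<subseteq> U"
   "!!u. u \<in> cube n y \<rho> ==> g u - g y = (\<Sum>l<n. a l u * (u l - y l))"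
   "!!e. e > 0 ==> \<exists>d>0. \<forall>l<n. \<forall>u\<in>cube n y d. \<bar>a l u - partial_deriv l g y\<bar> < e"
   using caratheodory_decomposition[OF U C1 yD(3)] by blast
  define \<gamma> where "\<gamma> = (%t. (z(i := t))(j := G (z(i := t))))"
  have evR: "eventually (%t. z(i := t) \<in> R) (at (z i))"
   using eventually_line_in_open[OF openR z i] by (simp add: eventually_nhds_conv_at)
  have ev0: "eventually (%t. \<gamma> t \<in> {x. \<forall>i\<ge>n. x i = 0}) (at (z i))"
   using evR
  proof (rule eventually_mono)
   fix t assume "z(i := t) \<in> R"
   then have "\<gamma> t \<in> D" unfolding \<gamma>_def by (rule inv(1))
   then show "\<gamma> t \<in> {x. \<forall>i\<ge>n. x i = 0}" using subD by blast
  qed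
  have limG: "((%t. G (z(i := t))) \<longlongrightarrow> G z) (at (z i))"
  proof (rule tendstoI)
   fix e :: real assume "e > 0"
   then obtain d where d: "d > 0" "\<forall>u\<in>R. (\<forall>i<n. \<bar>u i - z i\<bar> < d) --> \<bar>G u - G z\<bar> < e"
    using contG[unfolded continuous_on_cube[OF subR]] z by blast
   have "eventually (%t. dist t (z i) < d) (at (z i))"
    unfolding eventually_at using d(1) by auto
   with evR show "eventually (%t. dist (G (z(i := t))) (G z) < e) (at (z i))"
   proof (rule eventually_elim2)
    fix t assume "z(i := t) \<in> R" "dist t (z i) < d"
    then show "dist (G (z(i := t))) (G z) < e"
     using d by (auto simp: dist_real_def)
   qed
  qed
  have lim\<gamma>: "((%t. \<gamma> t l) \<longlongrightarrow> y l) (at (z i))" if "l < n" for l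
  proof -
   have "((%t. if l = i then t else z l) \<longlongrightarrow> z l) (at (z i))"
    by (cases "l = i") auto
   then show ?thesis using limG by (auto simp: \<gamma>_def y_def)
  qed
  have lima: "((%t. a l (\<gamma> t)) \<longlongrightarrow> partial_deriv l g y) (at (z i))" if "l < n" for l
   using tendsto_caratheodory_coefficient[OF a(4) ev0 lim\<gamma> that] by simp
  have "((%t. (if i = j then 1 else - a i (\<gamma> t)) * inverse (a j (\<gamma> t))) \<longlongrightarrow>
    (if i = j then 1 else - partial_deriv i g y) * inverse (partial_deriv j g y)) (at (z i))"
   using lima[OF i] lima[OF j] nzy by (auto intro!: tendsto_intros)
  moreover have "eventually (%t. (if i = j then 1 else - a i (\<gamma> t)) * inverse (a j (\<gamma> t)) =
    (G (z(i := t)) - G z) / (t - z i)) (at (z i))"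
  proof -
   have e1: "eventually (%t. \<gamma> t \<in> cube n y \<rho>) (at (z i))"
    by (rule eventually_curve_in_cube[OF ev0 lim\<gamma> a(1)])
   have e2: "eventually (%t. a j (\<gamma> t) \<noteq> 0) (at (z i))"
    by (rule tendsto_imp_eventually_ne[OF lima[OF j] nzy])
   have e3: "eventually (%t. t \<noteq> z i) (at (z i))" by (simp add: eventually_at_filter)
   show ?thesis using evR e1 e2 e3
   proof eventually_elim
    case (elim t)
    have "g (\<gamma> t) = (z(i := t)) j" using inv(2)[OF elim(1)] by (simp add: \<gamma>_def)
    then have "(z(i := t)) j - z j = (\<Sum>l<n. a l (\<gamma> t) * (\<gamma> t l - y l))"
     using a(3)[OF elim(2)] yD(2) by simp
    also have "\<dots> = a j (\<gamma> t) * (G (z(i := t)) - G z) + (\<Sum>l\<in>{..<n} - {j}. a l (\<gamma> t) * (\<gamma> t l - y l))"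
     using j by (subst sum.remove[of _ j]) (auto simp: \<gamma>_def y_def)
    also have "(\<Sum>l\<in>{..<n} - {j}. a l (\<gamma> t) * (\<gamma> t l - y l)) =
      (\<Sum>l\<in>{..<n} - {j}. if l = i then a i (\<gamma> t) * (t - z i) else 0)"
     by (rule sum.cong) (auto simp: \<gamma>_def y_def)
    also have "\<dots> = (if i = j then 0 else a i (\<gamma> t) * (t - z i))"
     using i by (simp add: sum.delta)
    finally show ?case using elim(3,4) by (auto simp: field_simps fun_upd_def split: if_splits)
   qed
  qed
  ultimately show ?thesis
   unfolding has_field_derivative_iff y_def[symmetric] by (simp add: Lim_transform_eventually)
 qed
 \<comment> \<open>Bootstrapping: the derivative of \<open>G\<close> is built from partial
   derivatives of \<open>g\<close> at \<open>z(j := G z)\<close>, so each order of smoothness of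
   \<open>G\<close> yields the next.\<close>
 have "Ck_on k n R G" for k
 proof (induction k)
  case 0 then show ?case using contG by simp
 next
  case (Suc k)
  have comp: "Ck_on k n R (%z. f (z(j := G z)))" if "Ck_on k n U f" for f
  proof (rule Ck_on_compose[OF openR U _ _ that])
   show "Ck_on k n R (%z. (z(j := G z)) l)" if "l < n" for l
    using Suc Ck_on_coordinate[OF openR] by (cases "l = j") auto
  qed (use inv(1) DU in auto)
  show ?case
  proof (rule Ck_on_SucI[OF openR contG derG])
   fix i assume i: "i < n"
   have "Ck_on k n R (%z. inverse (partial_deriv j g (z(j := G z))))"
    using r(3) inv(1) g[of "Suc k"] j by (intro Ck_on_inverse[OF openR] comp) (force simp: D_def)+
   moreover have "Ck_on k n R (%z. (if i = j then 1 else - partial_deriv i g (z(j := G z))))"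
   proof (cases "i = j")
    case True then show ?thesis by (simp add: Ck_on_const[OF openR])
   next
    case False
    have "Ck_on k n R (%z. 0 - partial_deriv i g (z(j := G z)))"
     using g[of "Suc k"] i by (intro Ck_on_diff[OF openR] Ck_on_const[OF openR] comp) auto
    then show ?thesis using False by simp
   qed
   ultimately show "Ck_on k n R (%z. (if i = j then 1 else - partial_deriv i g (z(j := G z))) *
     inverse (partial_deriv j g (z(j := G z))))"
    by (intro Ck_on_mult[OF openR])
  qed auto
 qed
 then show thesis
  using that[of D G] openD openR G DU x center_in_cube[OF r(1)] subU unfolding R_def D_def by blast
qed

section \<open>Local diffeomorphisms and the normal form of submersions\<close>

declare Ck_on.simps(2) [simp del]

definition diffeo_on :: "nat => (nat => real) set => ((nat => real) => nat => real) =>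
  ((nat => real) => nat => real) => bool" where
 "diffeo_on n D \<theta> \<theta>' \<longleftrightarrow> openin (EN n) D & openin (EN n) (\<theta> ` D) &
   smooth_into n n D \<theta> & smooth_into n n (\<theta> ` D) \<theta>' & (\<forall>x\<in>D. \<theta>' (\<theta> x) = x)"

lemma diffeo_on_zero_tail: "[|diffeo_on n D \<theta> \<theta>'; x \<in> D; n \<le> i|] ==> \<theta> x i = 0"
 unfolding diffeo_on_def using openin_Euclidean_zero_tail by blast

lemma diffeo_on_subset:
 assumes d: "diffeo_on n D \<theta> \<theta>'" and E: "openin (EN n) E" "E \<subseteq> D"
 shows "diffeo_on n E \<theta> \<theta>'"
proof -
 have "openin (EN n) {z\<in>\<theta> ` D. \<theta>' z \<in> E}"
  using d E openin_Euclidean_zero_tail[of n D]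
  by (intro openin_smooth_preimage[where m = n]) (auto simp: diffeo_on_def)
 moreover have "{z\<in>\<theta> ` D. \<theta>' z \<in> E} = \<theta> ` E" using d E(2) by (auto simp: diffeo_on_def)
 ultimately show ?thesis
  using d E smooth_into_subset[of n n D \<theta> E] smooth_into_subset[of n n "\<theta> ` D" \<theta>' "\<theta> ` E"]
  unfolding diffeo_on_def by auto
qed

lemma diffeo_on_compose:
 assumes 1: "diffeo_on n D \<theta> \<theta>'" and 2: "diffeo_on n E \<eta> \<eta>'" and E: "E \<subseteq> \<theta> ` D"
 shows "diffeo_on n {x\<in>D. \<theta> x \<in> E} (%x. \<eta> (\<theta> x)) (%z. \<theta>' (\<eta>' z))"
proof -
 let ?D = "{x\<in>D. \<theta> x \<in> E}"
 have oE: "openin (EN n) E" using 2 by (simp add: diffeo_on_def)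
 have oD: "openin (EN n) ?D"
  using 1 oE diffeo_on_zero_tail[OF 1] by (intro openin_smooth_preimage[where m = n]) (auto simp: diffeo_on_def)
 have im: "(%x. \<eta> (\<theta> x)) ` ?D = \<eta> ` E" using E by auto
 have "smooth_into n n ?D (%x. \<eta> (\<theta> x))"
 proof (rule smooth_into_compose[OF oD oE, where g = \<theta> and f = \<eta>])
  show "smooth_into n n ?D \<theta>" using 1 smooth_into_subset[of n n D \<theta> ?D] by (auto simp: diffeo_on_def)
 qed (use 2 in "auto simp: diffeo_on_def")
 moreover have "smooth_into n n (\<eta> ` E) (%z. \<theta>' (\<eta>' z))"
 proof (rule smooth_into_compose[where g = \<eta>' and f = \<theta>'])
  show "openin (EN n) (\<theta> ` D)" "smooth_into n n (\<theta> ` D) \<theta>'" using 1 by (auto simp: diffeo_on_def)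
  show "openin (EN n) (\<eta> ` E)" "smooth_into n n (\<eta> ` E) \<eta>'" using 2 by (auto simp: diffeo_on_def)
  show "\<eta>' z \<in> \<theta> ` D" if "z \<in> \<eta> ` E" for z using that 2 E by (auto simp: diffeo_on_def)
 qed
 ultimately show ?thesis
  using 1 2 oD unfolding diffeo_on_def im by auto
qed

lemma diffeo_on_permutation:
 assumes p: "bij_betw p {..<n} {..<n}"
 shows "diffeo_on n (topspace (EN n)) (%z l. if l < n then z (p l) else 0)
      (%z l. if l < n then z (inv_into {..<n} p l) else 0)"
proof -
 let ?T = "topspace (EN n)"
 let ?P = "%z l. if l < n then z (p l) else 0" and ?Q = "%z l. if l < n then z (inv_into {..<n} p l) else 0"
 have pl: "p l < n" "inv_into {..<n} p l < n" "inv_into {..<n} p (p l) = l" "p (inv_into {..<n} p l) = l"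
  if "l < n" for l
  using that p bij_betwE[OF p] bij_betwE[OF bij_betw_inv_into[OF p]]
   bij_betw_inv_into_left[OF p, of l] bij_betw_inv_into_right[OF p, of l] by auto
 have QP: "?Q (?P z) = z" "?P (?Q z) = z" if "z \<in> ?T" for z
  using that pl by (auto simp: topspace_Euclidean_space fun_eq_iff)
 have im: "?P ` ?T = ?T"
 proof
  show "?T \<subseteq> ?P ` ?T"
  proof
   fix z :: "nat => real" assume "z \<in> ?T"
   then show "z \<in> ?P ` ?T"
    using QP(2) by (intro image_eqI[where x = "?Q z"]) (auto simp: topspace_Euclidean_space)
  qed
 qed (auto simp: topspace_Euclidean_space)
 have sm: "smooth_into n n ?T (%z l. if l < n then z (q l) else 0)" for q
  unfolding smooth_into_def using Ck_on_coordinate[OF openin_topspace] by auto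
 show ?thesis
  unfolding diffeo_on_def im using sm QP(1) by auto
qed

lemma straightening:
 assumes U: "openin (EN n) U" and f: "smooth_into n m U f" and x: "x \<in> U"
  and jac: "jacobian_surj n m f x"
 obtains D \<theta> \<theta>' where "diffeo_on n D \<theta> \<theta>'" "x \<in> D" "D \<subseteq> U" "m \<le> n"
  "!!y i. [|y \<in> D; i < m|] ==> \<theta> y (n - m + i) = f y i"
proof -
 \<comment> \<open>\<open>e\<close> records the positions that the first \<open>k\<close> components
   occupy; the next step must alter a position outside its range.\<close>
 have "k \<le> m ==> \<exists>D \<theta> \<theta>' e. diffeo_on n D \<theta> \<theta>' & x \<in> D & D \<subseteq> U & inj_on e {..<k} & e ` {..<k} \<subseteq> {..<n} &
   (\<forall>y\<in>D. \<forall>i<k. \<theta> y (e i) = f y i)" for k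
 proof (induction k)
  case 0
  have "diffeo_on n U (%x. x) (%x. x)"
   using U by (auto simp: diffeo_on_def smooth_into_def Ck_on_coordinate)
  then show ?case using x by auto
 next
  case (Suc k)
  then obtain D \<theta> \<theta>' e where IH: "diffeo_on n D \<theta> \<theta>'" "x \<in> D" "D \<subseteq> U" "inj_on e {..<k}" "e ` {..<k} \<subseteq> {..<n}"
   "!!y i. y \<in> D ==> i < k ==> \<theta> y (e i) = f y i" by auto
  have km: "k < m" using Suc.prems by simp
  have oD: "openin (EN n) D" and oC: "openin (EN n) (\<theta> ` D)"
   and s\<theta>: "smooth_into n n D \<theta>" and s\<theta>': "smooth_into n n (\<theta> ` D) \<theta>'" and inv: "!!y. y \<in> D ==> \<theta>' (\<theta> y) = y"
   using IH(1) by (auto simp: diffeo_on_def)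
  define g where "g = (%z. f (\<theta>' z) k)"
  have "smooth_into n m (\<theta> ` D) (%z. f (\<theta>' z))"
   by (rule smooth_into_compose[OF oC oD _ s\<theta>' smooth_into_subset[OF f IH(3)]]) (use inv in auto)
  then have sg: "Ck_on c n (\<theta> ` D) g" for c
   unfolding g_def using smooth_intoD km by blast
  obtain v where v: "!!i. i < m ==> (\<Sum>j<n. partial_deriv j (%z. f z i) x * v j) = (if i = k then 1 else 0)"
   using spec[OF jac[unfolded jacobian_surj_def], of "%i. if i = k then 1 else 0"] by blast
  have pf: "partial_deriv j (%z. f z k) x = (\<Sum>l<n. partial_deriv l g (\<theta> x) * partial_deriv j (%z. \<theta> z l) x)"
   if "j < n" for j
  proof -
   have "partial_deriv j (%z. f z k) x = partial_deriv j (%z. g (\<theta> z)) x"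
    using inv by (intro partial_deriv_cong[OF oD IH(2) that]) (simp add: g_def)
   also have "\<dots> = (\<Sum>l<n. partial_deriv l g (\<theta> x) * partial_deriv j (%z. \<theta> z l) x)"
    by (rule partial_deriv_compose[OF oD oC _ smooth_intoD[OF s\<theta>] sg IH(2) that]) auto
   finally show ?thesis .
  qed
  have "\<exists>l<n. l \<notin> e ` {..<k} & partial_deriv l g (\<theta> x) \<noteq> 0"
  proof (rule ccontr)
   assume "\<not> ?thesis"
   then have z: "!!l. l < n ==> l \<notin> e ` {..<k} ==> partial_deriv l g (\<theta> x) = 0" by blast
   have "1 = (\<Sum>j<n. partial_deriv j (%z. f z k) x * v j)" using v[OF km] by simp
   also have "\<dots> = (\<Sum>j<n. (\<Sum>l<n. partial_deriv l g (\<theta> x) * partial_deriv j (%z. \<theta> z l) x) * v j)"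
    by (rule sum.cong) (simp_all add: pf)
   also have "\<dots> = (\<Sum>l<n. partial_deriv l g (\<theta> x) * (\<Sum>j<n. partial_deriv j (%z. \<theta> z l) x * v j))"
    unfolding sum_distrib_left sum_distrib_right by (subst sum.swap) (simp add: mult.assoc)
   also have "\<dots> = 0"
   proof (rule sum.neutral, rule ballI)
    fix l assume l: "l \<in> {..<n}"
    show "partial_deriv l g (\<theta> x) * (\<Sum>j<n. partial_deriv j (%z. \<theta> z l) x * v j) = 0"
    proof (cases "l \<in> e ` {..<k}")
     case True
     then obtain i where i: "i < k" "l = e i" by auto
     have "(\<Sum>j<n. partial_deriv j (%z. \<theta> z l) x * v j) = (\<Sum>j<n. partial_deriv j (%z. f z i) x * v j)"
      using IH(6) i by (intro sum.cong arg_cong2[where f = "(*)"] partial_deriv_cong[OF oD IH(2)]) auto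
     then show ?thesis using v[of i] i km by simp
    qed (use z l in auto)
   qed
   finally show False by simp
  qed
  then obtain l where l: "l < n" "l \<notin> e ` {..<k}" "partial_deriv l g (\<theta> x) \<noteq> 0" by blast
  obtain E G where E: "openin (EN n) E" "\<theta> x \<in> E" "E \<subseteq> \<theta> ` D"
   "openin (EN n) ((%y. y(l := g y)) ` E)" "!!y. y \<in> E ==> G (y(l := g y)) = y l"
   "!!k. Ck_on k n ((%y. y(l := g y)) ` E) G"
   using elementary_diffeo[OF oC sg _ l(1,3)] IH(2) by blast
  have dE: "diffeo_on n E (%y. y(l := g y)) (%y. y(l := G y))"
   unfolding diffeo_on_def smooth_into_def
  proof (intro conjI allI impI ballI)
   fix i k
   show "Ck_on k n E (%x. (x(l := g x)) i)"
    using Ck_on_subset[OF sg E(3)] Ck_on_coordinate[OF E(1)] by (cases "i = l") auto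
   show "Ck_on k n ((%y. y(l := g y)) ` E) (%x. (x(l := G x)) i)"
    using E(6) Ck_on_coordinate[OF E(4)] by (cases "i = l") auto
  qed (use E in auto)
  let ?D = "{y\<in>D. \<theta> y \<in> E}" and ?e = "e(k := l)"
  have "inj_on ?e {..<Suc k}"
   using IH(4) l by (auto simp: inj_on_def less_Suc_eq)
  moreover have "?e ` {..<Suc k} \<subseteq> {..<n}"
   using IH(5) l(1) by (auto simp: less_Suc_eq image_subset_iff)
  moreover have "((\<theta> y)(l := g (\<theta> y))) (?e i) = f y i" if "y \<in> ?D" "i < Suc k" for y i
   using that IH(6) l(2) inv by (auto simp: less_Suc_eq g_def)
  ultimately show ?case
   using IH(2,3) E(2)
   by (intro exI conjI) (rule diffeo_on_compose[OF IH(1) dE E(3)] | force)+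
 qed
 from this[OF order_refl] obtain D \<theta> \<theta>' e where
  d: "diffeo_on n D \<theta> \<theta>'" "x \<in> D" "D \<subseteq> U" "inj_on e {..<m}" "e ` {..<m} \<subseteq> {..<n}"
   "\<forall>y\<in>D. \<forall>i<m. \<theta> y (e i) = f y i" by (elim exE conjE) (rule that)
 have mn: "m \<le> n" using card_inj_on_le[OF d(4,5)] by simp
 have "card ({..<n} - e ` {..<m}) = n - m"
  using d(4,5) by (simp add: card_Diff_subset card_image)
 then obtain b where b: "bij_betw b {..<n - m} ({..<n} - e ` {..<m})"
  using finite_same_card_bij[of "{..<n - m}" "{..<n} - e ` {..<m}"] by auto
 define p where "p = (%l. if l < n - m then b l else e (l - (n - m)))"
 have "bij_betw p {..<n - m} ({..<n} - e ` {..<m})"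
  using b by (rule bij_betw_cong[THEN iffD1, rotated]) (simp add: p_def)
 moreover have "bij_betw p {n - m..<n} (e ` {..<m})"
 proof -
  have "bij_betw (%l. l - (n - m)) {n - m..<n} {..<m}"
   by (rule bij_betwI[where g = "%i. i + (n - m)"]) (use mn in auto)
  then have "bij_betw (e \<circ> (%l. l - (n - m))) {n - m..<n} (e ` {..<m})"
   using bij_betw_trans inj_on_imp_bij_betw[OF d(4)] by blast
  then show ?thesis by (rule bij_betw_cong[THEN iffD1, rotated]) (simp add: p_def)
 qed
 ultimately have "bij_betw p ({..<n - m} \<union> {n - m..<n}) (({..<n} - e ` {..<m}) \<union> e ` {..<m})"
  by (rule bij_betw_combine) auto
 moreover have "{..<n - m} \<union> {n - m..<n} = {..<n}" by auto
 moreover have "({..<n} - e ` {..<m}) \<union> e ` {..<m} = {..<n}" using d(5) by auto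
 ultimately have p: "bij_betw p {..<n} {..<n}" by simp
 have oC: "openin (EN n) (\<theta> ` D)" using d(1) by (simp add: diffeo_on_def)
 note comp = diffeo_on_compose[OF d(1) diffeo_on_subset[OF diffeo_on_permutation[OF p] oC openin_subset[OF oC]] order_refl]
 have "{x\<in>D. \<theta> x \<in> \<theta> ` D} = D" by auto
 with comp show thesis
  using d(2,3,6) mn
  by (intro that[of D "%y l. if l < n then \<theta> y (p l) else 0"]) (auto simp: p_def)
qed

text \<open>The derivative of a right inverse is a right inverse of the derivative: the required
  preimage of \<open>c\<close> is its image under the Jacobian of \<open>\<tau>\<close>. In this way
  local sections yield the rank condition.\<close>

lemma jacobian_surj_of_section:
 assumes U: "openin (EN n) U" and f: "smooth_into n m U f"
  and W: "openin (EN m) W" and \<tau>: "smooth_into m n W \<tau>" and w: "w \<in> W"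
  and "!!w. w \<in> W ==> \<tau> w \<in> U" and sec: "!!w i. [|w \<in> W; i < m|] ==> f (\<tau> w) i = w i"
 shows "jacobian_surj n m f (\<tau> w)"
 unfolding jacobian_surj_def
proof
 fix c :: "nat => real"
 define v where "v = (%j. \<Sum>l<m. partial_deriv l (%z. \<tau> z j) w * c l)"
 have "(\<Sum>j<n. partial_deriv j (%z. f z i) (\<tau> w) * v j) = c i" if i: "i < m" for i
 proof -
  have "(\<Sum>j<n. partial_deriv j (%z. f z i) (\<tau> w) * partial_deriv l (%z. \<tau> z j) w) = (if l = i then 1 else 0)"
   if l: "l < m" for l
  proof -
   have "(\<Sum>j<n. partial_deriv j (%z. f z i) (\<tau> w) * partial_deriv l (%z. \<tau> z j) w) =
     partial_deriv l (%z. f (\<tau> z) i) w"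
    by (rule partial_deriv_compose[OF W U _ smooth_intoD[OF \<tau>] smooth_intoD[OF f i] w l, symmetric])
     (rule assms(6))
   also have "\<dots> = partial_deriv l (%z. z i) w"
    by (rule partial_deriv_cong[OF W w l]) (rule sec[OF _ i])
   finally show ?thesis by (simp add: partial_deriv_coordinate)
  qed
  then have "(\<Sum>l<m. (\<Sum>j<n. partial_deriv j (%z. f z i) (\<tau> w) * partial_deriv l (%z. \<tau> z j) w) * c l) = c i"
  proof -
   assume *: "!!l. l < m ==> (\<Sum>j<n. partial_deriv j (%z. f z i) (\<tau> w) * partial_deriv l (%z. \<tau> z j) w) =
     (if l = i then 1 else 0)"
   have "(\<Sum>l<m. (\<Sum>j<n. partial_deriv j (%z. f z i) (\<tau> w) * partial_deriv l (%z. \<tau> z j) w) * c l) =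
     (\<Sum>l<m. if l = i then c i else 0)"
    by (rule sum.cong[OF refl]) (use * in auto)
   then show ?thesis using i by simp
  qed
  moreover have "(\<Sum>j<n. partial_deriv j (%z. f z i) (\<tau> w) * v j) =
    (\<Sum>l<m. (\<Sum>j<n. partial_deriv j (%z. f z i) (\<tau> w) * partial_deriv l (%z. \<tau> z j) w) * c l)"
   unfolding v_def sum_distrib_left sum_distrib_right by (subst sum.swap) (simp add: mult.assoc)
  ultimately show ?thesis by simp
 qed
 then show "\<exists>v. \<forall>i<m. (\<Sum>j<n. partial_deriv j (%z. f z i) (\<tau> w) * v j) = c i" by blast
qed

section \<open>Plots, submersions and submanifolds\<close>

lemma continuous_map_open_subtopology:
 assumes "openin Z W"
 shows "continuous_map (subtopology Z W) T f \<longleftrightarrow>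
  (\<forall>w\<in>W. f w \<in> topspace T) & (\<forall>B. openin T B --> openin Z {w\<in>W. f w \<in> B})"
proof -
 have "topspace (subtopology Z W) = W" using openin_subset[OF assms] by auto
 moreover have "openin (subtopology Z W) {w\<in>W. f w \<in> B} = openin Z {w\<in>W. f w \<in> B}" for B
  using assms by (auto simp: openin_open_subtopology)
 ultimately show ?thesis unfolding continuous_map_def by auto
qed

lemma openin_locally:
 assumes "!!x. x \<in> S ==> \<exists>T. openin X T & x \<in> T & T \<subseteq> S"
 shows "openin X S"
 using assms by (subst openin_subopen) blast

lemma continuous_map_Euclidean_iff:
 "continuous_map X (EN n) f \<longleftrightarrow>
   (\<forall>x\<in>topspace X. \<forall>i\<ge>n. f x i = 0) & (\<forall>i<n. continuous_map X euclideanreal (%x. f x i))" (is "?L \<longleftrightarrow> ?R")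
proof
 assume L: ?L
 then have z: "\<forall>x\<in>topspace X. \<forall>i\<ge>n. f x i = 0"
  by (auto simp: continuous_map_def topspace_Euclidean_space)
 have "continuous_map X (EN n) (%x i. if i < n then f x i else 0)"
  by (rule continuous_map_eq[OF L]) (use z in "auto simp: fun_eq_iff")
 then show ?R using z unfolding continuous_map_componentwise_Euclidean_space by auto
next
 assume R: ?R
 then have "continuous_map X (EN n) (%x i. if i < n then f x i else 0)"
  unfolding continuous_map_componentwise_Euclidean_space by auto
 then show ?L by (rule continuous_map_eq) (use R in "auto simp: fun_eq_iff")
qed

lemma subtopology_Euclidean_eq:
 assumes "k \<le> n" "A \<subseteq> {x. \<forall>i\<ge>k. x i = 0}"
 shows "subtopology (EN k) A = subtopology (EN n) A"
proof -
 have "A \<subseteq> {x. \<forall>i\<ge>n. x i = 0}" using assms by fastforce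
 then show ?thesis using assms
  unfolding Euclidean_space_def by (simp add: subtopology_subtopology Int_absorb1)
qed

lemma smooth_into_comp:
 assumes "openin (EN n) U" "openin (EN m) V"
  and "!!x. x \<in> U ==> g x \<in> V" "smooth_into n m U g" "smooth_into m l V f"
 shows "smooth_into n l U (f \<circ> g)"
 using smooth_into_compose[OF assms] by (simp add: o_def)

text \<open>Smoothness is tested on smooth maps from open subsets of Euclidean spaces, so that the atlases of
 products, submanifolds and coverings need to be inspected only once.\<close>

definition plot :: "'a mfd => nat => (nat => real) set => ((nat => real) => 'a) => bool" where
 "plot X k W \<sigma> \<longleftrightarrow> openin (EN k) W &
   continuous_map (subtopology (EN k) W) (mtop X) \<sigma> &
   (\<forall>(U, \<phi>)\<in>atlas X. smooth_into k (mdim X) {w\<in>W. \<sigma> w \<in> U} (\<phi> \<circ> \<sigma>))"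

definition smooth_fn :: "'a mfd => nat => 'a set => ('a => nat => real) => bool" where
 "smooth_fn X q B c \<longleftrightarrow> openin (mtop X) B & (\<forall>x\<in>B. \<forall>i\<ge>q. c x i = 0) &
   (\<forall>k W \<sigma>. plot X k W \<sigma> & \<sigma> ` W \<subseteq> B --> smooth_into k q W (c \<circ> \<sigma>))"

definition section_at :: "'a mfd => nat => 'a set => ('a => nat => real) => 'a =>
  (nat => real) set => ((nat => real) => 'a) => bool" where
 "section_at X q B c x W \<tau> \<longleftrightarrow> plot X q W \<tau> & c x \<in> W & \<tau> ` W \<subseteq> B & \<tau> (c x) = x & (\<forall>w\<in>W. c (\<tau> w) = w)"

text \<open>Submersions are encoded by local sections through every point. Sections can be lifted to
  coverings, restricted and composed without a choice of charts, and
  \<open>jacobian_surj_of_section\<close> recovers the rank condition from them.\<close>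

definition subm :: "'a mfd => nat => 'a set => ('a => nat => real) => bool" where
 "subm X q B c \<longleftrightarrow> smooth_fn X q B c & (\<forall>x\<in>B. \<exists>W \<tau>. section_at X q B c x W \<tau>)"

lemma plot_openin: "plot X k W \<sigma> ==> openin (EN k) W"
 by (simp add: plot_def)

lemma plot_continuous: "plot X k W \<sigma> ==> continuous_map (subtopology (EN k) W) (mtop X) \<sigma>"
 by (simp add: plot_def)

lemma plot_in_topspace: "[|plot X k W \<sigma>; w \<in> W|] ==> \<sigma> w \<in> topspace (mtop X)"
 using continuous_map_open_subtopology[of "EN k" W] by (auto simp: plot_def)

lemma plot_preimage_open:
 "[|plot X k W \<sigma>; openin (mtop X) B|] ==> openin (EN k) {w\<in>W. \<sigma> w \<in> B}"
 using continuous_map_open_subtopology[of "EN k" W] by (auto simp: plot_def)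

lemma plot_subset:
 assumes p: "plot X k W \<sigma>" and W': "openin (EN k) W'" "W' \<subseteq> W"
 shows "plot X k W' \<sigma>"
 unfolding plot_def
proof (intro conjI ballI)
 show "continuous_map (subtopology (EN k) W') (mtop X) \<sigma>"
  using continuous_map_from_subtopology_mono[OF plot_continuous[OF p] W'(2)] .
 fix c assume "c \<in> atlas X"
 then show "case c of (U, \<phi>) => smooth_into k (mdim X) {w \<in> W'. \<sigma> w \<in> U} (\<phi> \<circ> \<sigma>)"
  using p W'(2) unfolding plot_def
  by (auto elim!: smooth_into_subset dest!: bspec split: prod.splits)
qed (rule W'(1))

lemma smooth_fn_openin: "smooth_fn X q B c ==> openin (mtop X) B"
 and smooth_fn_zero_tail: "[|smooth_fn X q B c; x \<in> B; q \<le> i|] ==> c x i = 0"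
 and smooth_fn_plot: "[|smooth_fn X q B c; plot X k W \<sigma>; \<sigma> ` W \<subseteq> B|] ==> smooth_into k q W (%w. c (\<sigma> w))"
 by (auto simp: smooth_fn_def o_def)

lemma smooth_fn_subset: "[|smooth_fn X q B c; openin (mtop X) B'; B' \<subseteq> B|] ==> smooth_fn X q B' c"
 unfolding smooth_fn_def by blast

lemma smooth_fn_plot_preimage:
 assumes "smooth_fn X q B c" "plot X k W \<sigma>" "\<sigma> ` W \<subseteq> B" "openin (EN q) A"
 shows "openin (EN k) {w\<in>W. c (\<sigma> w) \<in> A}"
 using assms smooth_fn_zero_tail[OF assms(1)] smooth_fn_plot[OF assms(1-3)] plot_openin[OF assms(2)]
 by (intro openin_smooth_preimage[where m = q]) auto

lemma section_at_subset:
 assumes s: "section_at X q B c x W \<tau>" and B': "openin (mtop X) B'" "x \<in> B'"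
 shows "section_at X q B' c x {w\<in>W. \<tau> w \<in> B'} \<tau>"
 using s B' plot_preimage_open[of X q W \<tau> B'] plot_subset[of X q W \<tau> "{w\<in>W. \<tau> w \<in> B'}"]
 unfolding section_at_def by auto

lemma subm_subset:
 assumes "subm X q B c" "openin (mtop X) B'" "B' \<subseteq> B"
 shows "subm X q B' c"
 unfolding subm_def
proof (intro conjI ballI)
 show "smooth_fn X q B' c" using assms smooth_fn_subset unfolding subm_def by blast
 fix x assume x: "x \<in> B'"
 then obtain W \<tau> where "section_at X q B c x W \<tau>" using assms unfolding subm_def by blast
 then show "\<exists>W \<tau>. section_at X q B' c x W \<tau>" using section_at_subset[OF _ assms(2) x] by blast
qed

lemma subm_openin: "subm X q B c ==> openin (mtop X) B"
 unfolding subm_def using smooth_fn_openin by blast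

text \<open>The domains of the local sections are open and contained in the image.\<close>

lemma subm_image_open:
 assumes "subm X q B c"
 shows "openin (EN q) (c ` B)"
proof (rule openin_locally)
 fix z assume "z \<in> c ` B"
 then obtain x where x: "x \<in> B" "z = c x" by blast
 then obtain W \<tau> where W: "section_at X q B c x W \<tau>" using assms unfolding subm_def by blast
 then have "W \<subseteq> c ` B" unfolding section_at_def by force
 then show "\<exists>T. openin (EN q) T & z \<in> T & T \<subseteq> c ` B"
  using W x unfolding section_at_def plot_def by blast
qed

section \<open>Charts, the maximal atlas and tests by plots\<close>

lemma is_chartD:
 assumes "is_chart n X (U, \<phi>)"
 shows "openin X U" "openin (EN n) (\<phi> ` U)" "inj_on \<phi> U"
  "!!x. x \<in> U ==> inv_into U \<phi> (\<phi> x) = x"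
  "!!B. openin (EN n) B ==> openin X {x\<in>U. \<phi> x \<in> B}"
  "!!V. [|openin X V; V \<subseteq> U|] ==> openin (EN n) (\<phi> ` V)"
  "!!x i. [|x \<in> U; n \<le> i|] ==> \<phi> x i = 0"
  "!!V. openin X V ==> openin (EN n) (\<phi> ` (U \<inter> V))"
  "!!V. openin X V ==> openin (EN n) (\<phi> ` (V \<inter> U))"
proof -
 have h: "homeomorphic_map (subtopology X U) (subtopology (EN n) (\<phi> ` U)) \<phi>"
  and U: "openin X U" and im: "openin (EN n) (\<phi> ` U)"
  using assms by (auto simp: is_chart_def)
 have ts: "topspace (subtopology X U) = U" using openin_subset[OF U] by auto
 show "openin X U" "openin (EN n) (\<phi> ` U)" by (fact U im)+
 show inj: "inj_on \<phi> U" using homeomorphic_imp_injective_map[OF h] ts by simp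
 then show "inv_into U \<phi> (\<phi> x) = x" if "x \<in> U" for x using that by simp
 have c: "continuous_map (subtopology X U) (EN n) \<phi>"
  using homeomorphic_imp_continuous_map[OF h] continuous_map_in_subtopology by blast
 then show "openin X {x\<in>U. \<phi> x \<in> B}" if "openin (EN n) B" for B
  using that continuous_map_open_subtopology[OF U] by blast
 show im_open: "openin (EN n) (\<phi> ` V)" if "openin X V" "V \<subseteq> U" for V
 proof -
  have "openin (subtopology X U) V" using that U by (simp add: openin_open_subtopology)
  then have "openin (subtopology (EN n) (\<phi> ` U)) (\<phi> ` V)"
   using homeomorphic_imp_open_map[OF h] by (simp add: open_map_def)
  then show ?thesis using im by (simp add: openin_open_subtopology)
 qed
 show "\<phi> x i = 0" if "x \<in> U" "n \<le> i" for x i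
  using openin_Euclidean_zero_tail[OF im] that by blast
 show "openin (EN n) (\<phi> ` (U \<inter> V))" "openin (EN n) (\<phi> ` (V \<inter> U))"
  if "openin X V" for V
  using im_open[OF openin_Int[OF U that]] by (simp_all add: Int_commute)
qed

lemma is_chartI:
 assumes U: "openin X U" and im: "openin (EN n) (\<phi> ` U)"
  and c: "continuous_map (subtopology X U) (EN n) \<phi>"
  and r: "continuous_map (subtopology (EN n) (\<phi> ` U)) X \<rho>"
  and inv: "!!x. x \<in> U ==> \<rho> (\<phi> x) = x"
 shows "is_chart n X (U, \<phi>)"
proof -
 have "homeomorphic_maps (subtopology X U) (subtopology (EN n) (\<phi> ` U)) \<phi> \<rho>"
  unfolding homeomorphic_maps_def continuous_map_in_subtopology using c r inv openin_subset[OF U] by auto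
 then show ?thesis using U im by (auto simp: is_chart_def homeomorphic_map_maps)
qed

lemma manifold_chart: "[|manifold X; c \<in> atlas X|] ==> is_chart (mdim X) (mtop X) c"
 by (simp add: manifold_def)

lemma max_atlas_chart: "c \<in> max_atlas X ==> is_chart (mdim X) (mtop X) c"
 by (simp add: max_atlas_def)

lemma manifold_cover:
 assumes "manifold X" "x \<in> topspace (mtop X)"
 obtains U \<phi> where "(U, \<phi>) \<in> atlas X" "x \<in> U"
proof -
 have "x \<in> \<Union>(fst ` atlas X)" using assms by (simp add: manifold_def)
 then obtain c where "c \<in> atlas X" "x \<in> fst c" by blast
 then show thesis using that[of "fst c" "snd c"] by simp
qed

lemma atlas_max_atlas: "manifold X ==> c \<in> atlas X ==> c \<in> max_atlas X"
 by (auto simp: manifold_def max_atlas_def)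

text \<open>Members of \<open>max_atlas\<close> are by definition compatible with the atlas only;
  their compatibility with each other is checked locally, through an atlas chart around each
  point.\<close>

lemma max_atlas_transition:
 assumes X: "manifold X" and 1: "(U, \<phi>) \<in> max_atlas X" and 2: "(V, \<psi>) \<in> max_atlas X"
 shows "smooth_into (mdim X) (mdim X) (\<phi> ` (U \<inter> V)) (\<psi> \<circ> inv_into U \<phi>)"
proof (rule smooth_into_local)
 let ?n = "mdim X"
 note cU = is_chartD[OF max_atlas_chart[OF 1]] and cV = is_chartD[OF max_atlas_chart[OF 2]]
 show "openin (EN ?n) (\<phi> ` (U \<inter> V))" by (rule cU(8)[OF cV(1)])
 fix z assume "z \<in> \<phi> ` (U \<inter> V)"
 then obtain x where x: "x \<in> U" "x \<in> V" "z = \<phi> x" by blast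
 obtain A \<alpha> where A: "(A, \<alpha>) \<in> atlas X" "x \<in> A"
  using manifold_cover[OF X, of x] x cU(1) openin_subset by blast
 note cA = is_chartD[OF manifold_chart[OF X A(1)]]
 have s1: "smooth_into ?n ?n (\<phi> ` (U \<inter> A)) (\<alpha> \<circ> inv_into U \<phi>)"
  and s2: "smooth_into ?n ?n (\<alpha> ` (V \<inter> A)) (\<psi> \<circ> inv_into A \<alpha>)"
  using 1 2 A(1) unfolding max_atlas_def compatible_def by blast+
 let ?B = "\<phi> ` (U \<inter> V \<inter> A)"
 have oB: "openin (EN ?n) ?B" using cU(8)[OF openin_Int[OF cV(1) cA(1)]] by (simp add: Int_assoc)
 have "smooth_into ?n ?n ?B ((\<psi> \<circ> inv_into A \<alpha>) \<circ> (\<alpha> \<circ> inv_into U \<phi>))"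
 proof (rule smooth_into_comp[OF oB])
  show "openin (EN ?n) (\<alpha> ` (V \<inter> A))" by (rule cA(9)[OF cV(1)])
  show "(\<alpha> \<circ> inv_into U \<phi>) z \<in> \<alpha> ` (V \<inter> A)" if "z \<in> ?B" for z using that cU(4) by auto
  show "smooth_into ?n ?n ?B (\<alpha> \<circ> inv_into U \<phi>)" by (rule smooth_into_subset[OF s1]) blast
  show "smooth_into ?n ?n (\<alpha> ` (V \<inter> A)) (\<psi> \<circ> inv_into A \<alpha>)" by (rule s2)
 qed
 then have "smooth_into ?n ?n ?B (\<psi> \<circ> inv_into U \<phi>)"
  by (rule smooth_into_cong[OF oB, rotated]) (use cU(4) cA(4) in auto)
 moreover have "\<phi> ` (U \<inter> V) \<inter> ?B = ?B" by blast
 ultimately show "\<exists>T. openin (EN ?n) T & z \<in> T &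
   smooth_into ?n ?n (\<phi> ` (U \<inter> V) \<inter> T) (\<psi> \<circ> inv_into U \<phi>)"
  using oB x A(2) by (intro exI[of _ ?B]) auto
qed

text \<open>One compatible chart around each point suffices. Continuity is a consequence, since a
  chart carries open sets to open sets of the model space, whose preimages under smooth maps are
  open.\<close>

lemma plotI_max_atlas:
 assumes X: "manifold X" and W: "openin (EN k) W"
  and loc: "!!w. w \<in> W ==> \<exists>W' U \<phi>. openin (EN k) W' & w \<in> W' & W' \<subseteq> W & \<sigma> ` W' \<subseteq> U &
    (U, \<phi>) \<in> max_atlas X & smooth_into k (mdim X) W' (\<phi> \<circ> \<sigma>)"
 shows "plot X k W \<sigma>"
proof -
 let ?n = "mdim X"
 have pre: "openin (EN k) {w\<in>W. \<sigma> w \<in> B}" if B: "openin (mtop X) B" for B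
 proof (rule openin_locally)
  fix w assume "w \<in> {w\<in>W. \<sigma> w \<in> B}"
  then have w: "w \<in> W" "\<sigma> w \<in> B" by auto
  obtain W' U \<phi> where L: "openin (EN k) W'" "w \<in> W'" "W' \<subseteq> W" "\<sigma> ` W' \<subseteq> U"
   "(U, \<phi>) \<in> max_atlas X" "smooth_into k ?n W' (\<phi> \<circ> \<sigma>)" using loc[OF w(1)] by blast
  note cU = is_chartD[OF max_atlas_chart[OF L(5)]]
  have "openin (EN k) {w\<in>W'. (\<phi> \<circ> \<sigma>) w \<in> \<phi> ` (U \<inter> B)}"
   by (rule openin_smooth_preimage[OF L(1) cU(8)[OF B] L(6)]) (use L(4) cU(7) in auto)
  moreover have "{w\<in>W'. (\<phi> \<circ> \<sigma>) w \<in> \<phi> ` (U \<inter> B)} = {w\<in>W'. \<sigma> w \<in> B}"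
   using L(4) cU(3) by (auto dest: inj_onD)
  ultimately show "\<exists>T. openin (EN k) T & w \<in> T & T \<subseteq> {w\<in>W. \<sigma> w \<in> B}"
   using L(2,3) w by (intro exI[of _ "{w\<in>W'. \<sigma> w \<in> B}"]) auto
 qed
 have ts: "\<sigma> w \<in> topspace (mtop X)" if "w \<in> W" for w
  using loc[OF that] is_chartD(1)[OF max_atlas_chart] openin_subset by blast
 have "smooth_into k ?n {w\<in>W. \<sigma> w \<in> V} (\<psi> \<circ> \<sigma>)" if V: "(V, \<psi>) \<in> atlas X" for V \<psi>
 proof (rule smooth_into_local)
  note V' = atlas_max_atlas[OF X V]
  note cV = is_chartD[OF max_atlas_chart[OF V']]
  show "openin (EN k) {w\<in>W. \<sigma> w \<in> V}" using pre cV(1) by blast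
  fix w assume "w \<in> {w\<in>W. \<sigma> w \<in> V}"
  then have w: "w \<in> W" "\<sigma> w \<in> V" by auto
  obtain W' U \<phi> where L: "openin (EN k) W'" "w \<in> W'" "W' \<subseteq> W" "\<sigma> ` W' \<subseteq> U"
   "(U, \<phi>) \<in> max_atlas X" "smooth_into k ?n W' (\<phi> \<circ> \<sigma>)" using loc[OF w(1)] by blast
  note cU = is_chartD[OF max_atlas_chart[OF L(5)]]
  let ?A = "W' \<inter> {w\<in>W. \<sigma> w \<in> V}"
  have oA: "openin (EN k) ?A" using L(1) pre cV(1) by blast
  have "smooth_into k ?n ?A ((\<psi> \<circ> inv_into U \<phi>) \<circ> (\<phi> \<circ> \<sigma>))"
  proof (rule smooth_into_comp[OF oA])
   show "openin (EN ?n) (\<phi> ` (U \<inter> V))" by (rule cU(8)[OF cV(1)])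
   show "(\<phi> \<circ> \<sigma>) w \<in> \<phi> ` (U \<inter> V)" if "w \<in> ?A" for w using that L(4) by auto
   show "smooth_into k ?n ?A (\<phi> \<circ> \<sigma>)" by (rule smooth_into_subset[OF L(6)]) blast
   show "smooth_into ?n ?n (\<phi> ` (U \<inter> V)) (\<psi> \<circ> inv_into U \<phi>)" by (rule max_atlas_transition[OF X L(5) V'])
  qed
  then have "smooth_into k ?n ?A (\<psi> \<circ> \<sigma>)"
   by (rule smooth_into_cong[OF oA, rotated]) (use cU(4) L(4) in auto)
  then show "\<exists>T. openin (EN k) T & w \<in> T & smooth_into k ?n ({w\<in>W. \<sigma> w \<in> V} \<inter> T) (\<psi> \<circ> \<sigma>)"
   using L(1,2) by (intro exI[of _ W']) (simp add: Int_commute)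
 qed
 then show ?thesis
  unfolding plot_def continuous_map_open_subtopology[OF W] using W ts pre by auto
qed

text \<open>A \<open>plot\<close> is tested on the atlas only; smooth transition functions extend
  the test to all compatible charts.\<close>

lemma plot_max_atlas:
 assumes X: "manifold X" and p: "plot X k W \<sigma>" and V: "(V, \<psi>) \<in> max_atlas X"
 shows "smooth_into k (mdim X) {w\<in>W. \<sigma> w \<in> V} (\<psi> \<circ> \<sigma>)"
proof (rule smooth_into_local)
 let ?n = "mdim X"
 note cV = is_chartD[OF max_atlas_chart[OF V]]
 show oV: "openin (EN k) {w\<in>W. \<sigma> w \<in> V}" using plot_preimage_open[OF p cV(1)] .
 fix w assume "w \<in> {w\<in>W. \<sigma> w \<in> V}"
 then have w: "w \<in> W" "\<sigma> w \<in> V" by auto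
 obtain U \<phi> where U: "(U, \<phi>) \<in> atlas X" "\<sigma> w \<in> U"
  using manifold_cover[OF X plot_in_topspace[OF p w(1)]] by blast
 note U' = atlas_max_atlas[OF X U(1)]
 note cU = is_chartD[OF max_atlas_chart[OF U']]
 let ?B = "{w\<in>W. \<sigma> w \<in> U}"
 let ?A = "{w\<in>W. \<sigma> w \<in> V} \<inter> ?B"
 have oB: "openin (EN k) ?B" using plot_preimage_open[OF p cU(1)] .
 then have oA: "openin (EN k) ?A" using oV by blast
 have s: "smooth_into k ?n ?B (\<phi> \<circ> \<sigma>)" using p U(1) unfolding plot_def by blast
 have "smooth_into k ?n ?A ((\<psi> \<circ> inv_into U \<phi>) \<circ> (\<phi> \<circ> \<sigma>))"
 proof (rule smooth_into_comp[OF oA])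
  show "openin (EN ?n) (\<phi> ` (U \<inter> V))" by (rule cU(8)[OF cV(1)])
  show "smooth_into k ?n ?A (\<phi> \<circ> \<sigma>)" by (rule smooth_into_subset[OF s]) blast
  show "smooth_into ?n ?n (\<phi> ` (U \<inter> V)) (\<psi> \<circ> inv_into U \<phi>)" by (rule max_atlas_transition[OF X U' V])
 qed auto
 then have "smooth_into k ?n ?A (\<psi> \<circ> \<sigma>)"
  by (rule smooth_into_cong[OF oA, rotated]) (use cU(4) in auto)
 then show "\<exists>T. openin (EN k) T & w \<in> T & smooth_into k ?n ({w\<in>W. \<sigma> w \<in> V} \<inter> T) (\<psi> \<circ> \<sigma>)"
  using oB w U(2) by blast
qed

lemma chart_smooth_fn:
 assumes X: "manifold X" and U: "(U, \<phi>) \<in> max_atlas X"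
 shows "smooth_fn X (mdim X) U \<phi>"
 unfolding smooth_fn_def
proof (intro conjI allI impI ballI)
 note cU = is_chartD[OF max_atlas_chart[OF U]]
 show "openin (mtop X) U" by (fact cU(1))
 show "\<phi> x i = 0" if "x \<in> U" "mdim X \<le> i" for x i by (rule cU(7)[OF that])
 fix k W \<sigma> assume p: "plot X k W \<sigma> & \<sigma> ` W \<subseteq> U"
 then have "{w\<in>W. \<sigma> w \<in> U} = W" by auto
 with p show "smooth_into k (mdim X) W (\<phi> \<circ> \<sigma>)" using plot_max_atlas[OF X _ U, of k W \<sigma>] by simp
qed

lemma inverse_chart_plot:
 assumes X: "manifold X" and U: "(U, \<phi>) \<in> max_atlas X"
 shows "plot X (mdim X) (\<phi> ` U) (inv_into U \<phi>)"
proof (rule plotI_max_atlas[OF X])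
 let ?n = "mdim X"
 note cU = is_chartD[OF max_atlas_chart[OF U]]
 show o: "openin (EN ?n) (\<phi> ` U)" by (rule cU(2))
 have "smooth_into ?n ?n (\<phi> ` U) (\<phi> \<circ> inv_into U \<phi>)"
 proof (rule smooth_into_cong[OF o])
  show "smooth_into ?n ?n (\<phi> ` U) (%z. z)" using Ck_on_coordinate[OF o] by (simp add: smooth_into_def)
 qed (use cU(4) in auto)
 then show "\<exists>W' V \<psi>. openin (EN ?n) W' & w \<in> W' & W' \<subseteq> \<phi> ` U & inv_into U \<phi> ` W' \<subseteq> V &
    (V, \<psi>) \<in> max_atlas X & smooth_into ?n ?n W' (\<psi> \<circ> inv_into U \<phi>)" if "w \<in> \<phi> ` U" for w
  using o U that cU(4) by (intro exI[of _ "\<phi> ` U"] exI[of _ U] exI[of _ \<phi>]) auto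
qed

lemma plot_cong:
 assumes p: "plot X k W \<sigma>" and eq: "!!w. w \<in> W ==> \<sigma> w = \<sigma>' w" and X: "manifold X"
 shows "plot X k W \<sigma>'"
 unfolding plot_def
proof (intro conjI ballI)
 note W = plot_openin[OF p]
 show "openin (EN k) W" by (rule W)
 show "continuous_map (subtopology (EN k) W) (mtop X) \<sigma>'"
  by (rule continuous_map_eq[OF plot_continuous[OF p]]) (use eq in auto)
 fix c assume c: "c \<in> atlas X"
 obtain U \<phi> where U: "c = (U, \<phi>)" by (cases c)
 have e: "{w\<in>W. \<sigma> w \<in> U} = {w\<in>W. \<sigma>' w \<in> U}" using eq by auto
 have "openin (EN k) {w\<in>W. \<sigma>' w \<in> U}"
  using plot_preimage_open[OF p is_chartD(1)[OF manifold_chart[OF X]]] c U e by metis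
 moreover have "smooth_into k (mdim X) {w\<in>W. \<sigma>' w \<in> U} (\<phi> \<circ> \<sigma>)"
  using p c U e unfolding plot_def by auto
 ultimately have "smooth_into k (mdim X) {w\<in>W. \<sigma>' w \<in> U} (\<phi> \<circ> \<sigma>')"
  using smooth_into_cong[of k "{w\<in>W. \<sigma>' w \<in> U}" "mdim X" "\<phi> \<circ> \<sigma>" "\<phi> \<circ> \<sigma>'"] eq by auto
 then show "case c of (U, \<phi>) => smooth_into k (mdim X) {w\<in>W. \<sigma>' w \<in> U} (\<phi> \<circ> \<sigma>')"
  by (simp add: U)
qed

lemma plot_compose:
 assumes X: "manifold X" and p: "plot X k W \<sigma>" and V: "openin (EN l) V"
  and g: "smooth_into l k V g" and gW: "!!v. v \<in> V ==> g v \<in> W"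
 shows "plot X l V (%v. \<sigma> (g v))"
proof (rule plotI_max_atlas[OF X V])
 note W = plot_openin[OF p]
 have z: "g v i = 0" if "v \<in> V" "k \<le> i" for v i
  using openin_Euclidean_zero_tail[OF W gW[OF that(1)] that(2)] .
 fix v assume v: "v \<in> V"
 obtain U \<phi> where U: "(U, \<phi>) \<in> atlas X" "\<sigma> (g v) \<in> U"
  using manifold_cover[OF X plot_in_topspace[OF p gW[OF v]]] by blast
 let ?B = "{w\<in>W. \<sigma> w \<in> U}"
 have oB: "openin (EN k) ?B"
  using plot_preimage_open[OF p] is_chartD(1)[OF manifold_chart[OF X U(1)]] by blast
 let ?A = "{v\<in>V. g v \<in> ?B}"
 have oA: "openin (EN l) ?A" by (rule openin_smooth_preimage[OF V oB g z])
 have s: "smooth_into k (mdim X) ?B (\<phi> \<circ> \<sigma>)" using p U(1) unfolding plot_def by blast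
 have "smooth_into l (mdim X) ?A ((\<phi> \<circ> \<sigma>) \<circ> g)"
 proof (rule smooth_into_comp[OF oA oB _ _ s])
  show "smooth_into l k ?A g" by (rule smooth_into_subset[OF g]) blast
 qed auto
 then show "\<exists>W' U \<phi>. openin (EN l) W' & v \<in> W' & W' \<subseteq> V & (%v. \<sigma> (g v)) ` W' \<subseteq> U &
    (U, \<phi>) \<in> max_atlas X & smooth_into l (mdim X) W' (\<phi> \<circ> (%v. \<sigma> (g v)))"
  using oA v U gW atlas_max_atlas[OF X U(1)]
  by (intro exI[of _ ?A] exI[of _ U] exI[of _ \<phi>]) (auto simp: o_def)
qed

lemma plot_const:
 assumes "openin (EN k) W" "x \<in> topspace (mtop X)" "manifold X"
 shows "plot X k W (%_. x)"
 unfolding plot_def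
proof (intro conjI ballI)
 fix c assume "c \<in> atlas X"
 have "openin (EN k) {w\<in>W. x \<in> U}" for U using assms(1) by (cases "x \<in> U") auto
 then show "case c of (U, \<phi>) => smooth_into k (mdim X) {w\<in>W. x \<in> U} (\<phi> \<circ> (%_. x))"
  by (auto simp: smooth_into_def o_def Ck_on_const split: prod.splits)
qed (use assms in auto)

text \<open>The inverse of a chart is a plot, so the plot test contains the coordinate expression of
  the function, and this is smooth, hence continuous.\<close>

lemma smooth_fn_continuous:
 assumes X: "manifold X" and c: "smooth_fn X q B c"
 shows "continuous_map (subtopology (mtop X) B) (EN q) c"
 unfolding continuous_map_open_subtopology[OF smooth_fn_openin[OF c]]
proof (intro conjI ballI allI impI)
 show "c x \<in> topspace (EN q)" if "x \<in> B" for x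
  using smooth_fn_zero_tail[OF c that] by (auto simp: topspace_Euclidean_space)
 fix A assume A: "openin (EN q) A"
 note oB = smooth_fn_openin[OF c]
 show "openin (mtop X) {x\<in>B. c x \<in> A}"
 proof (rule openin_locally)
  fix x assume "x \<in> {x\<in>B. c x \<in> A}"
  then have x: "x \<in> B" "c x \<in> A" by auto
  obtain U \<phi> where U: "(U, \<phi>) \<in> atlas X" "x \<in> U"
   using manifold_cover[OF X, of x] x(1) openin_subset[OF oB] by blast
  note cU = is_chartD[OF manifold_chart[OF X U(1)]]
  have o: "openin (EN (mdim X)) (\<phi> ` (U \<inter> B))" by (rule cU(8)[OF oB])
  have p: "plot X (mdim X) (\<phi> ` (U \<inter> B)) (inv_into U \<phi>)"
   by (rule plot_subset[OF inverse_chart_plot[OF X atlas_max_atlas[OF X U(1)]] o]) auto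
  have "openin (EN (mdim X)) {w\<in>\<phi> ` (U \<inter> B). c (inv_into U \<phi> w) \<in> A}"
   by (rule smooth_fn_plot_preimage[OF c p _ A]) (use cU(4) in auto)
  from cU(5)[OF this] have "openin (mtop X) {x\<in>U. \<phi> x \<in> {w\<in>\<phi> ` (U \<inter> B). c (inv_into U \<phi> w) \<in> A}}" .
  moreover have "{x\<in>U. \<phi> x \<in> {w\<in>\<phi> ` (U \<inter> B). c (inv_into U \<phi> w) \<in> A}} = {x\<in>U \<inter> B. c x \<in> A}"
  proof -
   have "\<phi> x \<in> \<phi> ` (U \<inter> B) \<longleftrightarrow> x \<in> B" if "x \<in> U" for x
    using inj_on_image_mem_iff[OF cU(3) that, of "U \<inter> B"] that by blast
   then have "x \<in> U ==> \<phi> x \<in> {w\<in>\<phi> ` (U \<inter> B). c (inv_into U \<phi> w) \<in> A} \<longleftrightarrow> x \<in> B & c x \<in> A" for x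
    using cU(4)[of x] by simp
   then show ?thesis by blast
  qed
  ultimately show "\<exists>T. openin (mtop X) T & x \<in> T & T \<subseteq> {x\<in>B. c x \<in> A}"
   using x U(2) by (intro exI[of _ "{x\<in>U \<inter> B. c x \<in> A}"]) auto
 qed
qed

text \<open>The criterion by which new charts are recognised: both transition functions are
  instances of the plot test, one for the inverse \<open>\<rho>\<close> and one for the inverses of
  atlas charts.\<close>

lemma max_atlasI:
 assumes X: "manifold X" and c: "smooth_fn X (mdim X) U \<phi>"
  and p: "plot X (mdim X) (\<phi> ` U) \<rho>" and inv: "!!x. x \<in> U ==> \<rho> (\<phi> x) = x"
 shows "(U, \<phi>) \<in> max_atlas X"
proof -
 let ?n = "mdim X"
 note oU = smooth_fn_openin[OF c]
 have ch: "is_chart ?n (mtop X) (U, \<phi>)"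
  using is_chartI[OF oU plot_openin[OF p] smooth_fn_continuous[OF X c] plot_continuous[OF p] inv] .
 note cU = is_chartD[OF ch]
 have "compatible ?n (U, \<phi>) (V, \<psi>)" if V: "(V, \<psi>) \<in> atlas X" for V \<psi>
 proof -
  note cV = is_chartD[OF manifold_chart[OF X V]]
  have o1: "openin (EN ?n) (\<phi> ` (U \<inter> V))" by (rule cU(8)[OF cV(1)])
  have o2: "openin (EN ?n) (\<psi> ` (U \<inter> V))" by (rule cV(9)[OF cU(1)])
  have "{w\<in>\<phi> ` U. \<rho> w \<in> V} = \<phi> ` (U \<inter> V)" using inv by auto
  then have "smooth_into ?n ?n (\<phi> ` (U \<inter> V)) (\<psi> \<circ> \<rho>)" using p V unfolding plot_def by fastforce
  then have 1: "smooth_into ?n ?n (\<phi> ` (U \<inter> V)) (\<psi> \<circ> inv_into U \<phi>)"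
   by (rule smooth_into_cong[OF o1, rotated]) (use inv cU(4) in auto)
  have "plot X ?n (\<psi> ` (U \<inter> V)) (inv_into V \<psi>)"
   by (rule plot_subset[OF inverse_chart_plot[OF X atlas_max_atlas[OF X V]] o2]) auto
  moreover have "inv_into V \<psi> ` \<psi> ` (U \<inter> V) \<subseteq> U" using cV(4) by auto
  ultimately have "smooth_into ?n ?n (\<psi> ` (U \<inter> V)) (\<phi> \<circ> inv_into V \<psi>)"
   using smooth_fn_plot[OF c] by (simp add: o_def)
  with 1 show ?thesis by (simp add: compatible_def)
 qed
 with ch show ?thesis by (auto simp: max_atlas_def)
qed

text \<open>With \<open>smooth_mapI_plot\<close> as a counterpart, a continuous map between
  manifolds is smooth exactly if it carries plots to plots.\<close>

lemma smooth_map_plot: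
 assumes X: "manifold X" and Y: "manifold Y" and f: "smooth_map X Y f" and p: "plot X k W \<sigma>"
 shows "plot Y k W (%w. f (\<sigma> w))"
proof -
 have fc: "continuous_map (mtop X) (mtop Y) f" using f by (simp add: smooth_map_def)
 have cont: "continuous_map (subtopology (EN k) W) (mtop Y) (%w. f (\<sigma> w))"
  using continuous_map_compose[OF plot_continuous[OF p] fc] by (simp add: o_def)
 have "smooth_into k (mdim Y) {w\<in>W. f (\<sigma> w) \<in> V} (\<psi> \<circ> (%w. f (\<sigma> w)))" if V: "(V, \<psi>) \<in> atlas Y" for V \<psi>
 proof (rule smooth_into_local)
  note cV = is_chartD[OF manifold_chart[OF Y V]]
  show oV: "openin (EN k) {w\<in>W. f (\<sigma> w) \<in> V}"
   using cont cV(1) unfolding continuous_map_open_subtopology[OF plot_openin[OF p]] by blast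
  fix w assume "w \<in> {w\<in>W. f (\<sigma> w) \<in> V}"
  then have w: "w \<in> W" "f (\<sigma> w) \<in> V" by auto
  obtain U \<phi> where U: "(U, \<phi>) \<in> atlas X" "\<sigma> w \<in> U"
   using manifold_cover[OF X plot_in_topspace[OF p w(1)]] by blast
  note cU = is_chartD[OF manifold_chart[OF X U(1)]]
  let ?B = "{w\<in>W. \<sigma> w \<in> U}"
  let ?A = "{w\<in>W. f (\<sigma> w) \<in> V} \<inter> ?B"
  let ?V = "{x\<in>U. f x \<in> V}"
  have oB: "openin (EN k) ?B" using plot_preimage_open[OF p cU(1)] .
  then have oA: "openin (EN k) ?A" using oV by blast
  have oV': "openin (mtop X) ?V"
  proof -
   have "?V = U \<inter> {x\<in>topspace (mtop X). f x \<in> V}" using openin_subset[OF cU(1)] by auto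
   then show ?thesis using openin_continuous_map_preimage[OF fc cV(1)] cU(1) by auto
  qed
  have s: "smooth_into k (mdim X) ?B (\<phi> \<circ> \<sigma>)" using p U(1) unfolding plot_def by blast
  have "smooth_into k (mdim Y) ?A ((\<psi> \<circ> f \<circ> inv_into U \<phi>) \<circ> (\<phi> \<circ> \<sigma>))"
  proof (rule smooth_into_comp[OF oA])
   show "openin (EN (mdim X)) (\<phi> ` ?V)" using cU(6)[OF oV'] by blast
   show "smooth_into k (mdim X) ?A (\<phi> \<circ> \<sigma>)" by (rule smooth_into_subset[OF s]) blast
   show "smooth_into (mdim X) (mdim Y) (\<phi> ` ?V) (\<psi> \<circ> f \<circ> inv_into U \<phi>)"
    using f U(1) V unfolding smooth_map_def by blast
  qed auto
  then have "smooth_into k (mdim Y) ?A (\<psi> \<circ> (%w. f (\<sigma> w)))"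
   by (rule smooth_into_cong[OF oA, rotated]) (use cU(4) in auto)
  then show "\<exists>T. openin (EN k) T & w \<in> T &
    smooth_into k (mdim Y) ({w\<in>W. f (\<sigma> w) \<in> V} \<inter> T) (\<psi> \<circ> (%w. f (\<sigma> w)))"
   using oB w U(2) by blast
 qed
 then show ?thesis unfolding plot_def using cont plot_openin[OF p] by auto
qed

lemma smooth_mapI_plot:
 assumes X: "manifold X" and f: "continuous_map (mtop X) (mtop Y) f"
  and pl: "!!k W \<sigma>. plot X k W \<sigma> ==> plot Y k W (%w. f (\<sigma> w))"
 shows "smooth_map X Y f"
proof -
 have "smooth_into (mdim X) (mdim Y) (\<phi> ` {x\<in>U. f x \<in> V}) (\<psi> \<circ> f \<circ> inv_into U \<phi>)"
  if U: "(U, \<phi>) \<in> atlas X" and V: "(V, \<psi>) \<in> atlas Y" for U \<phi> V \<psi>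
 proof -
  note cU = is_chartD[OF manifold_chart[OF X U]]
  have e: "{w\<in>\<phi> ` U. f (inv_into U \<phi> w) \<in> V} = \<phi> ` {x\<in>U. f x \<in> V}" using cU(4) by auto
  have "plot Y (mdim X) (\<phi> ` U) (%w. f (inv_into U \<phi> w))"
   using pl inverse_chart_plot[OF X atlas_max_atlas[OF X U]] by blast
  then have "smooth_into (mdim X) (mdim Y) (\<phi> ` {x\<in>U. f x \<in> V}) (\<psi> \<circ> (%w. f (inv_into U \<phi> w)))"
   using V e unfolding plot_def by fastforce
  then show ?thesis by (simp add: o_def)
 qed
 then show ?thesis using f unfolding smooth_map_def by auto
qed

section \<open>Charts adapted to a submersion, and embedded submanifolds\<close>

lemma max_atlas_diffeo:
 assumes X: "manifold X" and U: "(U, \<phi>) \<in> max_atlas X"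
  and d: "diffeo_on (mdim X) D \<theta> \<theta>'" and D: "D \<subseteq> \<phi> ` U"
 shows "({x\<in>U. \<phi> x \<in> D}, \<theta> \<circ> \<phi>) \<in> max_atlas X"
proof (rule max_atlasI[OF X])
 let ?n = "mdim X" and ?U = "{x\<in>U. \<phi> x \<in> D}"
 note cU = is_chartD[OF max_atlas_chart[OF U]]
 have oD: "openin (EN ?n) D" and im: "openin (EN ?n) (\<theta> ` D)"
  and s: "smooth_into ?n ?n D \<theta>" "smooth_into ?n ?n (\<theta> ` D) \<theta>'" and inv: "!!x. x \<in> D ==> \<theta>' (\<theta> x) = x"
  using d by (auto simp: diffeo_on_def)
 have im_eq: "(\<theta> \<circ> \<phi>) ` ?U = \<theta> ` D"
 proof
  show "\<theta> ` D \<subseteq> (\<theta> \<circ> \<phi>) ` ?U"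
  proof
   fix z assume "z \<in> \<theta> ` D"
   then obtain y where y: "y \<in> D" "z = \<theta> y" by blast
   then obtain x where "x \<in> U" "y = \<phi> x" using D by blast
   then show "z \<in> (\<theta> \<circ> \<phi>) ` ?U" using y by auto
  qed
 qed auto
 show "smooth_fn X ?n ?U (\<theta> \<circ> \<phi>)"
  unfolding smooth_fn_def
 proof (intro conjI allI impI ballI)
  show "openin (mtop X) ?U" by (rule cU(5)[OF oD])
  show "(\<theta> \<circ> \<phi>) x i = 0" if "x \<in> ?U" "?n \<le> i" for x i
   using that diffeo_on_zero_tail[OF d] by simp
  fix k W \<sigma> assume p: "plot X k W \<sigma> & \<sigma> ` W \<subseteq> ?U"
  have "smooth_into k ?n W (%w. \<phi> (\<sigma> w))"
   using p by (intro smooth_fn_plot[OF chart_smooth_fn[OF X U]]) auto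
  then have "smooth_into k ?n W (\<theta> \<circ> (%w. \<phi> (\<sigma> w)))"
   using p plot_openin by (intro smooth_into_comp[OF _ oD _ _ s(1)]) auto
  then show "smooth_into k ?n W (\<theta> \<circ> \<phi> \<circ> \<sigma>)" by (simp add: o_def)
 qed
 have "plot X ?n (\<theta> ` D) (%v. inv_into U \<phi> (\<theta>' v))"
  using inv D by (intro plot_compose[OF X inverse_chart_plot[OF X U] im s(2)]) auto
 then show "plot X ?n ((\<theta> \<circ> \<phi>) ` ?U) (%v. inv_into U \<phi> (\<theta>' v))" unfolding im_eq .
 show "inv_into U \<phi> (\<theta>' ((\<theta> \<circ> \<phi>) x)) = x" if "x \<in> ?U" for x
  using that inv cU(4) by simp
qed

text \<open>The section gives the coordinate expression of \<open>\<kappa>\<close> full rank, and a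
  chart followed by the straightening diffeomorphism is again a compatible chart.\<close>

lemma straightened_chart:
 assumes X: "manifold X" and \<kappa>: "smooth_fn X r B \<kappa>" and x: "x \<in> B" and \<tau>: "section_at X r B \<kappa> x W \<tau>"
 obtains A \<phi> where "r \<le> mdim X" "(A, \<phi>) \<in> max_atlas X" "x \<in> A" "A \<subseteq> B"
  "!!y j. [|y \<in> A; j < r|] ==> \<phi> y (mdim X - r + j) = \<kappa> y j"
proof -
 let ?n = "mdim X"
 note oB = smooth_fn_openin[OF \<kappa>]
 obtain U \<phi> where U: "(U, \<phi>) \<in> atlas X" "x \<in> U"
  using manifold_cover[OF X, of x] x openin_subset[OF oB] by blast
 note U' = atlas_max_atlas[OF X U(1)]
 note cU = is_chartD[OF max_atlas_chart[OF U']]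
 let ?V = "\<phi> ` (U \<inter> B)" and ?f = "%z. \<kappa> (inv_into U \<phi> z)"
 have oV: "openin (EN ?n) ?V" by (rule cU(8)[OF oB])
 have p: "plot X ?n ?V (inv_into U \<phi>)" by (rule plot_subset[OF inverse_chart_plot[OF X U'] oV]) auto
 have f: "smooth_into ?n r ?V ?f"
  by (rule smooth_fn_plot[OF \<kappa> p]) (use cU(4) in auto)
 let ?W = "{w\<in>W. \<tau> w \<in> U}"
 have t: "plot X r W \<tau>" "\<kappa> x \<in> W" "\<tau> ` W \<subseteq> B" "\<tau> (\<kappa> x) = x" "!!w. w \<in> W ==> \<kappa> (\<tau> w) = w"
  using \<tau> by (auto simp: section_at_def)
 have oW: "openin (EN r) ?W" by (rule plot_preimage_open[OF t(1) cU(1)])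
 have "smooth_into r ?n ?W (%w. \<phi> (\<tau> w))"
  by (rule smooth_fn_plot[OF chart_smooth_fn[OF X U'] plot_subset[OF t(1) oW]]) auto
 then have "jacobian_surj ?n r ?f (\<phi> (\<tau> (\<kappa> x)))"
  by (rule jacobian_surj_of_section[OF oV f oW]) (use t U(2) cU(4) in auto)
 then have jac: "jacobian_surj ?n r ?f (\<phi> x)" using t(4) by simp
 have xV: "\<phi> x \<in> ?V" using x U(2) by blast
 obtain D \<theta> \<theta>' where d: "diffeo_on ?n D \<theta> \<theta>'" "\<phi> x \<in> D" "D \<subseteq> ?V" "r \<le> ?n"
  "!!y i. [|y \<in> D; i < r|] ==> \<theta> y (?n - r + i) = ?f y i"
  using straightening[OF oV f xV jac] by blast
 have "D \<subseteq> \<phi> ` U" using d(3) by blast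
 note ch = max_atlas_diffeo[OF X U' d(1) this]
 show thesis
 proof (rule that[OF d(4) ch])
  show "x \<in> {x\<in>U. \<phi> x \<in> D}" using U(2) d(2) by simp
  show "{x\<in>U. \<phi> x \<in> D} \<subseteq> B"
  proof
   fix y assume y: "y \<in> {x\<in>U. \<phi> x \<in> D}"
   then obtain z where "z \<in> U \<inter> B" "\<phi> y = \<phi> z" using d(3) by blast
   then have "y = z" using y cU(3) by (auto dest: inj_onD)
   then show "y \<in> B" using \<open>z \<in> U \<inter> B\<close> by simp
  qed
  show "(\<theta> \<circ> \<phi>) y (?n - r + j) = \<kappa> y j" if "y \<in> {x\<in>U. \<phi> x \<in> D}" "j < r" for y j
   using that d(5) cU(4) by simp
 qed
qed

lemma subm_straightened_chart:
 assumes "manifold X" "subm X r B \<kappa>" "x \<in> B"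
 obtains A \<phi> where "r \<le> mdim X" "(A, \<phi>) \<in> max_atlas X" "x \<in> A" "A \<subseteq> B"
  "!!y j. [|y \<in> A; j < r|] ==> \<phi> y (mdim X - r + j) = \<kappa> y j"
proof -
 obtain W \<tau> where "section_at X r B \<kappa> x W \<tau>" using assms(2,3) unfolding subm_def by blast
 then show thesis
  using straightened_chart[OF assms(1) _ assms(3)] assms(2) that unfolding subm_def by blast
qed

text \<open>An embedded submanifold of codimension \<open>r\<close> given by local equations.
  \<open>submfd\<close> only collects the slice charts that happen to exist; this condition
  guarantees that they cover \<open>S\<close>.\<close>

definition cut_out :: "'a mfd => nat => 'a set => bool" where
 "cut_out X r S \<longleftrightarrow> S \<subseteq> topspace (mtop X) &
   (\<forall>x\<in>S. \<exists>B \<kappa>. x \<in> B & subm X r B \<kappa> & S \<inter> B = {y\<in>B. \<forall>j<r. \<kappa> y j = 0})"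

lemma submfd_simps [simp]:
 "mdim (submfd k X S) = k" "mtop (submfd k X S) = subtopology (mtop X) S"
 by (simp_all add: submfd_def)

lemma submfd_atlasE:
 assumes "(A, \<phi>) \<in> atlas (submfd k X S)"
 obtains W where "(W, \<phi>) \<in> max_atlas X" "A = W \<inter> S"
  "\<phi> ` (W \<inter> S) = \<phi> ` W \<inter> {z. \<forall>i\<in>{k..<mdim X}. z i = 0}"
 using assms by (auto simp: submfd_def)

lemma submfd_cover:
 assumes X: "manifold X" and S: "cut_out X r S" and x: "x \<in> S"
 obtains A \<phi> where "r \<le> mdim X" "(A, \<phi>) \<in> max_atlas X" "x \<in> A"
  "(A \<inter> S, \<phi>) \<in> atlas (submfd (mdim X - r) X S)"
proof -
 let ?n = "mdim X"
 obtain B \<kappa> where B: "x \<in> B" "subm X r B \<kappa>" "S \<inter> B = {y\<in>B. \<forall>j<r. \<kappa> y j = 0}"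
  using S x unfolding cut_out_def by blast
 obtain A \<phi> where A: "r \<le> ?n" "(A, \<phi>) \<in> max_atlas X" "x \<in> A" "A \<subseteq> B"
  "!!y j. [|y \<in> A; j < r|] ==> \<phi> y (?n - r + j) = \<kappa> y j"
  using subm_straightened_chart[OF X B(2,1)] by blast
 have "y \<in> S \<longleftrightarrow> (\<forall>i\<in>{?n - r..<?n}. \<phi> y i = 0)" if y: "y \<in> A" for y
 proof -
  have "y \<in> S \<longleftrightarrow> (\<forall>j<r. \<phi> y (?n - r + j) = 0)" using B(3) A(4) A(5)[OF y] y by auto
  also have "\<dots> \<longleftrightarrow> (\<forall>i\<in>{?n - r..<?n}. \<phi> y i = 0)"
  proof (intro iffI ballI allI impI)
   fix i assume *: "\<forall>j<r. \<phi> y (?n - r + j) = 0" and "i \<in> {?n - r..<?n}"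
   then have "i - (?n - r) < r" "?n - r + (i - (?n - r)) = i" using A(1) by auto
   then show "\<phi> y i = 0" using * by metis
  next
   fix j assume *: "\<forall>i\<in>{?n - r..<?n}. \<phi> y i = 0" and "j < r"
   then have "?n - r + j \<in> {?n - r..<?n}" using A(1) by auto
   then show "\<phi> y (?n - r + j) = 0" using * by blast
  qed
  finally show ?thesis .
 qed
 then have "\<phi> ` (A \<inter> S) = \<phi> ` A \<inter> {z. \<forall>i\<in>{?n - r..<?n}. z i = 0}" by auto
 then have "(A \<inter> S, \<phi>) \<in> atlas (submfd (?n - r) X S)"
  using A(2) unfolding submfd_def by auto
 then show thesis using that A by blast
qed

text \<open>A smaller cube in the first \<open>k\<close> coordinates lies in the slice of a cube of
  \<open>EN n\<close>.\<close>

lemma openin_Euclidean_slice: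
 assumes B: "openin (EN n) B" and k: "k \<le> n"
 shows "openin (EN k) (B \<inter> {z. \<forall>i\<in>{k..<n}. z i = 0})"
 unfolding openin_Euclidean_cube
proof (intro conjI ballI)
 show "B \<inter> {z. \<forall>i\<in>{k..<n}. z i = 0} \<subseteq> {x. \<forall>i\<ge>k. x i = 0}"
  using openin_Euclidean_subset[OF B] by (auto simp: subset_iff)
 fix x assume x: "x \<in> B \<inter> {z. \<forall>i\<in>{k..<n}. z i = 0}"
 then obtain r where r: "r > 0" "cube n x r \<subseteq> B" using B openin_Euclidean_cubeE by blast
 have "cube k x r \<subseteq> B \<inter> {z. \<forall>i\<in>{k..<n}. z i = 0}"
 proof
  fix y assume y: "y \<in> cube k x r"
  have "\<bar>y i - x i\<bar> < r" if "i < n" for i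
   using y x r(1) that by (cases "i < k") (auto simp: cube_def)
  then have "y \<in> cube n x r" using y k by (auto simp: cube_def)
  then show "y \<in> B \<inter> {z. \<forall>i\<in>{k..<n}. z i = 0}" using r(2) y by (auto simp: cube_def)
 qed
 then show "\<exists>r>0. cube k x r \<subseteq> B \<inter> {z. \<forall>i\<in>{k..<n}. z i = 0}" using r(1) by blast
qed

text \<open>Slice charts are restrictions of charts of \<open>X\<close>; their transition functions
  are restrictions as well and stay smooth when the last variables are dropped. The local equations
  enter for the covering property.\<close>

lemma manifold_submfd:
 assumes X: "manifold X" and S: "cut_out X r S"
 shows "manifold (submfd (mdim X - r) X S)"
proof -
 let ?n = "mdim X" let ?k = "?n - r" let ?Y = "submfd ?k X S"
 have ch: "is_chart ?k (mtop ?Y) (A, \<phi>)" if A: "(A, \<phi>) \<in> atlas ?Y" for A \<phi>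
 proof -
  obtain W where W: "(W, \<phi>) \<in> max_atlas X" "A = W \<inter> S"
   "\<phi> ` (W \<inter> S) = \<phi> ` W \<inter> {z. \<forall>i\<in>{?k..<?n}. z i = 0}" using submfd_atlasE[OF A] by blast
  note cW = is_chartD[OF max_atlas_chart[OF W(1)]]
  have im: "openin (EN ?k) (\<phi> ` A)"
   unfolding W(2,3) using openin_Euclidean_slice[OF cW(2), of ?k] by simp
  have sub: "\<phi> ` A \<subseteq> {x. \<forall>i\<ge>?k. x i = 0}" using openin_Euclidean_subset[OF im] .
  have "continuous_map (subtopology (mtop X) W) (EN ?n) \<phi>"
   by (rule smooth_fn_continuous[OF X chart_smooth_fn[OF X W(1)]])
  then have c0: "continuous_map (subtopology (mtop X) A) (EN ?n) \<phi>"
   by (rule continuous_map_from_subtopology_mono) (use W(2) in auto)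
  have c: "continuous_map (subtopology (mtop ?Y) A) (EN ?k) \<phi>"
  proof -
   have e: "subtopology (mtop ?Y) A = subtopology (mtop X) A"
    using W(2) by (simp add: subtopology_subtopology Int_absorb1 inf_commute Int_ac)
   show ?thesis
    unfolding e continuous_map_Euclidean_iff
    using c0[unfolded continuous_map_Euclidean_iff] sub by auto
  qed
  have "plot X ?n (\<phi> ` W) (inv_into W \<phi>)" by (rule inverse_chart_plot[OF X W(1)])
  then have "continuous_map (subtopology (EN ?n) (\<phi> ` A)) (mtop X) (inv_into W \<phi>)"
   by (intro continuous_map_from_subtopology_mono[OF plot_continuous]) (use W(2) in auto)
  then have r: "continuous_map (subtopology (EN ?k) (\<phi> ` A)) (mtop ?Y) (inv_into W \<phi>)"
   unfolding subtopology_Euclidean_eq[OF diff_le_self sub]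
   by (simp add: continuous_map_in_subtopology) (use cW(4) W(2) in auto)
  show ?thesis
  proof (rule is_chartI[OF _ im c r])
   show "openin (mtop ?Y) A" using W(2) cW(1) by (simp add: openin_subtopology) blast
   show "inv_into W \<phi> (\<phi> x) = x" if "x \<in> A" for x using that W(2) cW(4) by auto
  qed
 qed
 have tr: "smooth_into ?k ?k (\<phi> ` (A \<inter> B)) (\<psi> \<circ> inv_into A \<phi>)"
  if A: "(A, \<phi>) \<in> atlas ?Y" and B: "(B, \<psi>) \<in> atlas ?Y" for A \<phi> B \<psi>
 proof -
  obtain W where W: "(W, \<phi>) \<in> max_atlas X" "A = W \<inter> S"
   "\<phi> ` (W \<inter> S) = \<phi> ` W \<inter> {z. \<forall>i\<in>{?k..<?n}. z i = 0}" using submfd_atlasE[OF A] by blast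
  obtain V where V: "(V, \<psi>) \<in> max_atlas X" "B = V \<inter> S"
   using submfd_atlasE[OF B] by blast
  note cW = is_chartD[OF max_atlas_chart[OF W(1)]]
  note cA = is_chartD[OF ch[OF A]]
  have o: "openin (EN ?k) (\<phi> ` (A \<inter> B))" using cA(8) is_chartD(1)[OF ch[OF B]] by blast
  have "smooth_into ?n ?n (\<phi> ` (W \<inter> V)) (\<psi> \<circ> inv_into W \<phi>)" by (rule max_atlas_transition[OF X W(1) V(1)])
  then have "smooth_into ?n ?n (\<phi> ` (A \<inter> B)) (\<psi> \<circ> inv_into W \<phi>)"
   by (rule smooth_into_subset) (use W(2) V(2) in auto)
  then have "smooth_into ?k ?k (\<phi> ` (A \<inter> B)) (\<psi> \<circ> inv_into W \<phi>)"
   unfolding smooth_into_def using Ck_on_fewer_variables[of _ ?n _ _ ?k] by auto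
  then show ?thesis
   by (rule smooth_into_cong[OF o, rotated]) (use cW(4) cA(4) W(2) in auto)
 qed
 have cov: "\<Union>(fst ` atlas ?Y) = topspace (mtop ?Y)"
 proof
  show "\<Union>(fst ` atlas ?Y) \<subseteq> topspace (mtop ?Y)"
  proof
   fix x assume "x \<in> \<Union>(fst ` atlas ?Y)"
   then obtain A \<phi> where "(A, \<phi>) \<in> atlas ?Y" "x \<in> A" by auto
   then show "x \<in> topspace (mtop ?Y)"
    using openin_subset[OF is_chartD(1)[OF ch]] by blast
  qed
  show "topspace (mtop ?Y) \<subseteq> \<Union>(fst ` atlas ?Y)"
  proof
   fix x assume "x \<in> topspace (mtop ?Y)"
   then have "x \<in> S" by simp
   then obtain A \<phi> where "x \<in> A" "(A \<inter> S, \<phi>) \<in> atlas ?Y" using submfd_cover[OF X S] by metis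
   then show "x \<in> \<Union>(fst ` atlas ?Y)" using \<open>x \<in> S\<close> by force
  qed
 qed
 have "compatible ?k c d" if "c \<in> atlas ?Y" "d \<in> atlas ?Y" for c d
 proof -
  obtain A \<phi> B \<psi> where "c = (A, \<phi>)" "d = (B, \<psi>)" by (cases c; cases d)
  then show ?thesis using that tr[of A \<phi> B \<psi>] tr[of B \<psi> A \<phi>] by (simp add: compatible_def Int_commute)
 qed
 then show ?thesis
  unfolding manifold_def using ch cov by auto
qed

lemma plot_submfd_iff:
 assumes X: "manifold X" and S: "cut_out X r S"
 shows "plot (submfd (mdim X - r) X S) l W \<sigma> \<longleftrightarrow> plot X l W \<sigma> & \<sigma> ` W \<subseteq> S" (is "?L \<longleftrightarrow> ?R")
proof
 let ?n = "mdim X" let ?k = "?n - r" let ?Y = "submfd ?k X S"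
 have sub: "S \<subseteq> topspace (mtop X)" using S by (simp add: cut_out_def)
 note Y = manifold_submfd[OF X S]
 {
  assume L: ?L
  have im: "\<sigma> ` W \<subseteq> S" using plot_in_topspace[OF L] by auto
  moreover have "plot X l W \<sigma>"
  proof (rule plotI_max_atlas[OF X plot_openin[OF L]])
   fix w assume w: "w \<in> W"
   then have "\<sigma> w \<in> S" using im by blast
   then obtain A \<phi> where A: "(A, \<phi>) \<in> max_atlas X" "\<sigma> w \<in> A" "(A \<inter> S, \<phi>) \<in> atlas ?Y"
    using submfd_cover[OF X S] by metis
   let ?W = "{w\<in>W. \<sigma> w \<in> A \<inter> S}"
   have oW: "openin (EN l) ?W"
    using plot_preimage_open[OF L is_chartD(1)[OF manifold_chart[OF Y A(3)]]] .
   have s: "smooth_into l ?k ?W (\<phi> \<circ> \<sigma>)" using L A(3) unfolding plot_def by fastforce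
   have "smooth_into l ?n ?W (\<phi> \<circ> \<sigma>)"
    unfolding smooth_into_def
   proof (intro allI impI)
    fix i m assume "i < ?n"
    show "Ck_on m l ?W (%x. (\<phi> \<circ> \<sigma>) x i)"
    \<comment> \<open>On a slice the coordinates from \<open>?k\<close> on vanish identically, so
      they are smooth as constants.\<close>
    proof (cases "i < ?k")
     case True then show ?thesis using smooth_intoD[OF s] by blast
    next
     case False
     then have "\<phi> y i = 0" if "y \<in> A \<inter> S" for y
      using is_chartD(7)[OF manifold_chart[OF Y A(3)] that] by simp
     then show ?thesis
      by (intro Ck_on_cong[OF oW _ Ck_on_const[OF oW, of m 0]]) auto
    qed
   qed
   then show "\<exists>W' U \<phi>. openin (EN l) W' & w \<in> W' & W' \<subseteq> W & \<sigma> ` W' \<subseteq> U &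
     (U, \<phi>) \<in> max_atlas X & smooth_into l ?n W' (\<phi> \<circ> \<sigma>)"
    using oW A w \<open>\<sigma> w \<in> S\<close> by (intro exI[of _ ?W] exI[of _ A] exI[of _ \<phi>]) auto
  qed
  ultimately show ?R by simp
 next
  assume R: ?R
  then have p: "plot X l W \<sigma>" and im: "!!w. w \<in> W ==> \<sigma> w \<in> S" by auto
  have "smooth_into l ?k {w\<in>W. \<sigma> w \<in> A} (\<phi> \<circ> \<sigma>)" if A: "(A, \<phi>) \<in> atlas ?Y" for A \<phi>
  proof -
   obtain V where V: "(V, \<phi>) \<in> max_atlas X" "A = V \<inter> S" using submfd_atlasE[OF A] by blast
   have "{w\<in>W. \<sigma> w \<in> A} = {w\<in>W. \<sigma> w \<in> V}" using V(2) im by auto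
   then show ?thesis using plot_max_atlas[OF X p V(1)] by (auto simp: smooth_into_def)
  qed
  moreover have "continuous_map (subtopology (EN l) W) (mtop ?Y) \<sigma>"
   using plot_continuous[OF p] im by (auto simp: continuous_map_in_subtopology)
  ultimately show ?L using plot_openin[OF p] unfolding plot_def by auto
 }
qed

section \<open>Products and pull-backs along local homeomorphisms\<close>

definition pjoin :: "nat => (nat => real) => (nat => real) => nat => real" where
 "pjoin n a b = (%i. if i < n then a i else b (i - n))"

definition pfst :: "nat => (nat => real) => nat => real" where
 "pfst n z = (%i. if i < n then z i else 0)"

definition psnd :: "nat => (nat => real) => nat => real" where
 "psnd n z = (%i. z (i + n))"

lemma pfst_pjoin: "(!!i. n \<le> i ==> a i = 0) ==> pfst n (pjoin n a b) = a"
 by (auto simp: pfst_def pjoin_def fun_eq_iff)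

lemma psnd_pjoin [simp]: "psnd n (pjoin n a b) = b"
 by (auto simp: psnd_def pjoin_def fun_eq_iff)

lemma pjoin_pfst_psnd [simp]: "pjoin n (pfst n z) (psnd n z) = z"
 by (auto simp: pfst_def psnd_def pjoin_def fun_eq_iff)

lemma smooth_pfst: "openin (EN k) W ==> smooth_into k n W (pfst n)"
 unfolding smooth_into_def pfst_def by (auto intro: Ck_on_coordinate)

lemma smooth_psnd: "openin (EN k) W ==> smooth_into k m W (psnd n)"
 unfolding smooth_into_def psnd_def by (auto intro: Ck_on_coordinate)

lemma smooth_pjoin:
 assumes "smooth_into k n W a" "smooth_into k m W b"
 shows "smooth_into k (n + m) W (%w. pjoin n (a w) (b w))"
 unfolding smooth_into_def
proof (intro allI impI)
 fix i l assume "i < n + m"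
 then show "Ck_on l k W (%w. pjoin n (a w) (b w) i)"
  using smooth_intoD[OF assms(1), of i l] smooth_intoD[OF assms(2), of "i - n" l]
  by (cases "i < n") (auto simp: pjoin_def)
qed

lemma openin_pjoin:
 assumes A: "openin (EN n) A" and B: "openin (EN m) B"
 shows "openin (EN (n + m)) {z\<in>topspace (EN (n + m)). pfst n z \<in> A & psnd n z \<in> B}"
proof -
 let ?T = "topspace (EN (n + m))"
 have "openin (EN (n + m)) {z\<in>?T. pfst n z \<in> A}"
  by (rule openin_smooth_preimage[OF openin_topspace A smooth_pfst[OF openin_topspace]]) (simp add: pfst_def)
 moreover have "openin (EN (n + m)) {z\<in>?T. psnd n z \<in> B}"
  by (rule openin_smooth_preimage[OF openin_topspace B smooth_psnd[OF openin_topspace]])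
   (simp add: psnd_def topspace_Euclidean_space)
 ultimately have "openin (EN (n + m)) ({z\<in>?T. pfst n z \<in> A} \<inter> {z\<in>?T. psnd n z \<in> B})" by blast
 moreover have "{z\<in>?T. pfst n z \<in> A} \<inter> {z\<in>?T. psnd n z \<in> B} = {z\<in>?T. pfst n z \<in> A & psnd n z \<in> B}" by blast
 ultimately show ?thesis by simp
qed

lemma pjoin_image:
 assumes A: "openin (EN n) A" and B: "openin (EN m) B"
 shows "(%(a, b). pjoin n a b) ` (A \<times> B) = {z\<in>topspace (EN (n + m)). pfst n z \<in> A & psnd n z \<in> B}"
proof (intro equalityI subsetI)
 fix z assume "z \<in> (%(a, b). pjoin n a b) ` (A \<times> B)"
 then obtain a b where ab: "a \<in> A" "b \<in> B" "z = pjoin n a b" by auto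
 then have "!!i. n \<le> i ==> a i = 0" "!!i. m \<le> i ==> b i = 0"
  using openin_Euclidean_zero_tail[OF A] openin_Euclidean_zero_tail[OF B] by blast+
 then have "pfst n z = a" "psnd n z = b" "z \<in> topspace (EN (n + m))"
  unfolding ab(3) by (simp_all add: pfst_pjoin topspace_Euclidean_space) (simp add: pjoin_def)
 then show "z \<in> {z\<in>topspace (EN (n + m)). pfst n z \<in> A & psnd n z \<in> B}"
  using ab by simp
next
 fix z assume "z \<in> {z\<in>topspace (EN (n + m)). pfst n z \<in> A & psnd n z \<in> B}"
 then show "z \<in> (%(a, b). pjoin n a b) ` (A \<times> B)"
  by (intro image_eqI[where x = "(pfst n z, psnd n z)"]) auto
qed

lemma continuous_map_Euclidean_smooth:
 assumes "openin (EN k) W" "smooth_into k n W f" "!!w i. w \<in> W ==> n \<le> i ==> f w i = 0"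
 shows "continuous_map (subtopology (EN k) W) (EN n) f"
 unfolding continuous_map_open_subtopology[OF assms(1)]
 using assms openin_smooth_preimage[OF assms(1) _ assms(2)] by (auto simp: topspace_Euclidean_space)

lemma prod_mfd_simps [simp]:
 "mdim (prod_mfd X Y) = mdim X + mdim Y" "mtop (prod_mfd X Y) = prod_topology (mtop X) (mtop Y)"
 by (simp_all add: prod_mfd_def)

lemma prod_mfd_atlas:
 "atlas (prod_mfd X Y) = {(U \<times> V, %p. pjoin (mdim X) (\<phi> (fst p)) (\<psi> (snd p))) | U \<phi> V \<psi>.
   (U, \<phi>) \<in> atlas X & (V, \<psi>) \<in> atlas Y}"
 by (simp add: prod_mfd_def pjoin_def case_prod_unfold)

lemma prod_chart:
 assumes X: "manifold X" and Y: "manifold Y" and U: "(U, \<phi>) \<in> atlas X" and V: "(V, \<psi>) \<in> atlas Y"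
 shows "is_chart (mdim X + mdim Y) (prod_topology (mtop X) (mtop Y))
      (U \<times> V, %p. pjoin (mdim X) (\<phi> (fst p)) (\<psi> (snd p)))"
proof -
 let ?n = "mdim X" and ?m = "mdim Y" and ?J = "%p. pjoin (mdim X) (\<phi> (fst p)) (\<psi> (snd p))"
 note U' = atlas_max_atlas[OF X U] and V' = atlas_max_atlas[OF Y V]
 note cU = is_chartD[OF max_atlas_chart[OF U']] and cV = is_chartD[OF max_atlas_chart[OF V']]
 have "?J ` (U \<times> V) = (%(a, b). pjoin ?n a b) ` (\<phi> ` U \<times> \<psi> ` V)" by force
 also note pjoin_image[OF cU(2) cV(2)]
 finally have im: "?J ` (U \<times> V) = {z\<in>topspace (EN (?n + ?m)). pfst ?n z \<in> \<phi> ` U & psnd ?n z \<in> \<psi> ` V}" .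
 have o: "openin (EN (?n + ?m)) (?J ` (U \<times> V))"
  unfolding im by (rule openin_pjoin[OF cU(2) cV(2)])
 let ?S = "subtopology (prod_topology (mtop X) (mtop Y)) (U \<times> V)"
 have S: "?S = prod_topology (subtopology (mtop X) U) (subtopology (mtop Y) V)"
  by (rule subtopology_Times)
 have c1: "continuous_map ?S (EN ?n) (\<phi> \<circ> fst)"
  unfolding S by (rule continuous_map_compose[OF continuous_map_fst smooth_fn_continuous[OF X chart_smooth_fn[OF X U']]])
 have c2: "continuous_map ?S (EN ?m) (\<psi> \<circ> snd)"
  unfolding S by (rule continuous_map_compose[OF continuous_map_snd smooth_fn_continuous[OF Y chart_smooth_fn[OF Y V']]])
 have c: "continuous_map ?S (EN (?n + ?m)) ?J"
  unfolding continuous_map_Euclidean_iff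
 proof (intro conjI ballI allI impI)
  fix p i assume "p \<in> topspace ?S" "?n + ?m \<le> i"
  then show "?J p i = 0" using cV(7)[of "snd p" "i - ?n"] by (auto simp: pjoin_def)
 next
  fix i assume i: "i < ?n + ?m"
  show "continuous_map ?S euclideanreal (%p. ?J p i)"
   using c1[unfolded continuous_map_Euclidean_iff] c2[unfolded continuous_map_Euclidean_iff] i
   by (cases "i < ?n") (simp_all add: pjoin_def)
 qed
 let ?r = "%z. (inv_into U \<phi> (pfst ?n z), inv_into V \<psi> (psnd ?n z))"
 let ?Z = "subtopology (EN (?n + ?m)) (?J ` (U \<times> V))"
 have "continuous_map ?Z (subtopology (EN ?n) (\<phi> ` U)) (pfst ?n)"
  unfolding continuous_map_in_subtopology
  using continuous_map_Euclidean_smooth[OF o smooth_pfst[OF o]] im by (auto simp: pfst_def)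
 from continuous_map_compose[OF this plot_continuous[OF inverse_chart_plot[OF X U']]]
 have r1: "continuous_map ?Z (mtop X) (%z. inv_into U \<phi> (pfst ?n z))" by (simp add: o_def)
 have "continuous_map ?Z (subtopology (EN ?m) (\<psi> ` V)) (psnd ?n)"
  unfolding continuous_map_in_subtopology
  using continuous_map_Euclidean_smooth[OF o smooth_psnd[OF o]] im
  by (auto simp: psnd_def topspace_Euclidean_space)
 from continuous_map_compose[OF this plot_continuous[OF inverse_chart_plot[OF Y V']]]
 have r2: "continuous_map ?Z (mtop Y) (%z. inv_into V \<psi> (psnd ?n z))" by (simp add: o_def)
 show ?thesis
 proof (rule is_chartI[OF _ o c])
  show "openin (prod_topology (mtop X) (mtop Y)) (U \<times> V)"
   using cU(1) cV(1) by (simp add: openin_prod_Times_iff)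
  show "continuous_map ?Z (prod_topology (mtop X) (mtop Y)) ?r"
   using r1 r2 by (simp add: continuous_map_pairwise o_def)
  show "?r (?J p) = p" if "p \<in> U \<times> V" for p
   using that cU(4,7) cV(4) by (auto simp: pfst_pjoin)
 qed
qed

lemma manifold_prod:
 assumes X: "manifold X" and Y: "manifold Y"
 shows "manifold (prod_mfd X Y)"
proof -
 let ?n = "mdim X" and ?m = "mdim Y"
 let ?J = "%\<phi> \<psi> p. pjoin ?n (\<phi> (fst p)) (\<psi> (snd p))"
 have tr: "smooth_into (?n + ?m) (?n + ?m) (?J \<phi> \<psi> ` (U \<times> V \<inter> U' \<times> V')) (?J \<phi>' \<psi>' \<circ> inv_into (U \<times> V) (?J \<phi> \<psi>))"
  if U: "(U, \<phi>) \<in> atlas X" and V: "(V, \<psi>) \<in> atlas Y" and U': "(U', \<phi>') \<in> atlas X" and V': "(V', \<psi>') \<in> atlas Y"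
  for U \<phi> V \<psi> U' \<phi>' V' \<psi>'
 proof -
  note c = is_chartD[OF prod_chart[OF X Y U V]] and c' = is_chartD[OF prod_chart[OF X Y U' V']]
  note cU = is_chartD[OF manifold_chart[OF X U]] and cV = is_chartD[OF manifold_chart[OF Y V]]
  note cU' = is_chartD[OF manifold_chart[OF X U']] and cV' = is_chartD[OF manifold_chart[OF Y V']]
  let ?W = "?J \<phi> \<psi> ` (U \<times> V \<inter> U' \<times> V')"
  have oW: "openin (EN (?n + ?m)) ?W" by (rule c(8)[OF c'(1)])
  have pW: "pfst ?n z \<in> \<phi> ` (U \<inter> U')" "psnd ?n z \<in> \<psi> ` (V \<inter> V')" if "z \<in> ?W" for z
   using that cU(7) by (auto simp: pfst_pjoin)
  have s1: "smooth_into (?n + ?m) ?n ?W ((\<phi>' \<circ> inv_into U \<phi>) \<circ> pfst ?n)"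
   by (rule smooth_into_comp[OF oW cU(8)[OF cU'(1)] pW(1) smooth_pfst[OF oW]
      max_atlas_transition[OF X atlas_max_atlas[OF X U] atlas_max_atlas[OF X U']]])
  have s2: "smooth_into (?n + ?m) ?m ?W ((\<psi>' \<circ> inv_into V \<psi>) \<circ> psnd ?n)"
   by (rule smooth_into_comp[OF oW cV(8)[OF cV'(1)] pW(2) smooth_psnd[OF oW]
      max_atlas_transition[OF Y atlas_max_atlas[OF Y V] atlas_max_atlas[OF Y V']]])
  show ?thesis
  proof (rule smooth_into_cong[OF oW _ smooth_pjoin[OF s1 s2]])
   fix z i assume "z \<in> ?W"
   then obtain p where p: "p \<in> U \<times> V" "p \<in> U' \<times> V'" "z = ?J \<phi> \<psi> p" by blast
   then have "pfst ?n z = \<phi> (fst p)" "psnd ?n z = \<psi> (snd p)"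
    using cU(7) by (auto simp: pfst_pjoin)
   then show "pjoin ?n (((\<phi>' \<circ> inv_into U \<phi>) \<circ> pfst ?n) z) (((\<psi>' \<circ> inv_into V \<psi>) \<circ> psnd ?n) z) i =
     (?J \<phi>' \<psi>' \<circ> inv_into (U \<times> V) (?J \<phi> \<psi>)) z i"
    using p c(4)[OF p(1)] cU(4) cV(4) by auto
  qed
 qed
 have "is_chart (?n + ?m) (prod_topology (mtop X) (mtop Y)) c" if "c \<in> atlas (prod_mfd X Y)" for c
  using that prod_chart[OF X Y] unfolding prod_mfd_atlas by blast
 moreover have "\<Union>(fst ` atlas (prod_mfd X Y)) = topspace (prod_topology (mtop X) (mtop Y))"
 proof
  show "\<Union>(fst ` atlas (prod_mfd X Y)) \<subseteq> topspace (prod_topology (mtop X) (mtop Y))"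
  proof
   fix x assume "x \<in> \<Union>(fst ` atlas (prod_mfd X Y))"
   then obtain U \<phi> V \<psi> where "(U, \<phi>) \<in> atlas X" "(V, \<psi>) \<in> atlas Y" "x \<in> U \<times> V"
    unfolding prod_mfd_atlas by auto
   then show "x \<in> topspace (prod_topology (mtop X) (mtop Y))"
    using openin_subset[OF is_chartD(1)[OF prod_chart[OF X Y]]] by blast
  qed
  show "topspace (prod_topology (mtop X) (mtop Y)) \<subseteq> \<Union>(fst ` atlas (prod_mfd X Y))"
  proof
   fix p assume "p \<in> topspace (prod_topology (mtop X) (mtop Y))"
   then have "fst p \<in> topspace (mtop X)" "snd p \<in> topspace (mtop Y)" by auto
   then obtain U \<phi> V \<psi> where UV: "(U, \<phi>) \<in> atlas X" "fst p \<in> U" "(V, \<psi>) \<in> atlas Y" "snd p \<in> V"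
    using manifold_cover[OF X] manifold_cover[OF Y] by metis
   then have "(U \<times> V, ?J \<phi> \<psi>) \<in> atlas (prod_mfd X Y)" unfolding prod_mfd_atlas by blast
   moreover have "p \<in> U \<times> V" using UV by (simp add: mem_Times_iff)
   ultimately show "p \<in> \<Union>(fst ` atlas (prod_mfd X Y))" by force
  qed
 qed
 moreover have "compatible (?n + ?m) c d" if c: "c \<in> atlas (prod_mfd X Y)" and d: "d \<in> atlas (prod_mfd X Y)" for c d
 proof -
  obtain U \<phi> V \<psi> where 1: "c = (U \<times> V, ?J \<phi> \<psi>)" "(U, \<phi>) \<in> atlas X" "(V, \<psi>) \<in> atlas Y"
   using c unfolding prod_mfd_atlas by blast
  obtain U' \<phi>' V' \<psi>' where 2: "d = (U' \<times> V', ?J \<phi>' \<psi>')" "(U', \<phi>') \<in> atlas X" "(V', \<psi>') \<in> atlas Y"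
   using d unfolding prod_mfd_atlas by blast
  show ?thesis
   unfolding 1(1) 2(1) compatible_def prod.case
   using tr[OF 1(2,3) 2(2,3)] tr[OF 2(2,3) 1(2,3)] by (simp only: Int_commute)
 qed
 ultimately show ?thesis unfolding manifold_def by simp
qed

lemma plot_prod_iff:
 assumes X: "manifold X" and Y: "manifold Y"
 shows "plot (prod_mfd X Y) k W \<sigma> \<longleftrightarrow> plot X k W (fst \<circ> \<sigma>) & plot Y k W (snd \<circ> \<sigma>)" (is "?L \<longleftrightarrow> ?R")
proof
 let ?n = "mdim X" and ?m = "mdim Y" and ?P = "prod_mfd X Y"
 let ?J = "%\<phi> \<psi> p. pjoin ?n (\<phi> (fst p)) (\<psi> (snd p))"
 {
  assume L: ?L
  note W = plot_openin[OF L]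
  have loc: "\<exists>U \<phi> V \<psi>. (U, \<phi>) \<in> atlas X & (V, \<psi>) \<in> atlas Y & fst (\<sigma> w) \<in> U & snd (\<sigma> w) \<in> V &
    openin (EN k) {w\<in>W. \<sigma> w \<in> U \<times> V} &
    smooth_into k (?n + ?m) {w\<in>W. \<sigma> w \<in> U \<times> V} (?J \<phi> \<psi> \<circ> \<sigma>)" if "w \<in> W" for w
  proof -
   have "\<sigma> w \<in> topspace (mtop ?P)" by (rule plot_in_topspace[OF L that])
   then have "fst (\<sigma> w) \<in> topspace (mtop X)" "snd (\<sigma> w) \<in> topspace (mtop Y)" by auto
   then obtain U \<phi> V \<psi> where UV: "(U, \<phi>) \<in> atlas X" "fst (\<sigma> w) \<in> U" "(V, \<psi>) \<in> atlas Y" "snd (\<sigma> w) \<in> V"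
    using manifold_cover[OF X] manifold_cover[OF Y] by metis
   then have c: "(U \<times> V, ?J \<phi> \<psi>) \<in> atlas ?P" unfolding prod_mfd_atlas by blast
   then have "smooth_into k (?n + ?m) {w\<in>W. \<sigma> w \<in> U \<times> V} (?J \<phi> \<psi> \<circ> \<sigma>)"
    using L unfolding plot_def by fastforce
   moreover have "openin (EN k) {w\<in>W. \<sigma> w \<in> U \<times> V}"
    using plot_preimage_open[OF L] is_chartD(1)[OF prod_chart[OF X Y UV(1,3)]] by simp
   ultimately show ?thesis using UV by blast
  qed
  have "plot X k W (fst \<circ> \<sigma>)"
  proof (rule plotI_max_atlas[OF X W])
   fix w assume w: "w \<in> W"
   obtain U \<phi> V \<psi> where *: "(U, \<phi>) \<in> atlas X" "fst (\<sigma> w) \<in> U" "snd (\<sigma> w) \<in> V"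
    "openin (EN k) {w\<in>W. \<sigma> w \<in> U \<times> V}"
    "smooth_into k (?n + ?m) {w\<in>W. \<sigma> w \<in> U \<times> V} (?J \<phi> \<psi> \<circ> \<sigma>)" using loc[OF w] by blast
   have "Ck_on l k {w\<in>W. \<sigma> w \<in> U \<times> V} (%x. (\<phi> \<circ> (fst \<circ> \<sigma>)) x i)" if "i < ?n" for i l
    using smooth_intoD[OF *(5), of i l] that by (simp add: pjoin_def)
   then have "smooth_into k ?n {w\<in>W. \<sigma> w \<in> U \<times> V} (\<phi> \<circ> (fst \<circ> \<sigma>))"
    by (simp add: smooth_into_def)
   then show "\<exists>W' U \<phi>. openin (EN k) W' & w \<in> W' & W' \<subseteq> W & (fst \<circ> \<sigma>) ` W' \<subseteq> U &
     (U, \<phi>) \<in> max_atlas X & smooth_into k ?n W' (\<phi> \<circ> (fst \<circ> \<sigma>))"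
    using * w atlas_max_atlas[OF X *(1)]
    by (intro exI[of _ "{w\<in>W. \<sigma> w \<in> U \<times> V}"] exI[of _ U] exI[of _ \<phi>]) (auto simp: mem_Times_iff)
  qed
  moreover have "plot Y k W (snd \<circ> \<sigma>)"
  proof (rule plotI_max_atlas[OF Y W])
   fix w assume w: "w \<in> W"
   obtain U \<phi> V \<psi> where *: "(V, \<psi>) \<in> atlas Y" "fst (\<sigma> w) \<in> U" "snd (\<sigma> w) \<in> V"
    "openin (EN k) {w\<in>W. \<sigma> w \<in> U \<times> V}"
    "smooth_into k (?n + ?m) {w\<in>W. \<sigma> w \<in> U \<times> V} (?J \<phi> \<psi> \<circ> \<sigma>)" using loc[OF w] by blast
   have "Ck_on l k {w\<in>W. \<sigma> w \<in> U \<times> V} (%x. (\<psi> \<circ> (snd \<circ> \<sigma>)) x i)" if "i < ?m" for i l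
    using smooth_intoD[OF *(5), of "?n + i" l] that by (simp add: pjoin_def)
   then have "smooth_into k ?m {w\<in>W. \<sigma> w \<in> U \<times> V} (\<psi> \<circ> (snd \<circ> \<sigma>))"
    by (simp add: smooth_into_def)
   then show "\<exists>W' U \<phi>. openin (EN k) W' & w \<in> W' & W' \<subseteq> W & (snd \<circ> \<sigma>) ` W' \<subseteq> U &
     (U, \<phi>) \<in> max_atlas Y & smooth_into k ?m W' (\<phi> \<circ> (snd \<circ> \<sigma>))"
    using * w atlas_max_atlas[OF Y *(1)]
    by (intro exI[of _ "{w\<in>W. \<sigma> w \<in> U \<times> V}"] exI[of _ V] exI[of _ \<psi>]) (auto simp: mem_Times_iff)
  qed
  ultimately show ?R by blast
 next
  assume R: ?R
  then have p1: "plot X k W (fst \<circ> \<sigma>)" and p2: "plot Y k W (snd \<circ> \<sigma>)" by auto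
  have "smooth_into k (?n + ?m) {w\<in>W. \<sigma> w \<in> A} (\<alpha> \<circ> \<sigma>)" if A: "(A, \<alpha>) \<in> atlas ?P" for A \<alpha>
  proof -
   obtain U \<phi> V \<psi> where 1: "A = U \<times> V" "\<alpha> = ?J \<phi> \<psi>" "(U, \<phi>) \<in> atlas X" "(V, \<psi>) \<in> atlas Y"
    using A unfolding prod_mfd_atlas by blast
   have "smooth_into k ?n {w\<in>W. (fst \<circ> \<sigma>) w \<in> U} (\<phi> \<circ> (fst \<circ> \<sigma>))"
    "smooth_into k ?m {w\<in>W. (snd \<circ> \<sigma>) w \<in> V} (\<psi> \<circ> (snd \<circ> \<sigma>))"
    using p1 p2 1(3,4) unfolding plot_def by blast+
   then have "smooth_into k ?n {w\<in>W. \<sigma> w \<in> A} (\<phi> \<circ> (fst \<circ> \<sigma>))"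
    "smooth_into k ?m {w\<in>W. \<sigma> w \<in> A} (\<psi> \<circ> (snd \<circ> \<sigma>))"
    by (auto elim!: smooth_into_subset simp: 1(1) mem_Times_iff)
   from smooth_pjoin[OF this] show ?thesis by (simp add: 1(2) o_def)
  qed
  moreover have "continuous_map (subtopology (EN k) W) (mtop ?P) \<sigma>"
   using plot_continuous[OF p1] plot_continuous[OF p2] by (simp add: continuous_map_pairwise)
  ultimately show ?L using plot_openin[OF p1] unfolding plot_def by auto
 }
qed

section \<open>Local homeomorphisms with explicit inverse branches, and the smooth structure pulled
  back along them\<close>

definition homeo_patch :: "'e topology => 'a topology => ('e => 'a) => 'e set => ('a => 'e) => bool" where
 "homeo_patch E X \<pi> W \<rho> \<longleftrightarrow> openin E W & openin X (\<pi> ` W) & (\<forall>e\<in>W. \<rho> (\<pi> e) = e) &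
   continuous_map (subtopology X (\<pi> ` W)) E \<rho>"

definition local_homeo :: "'e topology => 'a topology => ('e => 'a) => bool" where
 "local_homeo E X \<pi> \<longleftrightarrow> continuous_map E X \<pi> & (\<forall>e\<in>topspace E. \<exists>W \<rho>. e \<in> W & homeo_patch E X \<pi> W \<rho>)"

lemma homeo_patch_subset:
 assumes p: "homeo_patch E X \<pi> W \<rho>" and W': "openin E W'" "W' \<subseteq> W"
 shows "homeo_patch E X \<pi> W' \<rho>"
proof -
 have o: "openin X (\<pi> ` W)" and inv: "!!e. e \<in> W ==> \<rho> (\<pi> e) = e"
  and c: "continuous_map (subtopology X (\<pi> ` W)) E \<rho>" using p by (auto simp: homeo_patch_def)
 have "openin X {x\<in>\<pi> ` W. \<rho> x \<in> W'}" using c W'(1) unfolding continuous_map_open_subtopology[OF o] by blast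
 moreover have "{x\<in>\<pi> ` W. \<rho> x \<in> W'} = \<pi> ` W'" using inv W'(2) by auto
 ultimately have "openin X (\<pi> ` W')" by simp
 then show ?thesis
  unfolding homeo_patch_def using W' inv continuous_map_from_subtopology_mono[OF c, of "\<pi> ` W'"] by blast
qed

lemma local_homeo_patch:
 assumes "local_homeo E X \<pi>" "e \<in> topspace E" "openin X V" "\<pi> e \<in> V"
 obtains W \<rho> where "e \<in> W" "homeo_patch E X \<pi> W \<rho>" "\<pi> ` W \<subseteq> V"
proof -
 obtain W \<rho> where W: "e \<in> W" "homeo_patch E X \<pi> W \<rho>" using assms(1,2) unfolding local_homeo_def by blast
 have "openin E {e\<in>topspace E. \<pi> e \<in> V}"
  using assms(1,3) openin_continuous_map_preimage unfolding local_homeo_def by blast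
 then have "openin E (W \<inter> {e\<in>topspace E. \<pi> e \<in> V})" using W(2) by (auto simp: homeo_patch_def)
 from homeo_patch_subset[OF W(2) this] show thesis
  using assms(2,4) W(1) by (intro that[of "W \<inter> {e\<in>topspace E. \<pi> e \<in> V}" \<rho>]) auto
qed

text \<open>The bridge between explicit inverse branches and the homeomorphism condition in
  \<open>pullback_mfd\<close> and \<open>covering_map\<close>.\<close>

lemma homeo_patch_iff_homeomorphic_map:
 assumes c: "continuous_map E X \<pi>" and W: "openin E W"
 shows "(\<exists>\<rho>. homeo_patch E X \<pi> W \<rho>) \<longleftrightarrow>
   openin X (\<pi> ` W) & homeomorphic_map (subtopology E W) (subtopology X (\<pi> ` W)) \<pi>"
proof (intro iffI conjI)
 assume "\<exists>\<rho>. homeo_patch E X \<pi> W \<rho>"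
 then obtain \<rho> where p: "openin X (\<pi> ` W)" "!!e. e \<in> W ==> \<rho> (\<pi> e) = e"
  "continuous_map (subtopology X (\<pi> ` W)) E \<rho>" unfolding homeo_patch_def by blast
 then show "openin X (\<pi> ` W)" by simp
 have "homeomorphic_maps (subtopology E W) (subtopology X (\<pi> ` W)) \<pi> \<rho>"
  unfolding homeomorphic_maps_def continuous_map_in_subtopology
  using p c continuous_map_from_subtopology[OF c, of W] by auto
 then show "homeomorphic_map (subtopology E W) (subtopology X (\<pi> ` W)) \<pi>"
  by (auto simp: homeomorphic_map_maps)
next
 assume R: "openin X (\<pi> ` W) & homeomorphic_map (subtopology E W) (subtopology X (\<pi> ` W)) \<pi>"
 then obtain \<rho> where "homeomorphic_maps (subtopology E W) (subtopology X (\<pi> ` W)) \<pi> \<rho>"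
  by (auto simp: homeomorphic_map_maps)
 then show "\<exists>\<rho>. homeo_patch E X \<pi> W \<rho>"
  using R W openin_subset[OF W] unfolding homeo_patch_def homeomorphic_maps_def continuous_map_in_subtopology
  by (intro exI[of _ \<rho>]) auto
qed

lemma pullback_mfd_simps [simp]:
 "mdim (pullback_mfd E X \<pi>) = mdim X" "mtop (pullback_mfd E X \<pi>) = E"
 by (simp_all add: pullback_mfd_def)

lemma pullback_atlas:
 assumes "local_homeo E (mtop X) \<pi>"
 shows "atlas (pullback_mfd E X \<pi>) =
  {(W, \<phi> \<circ> \<pi>) | W U \<phi>. (U, \<phi>) \<in> atlas X & \<pi> ` W \<subseteq> U & (\<exists>\<rho>. homeo_patch E (mtop X) \<pi> W \<rho>)}"
proof -
 have "openin E W & openin (mtop X) (\<pi> ` W) & \<pi> ` W \<subseteq> U &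
   homeomorphic_map (subtopology E W) (subtopology (mtop X) (\<pi> ` W)) \<pi> \<longleftrightarrow>
   \<pi> ` W \<subseteq> U & (\<exists>\<rho>. homeo_patch E (mtop X) \<pi> W \<rho>)" for W U
  using homeo_patch_iff_homeomorphic_map[of E "mtop X" \<pi> W] assms
  unfolding local_homeo_def homeo_patch_def by blast
 then show ?thesis unfolding pullback_mfd_def by auto
qed

lemma pullback_cover:
 assumes X: "manifold X" and lh: "local_homeo E (mtop X) \<pi>" and e: "e \<in> topspace E"
 obtains W U \<phi> \<rho> where "e \<in> W" "(U, \<phi>) \<in> atlas X" "\<pi> ` W \<subseteq> U" "homeo_patch E (mtop X) \<pi> W \<rho>"
  "(W, \<phi> \<circ> \<pi>) \<in> atlas (pullback_mfd E X \<pi>)"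
proof -
 have "\<pi> e \<in> topspace (mtop X)" using lh e unfolding local_homeo_def continuous_map_def by blast
 then obtain U \<phi> where U: "(U, \<phi>) \<in> atlas X" "\<pi> e \<in> U" using manifold_cover[OF X] by blast
 obtain W \<rho> where "e \<in> W" "homeo_patch E (mtop X) \<pi> W \<rho>" "\<pi> ` W \<subseteq> U"
  using local_homeo_patch[OF lh e is_chartD(1)[OF manifold_chart[OF X U(1)]] U(2)] by blast
 then show thesis using that[of W U \<phi> \<rho>] U(1) unfolding pullback_atlas[OF lh] by blast
qed

lemma manifold_pullback:
 assumes X: "manifold X" and lh: "local_homeo E (mtop X) \<pi>"
 shows "manifold (pullback_mfd E X \<pi>)"
proof -
 let ?n = "mdim X" and ?E = "pullback_mfd E X \<pi>"
 have c\<pi>: "continuous_map E (mtop X) \<pi>" using lh by (simp add: local_homeo_def)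
 have ch: "is_chart ?n E (W, \<phi> \<circ> \<pi>)"
  if U: "(U, \<phi>) \<in> atlas X" and WU: "\<pi> ` W \<subseteq> U" and p: "homeo_patch E (mtop X) \<pi> W \<rho>" for W U \<phi> \<rho>
 proof -
  note U' = atlas_max_atlas[OF X U]
  note cU = is_chartD[OF max_atlas_chart[OF U']]
  have oW: "openin E W" and o\<pi>: "openin (mtop X) (\<pi> ` W)" and inv: "!!e. e \<in> W ==> \<rho> (\<pi> e) = e"
   and c\<rho>: "continuous_map (subtopology (mtop X) (\<pi> ` W)) E \<rho>" using p by (auto simp: homeo_patch_def)
  have im: "openin (EN ?n) ((\<phi> \<circ> \<pi>) ` W)" using cU(6)[OF o\<pi> WU] by (simp add: image_comp)
  have "continuous_map (subtopology E W) (subtopology (mtop X) U) \<pi>"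
   unfolding continuous_map_in_subtopology using continuous_map_from_subtopology[OF c\<pi>] WU by auto
  from continuous_map_compose[OF this smooth_fn_continuous[OF X chart_smooth_fn[OF X U']]]
  have c: "continuous_map (subtopology E W) (EN ?n) (\<phi> \<circ> \<pi>)" .
  have "continuous_map (subtopology (EN ?n) ((\<phi> \<circ> \<pi>) ` W)) (subtopology (mtop X) (\<pi> ` W)) (inv_into U \<phi>)"
   unfolding continuous_map_in_subtopology
  proof (intro conjI)
   show "continuous_map (subtopology (EN ?n) ((\<phi> \<circ> \<pi>) ` W)) (mtop X) (inv_into U \<phi>)"
    by (rule continuous_map_from_subtopology_mono[OF plot_continuous[OF inverse_chart_plot[OF X U']]]) (use WU in auto)
  qed (use cU(4) WU in auto)
  from continuous_map_compose[OF this c\<rho>]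
  have r: "continuous_map (subtopology (EN ?n) ((\<phi> \<circ> \<pi>) ` W)) E (\<rho> \<circ> inv_into U \<phi>)" .
  show ?thesis
   by (rule is_chartI[OF oW im c r]) (use WU inv cU(4) in auto)
 qed
 have cha: "is_chart ?n E c" if "c \<in> atlas ?E" for c
  using that ch unfolding pullback_atlas[OF lh] by blast
 have cov: "\<Union>(fst ` atlas ?E) = topspace E"
 proof
  show "\<Union>(fst ` atlas ?E) \<subseteq> topspace E"
  proof
   fix x assume "x \<in> \<Union>(fst ` atlas ?E)"
   then obtain A \<phi> where "(A, \<phi>) \<in> atlas ?E" "x \<in> A" by auto
   then show "x \<in> topspace E" using openin_subset[OF is_chartD(1)[OF cha]] by blast
  qed
  show "topspace E \<subseteq> \<Union>(fst ` atlas ?E)"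
  proof
   fix e assume "e \<in> topspace E"
   then show "e \<in> \<Union>(fst ` atlas ?E)" using pullback_cover[OF X lh, of e] by (metis UnionI fst_conv image_eqI)
  qed
 qed
 have tr: "smooth_into ?n ?n (\<alpha> ` (A \<inter> B)) (\<beta> \<circ> inv_into A \<alpha>)"
  if A: "(A, \<alpha>) \<in> atlas ?E" and B: "(B, \<beta>) \<in> atlas ?E" for A \<alpha> B \<beta>
 proof -
  obtain U \<phi> where 1: "\<alpha> = \<phi> \<circ> \<pi>" "(U, \<phi>) \<in> atlas X" "\<pi> ` A \<subseteq> U"
   using A unfolding pullback_atlas[OF lh] by blast
  obtain V \<psi> where 2: "\<beta> = \<psi> \<circ> \<pi>" "(V, \<psi>) \<in> atlas X" "\<pi> ` B \<subseteq> V"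
   using B unfolding pullback_atlas[OF lh] by blast
  note cA = is_chartD[OF cha[OF A]] and cB = is_chartD[OF cha[OF B]]
  have o: "openin (EN ?n) (\<alpha> ` (A \<inter> B))" by (rule cA(8)[OF cB(1)])
  have "smooth_into ?n ?n (\<phi> ` (U \<inter> V)) (\<psi> \<circ> inv_into U \<phi>)"
   by (rule max_atlas_transition[OF X atlas_max_atlas[OF X 1(2)] atlas_max_atlas[OF X 2(2)]])
  then have "smooth_into ?n ?n (\<alpha> ` (A \<inter> B)) (\<psi> \<circ> inv_into U \<phi>)"
   by (rule smooth_into_subset) (use 1 2 in auto)
  then show ?thesis
  proof (rule smooth_into_cong[OF o, rotated])
   fix z i assume "z \<in> \<alpha> ` (A \<inter> B)"
   then obtain e where e: "e \<in> A" "z = \<alpha> e" by blast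
   then show "(\<psi> \<circ> inv_into U \<phi>) z i = (\<beta> \<circ> inv_into A \<alpha>) z i"
    using cA(4)[OF e(1)] is_chartD(4)[OF manifold_chart[OF X 1(2)], of "\<pi> e"] 1 2 by auto
  qed
 qed
 have "compatible ?n c d" if "c \<in> atlas ?E" "d \<in> atlas ?E" for c d
 proof -
  obtain A \<phi> B \<psi> where "c = (A, \<phi>)" "d = (B, \<psi>)" by (cases c; cases d)
  then show ?thesis using that tr[of A \<phi> B \<psi>] tr[of B \<psi> A \<phi>] by (simp add: compatible_def Int_commute)
 qed
 then show ?thesis unfolding manifold_def using cha cov by auto
qed

lemma plot_pullback_iff:
 assumes X: "manifold X" and lh: "local_homeo E (mtop X) \<pi>"
 shows "plot (pullback_mfd E X \<pi>) k W \<sigma> \<longleftrightarrow>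
   continuous_map (subtopology (EN k) W) E \<sigma> & plot X k W (\<pi> \<circ> \<sigma>)" (is "?L \<longleftrightarrow> ?R")
proof
 let ?n = "mdim X" and ?E = "pullback_mfd E X \<pi>"
 note ME = manifold_pullback[OF X lh]
 {
  assume L: ?L
  have "plot X k W (\<pi> \<circ> \<sigma>)"
  proof (rule plotI_max_atlas[OF X plot_openin[OF L]])
   fix w assume w: "w \<in> W"
   then have "\<sigma> w \<in> topspace E" using plot_in_topspace[OF L] by simp
   then obtain A U \<phi> where A: "\<sigma> w \<in> A" "(U, \<phi>) \<in> atlas X" "\<pi> ` A \<subseteq> U" "(A, \<phi> \<circ> \<pi>) \<in> atlas ?E"
    using pullback_cover[OF X lh] by metis
   have "openin (EN k) {w\<in>W. \<sigma> w \<in> A}"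
    by (rule plot_preimage_open[OF L is_chartD(1)[OF manifold_chart[OF ME A(4)]]])
   moreover have "smooth_into k ?n {w\<in>W. \<sigma> w \<in> A} (\<phi> \<circ> \<pi> \<circ> \<sigma>)"
    using L A(4) unfolding plot_def by fastforce
   ultimately show "\<exists>W' U \<phi>. openin (EN k) W' & w \<in> W' & W' \<subseteq> W & (\<pi> \<circ> \<sigma>) ` W' \<subseteq> U &
     (U, \<phi>) \<in> max_atlas X & smooth_into k ?n W' (\<phi> \<circ> (\<pi> \<circ> \<sigma>))"
    using A w atlas_max_atlas[OF X A(2)]
    by (intro exI[of _ "{w\<in>W. \<sigma> w \<in> A}"] exI[of _ U] exI[of _ \<phi>]) (auto simp: o_assoc)
  qed
  then show ?R using plot_continuous[OF L] by simp
 next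
  assume R: ?R
  then have p: "plot X k W (\<pi> \<circ> \<sigma>)" by blast
  have "smooth_into k ?n {w\<in>W. \<sigma> w \<in> A} (\<alpha> \<circ> \<sigma>)" if A: "(A, \<alpha>) \<in> atlas ?E" for A \<alpha>
  proof -
   obtain U \<phi> where 1: "\<alpha> = \<phi> \<circ> \<pi>" "(U, \<phi>) \<in> atlas X" "\<pi> ` A \<subseteq> U"
    using A unfolding pullback_atlas[OF lh] by blast
   have "smooth_into k ?n {w\<in>W. (\<pi> \<circ> \<sigma>) w \<in> U} (\<phi> \<circ> (\<pi> \<circ> \<sigma>))" using p 1(2) unfolding plot_def by blast
   then have "smooth_into k ?n {w\<in>W. \<sigma> w \<in> A} (\<phi> \<circ> (\<pi> \<circ> \<sigma>))"
    by (rule smooth_into_subset) (use 1(3) in auto)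
   then show ?thesis by (simp add: 1(1) o_assoc)
  qed
  then show ?L using R plot_openin[OF p] unfolding plot_def by auto
 }
qed

text \<open>Near \<open>v\<close> the lift is the inverse branch applied to the plot. Shrinking the
  patch by \<open>B\<close> lets the lift keep any open condition that holds at
  \<open>e\<close>.\<close>

lemma plot_lift:
 assumes X: "manifold X" and lh: "local_homeo E (mtop X) \<pi>"
  and p: "plot X k V \<alpha>" and e: "e \<in> B" "openin E B" and v: "v \<in> V" "\<alpha> v = \<pi> e"
 obtains V' \<theta> where "v \<in> V'" "V' \<subseteq> V" "plot (pullback_mfd E X \<pi>) k V' \<theta>" "\<theta> v = e" "\<theta> ` V' \<subseteq> B"
  "!!v. v \<in> V' ==> \<pi> (\<theta> v) = \<alpha> v"
proof -
 have eE: "e \<in> topspace E" using e openin_subset by blast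
 then obtain W0 \<rho> where W0: "e \<in> W0" "homeo_patch E (mtop X) \<pi> W0 \<rho>"
  using lh unfolding local_homeo_def by blast
 define W where "W = W0 \<inter> B"
 have W: "homeo_patch E (mtop X) \<pi> W \<rho>"
  by (rule homeo_patch_subset[OF W0(2)]) (use W0(2) e in "auto simp: W_def homeo_patch_def")
 have o\<pi>: "openin (mtop X) (\<pi> ` W)" and inv: "!!e. e \<in> W ==> \<rho> (\<pi> e) = e"
   and c\<rho>: "continuous_map (subtopology (mtop X) (\<pi> ` W)) E \<rho>" using W by (auto simp: homeo_patch_def)
 let ?V = "{v\<in>V. \<alpha> v \<in> \<pi> ` W}"
 have oV: "openin (EN k) ?V" by (rule plot_preimage_open[OF p o\<pi>])
 note pV = plot_subset[OF p oV]
 have "continuous_map (subtopology (EN k) ?V) (subtopology (mtop X) (\<pi> ` W)) \<alpha>"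
  unfolding continuous_map_in_subtopology using plot_continuous[OF pV] by auto
 from continuous_map_compose[OF this c\<rho>]
 have c: "continuous_map (subtopology (EN k) ?V) E (\<rho> \<circ> \<alpha>)" .
 have eq: "\<pi> (\<rho> (\<alpha> v)) = \<alpha> v" "\<rho> (\<alpha> v) \<in> W" if "v \<in> ?V" for v using that inv by auto
 have "plot X k ?V (\<pi> \<circ> (\<rho> \<circ> \<alpha>))"
  by (rule plot_cong[OF pV _ X]) (use eq in auto)
 then have "plot (pullback_mfd E X \<pi>) k ?V (\<rho> \<circ> \<alpha>)"
  using plot_pullback_iff[OF X lh] c by blast
 moreover have "e \<in> W" using W0(1) e(1) W_def by simp
 ultimately show thesis
  using that[of ?V "\<rho> \<circ> \<alpha>"] eq v inv by (auto simp: W_def)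
qed

section \<open>Strict simplicity\<close>

text \<open>The normal form of a submersion is a coordinate projection, which has an evident section
  through each point. This is the passage from the rank condition to sections.\<close>

lemma submersion_imp_subm:
 assumes X: "manifold X" and Y: "manifold Y" and f: "submersion X Y f" and V: "(V, \<psi>) \<in> atlas Y"
 shows "subm X (mdim Y) {x\<in>topspace (mtop X). f x \<in> V} (\<psi> \<circ> f)"
proof -
 let ?n = "mdim X" and ?m = "mdim Y" and ?B = "{x\<in>topspace (mtop X). f x \<in> V}"
 note cV = is_chartD[OF manifold_chart[OF Y V]]
 have sf: "smooth_map X Y f" using f by (simp add: submersion_def)
 have fc: "continuous_map (mtop X) (mtop Y) f" using sf by (simp add: smooth_map_def)
 have oB: "openin (mtop X) ?B" using openin_continuous_map_preimage[OF fc cV(1)] .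
 have sm: "smooth_fn X ?m ?B (\<psi> \<circ> f)"
  unfolding smooth_fn_def
 proof (intro conjI allI impI ballI)
  show "(\<psi> \<circ> f) x i = 0" if "x \<in> ?B" "?m \<le> i" for x i using that cV(7) by simp
  fix k W \<sigma> assume p: "plot X k W \<sigma> & \<sigma> ` W \<subseteq> ?B"
  then have "plot Y k W (%w. f (\<sigma> w))" using smooth_map_plot[OF X Y sf] by blast
  then have "smooth_into k ?m {w\<in>W. f (\<sigma> w) \<in> V} (\<psi> \<circ> (%w. f (\<sigma> w)))"
   using V unfolding plot_def by blast
  moreover have "{w\<in>W. f (\<sigma> w) \<in> V} = W" using p by auto
  ultimately show "smooth_into k ?m W (\<psi> \<circ> f \<circ> \<sigma>)" by (simp add: o_def)
 qed (rule oB)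
 have "\<exists>W \<tau>. section_at X ?m ?B (\<psi> \<circ> f) x W \<tau>" if x: "x \<in> ?B" for x
 proof -
  obtain U \<phi> where U: "(U, \<phi>) \<in> atlas X" "x \<in> U" using manifold_cover[OF X, of x] x by blast
  note U' = atlas_max_atlas[OF X U(1)]
  note cU = is_chartD[OF max_atlas_chart[OF U']]
  let ?V = "\<phi> ` (U \<inter> ?B)" and ?F = "\<psi> \<circ> f \<circ> inv_into U \<phi>"
  have oV: "openin (EN ?n) ?V" by (rule cU(8)[OF oB])
  have p: "plot X ?n ?V (inv_into U \<phi>)" by (rule plot_subset[OF inverse_chart_plot[OF X U'] oV]) auto
  have "smooth_into ?n ?m ?V (%z. (\<psi> \<circ> f) (inv_into U \<phi> z))"
   by (rule smooth_fn_plot[OF sm p]) (use cU(4) in auto)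
  then have F: "smooth_into ?n ?m ?V ?F" by (simp add: o_def)
  have jac: "jacobian_surj ?n ?m ?F (\<phi> x)" using f U V x unfolding submersion_def by blast
  have xV: "\<phi> x \<in> ?V" using x U(2) by blast
  obtain D \<theta> \<theta>' where d: "diffeo_on ?n D \<theta> \<theta>'" "\<phi> x \<in> D" "D \<subseteq> ?V" "?m \<le> ?n"
   "!!y i. [|y \<in> D; i < ?m|] ==> \<theta> y (?n - ?m + i) = ?F y i"
   using straightening[OF oV F xV jac] by blast
  have im: "openin (EN ?n) (\<theta> ` D)" and s': "smooth_into ?n ?n (\<theta> ` D) \<theta>'"
   and inv: "!!y. y \<in> D ==> \<theta>' (\<theta> y) = y" using d(1) by (auto simp: diffeo_on_def)
  define a where "a = \<theta> (\<phi> x)"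
  \<comment> \<open>In straightened coordinates the section keeps the first \<open>?n - ?m\<close>
    coordinates at their values at \<open>x\<close> and lets the last ones run.\<close>
  define J where "J = pjoin (?n - ?m) a"
  let ?T = "topspace (EN ?m)"
  define W where "W = {w\<in>?T. J w \<in> \<theta> ` D}"
  have nm: "?n - ?m + ?m = ?n" using d(4) by simp
  have sJ: "smooth_into ?m ?n ?T J"
   using smooth_pjoin[of ?m "?n - ?m" ?T "%_. a" ?m "%w. w"] nm unfolding J_def
   by (simp add: smooth_into_def Ck_on_const Ck_on_coordinate)
  have zJ: "J w i = 0" if "w \<in> ?T" "?n \<le> i" for w i
   using that d(4) by (auto simp: J_def pjoin_def topspace_Euclidean_space)
  have oW: "openin (EN ?m) W"
   unfolding W_def by (rule openin_smooth_preimage[OF openin_topspace im sJ zJ])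
  have comp: "smooth_into ?m ?n W (\<theta>' \<circ> J)"
  proof (rule smooth_into_comp[OF oW im _ _ s'])
   show "smooth_into ?m ?n W J" by (rule smooth_into_subset[OF sJ]) (auto simp: W_def)
  qed (simp add: W_def)
  have JD: "\<theta>' (J w) \<in> D" "\<theta> (\<theta>' (J w)) = J w" if "w \<in> W" for w using that inv by (auto simp: W_def)
  define \<tau> where "\<tau> = (%w. inv_into U \<phi> ((\<theta>' \<circ> J) w))"
  have pl: "plot X ?m W \<tau>"
   unfolding \<tau>_def
   by (rule plot_compose[OF X inverse_chart_plot[OF X U'] oW comp]) (use JD d(3) in fastforce)
  \<comment> \<open>\<open>J\<close> takes the value at \<open>x\<close> back to
    \<open>\<theta> (\<phi> x)\<close>, so the section passes through \<open>x\<close>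
    itself.\<close>
  have cx: "J ((\<psi> \<circ> f) x) = a"
  proof
   fix l
   show "J ((\<psi> \<circ> f) x) l = a l"
   proof (cases "l < ?n - ?m")
    case True then show ?thesis by (simp add: J_def pjoin_def)
   next
    case False
    show ?thesis
    proof (cases "l < ?n")
     case True
     then have "l - (?n - ?m) < ?m" "?n - ?m + (l - (?n - ?m)) = l" using False by auto
     then have "a l = ?F (\<phi> x) (l - (?n - ?m))" using d(5)[OF d(2)] unfolding a_def by metis
     then show ?thesis using False cU(4)[OF U(2)] by (simp add: J_def pjoin_def)
    next
     case False
     have "(\<psi> \<circ> f) x \<in> ?T" using smooth_fn_zero_tail[OF sm x] by (auto simp: topspace_Euclidean_space)
     then show ?thesis using zJ[of "(\<psi> \<circ> f) x" l] diffeo_on_zero_tail[OF d(1,2), of l] False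
      by (simp add: a_def)
    qed
   qed
  qed
  have "section_at X ?m ?B (\<psi> \<circ> f) x W \<tau>"
   unfolding section_at_def
  proof (intro conjI ballI)
   show "(\<psi> \<circ> f) x \<in> W"
    using cx d(2) smooth_fn_zero_tail[OF sm x] by (auto simp: W_def topspace_Euclidean_space a_def)
   show "\<tau> ((\<psi> \<circ> f) x) = x" unfolding \<tau>_def o_apply[of \<theta>' J] cx
    using inv[OF d(2)] cU(4)[OF U(2)] by (simp add: a_def)
   show t: "\<tau> ` W \<subseteq> ?B"
   proof
    fix y assume "y \<in> \<tau> ` W"
    then obtain w where w: "w \<in> W" "y = \<tau> w" by blast
    then obtain z where "z \<in> U \<inter> ?B" "\<theta>' (J w) = \<phi> z" using JD d(3) by blast
    then show "y \<in> ?B" using w cU(4) by (simp add: \<tau>_def)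
   qed
   fix w assume w: "w \<in> W"
   show "(\<psi> \<circ> f) (\<tau> w) = w"
   proof
    fix i
    show "(\<psi> \<circ> f) (\<tau> w) i = w i"
    proof (cases "i < ?m")
     case True
     have "(\<psi> \<circ> f) (\<tau> w) i = ?F (\<theta>' (J w)) i" by (simp add: \<tau>_def)
     also have "\<dots> = \<theta> (\<theta>' (J w)) (?n - ?m + i)" using d(5)[OF JD(1)[OF w] True] by simp
     also have "\<dots> = w i" using JD(2)[OF w] by (simp add: J_def pjoin_def)
     finally show ?thesis .
    next
     case False
     then show ?thesis using w t smooth_fn_zero_tail[OF sm, of "\<tau> w" i]
      by (auto simp: W_def topspace_Euclidean_space)
    qed
   qed
  qed (rule pl)
  then show ?thesis by blast
 qed
 then show ?thesis using sm unfolding subm_def by blast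
qed

section \<open>Leaf charts and separation of leaves by saturated sets\<close>

definition saturated :: "'a topology => ('a => 'c) => 'a set => bool" where
 "saturated T f B \<longleftrightarrow> (\<forall>x\<in>B. \<forall>y\<in>topspace T. f x = f y --> y \<in> B)"

text \<open>A chart of the leaf space, pulled back to a saturated open set of \<open>X\<close>. The
  function \<open>f\<close> stands for any labelling of the leaves.\<close>

definition leaf_chart :: "'a mfd => ('a => 'c) => nat => 'a set => ('a => nat => real) => bool" where
 "leaf_chart X f q B c \<longleftrightarrow> subm X q B c & saturated (mtop X) f B & (\<forall>x\<in>B. \<forall>y\<in>B. c x = c y \<longleftrightarrow> f x = f y)"

definition separated_quot :: "'a topology => ('a => 'c) => bool" where
 "separated_quot T f \<longleftrightarrow> (\<forall>x\<in>topspace T. \<forall>y\<in>topspace T. f x \<noteq> f y -->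
   (\<exists>A B. openin T A & openin T B & saturated T f A & saturated T f B & x \<in> A & y \<in> B & A \<inter> B = {}))"

text \<open>The intrinsic form of strict simplicity: the leaf space disappears, and only functions that
 separate the leaves remain.\<close>

definition simple_quot :: "'a mfd => ('a => 'c) => bool" where
 "simple_quot X f \<longleftrightarrow> (\<exists>q. \<forall>x\<in>topspace (mtop X). \<exists>B c. x \<in> B & leaf_chart X f q B c) &
   separated_quot (mtop X) f"

text \<open>Near each point of the image, \<open>K\<close> is \<open>\<kappa>\<close> composed with
  a local section of \<open>c\<close>.\<close>

lemma smooth_into_descend:
 assumes c: "subm X q B c" and \<kappa>: "smooth_fn X r B \<kappa>" and K: "!!y i. y \<in> B ==> K (c y) i = \<kappa> y i"
 shows "smooth_into q r (c ` B) K"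
proof (rule smooth_into_local[OF subm_image_open[OF c]])
 fix z assume "z \<in> c ` B"
 then obtain y where y: "y \<in> B" "z = c y" by blast
 obtain W \<tau> where W: "plot X q W \<tau>" "c y \<in> W" "\<tau> ` W \<subseteq> B" "!!w. w \<in> W ==> c (\<tau> w) = w"
  using c y(1) unfolding subm_def section_at_def by blast
 have WI: "W \<subseteq> c ` B" using W(3,4) by force
 have "smooth_into q r W (%w. \<kappa> (\<tau> w))" by (rule smooth_fn_plot[OF \<kappa> W(1,3)])
 then have "smooth_into q r W K"
  by (rule smooth_into_cong[OF plot_openin[OF W(1)], rotated]) (use K W(3,4) in "metis image_subset_iff")
 then show "\<exists>V. openin (EN q) V & z \<in> V & smooth_into q r (c ` B \<inter> V) K"
  using W(2) y(2) WI plot_openin[OF W(1)] by (intro exI[of _ W]) (auto simp: Int_absorb1)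
qed

text \<open>The leaf space gets the quotient topology and one chart from each leaf chart. Local
  sections do the rest: they make the inverse charts continuous, the transition functions smooth and
  the projection a submersion.\<close>

lemma simple_quot_imp_leaf_space:
 assumes X: "manifold X" and s: "simple_quot X f"
 shows "\<exists>Y :: 'c mfd. manifold Y & Hausdorff_space (mtop Y) & topspace (mtop Y) = f ` topspace (mtop X) &
   quotient_map (mtop X) (mtop Y) f & submersion X Y f"
proof -
 obtain q where q: "!!x. x \<in> topspace (mtop X) ==> \<exists>B c. x \<in> B & leaf_chart X f q B c"
  and sep: "separated_quot (mtop X) f" using s unfolding simple_quot_def by blast
 let ?n = "mdim X" and ?Q = "quotient_top (mtop X) f" and ?T = "topspace (mtop X)"
 \<comment> \<open>Any representative in \<open>B\<close> may be evaluated, because \<open>c\<close>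
   is constant on the part of each fiber of \<open>f\<close> in \<open>B\<close>.\<close>
 define bar where "bar = (%B c l. c (inv_into B f l) :: nat => real)"
 define Y where "Y = \<lparr>mdim = q, mtop = ?Q, atlas = {(f ` B, bar B c) | B c. leaf_chart X f q B c}\<rparr>"
 have Ysimps: "mdim Y = q" "mtop Y = ?Q" by (simp_all add: Y_def)
 have atl: "d \<in> atlas Y \<longleftrightarrow> (\<exists>B c. d = (f ` B, bar B c) & leaf_chart X f q B c)" for d by (auto simp: Y_def)
 have qm: "quotient_map (mtop X) ?Q f" by (rule quotient_map_quotient_top)
 have tQ: "topspace ?Q = f ` ?T" using quotient_imp_surjective_map[OF qm] by simp
 have oQ: "openin ?Q (f ` B)" if B: "openin (mtop X) B" "saturated (mtop X) f B" for B
 proof -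
  have "{x\<in>?T. f x \<in> f ` B} = B" using B openin_subset[OF B(1)] unfolding saturated_def by force
  then show ?thesis using B openin_subset[OF B(1)] by (auto simp: openin_quotient_top)
 qed
 have lc: "subm X q B c" "openin (mtop X) B" "saturated (mtop X) f B" "B \<subseteq> ?T"
   "!!x y. x \<in> B ==> y \<in> B ==> c x = c y \<longleftrightarrow> f x = f y" if "leaf_chart X f q B c" for B c
  using that subm_openin openin_subset unfolding leaf_chart_def by blast+
 have bar: "bar B c (f x) = c x" if B: "leaf_chart X f q B c" and x: "x \<in> B" for B c x
 proof -
  have "f (inv_into B f (f x)) = f x" "inv_into B f (f x) \<in> B"
   using x by (auto intro: f_inv_into_f inv_into_into)
  then show ?thesis using lc(5)[OF B _ x] by (simp add: bar_def)
 qed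
 have barim: "bar B c ` f ` A = c ` A" if "leaf_chart X f q B c" "A \<subseteq> B" for B c A
  using bar[OF that(1)] that(2) by force
 have imInt: "f ` B \<inter> f ` B' = f ` (B \<inter> B')" if "leaf_chart X f q B c" "leaf_chart X f q B' c'" for B c B' c'
  using lc(3,4)[OF that(1)] lc(3,4)[OF that(2)] unfolding saturated_def by (auto 4 3)
 have ch: "is_chart q ?Q (f ` B, bar B c)" if B: "leaf_chart X f q B c" for B c
 proof -
  have oI: "openin (EN q) (c ` B)" by (rule subm_image_open[OF lc(1)[OF B]])
  have sm: "smooth_fn X q B c" using lc(1)[OF B] by (simp add: subm_def)
  have im: "openin (EN q) (bar B c ` f ` B)" using barim[OF B order_refl] oI by simp
  have oB: "openin ?Q (f ` B)" by (rule oQ[OF lc(2,3)[OF B]])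
  have c: "continuous_map (subtopology ?Q (f ` B)) (EN q) (bar B c)"
   unfolding continuous_map_open_subtopology[OF oB]
  proof (intro conjI ballI allI impI)
   show "bar B c l \<in> topspace (EN q)" if "l \<in> f ` B" for l
    using that bar[OF B] openin_subset[OF oI] by auto
   fix A assume A: "openin (EN q) A"
   have "openin (mtop X) {x\<in>B. c x \<in> A}"
    using smooth_fn_continuous[OF X sm] A unfolding continuous_map_open_subtopology[OF lc(2)[OF B]] by blast
   moreover have "saturated (mtop X) f {x\<in>B. c x \<in> A}"
    using lc(3)[OF B] lc(5)[OF B] unfolding saturated_def by (metis (mono_tags, lifting) mem_Collect_eq)
   ultimately have "openin ?Q (f ` {x\<in>B. c x \<in> A})" by (rule oQ)
   moreover have "f ` {x\<in>B. c x \<in> A} = {l\<in>f ` B. bar B c l \<in> A}" using bar[OF B] by auto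
   ultimately show "openin ?Q {l\<in>f ` B. bar B c l \<in> A}" by simp
  qed
  \<comment> \<open>The inverse chart; the choice of a preimage is harmless because \<open>c\<close>
    takes equal values in \<open>B\<close> only on one fiber of \<open>f\<close>.\<close>
  let ?\<rho> = "%z. f (inv_into B c z)"
  have \<rho>: "?\<rho> (c x) = f x" if x: "x \<in> B" for x
  proof -
   have "c (inv_into B c (c x)) = c x" "inv_into B c (c x) \<in> B"
    using x by (auto intro: f_inv_into_f inv_into_into)
   then show ?thesis using lc(5)[OF B _ x] by blast
  qed
  have r: "continuous_map (subtopology (EN q) (bar B c ` f ` B)) ?Q ?\<rho>"
   unfolding barim[OF B order_refl] continuous_map_open_subtopology[OF oI]
  proof (intro conjI ballI allI impI)
   show "?\<rho> z \<in> topspace ?Q" if "z \<in> c ` B" for z using that \<rho> lc(4)[OF B] tQ by auto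
   fix A assume A: "openin ?Q A"
   show "openin (EN q) {z\<in>c ` B. ?\<rho> z \<in> A}"
   proof (rule openin_locally)
    fix z assume "z \<in> {z\<in>c ` B. ?\<rho> z \<in> A}"
    then obtain x where x: "x \<in> B" "z = c x" "f x \<in> A" using \<rho> by auto
    obtain W \<tau> where W: "plot X q W \<tau>" "c x \<in> W" "\<tau> ` W \<subseteq> B" "\<tau> (c x) = x" "!!w. w \<in> W ==> c (\<tau> w) = w"
     using lc(1)[OF B] x(1) unfolding subm_def section_at_def by blast
    have "openin (mtop X) {x\<in>?T. f x \<in> A}" using A by (simp add: openin_quotient_top)
    then have "openin (EN q) {w\<in>W. \<tau> w \<in> {x\<in>?T. f x \<in> A}}" by (rule plot_preimage_open[OF W(1)])
    moreover have "{w\<in>W. \<tau> w \<in> {x\<in>?T. f x \<in> A}} \<subseteq> {z\<in>c ` B. ?\<rho> z \<in> A}"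
    proof
     fix w assume w: "w \<in> {w\<in>W. \<tau> w \<in> {x\<in>?T. f x \<in> A}}"
     then have "w = c (\<tau> w)" "\<tau> w \<in> B" using W(3,5) by auto
     then show "w \<in> {z\<in>c ` B. ?\<rho> z \<in> A}" using w \<rho>[of "\<tau> w"] by auto
    qed
    ultimately show "\<exists>T. openin (EN q) T & z \<in> T & T \<subseteq> {z\<in>c ` B. ?\<rho> z \<in> A}"
     using W(2,4) x lc(4)[OF B] by (intro exI[of _ "{w\<in>W. \<tau> w \<in> {x\<in>?T. f x \<in> A}}"]) auto
   qed
  qed
  show ?thesis
   by (rule is_chartI[OF oB im c r]) (use bar[OF B] \<rho> in auto)
 qed
 have tr: "smooth_into q q (bar B c ` (f ` B \<inter> f ` B')) (bar B' c' \<circ> inv_into (f ` B) (bar B c))"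
  if B: "leaf_chart X f q B c" and B': "leaf_chart X f q B' c'" for B c B' c'
 proof -
  note cB = is_chartD[OF ch[OF B]]
  let ?I = "bar B c ` (f ` B \<inter> f ` B')"
  have I: "?I = c ` (B \<inter> B')" unfolding imInt[OF B B'] by (rule barim[OF B]) blast
  have s: "subm X q (B \<inter> B') c" by (rule subm_subset[OF lc(1)[OF B]]) (use lc(2)[OF B] lc(2)[OF B'] in auto)
  have s': "smooth_fn X q (B \<inter> B') c'"
   using lc(1)[OF B'] subm_openin[OF s] smooth_fn_subset[of X q B' c'] unfolding subm_def by blast
  show ?thesis
   unfolding I
  proof (rule smooth_into_descend[OF s s'])
   fix y i assume y: "y \<in> B \<inter> B'"
   then have "inv_into (f ` B) (bar B c) (c y) = f y" using cB(4)[of "f y"] bar[OF B, of y] by simp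
   then show "(bar B' c' \<circ> inv_into (f ` B) (bar B c)) (c y) i = c' y i" using bar[OF B'] y by simp
  qed
 qed
 have MY: "manifold Y"
  unfolding manifold_def Ysimps
 proof (intro conjI ballI)
  show "is_chart q ?Q d" if "d \<in> atlas Y" for d using that ch unfolding atl by blast
  show "\<Union>(fst ` atlas Y) = topspace ?Q"
  proof
   show "\<Union>(fst ` atlas Y) \<subseteq> topspace ?Q" using lc(4) tQ by (fastforce simp: atl)
   show "topspace ?Q \<subseteq> \<Union>(fst ` atlas Y)"
   proof
    fix l assume "l \<in> topspace ?Q"
    then obtain x where x: "x \<in> ?T" "l = f x" using tQ by blast
    then obtain B c where "x \<in> B" "leaf_chart X f q B c" using q by blast
    then show "l \<in> \<Union>(fst ` atlas Y)" using x(2) by (force simp: atl)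
   qed
  qed
  fix d e assume "d \<in> atlas Y" "e \<in> atlas Y"
  then obtain B c B' c' where de: "d = (f ` B, bar B c)" "leaf_chart X f q B c"
   "e = (f ` B', bar B' c')" "leaf_chart X f q B' c'" unfolding atl by blast
  then show "compatible q d e"
   using tr[OF de(2,4)] tr[OF de(4,2)] by (simp add: compatible_def Int_commute)
 qed
 moreover have "Hausdorff_space (mtop Y)"
  unfolding Hausdorff_space_def Ysimps
 proof (intro allI impI)
  fix l m assume "l \<in> topspace ?Q & m \<in> topspace ?Q & l \<noteq> m"
  then obtain x y where xy: "x \<in> ?T" "y \<in> ?T" "l = f x" "m = f y" "f x \<noteq> f y" using tQ by auto
  then obtain A B where AB: "openin (mtop X) A" "openin (mtop X) B" "saturated (mtop X) f A"
   "saturated (mtop X) f B" "x \<in> A" "y \<in> B" "A \<inter> B = {}" using sep unfolding separated_quot_def by blast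
  have "disjnt (f ` A) (f ` B)"
   using AB(3,4,7) openin_subset[OF AB(2)] unfolding disjnt_def saturated_def by blast
  then show "\<exists>U V. openin ?Q U & openin ?Q V & l \<in> U & m \<in> V & disjnt U V"
   using oQ[OF AB(1,3)] oQ[OF AB(2,4)] AB(5,6) xy(3,4) by blast
 qed
 moreover have "submersion X Y f"
 proof -
  have eq: "f x \<in> f ` B \<longleftrightarrow> x \<in> B" if "x \<in> ?T" "leaf_chart X f q B c" for x B c
  proof
   assume "f x \<in> f ` B"
   then obtain b where "b \<in> B" "f b = f x" by auto
   then show "x \<in> B" using lc(3)[OF that(2)] that(1) unfolding saturated_def by blast
  qed blast
  have smo: "smooth_into ?n q (\<phi> ` (U \<inter> B)) (bar B c \<circ> f \<circ> inv_into U \<phi>)"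
   if U: "(U, \<phi>) \<in> atlas X" and B: "leaf_chart X f q B c" for U \<phi> B c
  proof -
   note cU = is_chartD[OF manifold_chart[OF X U]]
   have o: "openin (EN ?n) (\<phi> ` (U \<inter> B))" by (rule cU(8)[OF lc(2)[OF B]])
   have "plot X ?n (\<phi> ` (U \<inter> B)) (inv_into U \<phi>)"
    by (rule plot_subset[OF inverse_chart_plot[OF X atlas_max_atlas[OF X U]] o]) auto
   then have "smooth_into ?n q (\<phi> ` (U \<inter> B)) (%z. c (inv_into U \<phi> z))"
    using lc(1)[OF B] cU(4) by (intro smooth_fn_plot[of X q B c]) (auto simp: subm_def)
   then show ?thesis
    by (rule smooth_into_cong[OF o, rotated]) (use bar[OF B] cU(4) in auto)
  qed
  have jac: "jacobian_surj ?n q (bar B c \<circ> f \<circ> inv_into U \<phi>) (\<phi> x)"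
   if U: "(U, \<phi>) \<in> atlas X" and B: "leaf_chart X f q B c" and x: "x \<in> U" "x \<in> B" for U \<phi> B c x
  proof -
   note cU = is_chartD[OF manifold_chart[OF X U]]
   obtain W \<tau> where "section_at X q B c x W \<tau>" using lc(1)[OF B] x(2) unfolding subm_def by blast
   from section_at_subset[OF this openin_Int[OF cU(1) lc(2)[OF B]]]
   obtain W where W: "plot X q W \<tau>" "c x \<in> W" "\<tau> ` W \<subseteq> U \<inter> B" "\<tau> (c x) = x" "!!w. w \<in> W ==> c (\<tau> w) = w"
    using x unfolding section_at_def by blast
   have s: "smooth_into q ?n W (%w. \<phi> (\<tau> w))"
    by (rule smooth_fn_plot[OF chart_smooth_fn[OF X atlas_max_atlas[OF X U]] W(1)]) (use W(3) in auto)
   have "jacobian_surj ?n q (bar B c \<circ> f \<circ> inv_into U \<phi>) (\<phi> (\<tau> (c x)))"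
   proof (rule jacobian_surj_of_section[OF cU(8)[OF lc(2)[OF B]] smo[OF U B] plot_openin[OF W(1)] s W(2)])
    fix w assume w: "w \<in> W"
    then have t: "\<tau> w \<in> U" "\<tau> w \<in> B" using W(3) by auto
    then show "\<phi> (\<tau> w) \<in> \<phi> ` (U \<inter> B)" by blast
    show "(bar B c \<circ> f \<circ> inv_into U \<phi>) (\<phi> (\<tau> w)) i = w i" for i
     using cU(4)[OF t(1)] bar[OF B t(2)] W(5)[OF w] by simp
   qed
   then show ?thesis using W(4) by simp
  qed
  have "smooth_map X Y f"
   unfolding smooth_map_def Ysimps
  proof (intro conjI)
   show "continuous_map (mtop X) ?Q f" using quotient_imp_continuous_map[OF qm] .
   show "\<forall>(U, \<phi>)\<in>atlas X. \<forall>(V, \<psi>)\<in>atlas Y.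
     smooth_into ?n q (\<phi> ` {x\<in>U. f x \<in> V}) (\<psi> \<circ> f \<circ> inv_into U \<phi>)"
   proof clarify
    fix U \<phi> V \<psi> assume U: "(U, \<phi>) \<in> atlas X" and "(V, \<psi>) \<in> atlas Y"
    then obtain B c where B: "V = f ` B" "\<psi> = bar B c" "leaf_chart X f q B c" unfolding atl by blast
    have "U \<subseteq> ?T" using openin_subset[OF is_chartD(1)[OF manifold_chart[OF X U]]] .
    then have "{x\<in>U. f x \<in> V} = U \<inter> B" using eq[OF _ B(3)] B(1) by blast
    then show "smooth_into ?n q (\<phi> ` {x\<in>U. f x \<in> V}) (\<psi> \<circ> f \<circ> inv_into U \<phi>)"
     using smo[OF U B(3)] B(2) by simp
   qed
  qed
  moreover have "\<forall>(U, \<phi>)\<in>atlas X. \<forall>(V, \<psi>)\<in>atlas Y. \<forall>x\<in>U. f x \<in> V -->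
    jacobian_surj (mdim X) (mdim Y) (\<psi> \<circ> f \<circ> inv_into U \<phi>) (\<phi> x)"
  proof clarify
   fix U \<phi> V \<psi> x assume U: "(U, \<phi>) \<in> atlas X" and "(V, \<psi>) \<in> atlas Y" and x: "x \<in> U" "f x \<in> V"
   then obtain B c where B: "V = f ` B" "\<psi> = bar B c" "leaf_chart X f q B c" unfolding atl by blast
   have "U \<subseteq> ?T" using openin_subset[OF is_chartD(1)[OF manifold_chart[OF X U]]] .
   then have "x \<in> B" using eq[OF _ B(3)] B(1) x by blast
   then show "jacobian_surj (mdim X) (mdim Y) (\<psi> \<circ> f \<circ> inv_into U \<phi>) (\<phi> x)"
    using jac[OF U B(3) x(1)] B(2) Ysimps by simp
  qed
  ultimately show ?thesis unfolding submersion_def by blast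
 qed
 ultimately show ?thesis using qm tQ Ysimps by (intro exI[of _ Y]) simp
qed

text \<open>Charts of \<open>Y\<close> and disjoint open sets of \<open>Y\<close> are pulled back
  along \<open>f\<close>; preimages under \<open>f\<close> are saturated.\<close>

lemma leaf_space_imp_simple_quot:
 assumes X: "manifold X" and Y: "manifold Y" "Hausdorff_space (mtop Y)" and f: "submersion X Y f"
 shows "simple_quot X f"
 unfolding simple_quot_def
proof (intro conjI exI[of _ "mdim Y"] ballI)
 have fc: "continuous_map (mtop X) (mtop Y) f" using f by (simp add: submersion_def smooth_map_def)
 have oP: "openin (mtop X) {x\<in>topspace (mtop X). f x \<in> A}" if "openin (mtop Y) A" for A
  using openin_continuous_map_preimage[OF fc that] .
 fix x assume x: "x \<in> topspace (mtop X)"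
 then have "f x \<in> topspace (mtop Y)" using fc by (auto simp: continuous_map_def)
 then obtain V \<psi> where V: "(V, \<psi>) \<in> atlas Y" "f x \<in> V" using manifold_cover[OF Y(1)] by blast
 note cV = is_chartD[OF manifold_chart[OF Y(1) V(1)]]
 have "leaf_chart X f (mdim Y) {x\<in>topspace (mtop X). f x \<in> V} (\<psi> \<circ> f)"
  unfolding leaf_chart_def saturated_def
  using submersion_imp_subm[OF X Y(1) f V(1)] inj_onD[OF cV(3)] by auto
 then show "\<exists>B c. x \<in> B & leaf_chart X f (mdim Y) B c"
  using x V(2) by (intro exI[of _ "{x\<in>topspace (mtop X). f x \<in> V}"] exI[of _ "\<psi> \<circ> f"]) simp
next
 have fc: "continuous_map (mtop X) (mtop Y) f" using f by (simp add: submersion_def smooth_map_def)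
 show "separated_quot (mtop X) f"
  unfolding separated_quot_def
 proof (intro ballI impI)
  fix x y assume "x \<in> topspace (mtop X)" "y \<in> topspace (mtop X)" "f x \<noteq> f y"
  moreover then have "f x \<in> topspace (mtop Y)" "f y \<in> topspace (mtop Y)" using fc by (auto simp: continuous_map_def)
  ultimately obtain U V where "openin (mtop Y) U" "openin (mtop Y) V" "f x \<in> U" "f y \<in> V" "disjnt U V"
   using Y(2) unfolding Hausdorff_space_def by blast
  then show "\<exists>A B. openin (mtop X) A & openin (mtop X) B & saturated (mtop X) f A & saturated (mtop X) f B &
    x \<in> A & y \<in> B & A \<inter> B = {}"
   using openin_continuous_map_preimage[OF fc] \<open>x \<in> topspace (mtop X)\<close> \<open>y \<in> topspace (mtop X)\<close>
   by (intro exI[of _ "{x\<in>topspace (mtop X). f x \<in> U}"] exI[of _ "{x\<in>topspace (mtop X). f x \<in> V}"])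
    (auto simp: saturated_def disjnt_def)
 qed
qed

lemma strictly_simple_iff_simple_quot:
 assumes X: "manifold X" and F: "topspace F = topspace (mtop X)"
 shows "strictly_simple X F \<longleftrightarrow> simple_quot X (leaf_of F)"
proof
 assume "strictly_simple X F"
 then show "simple_quot X (leaf_of F)"
  unfolding strictly_simple_def using leaf_space_imp_simple_quot[OF X] by blast
next
 assume "simple_quot X (leaf_of F)"
 from simple_quot_imp_leaf_space[OF X this] show "strictly_simple X F"
  unfolding strictly_simple_def connected_components_of_def F by simp
qed

text \<open>Only the equivalence relation given by the fibers of \<open>f\<close> enters
  \<open>simple_quot\<close>, so the leaves may be labelled by any function with the same fibers,
  such as the leaves of a different foliation topology.\<close>

lemma simple_quot_cong:
 assumes "!!x y. [|x \<in> topspace (mtop X); y \<in> topspace (mtop X)|] ==> f x = f y \<longleftrightarrow> g x = g y"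
  and "simple_quot X f"
 shows "simple_quot X g"
proof -
 have sat: "saturated (mtop X) f B \<longleftrightarrow> saturated (mtop X) g B" if "B \<subseteq> topspace (mtop X)" for B
  using that assms(1) unfolding saturated_def by (metis subsetD)
 have lc: "leaf_chart X g q B c" if "leaf_chart X f q B c" for q B c
 proof -
  have "B \<subseteq> topspace (mtop X)" using that subm_openin openin_subset unfolding leaf_chart_def by blast
  then show ?thesis using that sat[of B] assms(1) unfolding leaf_chart_def by (metis subsetD)
 qed
 have sep: "separated_quot (mtop X) f" using assms(2) by (simp add: simple_quot_def)
 have "separated_quot (mtop X) g"
  unfolding separated_quot_def
 proof (intro ballI impI)
  fix x y assume xy: "x \<in> topspace (mtop X)" "y \<in> topspace (mtop X)" "g x \<noteq> g y"
  then have "f x \<noteq> f y" using assms(1) by blast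
  then obtain A B where AB: "openin (mtop X) A" "openin (mtop X) B" "saturated (mtop X) f A"
   "saturated (mtop X) f B" "x \<in> A" "y \<in> B" "A \<inter> B = {}"
   using sep[unfolded separated_quot_def, rule_format, OF xy(1,2)] by blast
  then have "saturated (mtop X) g A" "saturated (mtop X) g B"
   using sat[OF openin_subset[OF AB(1)]] sat[OF openin_subset[OF AB(2)]] by auto
  then show "\<exists>A B. openin (mtop X) A & openin (mtop X) B & saturated (mtop X) g A & saturated (mtop X) g B &
    x \<in> A & y \<in> B & A \<inter> B = {}"
   using AB by (intro exI[of _ A] exI[of _ B]) simp
 qed
 then show ?thesis using assms(2) lc unfolding simple_quot_def by meson
qed

text \<open>The submersion descends to the leaf space, where its zero set is straightened.\<close>

lemma simple_quot_restrict:
 assumes X: "manifold X" and X': "manifold X'" and s: "simple_quot X f"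
  and top: "mtop X' = subtopology (mtop X) S" and S: "S \<subseteq> topspace (mtop X)"
  and pl: "!!k W \<sigma>. plot X' k W \<sigma> \<longleftrightarrow> plot X k W \<sigma> & \<sigma> ` W \<subseteq> S"
  and cut: "!!x. x \<in> S ==> \<exists>B \<kappa>. x \<in> B & subm X r B \<kappa> & saturated (mtop X) f B &
    (\<forall>y\<in>B. \<forall>z\<in>B. f y = f z --> \<kappa> y = \<kappa> z) & S \<inter> B = {y\<in>B. \<forall>j<r. \<kappa> y j = 0}"
 shows "simple_quot X' f"
proof -
 obtain q where q: "!!x. x \<in> topspace (mtop X) ==> \<exists>B c. x \<in> B & leaf_chart X f q B c"
  and sep: "separated_quot (mtop X) f" using s unfolding simple_quot_def by blast
 have tS: "topspace (mtop X') = S" using S top by auto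
 have satS: "saturated (mtop X') f (S \<inter> B)" if "saturated (mtop X) f B" for B
  using that S tS unfolding saturated_def by blast
 have oS: "openin (mtop X') (S \<inter> B)" if "openin (mtop X) B" for B
  unfolding top openin_subtopology using that by blast
 have "separated_quot (mtop X') f"
  unfolding separated_quot_def tS
 proof (intro ballI impI)
  fix x y assume xy: "x \<in> S" "y \<in> S" "f x \<noteq> f y"
  then have "x \<in> topspace (mtop X)" "y \<in> topspace (mtop X)" using S by auto
  then obtain A B where "openin (mtop X) A" "openin (mtop X) B" "saturated (mtop X) f A"
   "saturated (mtop X) f B" "x \<in> A" "y \<in> B" "A \<inter> B = {}"
   using sep[unfolded separated_quot_def, rule_format, OF _ _ xy(3)] by blast
  then show "\<exists>A B. openin (mtop X') A & openin (mtop X') B & saturated (mtop X') f A & saturated (mtop X') f B &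
    x \<in> A & y \<in> B & A \<inter> B = {}"
   using xy oS satS by (intro exI[of _ "S \<inter> A"] exI[of _ "S \<inter> B"]) auto
 qed
 moreover have "\<exists>B c. x \<in> B & leaf_chart X' f (q - r) B c" if x: "x \<in> S" for x
 proof -
  obtain B1 c where B1: "x \<in> B1" "leaf_chart X f q B1 c" using q x S by blast
  obtain B2 \<kappa> where B2: "x \<in> B2" "subm X r B2 \<kappa>" "saturated (mtop X) f B2"
   "!!y z. y \<in> B2 ==> z \<in> B2 ==> f y = f z ==> \<kappa> y = \<kappa> z" "S \<inter> B2 = {y\<in>B2. \<forall>j<r. \<kappa> y j = 0}"
   using cut[OF x] by blast
  let ?B = "B1 \<inter> B2"
  have oB: "openin (mtop X) ?B" using B1(2) B2(2) subm_openin unfolding leaf_chart_def by blast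
  have satB: "saturated (mtop X) f ?B" using B1(2) B2(3) unfolding leaf_chart_def saturated_def by blast
  have c: "subm X q ?B c" using B1(2) oB subm_subset unfolding leaf_chart_def by blast
  have ker: "c y = c z \<longleftrightarrow> f y = f z" if "y \<in> ?B" "z \<in> ?B" for y z using B1(2) that unfolding leaf_chart_def by blast
  have \<kappa>: "subm X r ?B \<kappa>" by (rule subm_subset[OF B2(2) oB]) blast
  have sc: "smooth_fn X q ?B c" and s\<kappa>: "smooth_fn X r ?B \<kappa>" using c \<kappa> by (auto simp: subm_def)
  have sec: "\<exists>W \<tau>. plot X q W \<tau> & c y \<in> W & \<tau> ` W \<subseteq> ?B & \<tau> (c y) = y & (\<forall>w\<in>W. c (\<tau> w) = w)" if "y \<in> ?B" for y
   using c that unfolding subm_def section_at_def by blast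
  \<comment> \<open>\<open>\<kappa>\<close> is constant on the fibers of \<open>f\<close> in its
    domain, hence factors through the leaf chart \<open>c\<close>.\<close>
  define K where "K = (%z. \<kappa> (inv_into ?B c z))"
  have K: "K (c y) = \<kappa> y" if y: "y \<in> ?B" for y
  proof -
   have "c (inv_into ?B c (c y)) = c y" "inv_into ?B c (c y) \<in> ?B"
    using y by (auto intro!: f_inv_into_f inv_into_into[OF imageI[OF y]] simp del: Int_iff)
   then show ?thesis using ker[OF _ y] B2(4)[of "inv_into ?B c (c y)" y] y by (auto simp: K_def)
  qed
  have oI: "openin (EN q) (c ` ?B)" by (rule subm_image_open[OF c])
  have sK: "smooth_into q r (c ` ?B) K" by (rule smooth_into_descend[OF c s\<kappa>]) (simp only: K)
  have xB: "x \<in> ?B" using B1(1) B2(1) by blast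
  \<comment> \<open>A section of \<open>\<kappa>\<close> followed by \<open>c\<close> is a section
    of \<open>K\<close>.\<close>
  have "jacobian_surj q r K (c x)"
  proof -
   obtain W \<tau> where W: "plot X r W \<tau>" "\<kappa> x \<in> W" "\<tau> ` W \<subseteq> ?B" "\<tau> (\<kappa> x) = x" "!!w. w \<in> W ==> \<kappa> (\<tau> w) = w"
    using \<kappa> xB unfolding subm_def section_at_def by blast
   have \<tau>B: "\<tau> w \<in> ?B" if "w \<in> W" for w using W(3) that by blast
   have "jacobian_surj q r K (c (\<tau> (\<kappa> x)))"
    by (rule jacobian_surj_of_section[OF oI sK plot_openin[OF W(1)] smooth_fn_plot[OF sc W(1,3)] W(2)])
     (simp_all add: K[OF \<tau>B] W(5) \<tau>B imageI del: Int_iff)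
   then show ?thesis using W(4) by simp
  qed
  then obtain D \<theta> \<theta>' where d: "diffeo_on q D \<theta> \<theta>'" "c x \<in> D" "D \<subseteq> c ` ?B" "r \<le> q"
   "!!y i. [|y \<in> D; i < r|] ==> \<theta> y (q - r + i) = K y i"
   using straightening[OF oI sK] xB by blast
  have oD: "openin (EN q) D" and imD: "openin (EN q) (\<theta> ` D)"
   and s\<theta>: "smooth_into q q D \<theta>" "smooth_into q q (\<theta> ` D) \<theta>'" and inv: "!!y. y \<in> D ==> \<theta>' (\<theta> y) = y"
   using d(1) by (auto simp: diffeo_on_def)
  let ?p = "q - r"
  define B' where "B' = {y\<in>?B. c y \<in> D}"
  \<comment> \<open>After straightening, \<open>K\<close> occupies the last \<open>r\<close>
    coordinates. On \<open>S\<close> these vanish, so the truncation to the first \<open>?p\<close>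
    coordinates loses nothing there.\<close>
  define c' where "c' = (%y. pfst ?p (\<theta> (c y)))"
  have oB': "openin (mtop X) B'"
   using smooth_fn_continuous[OF X sc] oD unfolding B'_def continuous_map_open_subtopology[OF oB] by blast
  have satB': "saturated (mtop X) f B'"
   using satB ker unfolding saturated_def B'_def by (metis (no_types, lifting) mem_Collect_eq)
  have zero: "\<theta> (c y) = c' y" if "y \<in> S \<inter> B'" for y
  proof
   fix l
   have y: "y \<in> ?B" "c y \<in> D" "y \<in> S" using that by (auto simp: B'_def)
   show "\<theta> (c y) l = c' y l"
   proof (cases "?p \<le> l & l < q")
    case True
    then have "l - ?p < r" "q - r + (l - ?p) = l" by auto
    then have "\<theta> (c y) l = K (c y) (l - ?p)" using d(5)[OF y(2)] by metis
    also have "\<dots> = 0" using K[OF y(1)] B2(5) y \<open>l - ?p < r\<close> by auto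
    finally show ?thesis using True by (simp add: c'_def pfst_def)
   next
    case False
    then show ?thesis using diffeo_on_zero_tail[OF d(1) y(2), of l] by (auto simp: c'_def pfst_def)
   qed
  qed
  have "smooth_fn X' ?p (S \<inter> B') c'"
   unfolding smooth_fn_def
  proof (intro conjI allI impI ballI)
   show "openin (mtop X') (S \<inter> B')" by (rule oS[OF oB'])
   show "c' y i = 0" if "?p \<le> i" for y i using that by (simp add: c'_def pfst_def)
   fix k W \<sigma> assume "plot X' k W \<sigma> & \<sigma> ` W \<subseteq> S \<inter> B'"
   then have p: "plot X k W \<sigma>" "\<sigma> ` W \<subseteq> B'" using pl by auto
   note oW = plot_openin[OF p(1)]
   have "smooth_into k q W (%w. c (\<sigma> w))"
    by (rule smooth_fn_plot[OF sc p(1)]) (use p(2) in "auto simp: B'_def")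
   then have "smooth_into k q W (\<theta> \<circ> (%w. c (\<sigma> w)))"
    by (intro smooth_into_comp[OF oW oD _ _ s\<theta>(1)]) (use p(2) in "auto simp: B'_def")
   then show "smooth_into k ?p W (c' \<circ> \<sigma>)"
    unfolding smooth_into_def by (simp add: c'_def pfst_def o_def)
  qed
  moreover have "\<exists>W \<tau>. section_at X' ?p (S \<inter> B') c' y W \<tau>" if y: "y \<in> S \<inter> B'" for y
  proof -
   have yB: "y \<in> ?B" "c y \<in> D" using y by (auto simp: B'_def)
   obtain V \<tau> where V: "plot X q V \<tau>" "c y \<in> V" "\<tau> ` V \<subseteq> ?B" "\<tau> (c y) = y" "!!w. w \<in> V ==> c (\<tau> w) = w"
    using sec[OF yB(1)] by blast
   note oV = plot_openin[OF V(1)]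
   have oVD: "openin (EN q) (V \<inter> D)" using oV oD by blast
   have o1: "openin (EN q) (\<theta> ` (V \<inter> D))"
    using diffeo_on_subset[OF d(1) oVD] by (simp add: diffeo_on_def)
   \<comment> \<open>A section of \<open>c\<close> restricted to the slice on which the last
     \<open>r\<close> coordinates vanish takes its values in \<open>S\<close>.\<close>
   define W where "W = \<theta> ` (V \<inter> D) \<inter> {z. \<forall>i\<in>{?p..<q}. z i = 0}"
   have oW: "openin (EN ?p) W" unfolding W_def by (rule openin_Euclidean_slice[OF o1]) simp
   have Wd: "\<theta>' w \<in> V" "\<theta>' w \<in> D" "\<theta> (\<theta>' w) = w" if "w \<in> W" for w using that inv by (auto simp: W_def)
   have s': "smooth_into ?p q W \<theta>'"
   proof -
    have "smooth_into q q W \<theta>'" by (rule smooth_into_subset[OF s\<theta>(2)]) (auto simp: W_def)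
    then show ?thesis unfolding smooth_into_def using Ck_on_fewer_variables[of _ q _ _ ?p] by auto
   qed
   have p: "plot X ?p W (%w. \<tau> (\<theta>' w))" by (rule plot_compose[OF X V(1) oW s' Wd(1)])
   have t: "\<tau> (\<theta>' w) \<in> S \<inter> B'" "c' (\<tau> (\<theta>' w)) = w" if w: "w \<in> W" for w
   proof -
    let ?t = "\<tau> (\<theta>' w)"
    have ct: "c ?t = \<theta>' w" "?t \<in> ?B" using V(3,5) Wd[OF w] by auto
    then have "\<kappa> ?t j = 0" if "j < r" for j
    proof -
     have "\<kappa> ?t j = K (\<theta>' w) j" using K[OF ct(2)] ct(1) by simp
     also have "\<dots> = w (?p + j)" using d(5)[OF Wd(2)[OF w] that] Wd(3)[OF w] by simp
     also have "\<dots> = 0"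
     proof -
      have "?p + j \<in> {?p..<q}" using that d(4) by auto
      then show ?thesis using w unfolding W_def by blast
     qed
     finally show ?thesis .
    qed
    then have "?t \<in> S" using B2(5) ct(2) by auto
    then show "?t \<in> S \<inter> B'" using ct Wd[OF w] by (auto simp: B'_def)
    then show "c' ?t = w" using zero[of ?t] ct(1) Wd(3)[OF w] by simp
   qed
   have "c' y \<in> W"
   proof -
    have "c' y \<in> \<theta> ` (V \<inter> D)" using zero[OF y] V(2) yB(2) by (intro image_eqI[of _ \<theta> "c y"]) auto
    then show ?thesis unfolding W_def by (auto simp: c'_def pfst_def)
   qed
   moreover have "\<tau> (\<theta>' (c' y)) = y" using zero[OF y] inv[OF yB(2)] V(4) by metis
   moreover have "plot X' ?p W (%w. \<tau> (\<theta>' w))" using p t(1) pl by auto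
   ultimately have "section_at X' ?p (S \<inter> B') c' y W (%w. \<tau> (\<theta>' w))"
    unfolding section_at_def using t by auto
   then show ?thesis by blast
  qed
  moreover have "c' y = c' z \<longleftrightarrow> f y = f z" if y: "y \<in> S \<inter> B'" and z: "z \<in> S \<inter> B'" for y z
  proof -
   have "c' y = c' z \<longleftrightarrow> \<theta> (c y) = \<theta> (c z)" using zero[OF y] zero[OF z] by simp
   also have "\<dots> \<longleftrightarrow> c y = c z" using inv y z by (auto simp: B'_def) (metis inv)
   also have "\<dots> \<longleftrightarrow> f y = f z" using ker y z by (auto simp: B'_def)
   finally show ?thesis .
  qed
  ultimately have "leaf_chart X' f ?p (S \<inter> B') c'"
   using satS[OF satB'] unfolding leaf_chart_def subm_def by blast
  moreover have "x \<in> S \<inter> B'" using x xB d(2) by (auto simp: B'_def)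
  ultimately show ?thesis by blast
 qed
 ultimately show ?thesis unfolding simple_quot_def tS by blast
qed

section \<open>Homotopies of paths\<close>

abbreviation uI :: "real topology" where "uI \<equiv> top_of_set {0..1}"

text \<open>One notion for the two kinds of homotopy: a condition \<open>Q\<close> that fixes both
  ends gives \<open>path_homotopic\<close>, one that confines the ends to two sets gives
  \<open>movable\<close>.\<close>

definition mov :: "'a topology => ('a => 'a => bool) => (real => 'a) => (real => 'a) => bool" where
 "mov X Q p q \<longleftrightarrow> homotopic_with (%j. Q (j 0) (j 1)) uI X p q"

lemma mov_iff:
 "mov X Q p q \<longleftrightarrow> (\<exists>h. continuous_map (prod_topology uI uI) X h & (\<forall>t\<in>{0..1}. h (0, t) = p t) &
   (\<forall>t\<in>{0..1}. h (1, t) = q t) & (\<forall>a\<in>{0..1}. Q (h (a, 0)) (h (a, 1))))"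
 unfolding mov_def by (subst homotopic_with) auto

lemma path_homotopic_mov: "path_homotopic X p q \<longleftrightarrow> mov X (%u v. u = p 0 & v = p 1) p q"
 by (simp add: path_homotopic_def mov_def)

lemma movI:
 assumes "continuous_map (prod_topology uI uI) X h" "!!t. [|0 \<le> t; t \<le> 1|] ==> h (0, t) = p t"
  "!!t. [|0 \<le> t; t \<le> 1|] ==> h (1, t) = q t" "!!a. [|0 \<le> a; a \<le> 1|] ==> Q (h (a, 0)) (h (a, 1))"
 shows "mov X Q p q"
 unfolding mov_iff using assms by (intro exI[of _ h]) auto

lemma mov_pathin: "mov X Q p q ==> pathin X p" "mov X Q p q ==> pathin X q"
 unfolding mov_def pathin_def using homotopic_with_imp_continuous_maps by blast+

lemma mov_ends: "mov X Q p q ==> Q (p 0) (p 1)" "mov X Q p q ==> Q (q 0) (q 1)"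
 unfolding mov_def by (drule homotopic_with_imp_property, simp)+

lemma mov_sym: "mov X Q p q ==> mov X Q q p"
 unfolding mov_def by (rule homotopic_with_symD)

lemma mov_trans: "mov X Q p q ==> mov X Q q r ==> mov X Q p r"
 unfolding mov_def by (rule homotopic_with_trans)

lemma mov_mono: "mov X Q p q ==> (!!u v. Q u v ==> Q' u v) ==> mov X Q' p q"
 unfolding mov_iff by blast

lemma mov_eq:
 assumes "pathin X p" "Q (p 0) (p 1)" "!!t. [|0 \<le> t; t \<le> 1|] ==> p t = q t"
 shows "mov X Q p q"
 unfolding mov_def using assms by (intro homotopic_with_equal) (auto simp: pathin_def)

lemma mov_cong:
 assumes "mov X Q p q" "!!t. [|0 \<le> t; t \<le> 1|] ==> p t = p' t" "!!t. [|0 \<le> t; t \<le> 1|] ==> q t = q' t"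
 shows "mov X Q p' q'"
 using assms unfolding mov_iff by (metis atLeastAtMost_iff)

lemma mov_compose:
 assumes "mov X Q p q" "continuous_map X Y f" "!!u v. Q u v ==> Q' (f u) (f v)"
 shows "mov Y Q' (%t. f (p t)) (%t. f (q t))"
proof -
 obtain h where h: "continuous_map (prod_topology uI uI) X h" "\<forall>t\<in>{0..1}. h (0, t) = p t"
   "\<forall>t\<in>{0..1}. h (1, t) = q t" "\<forall>a\<in>{0..1}. Q (h (a, 0)) (h (a, 1))"
  using assms(1) unfolding mov_iff by blast
 show ?thesis
  by (rule movI[where h = "f \<circ> h", OF continuous_map_compose[OF h(1) assms(2)]]) (use h assms(3) in auto)
qed

text \<open>Paths with common ends in a convex set are joined by straight segments.
  Reparametrisations and the comparison of paths around a square are images of this one homotopy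
  under \<open>p\<close>.\<close>

lemma mov_convex:
 fixes S :: "'v::real_normed_vector set"
 assumes p: "continuous_map (top_of_set S) X p" and S: "convex S"
  and f: "continuous_on {0..1} f" "f \<in> {0..1} \<rightarrow> S" and g: "continuous_on {0..1} g" "g \<in> {0..1} \<rightarrow> S"
  and ends: "f 0 = g 0" "f 1 = g 1" and Q: "Q (p (f 0)) (p (f 1))"
 shows "mov X Q (%t. p (f t)) (%t. p (g t))"
proof (rule movI)
 let ?l = "%z. (1 - fst z) *\<^sub>R f (snd z) + fst z *\<^sub>R g (snd z)"
 have r: "?l z \<in> S" if "z \<in> {0..1} \<times> {0..1}" for z
 proof -
  have "f (snd z) \<in> S" "g (snd z) \<in> S" using that f(2) g(2) by (auto simp: mem_Times_iff)
  then show ?thesis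
   using convexD_alt[OF S, of "f (snd z)" "g (snd z)" "fst z"] that by (auto simp: mem_Times_iff)
 qed
 have "continuous_map (prod_topology uI uI) (top_of_set S) ?l"
  using r
  by (simp add: Pi_iff) (intro continuous_intros continuous_on_compose2[OF f(1)] continuous_on_compose2[OF g(1)]; auto)
 from continuous_map_compose[OF this p]
 show "continuous_map (prod_topology uI uI) X (p \<circ> ?l)" .
qed (use ends Q in "auto simp flip: scaleR_left.add")

lemma mov_reparam:
 assumes "pathin X p" "continuous_on {0..1} f" "f \<in> {0..1} \<rightarrow> {0..1}"
  "continuous_on {0..1} g" "g \<in> {0..1} \<rightarrow> {0..1}" "f 0 = g 0" "f 1 = g 1" "Q (p (f 0)) (p (f 1))"
 shows "mov X Q (%t. p (f t)) (%t. p (g t))"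
 using assms by (intro mov_convex[where S = "{0..1}"]) (auto simp: pathin_def)

text \<open>An equiconnecting map: a path from \<open>a\<close> to \<open>b\<close> inside
  \<open>C\<close> that depends continuously on both ends and is constant if they coincide. These
  are the canonical paths along which ends of paths are moved.\<close>

definition contr :: "'a topology => 'a set => (real \<times> 'a \<times> 'a => 'a) => bool" where
 "contr X C k \<longleftrightarrow>
   continuous_map (prod_topology uI (prod_topology (subtopology X C) (subtopology X C))) (subtopology X C) k &
   (\<forall>a\<in>C. \<forall>b\<in>C. k (0, a, b) = a & k (1, a, b) = b) & (\<forall>a\<in>C. \<forall>t\<in>{0..1}. k (t, a, a) = a)"

definition good :: "'a topology => 'a set => bool" where
 "good X C \<longleftrightarrow> openin X C & (\<exists>k. contr X C k)"

definition locally_good :: "'a topology => bool" where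
 "locally_good X \<longleftrightarrow> (\<forall>B x. openin X B & x \<in> B --> (\<exists>C. x \<in> C & C \<subseteq> B & good X C))"

lemma contr_simps:
 assumes "contr X C k"
 shows "[|a \<in> C; b \<in> C|] ==> k (0, a, b) = a" "[|a \<in> C; b \<in> C|] ==> k (1, a, b) = b"
  "[|a \<in> C; 0 \<le> t; t \<le> 1|] ==> k (t, a, a) = a"
 using assms by (auto simp: contr_def)

lemma contr_compose:
 assumes k: "contr X C k" and u: "continuous_map Z uI u" and a: "continuous_map Z X a" and b: "continuous_map Z X b"
  and C: "!!z. z \<in> topspace Z ==> a z \<in> C" "!!z. z \<in> topspace Z ==> b z \<in> C"
 shows "continuous_map Z X (%z. k (u z, a z, b z))" "!!z. z \<in> topspace Z ==> k (u z, a z, b z) \<in> C"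
proof -
 have "continuous_map Z (prod_topology uI (prod_topology (subtopology X C) (subtopology X C))) (%z. (u z, a z, b z))"
  by (intro continuous_map_pairedI u) (use a b C in "auto simp: continuous_map_in_subtopology")
 moreover have "continuous_map (prod_topology uI (prod_topology (subtopology X C) (subtopology X C))) (subtopology X C) k"
  using k by (simp add: contr_def)
 ultimately have "continuous_map Z (subtopology X C) (k \<circ> (%z. (u z, a z, b z)))"
  by (rule continuous_map_compose)
 then show "continuous_map Z X (%z. k (u z, a z, b z))" "!!z. z \<in> topspace Z ==> k (u z, a z, b z) \<in> C"
  by (auto simp: continuous_map_in_subtopology o_def)
qed

lemma contr_mem:
 assumes "contr X C k" "openin X C" "a \<in> C" "b \<in> C" "0 \<le> t" "t \<le> 1"
 shows "k (t, a, b) \<in> C"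
 using contr_compose(2)[OF assms(1), of "top_of_set {t}" "%_. t" "%_. a" "%_. b" t]
  openin_subset[OF assms(2)] assms by (auto simp: Pi_iff)

text \<open>Rests at 0 on the first third and at 1 on the last third, which leaves room for end
  pieces without changing a path up to homotopy.\<close>

definition middle :: "real => real" where "middle t = max 0 (min 1 (3 * t - 1))"

lemma middle: "continuous_on {0..1} middle" "middle \<in> {0..1} \<rightarrow> {0..1}" "middle 0 = 0" "middle 1 = 1"
proof -
 show "continuous_on {0..1} middle" unfolding middle_def[abs_def] by (intro continuous_intros)
qed (auto simp: middle_def)

text \<open>Attaching to each path \<open>H (v, _)\<close> short end pieces that lead from \<open>b v\<close> to its origin and from its
 end to \<open>a v\<close>.\<close>

definition glue :: "(real \<times> 'a \<times> 'a => 'a) => (real \<times> 'a \<times> 'a => 'a) => ('v \<times> real => 'a) =>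
  ('v => 'a) => ('v => 'a) => 'v \<times> real => 'a" where
 "glue kB kA H b a z =
   (if snd z \<le> 1/3 then kB (max 0 (1 - 3 * snd z), H (fst z, 0), b (fst z))
   else if snd z \<le> 2/3 then H (fst z, middle (snd z))
   else kA (max 0 (3 * snd z - 2), H (fst z, 1), a (fst z)))"

lemma continuous_map_snd_compose:
 assumes "continuous_on {0..1} f" "f \<in> {0..1} \<rightarrow> {0..1}"
 shows "continuous_map (prod_topology V uI) uI (%z. f (snd z))"
 using continuous_map_compose[OF continuous_map_snd, of uI uI f V] assms by (simp add: o_def)

lemma continuous_map_fst_const:
 assumes H: "continuous_map (prod_topology V uI) X H" and t: "t \<in> {0..1}"
 shows "continuous_map V X (%v. H (v, t))"
proof -
 have "continuous_map V (prod_topology V uI) (%v. (v, t))"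
  by (intro continuous_map_pairedI) (use t in auto)
 from continuous_map_compose[OF this H] show ?thesis by (simp add: o_def)
qed

lemma continuous_glue:
 assumes kB: "contr X B kB" and kA: "contr X A kA" and H: "continuous_map (prod_topology V uI) X H"
  and b: "continuous_map V X b" and a: "continuous_map V X a"
  and B: "!!v. v \<in> topspace V ==> H (v, 0) \<in> B & b v \<in> B" and A: "!!v. v \<in> topspace V ==> H (v, 1) \<in> A & a v \<in> A"
 shows "continuous_map (prod_topology V uI) X (glue kB kA H b a)"
proof -
 let ?Z = "prod_topology V uI"
 note cf = continuous_map_compose[OF continuous_map_fst[of V uI], unfolded o_def]
 have p1: "continuous_map ?Z X (%z. kB (max 0 (1 - 3 * snd z), H (fst z, 0), b (fst z)))"
 proof (rule contr_compose(1)[OF kB])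
  show "continuous_map ?Z uI (%z. max 0 (1 - 3 * snd z))"
   by (rule continuous_map_snd_compose) (auto intro!: continuous_intros)
  show "continuous_map ?Z X (%z. H (fst z, 0))" by (rule cf[OF continuous_map_fst_const[OF H]]) auto
  show "continuous_map ?Z X (%z. b (fst z))" by (rule cf[OF b])
 qed (use B in auto)
 have p3: "continuous_map ?Z X (%z. kA (max 0 (3 * snd z - 2), H (fst z, 1), a (fst z)))"
 proof (rule contr_compose(1)[OF kA])
  show "continuous_map ?Z uI (%z. max 0 (3 * snd z - 2))"
   by (rule continuous_map_snd_compose) (auto intro!: continuous_intros)
  show "continuous_map ?Z X (%z. H (fst z, 1))" by (rule cf[OF continuous_map_fst_const[OF H]]) auto
  show "continuous_map ?Z X (%z. a (fst z))" by (rule cf[OF a])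
 qed (use A in auto)
 have "continuous_map ?Z ?Z (%z. (fst z, middle (snd z)))"
  by (intro continuous_map_pairedI continuous_map_fst continuous_map_snd_compose middle)
 from continuous_map_compose[OF this H] have p2: "continuous_map ?Z X (%z. H (fst z, middle (snd z)))"
  by (simp add: o_def)
 have sn: "continuous_map ?Z euclideanreal snd"
  using continuous_map_snd[of V uI] continuous_map_in_subtopology by blast
 show ?thesis
  unfolding glue_def
 proof (rule continuous_map_cases_le[OF sn _ continuous_map_from_subtopology[OF p1] continuous_map_from_subtopology])
  show "continuous_map ?Z X (%z. if snd z \<le> 2/3 then H (fst z, middle (snd z))
    else kA (max 0 (3 * snd z - 2), H (fst z, 1), a (fst z)))"
   by (rule continuous_map_cases_le[OF sn _ continuous_map_from_subtopology[OF p2] continuous_map_from_subtopology[OF p3]])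
    (use A contr_simps(1)[OF kA] in "auto simp: middle_def")
 qed (use B contr_simps(1)[OF kB] in "auto simp: middle_def")
qed

lemma glue_ends:
 assumes "contr X B kB" "contr X A kA" "H (v, 0) \<in> B" "b v \<in> B" "H (v, 1) \<in> A" "a v \<in> A"
 shows "glue kB kA H b a (v, 0) = b v" "glue kB kA H b a (v, 1) = a v"
 using contr_simps(2)[OF assms(1)] contr_simps(2)[OF assms(2)] assms by (auto simp: glue_def)

text \<open>The purpose of the last clause of \<open>contr\<close>: end pieces between equal points
  are constant, so gluing changes such a path only by the reparametrisation
  \<open>middle\<close>.\<close>

lemma glue_constant:
 assumes kB: "contr X B kB" and kA: "contr X A kA" and "H (v, 0) \<in> B" "H (v, 1) \<in> A" "b v = H (v, 0)" "a v = H (v, 1)"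
  and t: "0 \<le> t" "t \<le> 1"
 shows "glue kB kA H b a (v, t) = H (v, middle t)"
 using contr_simps(3)[OF kB] contr_simps(3)[OF kA] assms by (auto simp: glue_def middle_def)

lemma mov_middle:
 assumes "pathin X p" "Q (p 0) (p 1)"
 shows "mov X Q p (%t. p (middle t))"
 using mov_reparam[OF assms(1), of "%t. t" middle Q] assms(2) middle by simp

text \<open>During a homotopy the ends trace paths in \<open>B\<close> and \<open>A\<close>.
  Canonical end pieces glued to all stages replace these traces by any other paths \<open>b\<close>
  and \<open>a\<close> in the same sets with the same ends; at the first and the last stage the
  pieces are constant.\<close>

lemma mov_change_traces:
 assumes H: "continuous_map (prod_topology uI uI) X H" and kB: "contr X B kB" and kA: "contr X A kA"
  and HB: "!!v. v \<in> {0..1} ==> H (v, 0) \<in> B" and HA: "!!v. v \<in> {0..1} ==> H (v, 1) \<in> A"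
  and b: "pathin X b" "b ` {0..1} \<subseteq> B" "b 0 = H (0, 0)" "b 1 = H (1, 0)"
  and a: "pathin X a" "a ` {0..1} \<subseteq> A" "a 0 = H (0, 1)" "a 1 = H (1, 1)"
  and Q: "!!v. v \<in> {0..1} ==> Q (b v) (a v)"
 shows "mov X Q (%t. H (0, t)) (%t. H (1, t))"
proof -
 have path: "pathin X (%t. H (v, t))" if "v \<in> {0..1}" for v
 proof -
  have "continuous_map uI (prod_topology uI uI) (%t. (v, t))"
   by (intro continuous_map_pairedI) (use that in auto)
  from continuous_map_compose[OF this H] show ?thesis by (simp add: pathin_def o_def)
 qed
 have c: "continuous_map (prod_topology uI uI) X (glue kB kA H b a)"
  by (rule continuous_glue[OF kB kA H]) (use b a HB HA in "auto simp: pathin_def")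
 have "mov X Q (%t. H (0, middle t)) (%t. H (1, middle t))"
 proof (rule movI[OF c])
  show "glue kB kA H b a (0, t) = H (0, middle t)" if "0 \<le> t" "t \<le> 1" for t
   by (rule glue_constant[OF kB kA _ _ _ _ that]) (use HB HA b a in auto)
  show "glue kB kA H b a (1, t) = H (1, middle t)" if "0 \<le> t" "t \<le> 1" for t
   by (rule glue_constant[OF kB kA _ _ _ _ that]) (use HB HA b a in auto)
  fix v :: real assume v: "0 \<le> v" "v \<le> 1"
  have "glue kB kA H b a (v, 0) = b v" "glue kB kA H b a (v, 1) = a v"
   by (rule glue_ends[OF kB kA]; use HB HA b a v in auto)+
  then show "Q (glue kB kA H b a (v, 0)) (glue kB kA H b a (v, 1))" using Q v by simp
 qed
 moreover have "mov X Q (%t. H (0, t)) (%t. H (0, middle t))"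
  by (rule mov_middle[OF path]) (use Q[of 0] b a in auto)
 moreover have "mov X Q (%t. H (1, t)) (%t. H (1, middle t))"
  by (rule mov_middle[OF path]) (use Q[of 1] b a in auto)
 ultimately show ?thesis using mov_trans mov_sym by meson
qed

section \<open>Homotopies whose ends move in small sets\<close>

abbreviation movable :: "'a topology => 'a set => 'a set => (real => 'a) => (real => 'a) => bool" where
 "movable X B A \<equiv> mov X (%u v. u \<in> B & v \<in> A)"

text \<open>The traces of the ends are loops in good sets and are replaced by constant ones.\<close>

lemma movable_imp_path_homotopic:
 assumes m: "movable X B A p q" and B: "good X B" and A: "good X A" and ends: "p 0 = q 0" "p 1 = q 1"
 shows "path_homotopic X p q"
proof -
 obtain h where h: "continuous_map (prod_topology uI uI) X h" "\<forall>t\<in>{0..1}. h (0, t) = p t"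
   "\<forall>t\<in>{0..1}. h (1, t) = q t" "\<forall>a\<in>{0..1}. h (a, 0) \<in> B & h (a, 1) \<in> A"
  using m unfolding mov_iff by blast
 obtain kB kA where k: "contr X B kB" "contr X A kA" using A B by (auto simp: good_def)
 have ts: "p 0 \<in> topspace X" "p 1 \<in> topspace X"
  using mov_pathin(1)[OF m] path_start_in_topspace path_finish_in_topspace by blast+
 have "mov X (%u v. u = p 0 & v = p 1) (%t. h (0, t)) (%t. h (1, t))"
  by (rule mov_change_traces[OF h(1) k, where b = "%_. p 0" and a = "%_. p 1"])
   (use h ends ts mov_ends[OF m] in auto)
 then show ?thesis unfolding path_homotopic_mov by (rule mov_cong) (use h in auto)
qed

lemma pathin_contr:
 assumes "contr X C k" "openin X C" "a \<in> C" "b \<in> C"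
 shows "pathin X (%t. k (t, a, b))"
 unfolding pathin_def using assms(3,4) openin_subset[OF assms(2)]
 by (intro contr_compose(1)[OF assms(1)]) auto

text \<open>The trace of the end in \<open>C\<close> is replaced by the canonical path in
  \<open>D\<close> from \<open>p 1\<close> to \<open>q 1\<close>, while the trace of the origin is
  kept.\<close>

lemma movable_shrink_end:
 assumes m: "movable X B C p q" and B: "good X B" and C: "good X C" and D: "good X D" "D \<subseteq> C" "p 1 \<in> D" "q 1 \<in> D"
 shows "movable X B D p q"
proof -
 obtain h where h: "continuous_map (prod_topology uI uI) X h" "\<forall>t\<in>{0..1}. h (0, t) = p t"
   "\<forall>t\<in>{0..1}. h (1, t) = q t" "\<forall>a\<in>{0..1}. h (a, 0) \<in> B & h (a, 1) \<in> C"
  using m unfolding mov_iff by blast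
 obtain kB kC kD where k: "contr X B kB" "contr X C kC" "contr X D kD" using B C D by (auto simp: good_def)
 have oD: "openin X D" using D by (simp add: good_def)
 have "movable X B D (%t. h (0, t)) (%t. h (1, t))"
 proof (rule mov_change_traces[OF h(1) k(1,2), where b = "%v. h (v, 0)" and a = "%v. kD (v, p 1, q 1)"])
  show "pathin X (%v. h (v, 0))" unfolding pathin_def by (rule continuous_map_fst_const[OF h(1)]) auto
  show "pathin X (%v. kD (v, p 1, q 1))" by (rule pathin_contr[OF k(3) oD D(3,4)])
 qed (use h D contr_simps[OF k(3)] contr_mem[OF k(3) oD] in auto)
 then show ?thesis by (rule mov_cong) (use h in auto)
qed

text \<open>The parameter at which \<open>p\<close> is cut off moves linearly from \<open>r\<close>
  to \<open>r'\<close>, so the end stays on the piece of \<open>p\<close> over that segment.\<close>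

lemma movable_truncate:
 assumes p: "pathin X p" and r: "r \<in> {0..1}" "r' \<in> {0..1}" and C: "p ` closed_segment r r' \<subseteq> C" and B: "p 0 \<in> B"
 shows "movable X B C (%t. p (r * t)) (%t. p (r' * t))"
proof (rule movI)
 let ?l = "%z. ((1 - fst z) * r + fst z * r') * snd z"
 have seg: "(1 - a) * r + a * r' \<in> closed_segment r r'" "(1 - a) * r + a * r' \<in> {0..1}" if "a \<in> {0..1}" for a
 proof -
  show *: "(1 - a) * r + a * r' \<in> closed_segment r r'"
   using that unfolding closed_segment_def by auto
  have "closed_segment r r' \<subseteq> {0..1}" using r by (intro closed_segment_subset) auto
  then show "(1 - a) * r + a * r' \<in> {0..1}" using * by blast
 qed
 have "?l z \<in> {0..1}" if "z \<in> {0..1} \<times> {0..1}" for z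
  using seg(2)[of "fst z"] that by (auto simp: mem_Times_iff mult_le_one)
 then have "continuous_map (prod_topology uI uI) uI ?l"
  by (simp add: Pi_iff) (intro continuous_intros)
 from continuous_map_compose[OF this p[unfolded pathin_def]]
 show "continuous_map (prod_topology uI uI) X (p \<circ> ?l)" .
 show "(p \<circ> ?l) (a, 0) \<in> B & (p \<circ> ?l) (a, 1) \<in> C" if "0 \<le> a" "a \<le> 1" for a
  using B C seg(1)[of a] that by auto
qed auto

text \<open>A basic neighbourhood of \<open>p\<close> in the compact-open topology, coded by its
  finitely many conditions.\<close>

definition path_nbhd :: "'a topology => (real set \<times> 'a set) set => (real => 'a) => bool" where
 "path_nbhd X \<K> p \<longleftrightarrow> finite \<K> & (\<forall>(K, V)\<in>\<K>. compact K & K \<subseteq> {0..1} & openin X V & p ` K \<subseteq> V)"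

text \<open>Continuation along \<open>p\<close>: the claim is proved for the initial segments
  \<open>p (r * t)\<close> and carried from \<open>r\<close> to nearby \<open>r'\<close>, so that
  connectedness of the unit interval takes the place of a subdivision. It is the source of all
  openness statements about sheets.\<close>

lemma movable_near:
 assumes X: "locally_good X" and p: "pathin X p" and A: "good X A" "p 1 \<in> A" and B: "good X B" "p 0 \<in> B"
 shows "\<exists>\<K>. path_nbhd X \<K> p & (\<forall>q. pathin X q & (\<forall>(K, V)\<in>\<K>. q ` K \<subseteq> V) --> movable X B A p q)"
proof -
 define Z where "Z = (%r. \<forall>A. good X A & p r \<in> A -->
  (\<exists>\<K>. path_nbhd X \<K> p & (\<forall>q. pathin X q & (\<forall>(K, V)\<in>\<K>. q ` K \<subseteq> V) -->
    movable X B A (%t. p (r * t)) (%t. q (r * t)))))"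
 have pr: "p r \<in> topspace X" if "r \<in> {0..1}" for r using path_image_subset_topspace[OF p] that by blast
 have "Z 0"
  unfolding Z_def
 proof (intro allI impI)
  fix A assume A: "good X A & p 0 \<in> A"
  then obtain C where C: "p 0 \<in> C" "C \<subseteq> A \<inter> B" "good X C"
   using X B unfolding locally_good_def good_def by (metis IntI openin_Int)
  then obtain k where k: "contr X C k" and oC: "openin X C" by (auto simp: good_def)
  \<comment> \<open>At \<open>r = 0\<close> both truncated paths are constant, and the canonical
    path inside \<open>C\<close> joins them.\<close>
  have "movable X B A (%t. p (0 * t)) (%t. q (0 * t))" if q: "pathin X q" "q ` {0} \<subseteq> C" for q
  proof (rule movI)
   have "continuous_map uI X (%t. k (t, p 0, q 0))"
    using pathin_contr[OF k oC C(1)] q(2) by (auto simp: pathin_def)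
   from continuous_map_compose[OF continuous_map_fst[of uI uI] this]
   show "continuous_map (prod_topology uI uI) X (%z. k (fst z, p 0, q 0))" by (simp add: o_def)
  qed (use contr_simps[OF k] contr_mem[OF k oC] C q in auto)
  moreover have "path_nbhd X {({0}, C)} p" using C oC by (auto simp: path_nbhd_def)
  ultimately show "\<exists>\<K>. path_nbhd X \<K> p & (\<forall>q. pathin X q & (\<forall>(K, V)\<in>\<K>. q ` K \<subseteq> V) -->
    movable X B A (%t. p (0 * t)) (%t. q (0 * t)))" by (intro exI[of _ "{({0}, C)}"]) auto
 qed
 have "Z 1"
 proof (rule connected_induction_simple[of "{0..1::real}" 0 1 Z])
  fix r0 :: real assume r0: "r0 \<in> {0..1}"
  obtain C where C: "p r0 \<in> C" "good X C"
   using X pr[OF r0] unfolding locally_good_def by (metis openin_topspace)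
  have oC: "openin X C" using C by (simp add: good_def)
  have "openin uI {r\<in>{0..1}. p r \<in> C}"
   using openin_continuous_map_preimage[OF p[unfolded pathin_def] oC] by simp
  then obtain e where e: "e > 0" "!!r. r \<in> {0..1} ==> \<bar>r - r0\<bar> < e ==> p r \<in> C"
   unfolding openin_euclidean_subtopology_iff using r0 C(1) by (auto simp: dist_real_def)
  let ?T = "{0..1} \<inter> ball r0 e"
  have conv: "closed_segment r r' \<subseteq> ?T" if "r \<in> ?T" "r' \<in> ?T" for r r'
   by (rule closed_segment_subset) (use that in "auto intro: convex_Int convex_ball")
  have step: "Z r'" if r: "r \<in> ?T" and r': "r' \<in> ?T" and Zr: "Z r" for r r'
   unfolding Z_def
  proof (intro allI impI)
   fix A assume A: "good X A & p r' \<in> A"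
   have pC: "p r \<in> C" "p r' \<in> C" using r r' e(2) by (auto simp: dist_real_def abs_minus_commute)
   obtain D where D: "p r' \<in> D" "D \<subseteq> A \<inter> C" "good X D"
    using X A pC(2) oC unfolding locally_good_def good_def by (metis IntI openin_Int)
   have oD: "openin X D" using D by (simp add: good_def)
   obtain \<K> where K: "path_nbhd X \<K> p"
    "!!q. pathin X q ==> (\<forall>(K, V)\<in>\<K>. q ` K \<subseteq> V) ==> movable X B C (%t. p (r * t)) (%t. q (r * t))"
    using Zr[unfolded Z_def] C(2) pC(1) by blast
   let ?S = "closed_segment r r'"
   have pS: "p ` ?S \<subseteq> C"
   proof (rule image_subsetI)
    fix u assume "u \<in> ?S"
    then have "u \<in> ?T" using conv[OF r r'] by blast
    then show "p u \<in> C" using e(2) by (auto simp: dist_real_def abs_minus_commute)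
   qed
   \<comment> \<open>Three moves: back along \<open>p\<close> from \<open>r'\<close> to
     \<open>r\<close>, over to \<open>q\<close>, forward along \<open>q\<close> to
     \<open>r'\<close>. The set \<open>C\<close> confines the end throughout; the set
     \<open>D\<close> is imposed only on the total move.\<close>
   have "movable X B A (%t. p (r' * t)) (%t. q (r' * t))"
    if q: "pathin X q" "\<forall>(K, V)\<in>insert (?S, C) (insert ({r'}, D) \<K>). q ` K \<subseteq> V" for q
   proof -
    have 1: "movable X B C (%t. p (r * t)) (%t. q (r * t))" using K(2) q by blast
    have q0: "q 0 \<in> B" using mov_ends(2)[OF 1] by simp
    have 2: "movable X B C (%t. p (r * t)) (%t. p (r' * t))"
     by (rule movable_truncate[OF p]) (use r r' pS B in auto)
    have 3: "movable X B C (%t. q (r * t)) (%t. q (r' * t))"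
     by (rule movable_truncate[OF q(1)]) (use r r' q(2) q0 in auto)
    have "movable X B C (%t. p (r' * t)) (%t. q (r' * t))"
     using mov_trans[OF mov_trans[OF mov_sym[OF 2] 1] 3] .
    then have "movable X B D (%t. p (r' * t)) (%t. q (r' * t))"
     by (rule movable_shrink_end[OF _ B(1) C(2) D(3)]) (use D q(2) in auto)
    then show ?thesis by (rule mov_mono) (use D(2) in auto)
   qed
   moreover have "path_nbhd X (insert (?S, C) (insert ({r'}, D) \<K>)) p"
    using K(1) pS oC oD D(1) conv[OF r r'] r' unfolding path_nbhd_def by auto
   ultimately show "\<exists>\<K>. path_nbhd X \<K> p & (\<forall>q. pathin X q & (\<forall>(K, V)\<in>\<K>. q ` K \<subseteq> V) -->
     movable X B A (%t. p (r' * t)) (%t. q (r' * t)))"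
    by (intro exI[of _ "insert (?S, C) (insert ({r'}, D) \<K>)"]) blast
  qed
  moreover have "openin uI ?T" by (rule openin_open_Int[OF open_ball])
  moreover have "r0 \<in> ?T" using r0 e(1) by simp
  ultimately show "\<exists>T. openin uI T & r0 \<in> T & (\<forall>x\<in>T. \<forall>y\<in>T. Z x --> Z y)" by meson
 qed (use \<open>Z 0\<close> in auto)
 then show ?thesis unfolding Z_def using A by simp
qed

text \<open>A coordinate cube is convex, so linear interpolation in a chart supplies the canonical
  paths.\<close>

lemma manifold_locally_good:
 assumes X: "manifold X"
 shows "locally_good (mtop X)"
 unfolding locally_good_def
proof (intro allI impI)
 fix B x assume B: "openin (mtop X) B & x \<in> B"
 let ?n = "mdim X"
 obtain U \<phi> where U: "(U, \<phi>) \<in> atlas X" "x \<in> U" using manifold_cover[OF X, of x] B openin_subset by blast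
 note U' = atlas_max_atlas[OF X U(1)]
 note cU = is_chartD[OF max_atlas_chart[OF U']]
 have "openin (EN ?n) (\<phi> ` (U \<inter> B))" by (rule cU(8)) (use B in blast)
 moreover have "\<phi> x \<in> \<phi> ` (U \<inter> B)" using U B by blast
 ultimately obtain r where r: "r > 0" "cube ?n (\<phi> x) r \<subseteq> \<phi> ` (U \<inter> B)" using openin_Euclidean_cubeE by blast
 let ?Q = "cube ?n (\<phi> x) r"
 define C where "C = {y\<in>U. \<phi> y \<in> ?Q}"
 let ?\<rho> = "inv_into U \<phi>"
 let ?S = "subtopology (mtop X) C"
 have oC: "openin (mtop X) C" unfolding C_def by (rule cU(5)[OF openin_cube])
 have CB: "C \<subseteq> B"
 proof
  fix y assume "y \<in> C"
  then obtain z where "y \<in> U" "z \<in> U \<inter> B" "\<phi> y = \<phi> z" using r(2) unfolding C_def by blast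
  then have "y = z" using cU(3) by (auto dest: inj_onD)
  then show "y \<in> B" using \<open>z \<in> U \<inter> B\<close> by simp
 qed
 have \<rho>: "?\<rho> z \<in> C" "\<phi> (?\<rho> z) = z" if z: "z \<in> ?Q" for z
 proof -
  obtain y where "y \<in> U" "z = \<phi> y" using r(2) z by blast
  then show "?\<rho> z \<in> C" "\<phi> (?\<rho> z) = z" using cU(4) z by (auto simp: C_def)
 qed
 define k where "k = (%(t, a, b). ?\<rho> (%i. (1 - t) * \<phi> a i + t * \<phi> b i))"
 have mem: "(%i. (1 - t) * \<phi> a i + t * \<phi> b i) \<in> ?Q" if "a \<in> C" "b \<in> C" "t \<in> {0..1}" for a b t
  unfolding cube_def
 proof (intro CollectI conjI allI impI)
  fix i assume "i < ?n"
  then have "\<bar>\<phi> a i - \<phi> x i\<bar> < r" "\<bar>\<phi> b i - \<phi> x i\<bar> < r" using that by (auto simp: C_def cube_def)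
  then have "\<phi> a i \<in> {\<phi> x i - r <..< \<phi> x i + r}" "\<phi> b i \<in> {\<phi> x i - r <..< \<phi> x i + r}" by auto
  then have "(1 - t) *\<^sub>R \<phi> a i + t *\<^sub>R \<phi> b i \<in> {\<phi> x i - r <..< \<phi> x i + r}"
   using that(3) by (intro convexD_alt) auto
  then show "\<bar>(1 - t) * \<phi> a i + t * \<phi> b i - \<phi> x i\<bar> < r" by (auto simp: abs_less_iff)
 qed (use that in "auto simp: C_def cube_def")
 have "contr (mtop X) C k"
  unfolding contr_def
 proof (intro conjI ballI)
  let ?P = "prod_topology uI (prod_topology ?S ?S)"
  have "continuous_map (subtopology (mtop X) U) (EN ?n) \<phi>"
   by (rule smooth_fn_continuous[OF X chart_smooth_fn[OF X U']])
  then have c\<phi>: "continuous_map ?S (EN ?n) \<phi>"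
   by (rule continuous_map_from_subtopology_mono) (auto simp: C_def)
  then have c\<phi>i: "continuous_map ?S euclideanreal (%a. \<phi> a i)" if "i < ?n" for i
   using that unfolding continuous_map_Euclidean_iff by blast
  have ct: "continuous_map ?P euclideanreal fst"
   using continuous_map_fst[of uI "prod_topology ?S ?S"] continuous_map_in_subtopology by blast
  have ca: "continuous_map ?P euclideanreal (%z. \<phi> (fst (snd z)) i)" "continuous_map ?P euclideanreal (%z. \<phi> (snd (snd z)) i)"
   if "i < ?n" for i
   using continuous_map_compose[OF continuous_map_compose[OF continuous_map_snd continuous_map_fst] c\<phi>i[OF that]]
    continuous_map_compose[OF continuous_map_compose[OF continuous_map_snd continuous_map_snd] c\<phi>i[OF that]]
   by (auto simp: o_def)
  let ?l = "%z i. (1 - fst z) * \<phi> (fst (snd z)) i + fst z * \<phi> (snd (snd z)) i"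
  have ml: "?l z \<in> ?Q" if "z \<in> topspace ?P" for z
   by (rule mem) (use that in auto)
  have "continuous_map ?P (EN ?n) ?l"
   unfolding continuous_map_Euclidean_iff
  proof (intro conjI ballI allI impI)
   show "?l z i = 0" if "z \<in> topspace ?P" "?n \<le> i" for z i using ml[OF that(1)] that(2) unfolding cube_def by blast
   show "continuous_map ?P euclideanreal (%z. ?l z i)" if "i < ?n" for i
    by (intro continuous_map_add continuous_map_real_mult continuous_map_diff ct ca that) auto
  qed
  then have "continuous_map ?P (subtopology (EN ?n) ?Q) ?l"
   using ml by (auto simp: continuous_map_in_subtopology)
  moreover have "continuous_map (subtopology (EN ?n) ?Q) ?S ?\<rho>"
  proof -
   have "continuous_map (subtopology (EN ?n) ?Q) (mtop X) ?\<rho>"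
    by (rule continuous_map_from_subtopology_mono[OF plot_continuous[OF inverse_chart_plot[OF X U']]]) (use r(2) in auto)
   then show ?thesis using \<rho>(1) by (auto simp: continuous_map_in_subtopology)
  qed
  ultimately have "continuous_map ?P ?S (?\<rho> \<circ> ?l)" by (rule continuous_map_compose)
  then show "continuous_map ?P ?S k" by (simp add: k_def o_def case_prod_unfold)
 qed (use cU(4) in "auto simp: k_def C_def algebra_simps")
 then have "good (mtop X) C" using oC by (auto simp: good_def)
 moreover have "x \<in> C" using U(2) center_in_cube[OF r(1)] cU(7)[OF U(2)] by (simp add: C_def)
 ultimately show "\<exists>C. x \<in> C & C \<subseteq> B & good (mtop X) C" using CB by blast
qed

section \<open>The fundamental groupoid as a covering\<close>

abbreviation Fib :: "'a mfd => ('a => 'b) => 'b => 'a topology" where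
 "Fib N s x \<equiv> subtopology (mtop N) (fiber N s x)"

lemma mem_fiber: "y \<in> fiber N s x \<longleftrightarrow> y \<in> topspace (mtop N) & s y = x"
 by (simp add: preim_def)

lemma fiber_paths_iff: "\<gamma> \<in> fiber_paths N s \<longleftrightarrow> pathin (Fib N s (s (\<gamma> 0))) \<gamma>"
 using path_image_subset_topspace[of "mtop N" \<gamma>]
 by (auto simp: fiber_paths_def pathin_subtopology mem_fiber)

lemma fiber_pathsI: "pathin (Fib N s x) \<gamma> ==> \<gamma> \<in> fiber_paths N s & s (\<gamma> 0) = x"
 unfolding fiber_paths_iff by (auto simp: pathin_subtopology mem_fiber)

lemma fiber_paths_pathin: "\<gamma> \<in> fiber_paths N s ==> pathin (mtop N) \<gamma>"
 by (simp add: fiber_paths_def)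

lemma fiber_paths_s:
 assumes "\<gamma> \<in> fiber_paths N s" "0 \<le> t" "t \<le> 1"
 shows "s (\<gamma> t) = s (\<gamma> 0)"
proof -
 have "t \<in> {0..1}" using assms by simp
 then show ?thesis using assms(1) unfolding fiber_paths_def by blast
qed

lemma fiber_paths_topspace: "[|\<gamma> \<in> fiber_paths N s; 0 \<le> t; t \<le> 1|] ==> \<gamma> t \<in> topspace (mtop N)"
 using path_image_subset_topspace[OF fiber_paths_pathin] by fastforce

lemma mem_arrow_of: "\<delta> \<in> arrow_of N s \<gamma> \<longleftrightarrow> path_homotopic (Fib N s (s (\<gamma> 0))) \<gamma> \<delta>"
 by (simp add: arrow_of_def)

lemma arrow_of_self: "\<gamma> \<in> fiber_paths N s ==> \<gamma> \<in> arrow_of N s \<gamma>"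
 unfolding mem_arrow_of path_homotopic_mov by (rule mov_eq) (auto simp: fiber_paths_iff)

lemma arrow_of_memD:
 assumes "\<delta> \<in> arrow_of N s \<gamma>"
 shows "\<delta> 0 = \<gamma> 0" "\<delta> 1 = \<gamma> 1" "\<delta> \<in> fiber_paths N s"
proof -
 have m: "mov (Fib N s (s (\<gamma> 0))) (%u v. u = \<gamma> 0 & v = \<gamma> 1) \<gamma> \<delta>"
  using assms unfolding mem_arrow_of path_homotopic_mov .
 then show e: "\<delta> 0 = \<gamma> 0" "\<delta> 1 = \<gamma> 1" using mov_ends(2) by fastforce+
 show "\<delta> \<in> fiber_paths N s" using mov_pathin(2)[OF m] e unfolding fiber_paths_iff by simp
qed

lemma arrow_of_eq:
 assumes "\<gamma> \<in> fiber_paths N s" "\<delta> \<in> fiber_paths N s"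
 shows "arrow_of N s \<gamma> = arrow_of N s \<delta> \<longleftrightarrow> path_homotopic (Fib N s (s (\<gamma> 0))) \<gamma> \<delta>"
proof
 assume "arrow_of N s \<gamma> = arrow_of N s \<delta>"
 then show "path_homotopic (Fib N s (s (\<gamma> 0))) \<gamma> \<delta>"
  using arrow_of_self[OF assms(2)] unfolding mem_arrow_of[symmetric] by simp
next
 assume h: "path_homotopic (Fib N s (s (\<gamma> 0))) \<gamma> \<delta>"
 then have e: "\<delta> 0 = \<gamma> 0" "\<delta> 1 = \<gamma> 1" using arrow_of_memD by (metis mem_arrow_of)+
 note h' = h[unfolded path_homotopic_mov]
 show "arrow_of N s \<gamma> = arrow_of N s \<delta>"
  unfolding set_eq_iff mem_arrow_of path_homotopic_mov e
  using mov_trans[OF h'] mov_trans[OF mov_sym[OF h']] by blast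
qed

lemma arrow_src_arrow_of [simp]: "\<gamma> \<in> fiber_paths N s ==> arrow_src (arrow_of N s \<gamma>) = \<gamma> 0"
 and arrow_tgt_arrow_of [simp]: "\<gamma> \<in> fiber_paths N s ==> arrow_tgt (arrow_of N s \<gamma>) = \<gamma> 1"
 unfolding arrow_src_def arrow_tgt_def
 using arrow_of_memD[OF someI[of "%\<delta>. \<delta> \<in> arrow_of N s \<gamma>", OF arrow_of_self]] by auto

lemma topspace_fiber_paths_top: "topspace (fiber_paths_top N s) = fiber_paths N s"
proof -
 have "fiber_paths N s \<subseteq> \<Union>{{\<gamma>\<in>fiber_paths N s. \<gamma> ` K \<subseteq> V} |K V. compact K & K \<subseteq> {0..1} & openin (mtop N) V}"
 proof
  fix \<gamma> assume "\<gamma> \<in> fiber_paths N s"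
  then have "\<gamma> \<in> {\<gamma>\<in>fiber_paths N s. \<gamma> ` {} \<subseteq> {}}" by simp
  then show "\<gamma> \<in> \<Union>{{\<gamma>\<in>fiber_paths N s. \<gamma> ` K \<subseteq> V} |K V. compact K & K \<subseteq> {0..1} & openin (mtop N) V}"
   by (rule UnionI[rotated]) (use compact_empty in blast)
 qed
 then show ?thesis unfolding fiber_paths_top_def topology_generated_by_topspace by blast
qed

section \<open>The quotient topology on the set of arrows\<close>

lemma openin_fiber_paths_top:
 "[|compact K; K \<subseteq> {0..1}; openin (mtop N) V|] ==> openin (fiber_paths_top N s) {\<gamma>\<in>fiber_paths N s. \<gamma> ` K \<subseteq> V}"
 unfolding fiber_paths_top_def by (rule topology_generated_by_Basis) blast

lemma topspace_Pi_top: "topspace (Pi_top N s) = arrow_of N s ` fiber_paths N s"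
 using quotient_imp_surjective_map[OF quotient_map_quotient_top[of "fiber_paths_top N s" "arrow_of N s"]]
 by (simp add: Pi_top_def topspace_fiber_paths_top)

lemma arrow_cases:
 assumes "g \<in> topspace (Pi_top N s)"
 obtains \<gamma> where "\<gamma> \<in> fiber_paths N s" "g = arrow_of N s \<gamma>" "arrow_src g = \<gamma> 0" "arrow_tgt g = \<gamma> 1"
 using assms unfolding topspace_Pi_top by auto

lemma openin_Pi_top:
 "openin (Pi_top N s) W \<longleftrightarrow> W \<subseteq> arrow_of N s ` fiber_paths N s &
   openin (fiber_paths_top N s) {\<gamma>\<in>fiber_paths N s. arrow_of N s \<gamma> \<in> W}"
 by (simp add: Pi_top_def openin_quotient_top topspace_fiber_paths_top)

lemma quotient_map_arrow_of: "quotient_map (fiber_paths_top N s) (Pi_top N s) (arrow_of N s)"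
 unfolding Pi_top_def by (rule quotient_map_quotient_top)

text \<open>A jointly continuous family is continuous as a map into the compact-open topology, by
  the tube lemma applied to the compact set \<open>K\<close>; then one passes to classes. Continuity
  of maps into the space of arrows is usually obtained in this way.\<close>

lemma continuous_map_arrow_of:
 assumes G: "continuous_map (prod_topology Z uI) (mtop N) G"
  and fp: "!!z. z \<in> topspace Z ==> (%t. G (z, t)) \<in> fiber_paths N s"
 shows "continuous_map Z (Pi_top N s) (%z. arrow_of N s (%t. G (z, t)))"
proof -
 have "continuous_map Z (fiber_paths_top N s) (%z t. G (z, t))"
  unfolding fiber_paths_top_def continuous_on_generated_topo_iff
 proof (intro conjI allI impI)
  show "(%z t. G (z, t)) ` topspace Z \<subseteq>
    \<Union>{{\<gamma>\<in>fiber_paths N s. \<gamma> ` K \<subseteq> V} |K V. compact K & K \<subseteq> {0..1} & openin (mtop N) V}"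
   using fp topspace_fiber_paths_top[of N s] unfolding fiber_paths_top_def topology_generated_by_topspace by blast
  fix U assume "U \<in> {{\<gamma>\<in>fiber_paths N s. \<gamma> ` K \<subseteq> V} |K V. compact K & K \<subseteq> {0..1} & openin (mtop N) V}"
  then obtain K V where U: "U = {\<gamma>\<in>fiber_paths N s. \<gamma> ` K \<subseteq> V}" "compact K" "K \<subseteq> {0..1}" "openin (mtop N) V" by blast
  let ?W = "{p\<in>topspace (prod_topology Z uI). G p \<in> V}"
  have W: "openin (prod_topology Z uI) ?W" using openin_continuous_map_preimage[OF G U(4)] .
  have cK: "compactin uI K" using U(2,3) by (simp add: compactin_subtopology)
  show "openin Z ((%z t. G (z, t)) -` U \<inter> topspace Z)"
  proof (rule openin_locally)
   fix z assume "z \<in> (%z t. G (z, t)) -` U \<inter> topspace Z"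
   then have z: "z \<in> topspace Z" "!!t. t \<in> K ==> G (z, t) \<in> V" using U(1) by auto
   then have "{z} \<times> K \<subseteq> ?W" using U(3) by auto
   then obtain A B where AB: "openin Z A" "z \<in> A" "K \<subseteq> B" "A \<times> B \<subseteq> ?W"
    using tube_lemma_right[OF W cK z(1)] by blast
   have "A \<subseteq> (%z t. G (z, t)) -` U \<inter> topspace Z"
    using AB(3,4) fp openin_subset[OF AB(1)] U(1) by auto
   then show "\<exists>T. openin Z T & z \<in> T & T \<subseteq> (%z t. G (z, t)) -` U \<inter> topspace Z" using AB(1,2) by blast
  qed
 qed
 from continuous_map_compose[OF this quotient_imp_continuous_map[OF quotient_map_arrow_of]]
 show ?thesis by (simp add: o_def)
qed

lemma continuous_map_arrow_ends:
 "continuous_map (Pi_top N s) (mtop N) arrow_src" "continuous_map (Pi_top N s) (mtop N) arrow_tgt"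
proof -
 have ev: "continuous_map (fiber_paths_top N s) (mtop N) (%\<gamma>. \<gamma> t)" if t: "t \<in> {0..1}" for t
  unfolding continuous_map_def topspace_fiber_paths_top
 proof (intro conjI allI impI)
  show "(%\<gamma>. \<gamma> t) \<in> fiber_paths N s \<rightarrow> topspace (mtop N)" using fiber_paths_topspace t by fastforce
  show "openin (fiber_paths_top N s) {\<gamma>\<in>fiber_paths N s. \<gamma> t \<in> U}" if "openin (mtop N) U" for U
   using openin_fiber_paths_top[of "{t}" N U s] t that by simp
 qed
 show "continuous_map (Pi_top N s) (mtop N) arrow_src"
  by (rule continuous_compose_quotient_map[OF quotient_map_arrow_of], rule continuous_map_eq[OF ev[of 0]])
   (auto simp: topspace_fiber_paths_top)
 show "continuous_map (Pi_top N s) (mtop N) arrow_tgt"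
  by (rule continuous_compose_quotient_map[OF quotient_map_arrow_of], rule continuous_map_eq[OF ev[of 1]])
   (auto simp: topspace_fiber_paths_top)
qed

section \<open>Arrows over a trivializing open set, compared in the model fiber\<close>

definition trivialization :: "'a mfd => 'b topology => ('a => 'b) => 'a topology => 'b set =>
  ('a => 'a \<times> 'b) => ('a \<times> 'b => 'a) => bool" where
 "trivialization N TM s X0 U h k \<longleftrightarrow> openin TM U &
   homeomorphic_maps (subtopology (mtop N) (preim N s U)) (prod_topology X0 (subtopology TM U)) h k &
   (\<forall>y\<in>preim N s U. snd (h y) = s y)"

lemma trivializationD:
 assumes "trivialization N TM s X0 U h k"
 shows "openin TM U" "continuous_map (subtopology (mtop N) (preim N s U)) X0 (fst \<circ> h)"
  "continuous_map (prod_topology X0 (subtopology TM U)) (mtop N) k"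
  "!!y. y \<in> preim N s U ==> fst (h y) \<in> topspace X0"
  "!!y. y \<in> preim N s U ==> k (fst (h y), s y) = y"
  "!!a u. [|a \<in> topspace X0; u \<in> U|] ==> k (a, u) \<in> preim N s U"
  "!!a u. [|a \<in> topspace X0; u \<in> U|] ==> fst (h (k (a, u))) = a"
  "!!a u. [|a \<in> topspace X0; u \<in> U|] ==> s (k (a, u)) = u"
proof -
 let ?S = "subtopology (mtop N) (preim N s U)" and ?P = "prod_topology X0 (subtopology TM U)"
 show U: "openin TM U" using assms by (simp add: trivialization_def)
 have hm: "homeomorphic_maps ?S ?P h k" and sn: "!!y. y \<in> preim N s U ==> snd (h y) = s y"
  using assms by (auto simp: trivialization_def)
 have tS: "topspace ?S = preim N s U" by (auto simp: preim_def)
 have tP: "topspace ?P = topspace X0 \<times> U" using openin_subset[OF U] by auto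
 have ch: "continuous_map ?S ?P h" and ck: "continuous_map ?P ?S k"
  and kh: "!!y. y \<in> preim N s U ==> k (h y) = y"
  using hm tS unfolding homeomorphic_maps_def by auto
 have hk: "h (k p) = p" if "p \<in> topspace X0 \<times> U" for p
  using hm that unfolding homeomorphic_maps_def tP by blast
 show "continuous_map ?S X0 (fst \<circ> h)" by (rule continuous_map_compose[OF ch continuous_map_fst])
 show "continuous_map ?P (mtop N) k" using ck continuous_map_in_subtopology by blast
 have hy: "h y \<in> topspace X0 \<times> U" if "y \<in> preim N s U" for y
  using ch that tS tP by (auto simp: continuous_map_def)
 then show "fst (h y) \<in> topspace X0" if "y \<in> preim N s U" for y using that by (auto simp: mem_Times_iff)
 show "k (fst (h y), s y) = y" if "y \<in> preim N s U" for y
  using kh[OF that] sn[OF that] by (metis prod.collapse)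
 show ks: "k (a, u) \<in> preim N s U" if "a \<in> topspace X0" "u \<in> U" for a u
  using ck that tS tP by (auto simp: continuous_map_def)
 show "fst (h (k (a, u))) = a" if "a \<in> topspace X0" "u \<in> U" for a u using hk that by simp
 show "s (k (a, u)) = u" if "a \<in> topspace X0" "u \<in> U" for a u
  using hk[of "(a, u)"] sn[OF ks[OF that]] that by simp
qed

locale trivial_bundle =
 fixes N :: "'a mfd" and TM :: "'b topology" and s :: "'a => 'b" and X0 :: "'a topology"
  and U :: "'b set" and h :: "'a => 'a \<times> 'b" and k :: "'a \<times> 'b => 'a"
 assumes tr: "trivialization N TM s X0 U h k" and cs: "continuous_map (mtop N) TM s"
begin

abbreviation "h1 \<equiv> %y. fst (h y)"

lemmas trD = trivializationD[OF tr]

lemma openin_preim: "openin (mtop N) (preim N s U)"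
 using openin_continuous_map_preimage[OF cs trD(1)] by (simp add: preim_def)

lemma openin_h1: "openin X0 A ==> openin (mtop N) {y\<in>preim N s U. h1 y \<in> A}"
 using trD(2) unfolding continuous_map_open_subtopology[OF openin_preim] by simp

lemma h1_path:
 assumes "\<gamma> \<in> fiber_paths N s" "s (\<gamma> 0) \<in> U"
 shows "pathin X0 (%t. h1 (\<gamma> t))" "!!t. [|0 \<le> t; t \<le> 1|] ==> \<gamma> t \<in> preim N s U"
proof -
 show g: "\<gamma> t \<in> preim N s U" if "0 \<le> t" "t \<le> 1" for t
  using fiber_paths_s[OF assms(1) that] fiber_paths_topspace[OF assms(1) that] assms(2) by (simp add: preim_def)
 then have "pathin (subtopology (mtop N) (preim N s U)) \<gamma>"
  using fiber_paths_pathin[OF assms(1)] by (auto simp: pathin_subtopology)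
 from pathin_compose[OF this trD(2)] show "pathin X0 (%t. h1 (\<gamma> t))" by (simp add: o_def)
qed

lemma continuous_k_fiber:
 assumes u: "u \<in> U"
 shows "continuous_map X0 (Fib N s u) (%a. k (a, u))"
proof -
 have "continuous_map X0 (prod_topology X0 (subtopology TM U)) (%a. (a, u))"
  using u openin_subset[OF trD(1)] by (intro continuous_map_pairedI) auto
 from continuous_map_compose[OF this trD(3)] have "continuous_map X0 (mtop N) (%a. k (a, u))" by (simp add: o_def)
 then show ?thesis
  using trD(6)[OF _ u] trD(8)[OF _ u] by (auto simp: continuous_map_in_subtopology preim_def)
qed

lemma k_path: "[|pathin X0 p; u \<in> U|] ==> (%t. k (p t, u)) \<in> fiber_paths N s"
 using fiber_pathsI[OF pathin_compose[OF _ continuous_k_fiber]] by (auto simp: o_def)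

lemma path_homotopic_h1:
 assumes "path_homotopic (Fib N s u) \<gamma> \<delta>" "u \<in> U"
 shows "path_homotopic X0 (%t. h1 (\<gamma> t)) (%t. h1 (\<delta> t))"
proof -
 have "fiber N s u \<subseteq> preim N s U" using assms(2) by (auto simp: preim_def)
 then have "continuous_map (Fib N s u) X0 (%y. h1 y)"
  using continuous_map_from_subtopology_mono[OF trD(2)] by (simp add: o_def)
 from mov_compose[OF assms(1)[unfolded path_homotopic_mov] this]
 show ?thesis unfolding path_homotopic_mov by auto
qed

text \<open>For fixed \<open>u\<close>, the map \<open>k\<close> carries a homotopy in the model
  fiber back into the fiber over \<open>u\<close>, so arrows over \<open>U\<close> may be compared
  in \<open>X0\<close>.\<close>

lemma arrow_of_eq_h1:
 assumes \<gamma>: "\<gamma> \<in> fiber_paths N s" and \<delta>: "\<delta> \<in> fiber_paths N s" and u: "s (\<gamma> 0) = u" "s (\<delta> 0) = u" "u \<in> U"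
  and h: "path_homotopic X0 (%t. h1 (\<gamma> t)) (%t. h1 (\<delta> t))"
 shows "arrow_of N s \<gamma> = arrow_of N s \<delta>"
proof -
 have k: "k (h1 (\<gamma> t), u) = \<gamma> t" "k (h1 (\<delta> t), u) = \<delta> t" if "0 \<le> t" "t \<le> 1" for t
  using trD(5)[OF h1_path(2)[OF \<gamma> _ that]] trD(5)[OF h1_path(2)[OF \<delta> _ that]]
   fiber_paths_s[OF \<gamma> that] fiber_paths_s[OF \<delta> that] u by auto
 have "mov (Fib N s u) (%a b. a = \<gamma> 0 & b = \<gamma> 1) (%t. k (h1 (\<gamma> t), u)) (%t. k (h1 (\<delta> t), u))"
  by (rule mov_compose[OF h[unfolded path_homotopic_mov] continuous_k_fiber[OF u(3)]]) (use k[of 0] k[of 1] in auto)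
 then have "mov (Fib N s u) (%a b. a = \<gamma> 0 & b = \<gamma> 1) \<gamma> \<delta>" by (rule mov_cong) (use k in auto)
 then show ?thesis unfolding arrow_of_eq[OF \<gamma> \<delta>] path_homotopic_mov u(1) .
qed

definition hbox :: "'a set => 'a set" where "hbox A = {y\<in>preim N s U. h1 y \<in> A}"

text \<open>The sheet of the end point map determined by a path \<open>p\<close> of the model fiber:
  sources range over the box of \<open>B\<close>, targets over the box of \<open>A\<close>, and the
  arrow is the one obtained from \<open>p\<close> by moving its ends within these sets.\<close>

definition sheet :: "'a set => 'a set => (real => 'a) => (real => 'a) set set" where
 "sheet B A p = {arrow_of N s \<delta> | \<delta>. \<delta> \<in> fiber_paths N s & \<delta> 0 \<in> hbox B & \<delta> 1 \<in> hbox A &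
   movable X0 B A p (%t. h1 (\<delta> t))}"

text \<open>Membership does not depend on the representative, because a homotopy with fixed ends in
  \<open>B\<close> and \<open>A\<close> is a special case of a movable one.\<close>

lemma sheet_mem:
 assumes "\<delta> \<in> fiber_paths N s"
 shows "arrow_of N s \<delta> \<in> sheet B A p \<longleftrightarrow>
  \<delta> 0 \<in> hbox B & \<delta> 1 \<in> hbox A & movable X0 B A p (%t. h1 (\<delta> t))" (is "_ \<longleftrightarrow> ?R")
proof
 assume "arrow_of N s \<delta> \<in> sheet B A p"
 then obtain \<delta>' where d: "arrow_of N s \<delta> = arrow_of N s \<delta>'" "\<delta>' \<in> fiber_paths N s" "\<delta>' 0 \<in> hbox B" "\<delta>' 1 \<in> hbox A"
  "movable X0 B A p (%t. h1 (\<delta>' t))" unfolding sheet_def by blast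
 have e: "\<delta> 0 = \<delta>' 0" "\<delta> 1 = \<delta>' 1" using d(1,2) assms by (metis arrow_src_arrow_of, metis arrow_tgt_arrow_of)
 have "path_homotopic (Fib N s (s (\<delta>' 0))) \<delta>' \<delta>" using d(1) arrow_of_eq[OF d(2) assms] by simp
 then have "path_homotopic X0 (%t. h1 (\<delta>' t)) (%t. h1 (\<delta> t))"
  by (rule path_homotopic_h1) (use d(3) in "auto simp: hbox_def preim_def")
 then have "movable X0 B A (%t. h1 (\<delta>' t)) (%t. h1 (\<delta> t))"
  unfolding path_homotopic_mov by (rule mov_mono) (use d(3,4) in "auto simp: hbox_def")
 from mov_trans[OF d(5) this] show ?R using d(3,4) e by simp
qed (use assms in "auto simp: sheet_def")

lemma openin_hbox: "openin X0 A ==> openin (mtop N) (hbox A)"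
 unfolding hbox_def by (rule openin_h1)

text \<open>By \<open>movable_near\<close>, paths whose images are close in the compact-open
  topology of \<open>X0\<close> stay in the same sheet; the finitely many conditions are pulled back
  along \<open>h1\<close>.\<close>

lemma openin_sheet:
 assumes X: "locally_good X0" and A: "good X0 A" and B: "good X0 B"
 shows "openin (Pi_top N s) (sheet B A p)"
 unfolding openin_Pi_top
proof
 show "sheet B A p \<subseteq> arrow_of N s ` fiber_paths N s" by (auto simp: sheet_def)
 have oA: "openin (mtop N) (hbox A)" and oB: "openin (mtop N) (hbox B)"
  using A B openin_hbox by (auto simp: good_def)
 show "openin (fiber_paths_top N s) {\<delta>\<in>fiber_paths N s. arrow_of N s \<delta> \<in> sheet B A p}"
 proof (rule openin_locally)
  fix \<delta> assume "\<delta> \<in> {\<delta>\<in>fiber_paths N s. arrow_of N s \<delta> \<in> sheet B A p}"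
  then have d: "\<delta> \<in> fiber_paths N s" "\<delta> 0 \<in> hbox B" "\<delta> 1 \<in> hbox A" "movable X0 B A p (%t. h1 (\<delta> t))"
   using sheet_mem by auto
  have sU: "s (\<delta> 0) \<in> U" using d(2) by (auto simp: hbox_def preim_def)
  obtain \<K> where K: "path_nbhd X0 \<K> (%t. h1 (\<delta> t))"
   "!!q. pathin X0 q ==> (\<forall>(K, V)\<in>\<K>. q ` K \<subseteq> V) ==> movable X0 B A (%t. h1 (\<delta> t)) q"
   using movable_near[OF X h1_path(1)[OF d(1) sU] A _ B] d(2,3) by (auto simp: hbox_def)
  let ?G = "%(K, V). {\<gamma>\<in>fiber_paths N s. \<gamma> ` K \<subseteq> V}"
  \<comment> \<open>The two additional conditions keep the ends in the boxes; the one at 0 also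
    ensures that the whole path lies over \<open>U\<close>, where \<open>h1\<close> is
    meaningful.\<close>
  define \<G> where "\<G> = ?G ` (insert ({0}, hbox B) (insert ({1}, hbox A) ((%(K, V). (K, hbox V)) ` \<K>)))"
  have fin: "finite \<G>" using K(1) by (simp add: \<G>_def path_nbhd_def)
  have "openin (fiber_paths_top N s) G" if "G \<in> \<G>" for G
  proof -
   consider "G = ?G ({0}, hbox B)" | "G = ?G ({1}, hbox A)" | K V where "(K, V) \<in> \<K>" "G = ?G (K, hbox V)"
   proof -
    have "G = ?G ({0}, hbox B) \<or> G = ?G ({1}, hbox A) \<or> (\<exists>P\<in>\<K>. G = ?G ((%(K, V). (K, hbox V)) P))"
     using \<open>G \<in> \<G>\<close> unfolding \<G>_def image_insert image_image insert_iff image_iff .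
    then show thesis
    proof (elim disjE bexE)
     fix P assume P: "P \<in> \<K>" "G = ?G ((%(K, V). (K, hbox V)) P)"
     obtain K V where "P = (K, V)" by (cases P)
     then show thesis using P that(3)[of K V] by simp
    qed (rule that(1), assumption, rule that(2), assumption)
   qed
   then show ?thesis
   proof cases
    case 3
    then have "compact K" "K \<subseteq> {0..1}" "openin X0 V" using K(1) by (auto simp: path_nbhd_def)
    then show ?thesis using openin_fiber_paths_top[of K N "hbox V" s] openin_hbox 3(2) by simp
   qed (use openin_fiber_paths_top[of "{0}" N "hbox B" s] openin_fiber_paths_top[of "{1}" N "hbox A" s] oA oB in simp_all)
  qed
  then have "openin (fiber_paths_top N s) (\<Inter>\<G>)"
   using fin by (intro openin_Inter) (auto simp: \<G>_def)
  moreover have "\<delta> \<in> \<Inter>\<G>"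
  proof -
   have "\<delta> ` K \<subseteq> hbox V" if "(K, V) \<in> \<K>" for K V
   proof (rule image_subsetI)
    fix t assume "t \<in> K"
    moreover have "case (K, V) of (K, V) => compact K & K \<subseteq> {0..1} & openin X0 V & (%t. h1 (\<delta> t)) ` K \<subseteq> V"
     using K(1) that unfolding path_nbhd_def by blast
    ultimately have "t \<in> {0..1}" "h1 (\<delta> t) \<in> V" by auto
    then show "\<delta> t \<in> hbox V" using h1_path(2)[OF d(1) sU, of t] by (simp add: hbox_def)
   qed
   then show ?thesis using d(1-3) unfolding \<G>_def image_insert image_image by auto
  qed
  moreover have "\<Inter>\<G> \<subseteq> {\<delta>\<in>fiber_paths N s. arrow_of N s \<delta> \<in> sheet B A p}"
  proof
   fix \<gamma> assume g: "\<gamma> \<in> \<Inter>\<G>"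
   then have g': "\<gamma> \<in> fiber_paths N s" "\<gamma> 0 \<in> hbox B" "\<gamma> 1 \<in> hbox A" unfolding \<G>_def by auto
   have "(%t. h1 (\<gamma> t)) ` K \<subseteq> V" if "(K, V) \<in> \<K>" for K V
   proof -
    have "?G ((%(K, V). (K, hbox V)) (K, V)) \<in> \<G>"
     unfolding \<G>_def by (intro imageI insertI2 that)
    then have "{\<gamma>\<in>fiber_paths N s. \<gamma> ` K \<subseteq> hbox V} \<in> \<G>" by simp
    from InterD[OF g this] have "\<gamma> ` K \<subseteq> hbox V" by simp
    then show ?thesis by (auto simp: hbox_def)
   qed
   then have "\<forall>(K, V)\<in>\<K>. (%t. h1 (\<gamma> t)) ` K \<subseteq> V" by blast
   moreover have "s (\<gamma> 0) \<in> U" using g'(2) by (auto simp: hbox_def preim_def)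
   ultimately have "movable X0 B A (%t. h1 (\<delta> t)) (%t. h1 (\<gamma> t))" using K(2) h1_path(1)[OF g'(1)] by blast
   from mov_trans[OF d(4) this] show "\<gamma> \<in> {\<delta>\<in>fiber_paths N s. arrow_of N s \<delta> \<in> sheet B A p}"
    using g' sheet_mem by blast
  qed
  ultimately show "\<exists>T. openin (fiber_paths_top N s) T & \<delta> \<in> T & T \<subseteq> {\<delta>\<in>fiber_paths N s. arrow_of N s \<delta> \<in> sheet B A p}"
   by blast
 qed
qed

text \<open>Two arrows of a sheet are movable into each other; if their ends agree, the moving ends
  can be frozen by \<open>movable_imp_path_homotopic\<close>.\<close>

lemma sheet_inj:
 assumes A: "good X0 A" and B: "good X0 B" and g: "g \<in> sheet B A p" and g': "g' \<in> sheet B A p"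
  and e: "arrow_src g = arrow_src g'" "arrow_tgt g = arrow_tgt g'"
 shows "g = g'"
proof -
 obtain \<gamma> \<delta> where 1: "g = arrow_of N s \<gamma>" "\<gamma> \<in> fiber_paths N s" "\<gamma> 0 \<in> hbox B" "movable X0 B A p (%t. h1 (\<gamma> t))"
  and 2: "g' = arrow_of N s \<delta>" "\<delta> \<in> fiber_paths N s" "movable X0 B A p (%t. h1 (\<delta> t))"
  using g g' unfolding sheet_def by blast
 have e': "\<gamma> 0 = \<delta> 0" "\<gamma> 1 = \<delta> 1" using e 1 2 by auto
 have "movable X0 B A (%t. h1 (\<gamma> t)) (%t. h1 (\<delta> t))" using mov_trans[OF mov_sym[OF 1(4)] 2(3)] .
 then have "path_homotopic X0 (%t. h1 (\<gamma> t)) (%t. h1 (\<delta> t))"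
  by (rule movable_imp_path_homotopic[OF _ B A]) (use e' in auto)
 then show ?thesis
  unfolding 1(1) 2(1) by (intro arrow_of_eq_h1[OF 1(2) 2(2) refl]) (use e' 1(3) in "auto simp: hbox_def preim_def")
qed

text \<open>The inverse of the end point map on a sheet: canonical pieces are attached to
  \<open>p\<close> so that it runs from the model coordinate of \<open>z\<close> to that of
  \<open>y\<close>, and the result is transported into the fiber. The end pieces depend continuously
  on \<open>y\<close> and \<open>z\<close>.\<close>

lemma sheet_section:
 assumes A: "good X0 A" and B: "good X0 B" and p: "pathin X0 p" "p 0 \<in> B" "p 1 \<in> A"
 obtains \<rho> where "continuous_map (subtopology (prod_topology (mtop N) (mtop N)) (fiber_product N s \<inter> hbox A \<times> hbox B))
   (Pi_top N s) \<rho>"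
  "!!y z. [|(y, z) \<in> fiber_product N s; y \<in> hbox A; z \<in> hbox B|] ==>
    \<rho> (y, z) \<in> sheet B A p & arrow_tgt (\<rho> (y, z)) = y & arrow_src (\<rho> (y, z)) = z"
proof -
 obtain kA kB where k: "contr X0 A kA" "contr X0 B kB" and o: "openin X0 A" "openin X0 B"
  using A B by (auto simp: good_def)
 let ?V = "subtopology (prod_topology (mtop N) (mtop N)) (fiber_product N s \<inter> hbox A \<times> hbox B)"
 let ?a = "%v. h1 (fst v)" and ?b = "%v. h1 (snd v)" and ?H = "%z. p (snd z)"
 have tV: "topspace ?V = fiber_product N s \<inter> hbox A \<times> hbox B"
  by (auto simp: fiber_product_def)
 have vAB: "h1 (fst v) \<in> A" "h1 (snd v) \<in> B" if "v \<in> topspace ?V" for v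
  using that unfolding tV by (auto simp: hbox_def)
 have c1: "continuous_map ?V (subtopology (mtop N) (preim N s U)) fst"
  and c2: "continuous_map ?V (subtopology (mtop N) (preim N s U)) snd"
  by (auto simp: continuous_map_in_subtopology hbox_def intro!: continuous_map_from_subtopology continuous_map_fst continuous_map_snd)
 have ca: "continuous_map ?V X0 ?a" using continuous_map_compose[OF c1 trD(2)] by (simp add: o_def)
 have cb: "continuous_map ?V X0 ?b" using continuous_map_compose[OF c2 trD(2)] by (simp add: o_def)
 have cH: "continuous_map (prod_topology ?V uI) X0 ?H"
  using continuous_map_compose[OF continuous_map_snd p(1)[unfolded pathin_def]] by (simp add: o_def)
 let ?g = "glue kB kA ?H ?b ?a"
 have cg: "continuous_map (prod_topology ?V uI) X0 ?g"
  by (rule continuous_glue[OF k(2,1) cH cb ca]) (simp_all add: p vAB del: topspace_subtopology)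
 \<comment> \<open>The glued path lives in the model fiber; \<open>k\<close> places it in the fiber
   over the common base point of the pair.\<close>
 let ?G = "%z. k (?g z, s (fst (fst z)))"
 have "continuous_map ?V (subtopology TM U) (%v. s (fst v))"
 proof -
  have "continuous_map (subtopology (mtop N) (preim N s U)) (subtopology TM U) s"
   using continuous_map_from_subtopology[OF cs] by (auto simp: continuous_map_in_subtopology preim_def)
  from continuous_map_compose[OF c1 this] show ?thesis by (simp add: o_def)
 qed
 from continuous_map_compose[OF continuous_map_fst this]
 have "continuous_map (prod_topology ?V uI) (subtopology TM U) (%z. s (fst (fst z)))" by (simp add: o_def)
 from continuous_map_compose[OF continuous_map_pairedI[OF cg this] trD(3)]
 have cG: "continuous_map (prod_topology ?V uI) (mtop N) ?G" by (simp add: o_def)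
 have path: "pathin X0 (%t. ?g (v, t))" if "v \<in> topspace ?V" for v
 proof -
  have "continuous_map uI (prod_topology ?V uI) (%t. (v, t))" by (intro continuous_map_pairedI) (use that in auto)
  from continuous_map_compose[OF this cg] show ?thesis by (simp add: o_def pathin_def)
 qed
 have sU: "s (fst v) \<in> U" if "v \<in> topspace ?V" for v
 proof -
  have "fst v \<in> hbox A" using that unfolding tV by auto
  then show ?thesis by (auto simp: hbox_def preim_def)
 qed
 have fp: "(%t. ?G (v, t)) \<in> fiber_paths N s" if "v \<in> topspace ?V" for v
  using k_path[OF path[OF that] sU[OF that]] by simp
 define \<rho> where "\<rho> = (%v. arrow_of N s (%t. ?G (v, t)))"
 have "continuous_map ?V (Pi_top N s) \<rho>" unfolding \<rho>_def by (rule continuous_map_arrow_of[OF cG fp])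
 moreover have "\<rho> (y, z) \<in> sheet B A p & arrow_tgt (\<rho> (y, z)) = y & arrow_src (\<rho> (y, z)) = z"
  if yz: "(y, z) \<in> fiber_product N s" "y \<in> hbox A" "z \<in> hbox B" for y z
 proof -
  let ?v = "(y, z)"
  have v: "?v \<in> topspace ?V" using yz tV by blast
  have h1yz: "h1 y \<in> A" "h1 z \<in> B" "y \<in> preim N s U" "z \<in> preim N s U" "s z = s y"
   using yz by (auto simp: hbox_def fiber_product_def)
  have gt: "?g (?v, t) \<in> topspace X0" if "0 \<le> t" "t \<le> 1" for t
   using path_image_subset_topspace[OF path[OF v]] that by auto
  have g01: "?g (?v, 0) = h1 z" "?g (?v, 1) = h1 y"
   using glue_ends[OF k(2,1), of ?H ?v ?b ?a] p h1yz by auto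
  have G01: "?G (?v, 0) = z" "?G (?v, 1) = y" using trD(5)[OF h1yz(4)] trD(5)[OF h1yz(3)] g01 h1yz(5) by simp_all
  have h1G: "h1 (?G (?v, t)) = ?g (?v, t)" if "0 \<le> t" "t \<le> 1" for t
   using trD(7)[OF gt[OF that] sU[OF v]] by simp
  have "movable X0 B A p (%t. ?g (?v, t))"
  proof -
   \<comment> \<open>Letting the new ends travel along the canonical paths from \<open>p 0\<close>
     and \<open>p 1\<close> deforms \<open>p\<close>, up to \<open>middle\<close>, into the glued
     path; at \<open>l = 0\<close> the end pieces are constant.\<close>
   let ?b' = "%l. kB (l, p 0, h1 z)" and ?a' = "%l. kA (l, p 1, h1 y)"
   let ?g' = "glue kB kA ?H ?b' ?a'"
   have cH': "continuous_map (prod_topology uI uI) X0 ?H"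
    using continuous_map_compose[OF continuous_map_snd[of uI uI] p(1)[unfolded pathin_def]] by (simp add: o_def)
   have mem: "?b' l \<in> B" "?a' l \<in> A" if "0 \<le> l" "l \<le> 1" for l
    using contr_mem[OF k(2) o(2) p(2) h1yz(2) that] contr_mem[OF k(1) o(1) p(3) h1yz(1) that] by auto
   have cg': "continuous_map (prod_topology uI uI) X0 ?g'"
    by (rule continuous_glue[OF k(2,1) cH'])
     (use mem p pathin_contr[OF k(2) o(2) p(2) h1yz(2)] pathin_contr[OF k(1) o(1) p(3) h1yz(1)]
      in "auto simp: pathin_def")
   have "movable X0 B A (%t. p (middle t)) (%t. ?g (?v, t))"
   proof (rule movI[OF cg'])
    fix t :: real assume t: "0 \<le> t" "t \<le> 1"
    have "glue kB kA ?H ?b' ?a' (0, t) = ?H (0 :: real, middle t)"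
     by (rule glue_constant[OF k(2,1) _ _ _ _ t]) (use p h1yz contr_simps(1)[OF k(2)] contr_simps(1)[OF k(1)] in auto)
    then show "?g' (0, t) = p (middle t)" by simp
    show "?g' (1, t) = ?g (?v, t)"
     unfolding glue_def using contr_simps(2)[OF k(2) p(2) h1yz(2)] contr_simps(2)[OF k(1) p(3) h1yz(1)] by simp
   next
    fix l :: real assume l: "0 \<le> l" "l \<le> 1"
    show "?g' (l, 0) \<in> B & ?g' (l, 1) \<in> A"
     using glue_ends[OF k(2,1), of ?H l ?b' ?a'] p mem[OF l] by simp
   qed
   moreover have "movable X0 B A p (%t. p (middle t))" by (rule mov_middle[OF p(1)]) (use p in simp)
   ultimately show ?thesis using mov_trans by blast
  qed
  then have "movable X0 B A p (%t. h1 (?G (?v, t)))"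
   by (rule mov_cong) (use h1G in auto)
  then have "\<rho> ?v \<in> sheet B A p" unfolding \<rho>_def sheet_mem[OF fp[OF v]] using G01 yz by simp
  moreover have "arrow_tgt (\<rho> ?v) = y" "arrow_src (\<rho> ?v) = z" unfolding \<rho>_def using fp[OF v] G01 by simp_all
  ultimately show ?thesis by blast
 qed
 ultimately show thesis using that by blast
qed

end

lemma arrow_fiber_product: "g \<in> topspace (Pi_top N s) ==> (arrow_tgt g, arrow_src g) \<in> fiber_product N s"
proof -
 assume "g \<in> topspace (Pi_top N s)"
 then obtain \<gamma> where "\<gamma> \<in> fiber_paths N s" "arrow_src g = \<gamma> 0" "arrow_tgt g = \<gamma> 1" using arrow_cases by blast
 then show ?thesis
  using fiber_paths_topspace[of \<gamma> N s 0] fiber_paths_topspace[of \<gamma> N s 1] fiber_paths_s[of \<gamma> N s 1]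
  by (simp add: fiber_product_def)
qed

text \<open>Over a product of boxes the preimage is a union of sheets. These are classes of the
  equivalence relation \<open>movable\<close>, hence equal or disjoint, and
  \<open>sheet_section\<close> inverts the projection on each of them. Path connected fibers give
  surjectivity.\<close>

lemma covering_tgt_src:
 assumes cs: "continuous_map (mtop N) TM s" and X0: "locally_good X0"
  and triv: "!!x. x \<in> topspace TM ==> \<exists>U h k. x \<in> U & trivialization N TM s X0 U h k"
  and pc: "!!x. x \<in> topspace TM ==> path_connected_space (Fib N s x)"
 shows "covering_map (Pi_top N s) (subtopology (prod_topology (mtop N) (mtop N)) (fiber_product N s))
   (%g. (arrow_tgt g, arrow_src g))"
proof -
 let ?X = "subtopology (prod_topology (mtop N) (mtop N)) (fiber_product N s)"
 let ?\<pi> = "%g. (arrow_tgt g, arrow_src g)"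
 have tX: "topspace ?X = fiber_product N s" by (auto simp: fiber_product_def)
 note mem = arrow_fiber_product[of _ N s]
 have c: "continuous_map (Pi_top N s) ?X ?\<pi>"
  using mem by (auto simp: continuous_map_in_subtopology continuous_map_paired continuous_map_arrow_ends)
 have surj: "?\<pi> ` topspace (Pi_top N s) = topspace ?X"
 proof (rule subset_antisym)
  show "?\<pi> ` topspace (Pi_top N s) \<subseteq> topspace ?X" using mem tX by blast
  show "topspace ?X \<subseteq> ?\<pi> ` topspace (Pi_top N s)"
  proof
   fix v assume "v \<in> topspace ?X"
   then obtain y z where v: "v = (y, z)" "y \<in> topspace (mtop N)" "z \<in> topspace (mtop N)" "s y = s z"
    using tX by (auto simp: fiber_product_def)
   have "s y \<in> topspace TM" using cs v(2) by (auto simp: continuous_map_def)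
   moreover have "y \<in> topspace (Fib N s (s y))" "z \<in> topspace (Fib N s (s y))"
    using v by (auto simp: preim_def)
   ultimately obtain \<gamma> where g: "pathin (Fib N s (s y)) \<gamma>" "\<gamma> 0 = z" "\<gamma> 1 = y"
    using pc unfolding path_connected_space_def by blast
   have "\<gamma> \<in> fiber_paths N s" using fiber_pathsI[OF g(1)] by simp
   then show "v \<in> ?\<pi> ` topspace (Pi_top N s)"
    using g v by (intro image_eqI[where x = "arrow_of N s \<gamma>"]) (auto simp: topspace_Pi_top)
  qed
 qed
 have "\<exists>V. v \<in> V & openin ?X V & (\<exists>\<W>. \<Union>\<W> = {g\<in>topspace (Pi_top N s). ?\<pi> g \<in> V} & pairwise disjnt \<W> &
   (\<forall>W\<in>\<W>. openin (Pi_top N s) W & homeomorphic_map (subtopology (Pi_top N s) W) (subtopology ?X V) ?\<pi>))"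
  if "v \<in> topspace ?X" for v
 proof -
  obtain y0 z0 where v1: "v = (y0, z0)" by (cases v)
  then have v: "v = (y0, z0)" "y0 \<in> topspace (mtop N)" "z0 \<in> topspace (mtop N)" "s y0 = s z0"
   using that unfolding tX by (simp_all add: fiber_product_def)
  have "s y0 \<in> topspace TM" using cs v(2) by (auto simp: continuous_map_def)
  then obtain U h k where U: "s y0 \<in> U" "trivialization N TM s X0 U h k" using triv by blast
  interpret trivial_bundle N TM s X0 U h k by unfold_locales (rule U(2), rule cs)
  have pre: "y0 \<in> preim N s U" "z0 \<in> preim N s U" using v U(1) by (auto simp: preim_def)
  then have "h1 y0 \<in> topspace X0" "h1 z0 \<in> topspace X0" using trD(4) by auto
  then obtain A B where A: "h1 y0 \<in> A" "good X0 A" and B: "h1 z0 \<in> B" "good X0 B"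
   using X0 unfolding locally_good_def by (metis openin_topspace)
  let ?V = "fiber_product N s \<inter> hbox A \<times> hbox B"
  \<comment> \<open>The paths \<open>\<gamma>\<close> may repeat a sheet; as a set the family
    contains each sheet once.\<close>
  define \<W> where "\<W> = {sheet B A (%t. h1 (\<gamma> t)) | \<gamma>. \<gamma> \<in> fiber_paths N s & \<gamma> 0 \<in> hbox B & \<gamma> 1 \<in> hbox A}"
  have oV: "openin ?X ?V"
  proof -
   have "openin (prod_topology (mtop N) (mtop N)) (hbox A \<times> hbox B)"
    using A(2) B(2) openin_hbox by (simp add: openin_prod_Times_iff good_def)
   then show ?thesis unfolding openin_subtopology by blast
  qed
  have path: "pathin X0 (%t. h1 (\<gamma> t))" "h1 (\<gamma> 0) \<in> B" "h1 (\<gamma> 1) \<in> A"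
   if "\<gamma> \<in> fiber_paths N s" "\<gamma> 0 \<in> hbox B" "\<gamma> 1 \<in> hbox A" for \<gamma>
   using h1_path(1)[OF that(1)] that(2,3) by (auto simp: hbox_def preim_def)
  have un: "\<Union>\<W> = {g\<in>topspace (Pi_top N s). ?\<pi> g \<in> ?V}"
  proof (rule subset_antisym)
   show "\<Union>\<W> \<subseteq> {g\<in>topspace (Pi_top N s). ?\<pi> g \<in> ?V}"
   proof
    fix g assume "g \<in> \<Union>\<W>"
    then obtain \<delta> where "\<delta> \<in> fiber_paths N s" "\<delta> 0 \<in> hbox B" "\<delta> 1 \<in> hbox A" "g = arrow_of N s \<delta>"
     unfolding \<W>_def sheet_def by blast
    then show "g \<in> {g\<in>topspace (Pi_top N s). ?\<pi> g \<in> ?V}" using mem[of g] by (simp add: topspace_Pi_top)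
   qed
   show "{g\<in>topspace (Pi_top N s). ?\<pi> g \<in> ?V} \<subseteq> \<Union>\<W>"
   proof
    fix g assume g: "g \<in> {g\<in>topspace (Pi_top N s). ?\<pi> g \<in> ?V}"
    then obtain \<gamma> where \<gamma>: "\<gamma> \<in> fiber_paths N s" "g = arrow_of N s \<gamma>" "arrow_src g = \<gamma> 0" "arrow_tgt g = \<gamma> 1"
     using arrow_cases by blast
    then have e: "\<gamma> 0 \<in> hbox B" "\<gamma> 1 \<in> hbox A" using g by auto
    then have "g \<in> sheet B A (%t. h1 (\<gamma> t))"
     unfolding \<gamma>(2) sheet_mem[OF \<gamma>(1)] using path[OF \<gamma>(1) e] by (auto intro: mov_eq)
    then show "g \<in> \<Union>\<W>" using \<gamma>(1) e unfolding \<W>_def by blast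
   qed
  qed
  have disj: "pairwise disjnt \<W>"
  proof (rule pairwiseI)
   fix W1 W2 assume "W1 \<in> \<W>" "W2 \<in> \<W>" "W1 \<noteq> W2"
   then obtain p q where pq: "W1 = sheet B A p" "W2 = sheet B A q" unfolding \<W>_def by blast
   show "disjnt W1 W2"
   proof (rule ccontr)
    assume "\<not> disjnt W1 W2"
    then obtain g where g: "g \<in> sheet B A p" "g \<in> sheet B A q" unfolding pq disjnt_def by blast
    then obtain \<delta> where d: "\<delta> \<in> fiber_paths N s" "g = arrow_of N s \<delta>" unfolding sheet_def by blast
    have "movable X0 B A p (%t. h1 (\<delta> t))" "movable X0 B A q (%t. h1 (\<delta> t))"
     using g unfolding d(2) sheet_mem[OF d(1)] by auto
    then have "movable X0 B A p q" using mov_trans mov_sym by blast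
    then have "sheet B A p = sheet B A q" unfolding sheet_def using mov_trans[OF \<open>movable X0 B A p q\<close>] mov_trans[OF mov_sym[OF \<open>movable X0 B A p q\<close>]] by blast
    then show False using \<open>W1 \<noteq> W2\<close> pq by simp
   qed
  qed
  have "openin (Pi_top N s) W & homeomorphic_map (subtopology (Pi_top N s) W) (subtopology ?X ?V) ?\<pi>" if "W \<in> \<W>" for W
  proof
   obtain \<gamma> where W: "W = sheet B A (%t. h1 (\<gamma> t))" and \<gamma>: "\<gamma> \<in> fiber_paths N s" "\<gamma> 0 \<in> hbox B" "\<gamma> 1 \<in> hbox A"
    using \<open>W \<in> \<W>\<close> unfolding \<W>_def by blast
   show oW: "openin (Pi_top N s) W" unfolding W by (rule openin_sheet[OF X0 A(2) B(2)])
   obtain \<rho> where \<rho>: "continuous_map (subtopology (prod_topology (mtop N) (mtop N)) ?V) (Pi_top N s) \<rho>"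
    "!!y z. [|(y, z) \<in> fiber_product N s; y \<in> hbox A; z \<in> hbox B|] ==>
      \<rho> (y, z) \<in> W & arrow_tgt (\<rho> (y, z)) = y & arrow_src (\<rho> (y, z)) = z"
    using sheet_section[OF A(2) B(2) path[OF \<gamma>]] unfolding W by blast
   have \<pi>W: "?\<pi> g \<in> ?V" if "g \<in> W" for g using un that \<open>W \<in> \<W>\<close> by blast
   have "homeomorphic_maps (subtopology (Pi_top N s) W) (subtopology ?X ?V) ?\<pi> \<rho>"
    unfolding homeomorphic_maps_def
   proof (intro conjI ballI)
    show "continuous_map (subtopology (Pi_top N s) W) (subtopology ?X ?V) ?\<pi>"
     using continuous_map_from_subtopology[OF c] \<pi>W unfolding continuous_map_in_subtopology by auto
    have "subtopology ?X ?V = subtopology (prod_topology (mtop N) (mtop N)) ?V"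
     by (simp add: subtopology_subtopology Int_absorb2 Int_assoc[symmetric])
    then show "continuous_map (subtopology ?X ?V) (subtopology (Pi_top N s) W) \<rho>"
     using \<rho> by (auto simp: continuous_map_in_subtopology)
    show "\<rho> (?\<pi> g) = g" if "g \<in> topspace (subtopology (Pi_top N s) W)" for g
    proof -
     have g: "g \<in> W" using that by simp
     have "\<rho> (?\<pi> g) \<in> W" "arrow_tgt (\<rho> (?\<pi> g)) = arrow_tgt g" "arrow_src (\<rho> (?\<pi> g)) = arrow_src g"
      using \<pi>W[OF g] \<rho>(2)[of "arrow_tgt g" "arrow_src g"] by auto
     then show ?thesis using sheet_inj[OF A(2) B(2)] g unfolding W by blast
    qed
    show "?\<pi> (\<rho> w) = w" if "w \<in> topspace (subtopology ?X ?V)" for w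
     using \<rho>(2)[of "fst w" "snd w"] that by (cases w) auto
   qed
   then show "homeomorphic_map (subtopology (Pi_top N s) W) (subtopology ?X ?V) ?\<pi>"
    using homeomorphic_map_maps by blast
  qed
  moreover have "v \<in> ?V" using that v pre A(1) B(1) tX by (auto simp: hbox_def)
  ultimately show ?thesis using oV un disj by (intro exI[of _ ?V] conjI exI[of _ \<W>]) auto
 qed
 then show ?thesis unfolding covering_map_def using c surj by blast
qed

section \<open>Lifting along coverings\<close>

lemma covering_evenly:
 assumes c: "covering_map E X \<pi>" and x: "x \<in> topspace X"
 obtains V \<W> where "x \<in> V" "openin X V" "\<Union>\<W> = {e\<in>topspace E. \<pi> e \<in> V}" "pairwise disjnt \<W>"
  "\<forall>W\<in>\<W>. openin E W & homeomorphic_map (subtopology E W) (subtopology X V) \<pi>"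
proof -
 have "\<exists>V. x \<in> V & openin X V &
    (\<exists>\<W>. \<Union>\<W> = {e\<in>topspace E. \<pi> e \<in> V} & pairwise disjnt \<W> &
      (\<forall>W\<in>\<W>. openin E W & homeomorphic_map (subtopology E W) (subtopology X V) \<pi>))"
  using c x unfolding covering_map_def by blast
 then show thesis by (elim exE conjE) (rule that)
qed

lemma covering_patch:
 assumes c: "covering_map E X \<pi>" and x: "x \<in> topspace X"
 obtains V where "x \<in> V" "openin X V" "!!e. [|e \<in> topspace E; \<pi> e \<in> V|] ==> \<exists>W \<rho>. e \<in> W & homeo_patch E X \<pi> W \<rho> & \<pi> ` W = V"
proof -
 have c\<pi>: "continuous_map E X \<pi>" using c by (simp add: covering_map_def)
 obtain V \<W> where V0: "x \<in> V" "openin X V" "\<Union>\<W> = {e\<in>topspace E. \<pi> e \<in> V}" "pairwise disjnt \<W>"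
  "\<forall>W\<in>\<W>. openin E W & homeomorphic_map (subtopology E W) (subtopology X V) \<pi>"
  by (rule covering_evenly[OF c x])
 note V = V0(1-3) bspec[OF V0(5)]
 show thesis
 proof (rule that[OF V(1,2)])
  fix e assume "e \<in> topspace E" "\<pi> e \<in> V"
  then obtain W where W: "W \<in> \<W>" "e \<in> W" using V(3) by blast
  have "topspace (subtopology E W) = W" "topspace (subtopology X V) = V"
   using V(4)[OF W(1)] openin_subset V(2) by (auto dest: openin_subset)
  then have im: "\<pi> ` W = V" using homeomorphic_imp_surjective_map V(4)[OF W(1)] by metis
  then have "\<exists>\<rho>. homeo_patch E X \<pi> W \<rho>"
   unfolding homeo_patch_iff_homeomorphic_map[OF c\<pi> conjunct1[OF V(4)[OF W(1)]]] using V(2,4) W(1) by simp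
  then show "\<exists>W \<rho>. e \<in> W & homeo_patch E X \<pi> W \<rho> & \<pi> ` W = V" using W(2) im by blast
 qed
qed

lemma covering_imp_local_homeo:
 assumes c: "covering_map E X \<pi>"
 shows "local_homeo E X \<pi>"
proof -
 have c\<pi>: "continuous_map E X \<pi>" using c by (simp add: covering_map_def)
 have "\<exists>W \<rho>. e \<in> W & homeo_patch E X \<pi> W \<rho>" if e: "e \<in> topspace E" for e
 proof -
  have "\<pi> e \<in> topspace X" using c\<pi> e by (auto simp: continuous_map_def)
  then show ?thesis using covering_patch[OF c] e by metis
 qed
 then show ?thesis using c\<pi> by (simp add: local_homeo_def)
qed

text \<open>A sheet contains at most one point over a given point, so distinct points of one fiber
  lie in different, hence disjoint, sheets.\<close>

lemma covering_separated:
 assumes c: "covering_map E X \<pi>" and e: "e \<in> topspace E" "e' \<in> topspace E" "\<pi> e = \<pi> e'" "e \<noteq> e'"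
 shows "\<exists>W W'. openin E W & openin E W' & e \<in> W & e' \<in> W' & W \<inter> W' = {}"
proof -
 have x: "\<pi> e \<in> topspace X" using c e(1) unfolding covering_map_def continuous_map_def by blast
 obtain V \<W> where V0: "\<pi> e \<in> V" "openin X V" "\<Union>\<W> = {e\<in>topspace E. \<pi> e \<in> V}" "pairwise disjnt \<W>"
  "\<forall>W\<in>\<W>. openin E W & homeomorphic_map (subtopology E W) (subtopology X V) \<pi>"
  by (rule covering_evenly[OF c x])
 note V = V0(1,3,4) bspec[OF V0(5)]
 have "e \<in> \<Union>\<W>" "e' \<in> \<Union>\<W>" unfolding V(2) using e V(1) by auto
 then obtain W W' where W: "W \<in> \<W>" "e \<in> W" "W' \<in> \<W>" "e' \<in> W'" by blast
 have "W \<noteq> W'"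
 proof
  assume "W = W'"
  have "inj_on \<pi> W"
   using homeomorphic_imp_injective_map[of "subtopology E W" "subtopology X V" \<pi>] V(4)[OF W(1)]
   by (simp add: openin_subset Int_absorb1)
  then show False using W \<open>W = W'\<close> e by (auto dest: inj_onD)
 qed
 then have "W \<inter> W' = {}" using V(3) W by (auto simp: pairwise_def disjnt_def)
 then show ?thesis using V(4) W by blast
qed

text \<open>The set where the lifts agree is open because \<open>\<pi>\<close> is injective on
  patches, and its complement is open because points over the same base point are separated.\<close>

lemma covering_lift_unique:
 assumes c: "covering_map E X \<pi>" and Z: "connected_space Z" and f: "continuous_map Z E f" and g: "continuous_map Z E g"
  and eq: "!!z. z \<in> topspace Z ==> \<pi> (f z) = \<pi> (g z)" and z0: "z0 \<in> topspace Z" "f z0 = g z0"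
  and z: "z \<in> topspace Z"
 shows "f z = g z"
proof -
 have fE: "f z \<in> topspace E" "g z \<in> topspace E" if "z \<in> topspace Z" for z
  using f g that by (auto simp: continuous_map_def)
 have pre: "openin Z {z\<in>topspace Z. f z \<in> A & g z \<in> B}" if "openin E A" "openin E B" for A B
 proof -
  have "{z\<in>topspace Z. f z \<in> A & g z \<in> B} = {z\<in>topspace Z. f z \<in> A} \<inter> {z\<in>topspace Z. g z \<in> B}" by blast
  then show ?thesis
   using openin_continuous_map_preimage[OF f that(1)] openin_continuous_map_preimage[OF g that(2)] by auto
 qed
 let ?S = "{z\<in>topspace Z. f z = g z}"
 have "openin Z ?S"
 proof (rule openin_locally)
  fix z assume z: "z \<in> ?S"
  then obtain W \<rho> where W: "f z \<in> W" "homeo_patch E X \<pi> W \<rho>"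
   using covering_imp_local_homeo[OF c] fE(1) unfolding local_homeo_def by blast
  then have "openin E W" "!!e. e \<in> W ==> \<rho> (\<pi> e) = e" by (auto simp: homeo_patch_def)
  then show "\<exists>T. openin Z T & z \<in> T & T \<subseteq> ?S"
   using pre[of W W] z W(1) eq by (intro exI[of _ "{z\<in>topspace Z. f z \<in> W & g z \<in> W}"]) (auto, metis)
 qed
 moreover have "openin Z (topspace Z - ?S)"
 proof (rule openin_locally)
  fix z assume z: "z \<in> topspace Z - ?S"
  then obtain W W' where "openin E W" "openin E W'" "f z \<in> W" "g z \<in> W'" "W \<inter> W' = {}"
   using covering_separated[OF c fE eq] by blast
  then show "\<exists>T. openin Z T & z \<in> T & T \<subseteq> topspace Z - ?S"
   using pre[of W W'] z by (intro exI[of _ "{z\<in>topspace Z. f z \<in> W & g z \<in> W'}"]) auto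
 qed
 ultimately have "?S = {} \<or> ?S = topspace Z"
  using Z unfolding connected_space_clopen_in by (auto simp: closedin_def)
 then show ?thesis using z0 z by blast
qed

lemma covering_path_lift_unique:
 assumes c: "covering_map E X \<pi>" and "pathin E L" "pathin E L'"
  and "!!t. [|0 \<le> t; t \<le> 1|] ==> \<pi> (L t) = \<pi> (L' t)" "L 0 = L' 0" and t: "0 \<le> t" "t \<le> 1"
 shows "L t = L' t"
proof (rule covering_lift_unique[OF c, of uI L L' 0])
 show "connected_space uI" by (simp add: connected_space_subtopology flip: connectedin_def) 
qed (use assms in "auto simp: pathin_def")

text \<open>A lift over an initial segment ending at \<open>r\<close> is restricted to smaller
  parameters, or continued to larger ones by the inverse branch over an evenly covered set.
  Connectedness of the parameter interval then reaches 1.\<close>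

lemma covering_path_lift:
 assumes c: "covering_map E X \<pi>" and p: "pathin X p" and e: "e \<in> topspace E" "\<pi> e = p 0"
 obtains L where "pathin E L" "L 0 = e" "!!t. [|0 \<le> t; t \<le> 1|] ==> \<pi> (L t) = p t"
proof -
 define P where "P = (%r. \<exists>L. continuous_map (top_of_set {0..r}) E L & L 0 = e & (\<forall>t\<in>{0..r}. \<pi> (L t) = p t))"
 have pr: "p r \<in> topspace X" if "r \<in> {0..1}" for r using path_image_subset_topspace[OF p] that by blast
 have "P 1"
 proof (rule connected_induction_simple[of "{0..1::real}" 0 1 P])
  show "P 0" unfolding P_def using e by (intro exI[of _ "%_. e"]) auto
  fix r0 :: real assume r0: "r0 \<in> {0..1}"
  obtain V where V: "p r0 \<in> V" "openin X V"
   "!!e. [|e \<in> topspace E; \<pi> e \<in> V|] ==> \<exists>W \<rho>. e \<in> W & homeo_patch E X \<pi> W \<rho> & \<pi> ` W = V"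
   using covering_patch[OF c pr[OF r0]] by blast
  have "openin uI {r\<in>{0..1}. p r \<in> V}"
   using openin_continuous_map_preimage[OF p[unfolded pathin_def] V(2)] by simp
  then obtain d where d: "d > 0" "!!r. r \<in> {0..1} ==> \<bar>r - r0\<bar> < d ==> p r \<in> V"
   unfolding openin_euclidean_subtopology_iff using r0 V(1) by (auto simp: dist_real_def)
  let ?T = "{0..1} \<inter> ball r0 d"
  have "P r'" if r: "r \<in> ?T" and r': "r' \<in> ?T" and Pr: "P r" for r r'
  proof -
   obtain L where L: "continuous_map (top_of_set {0..r}) E L" "L 0 = e" "!!t. t \<in> {0..r} ==> \<pi> (L t) = p t"
    using Pr unfolding P_def by blast
   show ?thesis
   proof (cases "r' \<le> r")
    case True
    have "continuous_map (top_of_set {0..r'}) E L"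
     by (rule continuous_map_from_subtopology_mono[OF L(1)]) (use True in auto)
    then show ?thesis unfolding P_def using L True by (intro exI[of _ L]) auto
   next
    case False
    have "L r \<in> topspace E" using L(1) r by (auto simp: continuous_map_def)
    moreover have "\<pi> (L r) \<in> V" using L(3)[of r] r d(2)[of r] by (auto simp: dist_real_def abs_minus_commute)
    ultimately obtain W \<rho> where W: "L r \<in> W" "homeo_patch E X \<pi> W \<rho>" "\<pi> ` W = V" using V(3) by blast
    have inv: "!!e. e \<in> W ==> \<rho> (\<pi> e) = e" and c\<rho>: "continuous_map (subtopology X V) E \<rho>"
     using W(2,3) by (auto simp: homeo_patch_def)
    have pV: "p t \<in> V" if "r \<le> t" "t \<le> r'" for t
    proof -
     have "t \<in> ?T" using that r r' by (auto simp: dist_real_def)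
     then show ?thesis using d(2) by (auto simp: dist_real_def abs_minus_commute)
    qed
    have \<rho>V: "\<pi> (\<rho> v) = v" if "v \<in> V" for v using that W(3) inv by (metis imageE)
    let ?L = "%t. if t \<le> r then L t else \<rho> (p t)"
    have "continuous_map (top_of_set {0..r'}) E ?L"
    proof (rule continuous_map_cases_le)
     have e1: "subtopology (top_of_set {0..r'}) {x \<in> topspace (top_of_set {0..r'}). x \<le> r} = top_of_set {0..r}"
      using False by (simp add: subtopology_subtopology) (rule arg_cong[of _ _ top_of_set], auto)
     show "continuous_map (subtopology (top_of_set {0..r'}) {x \<in> topspace (top_of_set {0..r'}). x \<le> r}) E L"
      unfolding e1 by (rule L(1))
     have e2: "subtopology (top_of_set {0..r'}) {x \<in> topspace (top_of_set {0..r'}). r \<le> x} = top_of_set {r..r'}"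
      using r by (simp add: subtopology_subtopology) (rule arg_cong[of _ _ top_of_set], auto)
     have "continuous_map (top_of_set {r..r'}) X p"
      by (rule continuous_map_from_subtopology_mono[OF p[unfolded pathin_def]]) (use r r' in auto)
     then have "continuous_map (top_of_set {r..r'}) (subtopology X V) p"
      using pV by (auto simp: continuous_map_in_subtopology)
     from continuous_map_compose[OF this c\<rho>]
     show "continuous_map (subtopology (top_of_set {0..r'}) {x \<in> topspace (top_of_set {0..r'}). r \<le> x}) E (%t. \<rho> (p t))"
      unfolding e2 by (simp add: o_def)
     show "L t = \<rho> (p t)" if "t = r" for t using inv[OF W(1)] L(3)[of r] r that by simp
    qed auto
    moreover have "\<pi> (?L t) = p t" if "t \<in> {0..r'}" for t using L(3) \<rho>V pV that by auto
    ultimately show ?thesis unfolding P_def using L(2) r by (intro exI[of _ ?L]) auto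
   qed
  qed
  moreover have "openin uI ?T" by (rule openin_open_Int[OF open_ball])
  moreover have "r0 \<in> ?T" using r0 d(1) by simp
  ultimately show "\<exists>T. openin uI T & r0 \<in> T & (\<forall>x\<in>T. \<forall>y\<in>T. P x --> P y)" by meson
 qed auto
 then show thesis using that unfolding P_def pathin_def by auto
qed

text \<open>The lifts \<open>L a\<close> are given separately for each \<open>a\<close>. Continuity
  in \<open>a\<close> at a fixed parameter is known at 0 and is continued along the path to 1, which
  yields the homotopy lifting property for the end points.\<close>

lemma covering_lift_end_continuous:
 assumes c: "covering_map E X \<pi>" and H: "continuous_map (prod_topology uI uI) X H"
  and L: "!!a. a \<in> {0..1} ==> pathin E (L a)" "!!a t. [|a \<in> {0..1}; t \<in> {0..1}|] ==> \<pi> (L a t) = H (a, t)"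
  and L0: "pathin E (%a. L a 0)"
 shows "pathin E (%a. L a 1)"
proof -
 have LE: "L a t \<in> topspace E" if "a \<in> {0..1}" "t \<in> {0..1}" for a t
  using path_image_subset_topspace[OF L(1)[OF that(1)]] that(2) by blast
 have HX: "H (a, t) \<in> topspace X" if "a \<in> {0..1}" "t \<in> {0..1}" for a t
  using H that by (auto simp: continuous_map_def)
 have nbhd: "\<exists>A. openin uI A & a0 \<in> A & (\<forall>a\<in>A. L a 1 \<in> B)"
  if a0: "a0 \<in> {0..1}" and B: "openin E B" "L a0 1 \<in> B" for a0 B
 proof -
  define P where "P = (%r. \<forall>B. openin E B & L a0 r \<in> B --> (\<exists>A. openin uI A & a0 \<in> A & (\<forall>a\<in>A. L a r \<in> B)))"
  have "P 1"
  proof (rule connected_induction_simple[of "{0..1::real}" 0 1 P])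
   show "P 0"
    unfolding P_def
   proof (intro allI impI)
    fix B assume B: "openin E B & L a0 0 \<in> B"
    have "openin uI {a\<in>{0..1}. L a 0 \<in> B}"
     using openin_continuous_map_preimage[OF L0[unfolded pathin_def], of B] B by simp
    then show "\<exists>A. openin uI A & a0 \<in> A & (\<forall>a\<in>A. L a 0 \<in> B)"
     using a0 B by (intro exI[of _ "{a\<in>{0..1}. L a 0 \<in> B}"]) auto
   qed
   fix r0 :: real assume r0: "r0 \<in> {0..1}"
   obtain V where V: "H (a0, r0) \<in> V" "openin X V"
    "!!e. [|e \<in> topspace E; \<pi> e \<in> V|] ==> \<exists>W \<rho>. e \<in> W & homeo_patch E X \<pi> W \<rho> & \<pi> ` W = V"
    using covering_patch[OF c HX[OF a0 r0]] by blast
   then obtain W \<rho> where W: "L a0 r0 \<in> W" "homeo_patch E X \<pi> W \<rho>" "\<pi> ` W = V"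
    using LE[OF a0 r0] L(2)[OF a0 r0] by metis
   have oW: "openin E W" and inv: "!!e. e \<in> W ==> \<rho> (\<pi> e) = e" and c\<rho>: "continuous_map (subtopology X V) E \<rho>"
    using W(2,3) by (auto simp: homeo_patch_def)
   have \<rho>V: "\<pi> (\<rho> v) = v" if "v \<in> V" for v using that W(3) inv by (metis imageE)
   have "openin uI {r\<in>{0..1}. L a0 r \<in> W}"
    using openin_continuous_map_preimage[OF L(1)[OF a0, unfolded pathin_def] oW] by simp
   then obtain d1 where d1: "d1 > 0" "!!r. r \<in> {0..1} ==> \<bar>r - r0\<bar> < d1 ==> L a0 r \<in> W"
    unfolding openin_euclidean_subtopology_iff using r0 W(1) by (auto simp: dist_real_def)
   have "openin (prod_topology uI uI) {z\<in>{0..1} \<times> {0..1}. H z \<in> V}"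
    using openin_continuous_map_preimage[OF H V(2)] by simp
   then obtain A0 R0 where AR: "openin uI A0" "openin uI R0" "a0 \<in> A0" "r0 \<in> R0" "A0 \<times> R0 \<subseteq> {z\<in>{0..1} \<times> {0..1}. H z \<in> V}"
    unfolding openin_prod_topology_alt using a0 r0 V(1) by (elim allE[of _ a0] allE[of _ r0]) auto
   obtain d2 where d2: "d2 > 0" "!!r. r \<in> {0..1} ==> \<bar>r - r0\<bar> < d2 ==> r \<in> R0"
    using AR(2,4) unfolding openin_euclidean_subtopology_iff by (auto simp: dist_real_def)
   define d where "d = min d1 d2"
   let ?T = "{0..1} \<inter> ball r0 d"
   have T: "L a0 r \<in> W" "r \<in> R0" "r \<in> {0..1}" if "r \<in> ?T" for r
    using that d1 d2 by (auto simp: d_def dist_real_def abs_minus_commute)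
   have step: "P r'" if r: "r \<in> ?T" and r': "r' \<in> ?T" and Pr: "P r" for r r'
    unfolding P_def
   proof (intro allI impI)
    fix B assume B: "openin E B & L a0 r' \<in> B"
    obtain A1 where A1: "openin uI A1" "a0 \<in> A1" "!!a. a \<in> A1 ==> L a r \<in> W"
     using Pr[unfolded P_def, rule_format, OF conjI[OF oW T(1)[OF r]]] by blast
    let ?S = "closed_segment r r'"
    have S: "?S \<subseteq> ?T"
     by (rule closed_segment_subset) (use r r' in "auto intro: convex_Int convex_ball")
    have A01: "a \<in> {0..1}" if "a \<in> A0" for a using openin_subset[OF AR(1)] that by auto
    have HV: "H (a, t) \<in> V" if "a \<in> A0" "t \<in> ?S" for a t using AR(5) T(2) S that by blast
    \<comment> \<open>For \<open>a\<close> near \<open>a0\<close> the lift meets the patch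
      \<open>W\<close> at parameter \<open>r\<close>; by uniqueness it then coincides with the
      inverse branch along the whole segment from \<open>r\<close> to \<open>r'\<close>, and the
      branch is continuous in \<open>a\<close>.\<close>
    have key: "L a r' = \<rho> (H (a, r'))" if a: "a \<in> A0" "a \<in> A1" for a
    proof (rule covering_lift_unique[OF c, of "top_of_set ?S" "L a" "%t. \<rho> (H (a, t))" r])
     show "connected_space (top_of_set ?S)"
      by (simp add: connected_space_subtopology flip: connectedin_def)
     have S01: "?S \<subseteq> {0..1}" using S by blast
     show "continuous_map (top_of_set ?S) E (L a)"
      by (rule continuous_map_from_subtopology_mono[OF L(1)[OF A01[OF a(1)], unfolded pathin_def] S01])
     have "continuous_map (top_of_set ?S) (prod_topology uI uI) (%t. (a, t))"
      using A01[OF a(1)] S01 by (auto intro!: continuous_intros)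
     from continuous_map_compose[OF this H] have "continuous_map (top_of_set ?S) (subtopology X V) (%t. H (a, t))"
      using HV[OF a(1)] by (auto simp: continuous_map_in_subtopology o_def)
     from continuous_map_compose[OF this c\<rho>] show "continuous_map (top_of_set ?S) E (%t. \<rho> (H (a, t)))"
      by (simp add: o_def)
     show "\<pi> (L a t) = \<pi> (\<rho> (H (a, t)))" if "t \<in> topspace (top_of_set ?S)" for t
      using L(2)[OF A01[OF a(1)], of t] \<rho>V[OF HV[OF a(1), of t]] S01 that by auto
     show "L a r = \<rho> (H (a, r))"
      using inv[OF A1(3)[OF a(2)]] L(2)[OF A01[OF a(1)], of r] T(3)[OF r] by simp
    qed auto
    have "continuous_map (top_of_set A0) (prod_topology uI uI) (%a. (a, r'))"
     using A01 T(3)[OF r'] by (auto intro!: continuous_intros)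
    from continuous_map_compose[OF this H] have "continuous_map (top_of_set A0) (subtopology X V) (%a. H (a, r'))"
     using HV by (auto simp: continuous_map_in_subtopology o_def)
    from continuous_map_compose[OF this c\<rho>] have "continuous_map (top_of_set A0) E (%a. \<rho> (H (a, r')))"
     by (simp add: o_def)
    then have "openin (top_of_set A0) {a\<in>A0. \<rho> (H (a, r')) \<in> B}"
     using openin_continuous_map_preimage[of "top_of_set A0" E _ B] B by simp
    then have "openin uI {a\<in>A0. \<rho> (H (a, r')) \<in> B}"
     using AR(1) openin_trans by blast
    then have "openin uI ({a\<in>A0. \<rho> (H (a, r')) \<in> B} \<inter> A1)" using A1(1) by blast
    then show "\<exists>A. openin uI A & a0 \<in> A & (\<forall>a\<in>A. L a r' \<in> B)"
     using key A1(2) AR(3) B by (intro exI[of _ "{a\<in>A0. \<rho> (H (a, r')) \<in> B} \<inter> A1"]) auto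
   qed
   moreover have "openin uI ?T" by (rule openin_open_Int[OF open_ball])
   moreover have "r0 \<in> ?T" using r0 d1(1) d2(1) by (simp add: d_def)
   ultimately show "\<exists>T. openin uI T & r0 \<in> T & (\<forall>x\<in>T. \<forall>y\<in>T. P x --> P y)" by meson
  qed auto
  then show ?thesis using B unfolding P_def by blast
 qed
 show ?thesis
  unfolding pathin_def continuous_map_def
 proof (intro conjI allI impI)
  show "(%a. L a 1) \<in> topspace uI \<rightarrow> topspace E" using LE by auto
  fix B assume B: "openin E B"
  show "openin uI {a\<in>topspace uI. L a 1 \<in> B}"
  proof (rule openin_locally)
   fix a assume "a \<in> {a\<in>topspace uI. L a 1 \<in> B}"
   then obtain A where "openin uI A" "a \<in> A" "\<forall>a\<in>A. L a 1 \<in> B" using nbhd[of a B] B by auto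
   then show "\<exists>T. openin uI T & a \<in> T & T \<subseteq> {a\<in>topspace uI. L a 1 \<in> B}"
    using openin_subset[of uI A] by (intro exI[of _ A]) auto
  qed
 qed
qed

text \<open>The monodromy argument for moving ends. The branch over \<open>W0\<close> provides
  continuous starting points for the lifts of all stages; their end points form a path over the
  image of \<open>W1\<close> which begins in \<open>W1\<close> and therefore agrees with the branch
  there.\<close>

lemma covering_movable_lift:
 assumes c: "covering_map E X \<pi>" and W0: "homeo_patch E X \<pi> W0 \<rho>0" and W1: "homeo_patch E X \<pi> W1 \<rho>1"
  and m: "movable X (\<pi> ` W0) (\<pi> ` W1) p p'"
  and L: "pathin E L" "!!t. [|0 \<le> t; t \<le> 1|] ==> \<pi> (L t) = p t" "L 0 \<in> W0" "L 1 \<in> W1"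
  and L': "pathin E L'" "!!t. [|0 \<le> t; t \<le> 1|] ==> \<pi> (L' t) = p' t" "L' 0 \<in> W0"
 shows "L' 1 \<in> W1"
proof -
 obtain h where h: "continuous_map (prod_topology uI uI) X h" "!!t. t \<in> {0..1} ==> h (0, t) = p t"
   "!!t. t \<in> {0..1} ==> h (1, t) = p' t" "!!a. a \<in> {0..1} ==> h (a, 0) \<in> \<pi> ` W0 & h (a, 1) \<in> \<pi> ` W1"
  using m unfolding mov_iff by blast
 have inv0: "!!e. e \<in> W0 ==> \<rho>0 (\<pi> e) = e" and c0: "continuous_map (subtopology X (\<pi> ` W0)) E \<rho>0"
  and inv1: "!!e. e \<in> W1 ==> \<rho>1 (\<pi> e) = e" and c1: "continuous_map (subtopology X (\<pi> ` W1)) E \<rho>1"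
  and o: "openin E W0" using W0 W1 by (auto simp: homeo_patch_def)
 have end_path: "pathin (subtopology X (\<pi> ` W)) (%a. h (a, t))" if "!!a. a \<in> {0..1} ==> h (a, t) \<in> \<pi> ` W" "t \<in> {0..1}" for W t
  unfolding pathin_subtopology unfolding pathin_def using continuous_map_fst_const[OF h(1) that(2)] that(1) by blast
 have p0: "pathin E (%a. \<rho>0 (h (a, 0)))"
  using pathin_compose[OF end_path[of 0 W0] c0] h(4) by (simp add: o_def)
 have p1: "pathin E (%a. \<rho>1 (h (a, 1)))"
  using pathin_compose[OF end_path[of 1 W1] c1] h(4) by (simp add: o_def)
 have "\<exists>K. pathin E K & K 0 = \<rho>0 (h (a, 0)) & (\<forall>t\<in>{0..1}. \<pi> (K t) = h (a, t))" if a: "a \<in> {0..1}" for a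
 proof -
  have "continuous_map uI (prod_topology uI uI) (%t. (a, t))" using a by (auto intro!: continuous_intros)
  from continuous_map_compose[OF this h(1)] have ha: "pathin X (%t. h (a, t))" by (simp add: o_def pathin_def)
  have "\<rho>0 (h (a, 0)) \<in> topspace E" using path_image_subset_topspace[OF p0] a by blast
  moreover have "\<pi> (\<rho>0 (h (a, 0))) = h (a, 0)" using h(4)[OF a] inv0 by auto
  ultimately show ?thesis using covering_path_lift[OF c ha] by (metis atLeastAtMost_iff)
 qed
 then obtain K where K: "!!a. a \<in> {0..1} ==> pathin E (K a)" "!!a. a \<in> {0..1} ==> K a 0 = \<rho>0 (h (a, 0))"
  "!!a t. [|a \<in> {0..1}; t \<in> {0..1}|] ==> \<pi> (K a t) = h (a, t)" by metis
 have "pathin E (%a. K a 0)"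
  unfolding pathin_def by (rule continuous_map_eq[OF p0[unfolded pathin_def]]) (use K(2) in auto)
 from covering_lift_end_continuous[OF c h(1) K(1,3) this] have Kend: "pathin E (%a. K a 1)" .
 have KL: "K 0 t = L t" if "0 \<le> t" "t \<le> 1" for t
  by (rule covering_path_lift_unique[OF c K(1) L(1) _ _ that]) (use K(2,3) L h(2) inv0[OF L(3)] in auto)
 have KL': "K 1 t = L' t" if "0 \<le> t" "t \<le> 1" for t
  by (rule covering_path_lift_unique[OF c K(1) L'(1) _ _ that]) (use K(2,3) L' h(3) inv0[OF L'(3)] in auto)
 have "K 1 1 = \<rho>1 (h (1, 1))"
 proof (rule covering_path_lift_unique[OF c Kend p1])
  show "\<pi> (K a 1) = \<pi> (\<rho>1 (h (a, 1)))" if "0 \<le> a" "a \<le> 1" for a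
   using K(3)[of a 1] h(4)[of a] inv1 that by auto
  show "K 0 1 = \<rho>1 (h (0, 1))" using KL[of 1] L(2)[of 1] h(2)[of 1] inv1[OF L(4)] by simp
 qed auto
 then show ?thesis using KL'[of 1] h(4)[of 1] inv1 by auto
qed

text \<open>\<open>j\<close> embeds \<open>Y\<close> with inverse \<open>r\<close> on its image;
  every sheet is cut down to the part that lies over this image.\<close>

lemma covering_map_restrict:
 assumes c: "covering_map E X \<pi>" and j: "continuous_map Y X j"
  and r: "continuous_map (subtopology X (j ` topspace Y)) Y r" and rj: "!!y. y \<in> topspace Y ==> r (j y) = y"
 shows "covering_map (subtopology E {e\<in>topspace E. \<pi> e \<in> j ` topspace Y}) Y (%e. r (\<pi> e))"
proof -
 let ?S = "j ` topspace Y"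
 let ?T = "{e\<in>topspace E. \<pi> e \<in> ?S}" let ?E = "subtopology E ?T"
 have c\<pi>: "continuous_map E X \<pi>" and sur: "\<pi> ` topspace E = topspace X" using c by (auto simp: covering_map_def)
 have jX: "j y \<in> topspace X" if "y \<in> topspace Y" for y using j that by (auto simp: continuous_map_def)
 have "continuous_map ?E (subtopology X ?S) \<pi>"
  using continuous_map_from_subtopology[OF c\<pi>] by (auto simp: continuous_map_in_subtopology)
 from continuous_map_compose[OF this r] have cr: "continuous_map ?E Y (%e. r (\<pi> e))" by (simp add: o_def)
 have "(%e. r (\<pi> e)) ` topspace ?E = topspace Y"
 proof (rule subset_antisym)
  show "topspace Y \<subseteq> (%e. r (\<pi> e)) ` topspace ?E"
  proof
   fix y assume y: "y \<in> topspace Y"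
   then obtain e where "e \<in> topspace E" "\<pi> e = j y" using sur jX by (metis imageE)
   then show "y \<in> (%e. r (\<pi> e)) ` topspace ?E" using y rj by (intro image_eqI[where x = e]) auto
  qed
 qed (use rj in auto)
 moreover have "\<exists>V. y \<in> V & openin Y V & (\<exists>\<W>. \<Union>\<W> = {e\<in>topspace ?E. r (\<pi> e) \<in> V} & pairwise disjnt \<W> &
   (\<forall>W\<in>\<W>. openin ?E W & homeomorphic_map (subtopology ?E W) (subtopology Y V) (%e. r (\<pi> e))))"
  if y: "y \<in> topspace Y" for y
 proof -
  obtain V \<W> where V0: "j y \<in> V" "openin X V" "\<Union>\<W> = {e\<in>topspace E. \<pi> e \<in> V}" "pairwise disjnt \<W>"
   "\<forall>W\<in>\<W>. openin E W & homeomorphic_map (subtopology E W) (subtopology X V) \<pi>"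
   by (rule covering_evenly[OF c jX[OF y]])
  note V = V0(1-4) bspec[OF V0(5)]
  let ?V = "{y\<in>topspace Y. j y \<in> V}" and ?W = "(%W. W \<inter> ?T) ` \<W>"
  have oV: "openin Y ?V" by (rule openin_continuous_map_preimage[OF j V(2)])
  have "openin ?E W & homeomorphic_map (subtopology ?E W) (subtopology Y ?V) (%e. r (\<pi> e))" if "W \<in> ?W" for W
  proof -
   obtain W0 where W0: "W = W0 \<inter> ?T" "W0 \<in> \<W>" using \<open>W \<in> ?W\<close> by blast
   have oW: "openin E W0" using V(5)[OF W0(2)] by blast
   have o: "openin ?E W" unfolding W0(1) openin_subtopology using oW by blast
   obtain \<rho> where \<rho>: "homeomorphic_maps (subtopology E W0) (subtopology X V) \<pi> \<rho>"
    using V(5)[OF W0(2)] homeomorphic_map_maps by blast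
   have tW: "topspace (subtopology E W0) = W0" using openin_subset[OF oW] by auto
   have tV: "topspace (subtopology X V) = V" using openin_subset[OF V(2)] by auto
   have W0T: "W0 \<subseteq> topspace E" using openin_subset[OF oW] .
   have \<rho>': "continuous_map (subtopology X V) E \<rho>" "!!v. v \<in> V ==> \<rho> v \<in> W0 & \<pi> (\<rho> v) = v" "!!e. e \<in> W0 ==> \<rho> (\<pi> e) = e & \<pi> e \<in> V"
    using \<rho> tW tV unfolding homeomorphic_maps_def continuous_map_in_subtopology by (auto simp: Pi_iff image_subset_iff)
   have eW: "r (\<pi> e) \<in> ?V" "\<rho> (j (r (\<pi> e))) = e" if e: "e \<in> W" for e
   proof -
    obtain y where y: "y \<in> topspace Y" "\<pi> e = j y" using e W0(1) by blast
    moreover have "\<pi> e \<in> V" "\<rho> (\<pi> e) = e" using e W0(1) \<rho>'(3) by blast+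
    ultimately show "r (\<pi> e) \<in> ?V" "\<rho> (j (r (\<pi> e))) = e" using rj[OF y(1)] by simp_all
   qed
   have "homeomorphic_maps (subtopology ?E W) (subtopology Y ?V) (%e. r (\<pi> e)) (%y. \<rho> (j y))"
    unfolding homeomorphic_maps_def
   proof (intro conjI ballI)
    show "continuous_map (subtopology ?E W) (subtopology Y ?V) (%e. r (\<pi> e))"
     using continuous_map_from_subtopology[OF cr] eW(1) by (auto simp: continuous_map_in_subtopology)
    have "continuous_map (subtopology Y ?V) (subtopology X V) j"
     using continuous_map_from_subtopology[OF j] by (auto simp: continuous_map_in_subtopology)
    from continuous_map_compose[OF this \<rho>'(1)] have "continuous_map (subtopology Y ?V) E (%y. \<rho> (j y))" by (simp add: o_def)
    then show "continuous_map (subtopology Y ?V) (subtopology ?E W) (%y. \<rho> (j y))"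
     using \<rho>'(2) W0(1) W0T by (auto simp: continuous_map_in_subtopology)
   next
    show "\<rho> (j (r (\<pi> e))) = e" if "e \<in> topspace (subtopology ?E W)" for e using eW(2) that by simp
    show "r (\<pi> (\<rho> (j y))) = y" if "y \<in> topspace (subtopology Y ?V)" for y using \<rho>'(2)[of "j y"] rj that by simp
   qed
   then show ?thesis using o homeomorphic_map_maps by blast
  qed
  moreover have "\<Union>?W = {e\<in>topspace ?E. r (\<pi> e) \<in> ?V}" using V(3) rj by auto
  moreover have "pairwise disjnt ?W"
   using V(4) unfolding pairwise_def disjnt_def by blast
  moreover have "y \<in> ?V" using V(1) y by simp
  ultimately show ?thesis using oV by (intro exI[of _ ?V] conjI exI[of _ ?W]) auto
 qed
 ultimately show ?thesis unfolding covering_map_def using cr by blast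
qed

section \<open>Paths in simply connected spaces\<close>

lemma pathin_concat:
 assumes "pathin X p" "pathin X q" "p 1 = q 0"
 shows "pathin X (%t. if t \<le> 1/2 then p (2 * t) else q (2 * t - 1))"
proof -
 let ?f = "%t :: real. min 1 (2 * t)" and ?g = "%t :: real. max 0 (2 * t - 1)"
 have "continuous_map uI uI ?f" "continuous_map uI uI ?g" by (auto intro!: continuous_intros)
 then have 1: "continuous_map uI X (%t. p (?f t))" and 2: "continuous_map uI X (%t. q (?g t))"
  using continuous_map_compose[of uI uI ?f X p] continuous_map_compose[of uI uI ?g X q] assms(1,2)
  unfolding pathin_def o_def by blast+
 have "continuous_map uI X (%t. if t \<le> 1/2 then p (?f t) else q (?g t))"
  by (rule continuous_map_cases_le[OF _ _ continuous_map_from_subtopology[OF 1] continuous_map_from_subtopology[OF 2]])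
   (use assms(3) in auto)
 then show ?thesis unfolding pathin_def by (rule continuous_map_eq) auto
qed

text \<open>Two paths with common end points bound a square on whose other sides a null homotopy of the loop they form
 is constant.\<close>

lemma simply_connected_paths:
 assumes X: "simply_connected_top X" and p: "pathin X p" and q: "pathin X q" and e: "p 0 = q 0" "p 1 = q 1"
 shows "path_homotopic X p q"
proof -
 let ?x = "p 0"
 define \<gamma> where "\<gamma> = (%t. if t \<le> 1/2 then p (2 * t) else q (1 - (2 * t - 1)))"
 have "pathin X (%t. q (1 - t))"
 proof -
  have "continuous_map uI uI (%t. 1 - t)" by (auto intro!: continuous_intros)
  from continuous_map_compose[OF this q[unfolded pathin_def]] show ?thesis by (simp add: pathin_def o_def)
 qed
 then have g: "pathin X \<gamma>" unfolding \<gamma>_def by (rule pathin_concat[OF p]) (use e in simp)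
 moreover have "\<gamma> 0 = ?x" "\<gamma> 1 = ?x" using e by (auto simp: \<gamma>_def)
 ultimately have "path_homotopic X \<gamma> (%_. ?x)" using X unfolding simply_connected_top_def by metis
 then obtain K where K: "continuous_map (prod_topology uI uI) X K" "!!t. t \<in> {0..1} ==> K (0, t) = \<gamma> t"
   "!!t. t \<in> {0..1} ==> K (1, t) = ?x" "!!a. a \<in> {0..1} ==> K (a, 0) = ?x & K (a, 1) = ?x"
  unfolding path_homotopic_mov mov_iff using \<open>\<gamma> 0 = ?x\<close> \<open>\<gamma> 1 = ?x\<close> by auto
 \<comment> \<open>Both curves run in the square from \<open>(0, 0)\<close> to
   \<open>(0, 1/2)\<close>. \<open>?u\<close> takes the first half of the side where
   \<open>K\<close> is the loop, hence reads \<open>p\<close>. \<open>?v\<close> goes round the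
   three sides where \<open>K\<close> is constant, a quarter of the time each, and comes back along
   the second half of the loop, hence reads \<open>q\<close>.\<close>
 let ?u = "%t :: real. (0 :: real, t / 2)"
 let ?a = "%t :: real. max 0 (min (min (4 * t) 1) (3 - 4 * t))"
 let ?b = "%t :: real. min (max 0 (min 1 (4 * t - 1))) (1 - max 0 (2 * t - 3/2))"
 let ?v = "%t. (?a t, ?b t)"
 have cK: "continuous_map (top_of_set ({0..1} \<times> {0..1})) X K" using K(1) by simp
 have "mov X (%u v. u = ?x & v = p 1) (%t. K (?u t)) (%t. K (?v t))"
 proof (rule mov_convex[OF cK])
  show "continuous_on {0..1} ?u" by (intro continuous_intros) auto
  have "continuous_on {0..1} ?a" by (intro continuous_intros)
  moreover have "continuous_on {0..1} ?b" by (intro continuous_intros)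
  ultimately show "continuous_on {0..1} ?v" by (intro continuous_on_Pair)
  show "?v \<in> {0..1} \<rightarrow> {0..1} \<times> {0..1}" by (auto simp: max_def min_def)
  show "K (?u 0) = ?x & K (?u 1) = p 1" using K(2)[of 0] K(2)[of "1/2"] by (simp add: \<gamma>_def)
 qed (auto intro: convex_Times)
 moreover have "K (?u t) = p t" if "0 \<le> t" "t \<le> 1" for t using K(2)[of "t/2"] that by (auto simp: \<gamma>_def)
 moreover have "K (?v t) = q (max 0 (4 * t - 3))" if t: "0 \<le> t" "t \<le> 1" for t
 proof -
  consider "t \<le> 1/4" | "1/4 \<le> t" "t \<le> 1/2" | "1/2 \<le> t" "t \<le> 3/4" | "3/4 < t" by linarith
  then show ?thesis
  proof cases
   case 1
   then have "?b t = 0" "?a t \<in> {0..1}" "max 0 (4 * t - 3) = 0" using t by auto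
   then show ?thesis using K(4)[of "?a t"] e by (simp only:) 
  next
   case 2
   then have "?a t = 1" "?b t \<in> {0..1}" "max 0 (4 * t - 3) = 0" using t by auto
   then show ?thesis using K(3)[of "?b t"] e by (simp only:)
  next
   case 3
   then have "?b t = 1" "?a t \<in> {0..1}" "max 0 (4 * t - 3) = 0" using t by auto
   then show ?thesis using K(4)[of "?a t"] e by (simp only:)
  next
   case 4
   then have "?a t = 0" "?b t = 1 - (2 * t - 3/2)" "max 0 (4 * t - 3) = 4 * t - 3" using t by auto
   moreover have "\<gamma> (1 - (2 * t - 3/2)) = q (4 * t - 3)"
    using 4 t e by (cases "t = 1") (auto simp: \<gamma>_def)
   ultimately show ?thesis using K(2)[of "1 - (2 * t - 3/2)"] 4 t by (simp only:) auto
  qed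
 qed
 ultimately have 1: "mov X (%u v. u = ?x & v = p 1) p (%t. q (max 0 (4 * t - 3)))"
  by (elim mov_cong) auto
 have "mov X (%u v. u = ?x & v = p 1) (%t. q (max 0 (4 * t - 3))) (%t. q t)"
  by (rule mov_reparam[OF q]) (use e in "auto intro!: continuous_intros")
 from mov_trans[OF 1 this] show ?thesis by (simp add: path_homotopic_mov)
qed

text \<open>\<open>p\<close> is prolonged inside \<open>A\<close> to the end of \<open>q\<close>.
  The prolongation is undone by moving the end within \<open>A\<close>, and the prolonged path is
  homotopic to \<open>q\<close> with fixed ends.\<close>

lemma simply_connected_movable:
 assumes X: "simply_connected_top X" and p: "pathin X p" "p 1 \<in> A" and q: "pathin X q" "q 1 \<in> A"
  and s: "p 0 = q 0" "p 0 \<in> B" and A: "path_connected_space (subtopology X A)"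
 shows "movable X B A p q"
proof -
 have ts: "p 1 \<in> topspace (subtopology X A)" "q 1 \<in> topspace (subtopology X A)"
  using p q path_finish_in_topspace by fastforce+
 then obtain c where c: "pathin (subtopology X A) c" "c 0 = p 1" "c 1 = q 1"
  using A unfolding path_connected_space_def by blast
 then have c': "pathin X c" "!!t. t \<in> {0..1} ==> c t \<in> A" by (auto simp: pathin_subtopology)
 let ?r = "%t. if t \<le> 1/2 then p (2 * t) else c (2 * t - 1)"
 have r: "pathin X ?r" by (rule pathin_concat[OF p(1) c'(1)]) (use c in simp)
 have "movable X B A (%t. ?r (1/2 * t)) (%t. ?r (1 * t))"
 proof (rule movable_truncate[OF r])
  have "closed_segment (1/2) 1 = {1/2..1::real}" by (simp add: closed_segment_eq_real_ivl)
  moreover have "?r t \<in> A" if "t \<in> {1/2..1}" for t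
  proof (cases "t \<le> 1/2")
   case True
   then have "2 * t = 1" using that by simp
   then have "?r t = p 1" using True by presburger
   then show ?thesis using p(2) by simp
  qed (use c'(2)[of "2 * t - 1"] that in auto)
  ultimately show "?r ` closed_segment (1/2) 1 \<subseteq> A" by blast
 qed (use s in auto)
 then have 1: "movable X B A p ?r" by (rule mov_cong) auto
 have "path_homotopic X q ?r" by (rule simply_connected_paths[OF X q(1) r]) (use c s in auto)
 then have "movable X B A q ?r" unfolding path_homotopic_mov by (rule mov_mono) (use q s in auto)
 then show ?thesis using 1 mov_trans mov_sym by meson
qed

section \<open>Source fibers and leaf topologies\<close>

abbreviation source_fiber :: "'a mfd => ('a => 'b) => 'a => (real => 'a) set set" where
 "source_fiber N s y \<equiv> {g\<in>topspace (Pi_top N s). arrow_src g = y}"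

text \<open>The covering by arrows is restricted to the pairs \<open>(z, y)\<close> with
  \<open>z\<close> in the fiber through \<open>y\<close>.\<close>

lemma source_fiber_covering:
 assumes c: "covering_map (Pi_top N s) (subtopology (prod_topology (mtop N) (mtop N)) (fiber_product N s))
   (%g. (arrow_tgt g, arrow_src g))" and y: "y \<in> topspace (mtop N)"
 shows "covering_map (subtopology (Pi_top N s) (source_fiber N s y)) (Fib N s (s y)) arrow_tgt"
proof -
 let ?X = "subtopology (prod_topology (mtop N) (mtop N)) (fiber_product N s)"
 let ?j = "%z. (z, y)" and ?Y = "Fib N s (s y)"
 have tY: "topspace ?Y = fiber N s (s y)" by (auto simp: preim_def)
 have j: "continuous_map ?Y ?X ?j"
  using y unfolding continuous_map_in_subtopology
  by (auto simp: fiber_product_def preim_def intro!: continuous_map_pairedI continuous_map_from_subtopology)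
 have r: "continuous_map (subtopology ?X (?j ` topspace ?Y)) ?Y fst"
  by (auto simp: continuous_map_in_subtopology preim_def intro!: continuous_map_from_subtopology continuous_map_fst)
 have tgt: "(arrow_tgt g, arrow_src g) \<in> fiber_product N s" if "g \<in> topspace (Pi_top N s)" for g
  using c that by (auto simp: covering_map_def continuous_map_def)
 have e: "{g\<in>topspace (Pi_top N s). (arrow_tgt g, arrow_src g) \<in> ?j ` topspace ?Y} = source_fiber N s y"
  using tgt unfolding tY by (auto simp: fiber_product_def preim_def)
 show ?thesis using covering_map_restrict[OF c j r] unfolding e by simp
qed

text \<open>The truncation parameter is made part of the parameter space, so that
  \<open>continuous_map_arrow_of\<close> applies to the family of initial segments.\<close>

lemma continuous_truncated_arrows:
 assumes K: "continuous_map (prod_topology Z uI) (mtop N) K"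
  and fp: "!!z. z \<in> topspace Z ==> (%t. K (z, t)) \<in> fiber_paths N s"
 shows "continuous_map (prod_topology Z uI) (Pi_top N s) (%z. arrow_of N s (%t. K (fst z, snd z * t)))"
  "!!z r. [|z \<in> topspace Z; r \<in> {0..1}|] ==> (%t. K (z, r * t)) \<in> fiber_paths N s"
proof -
 have c: "continuous_map (prod_topology (prod_topology Z uI) uI) (prod_topology Z uI) (%w. (fst (fst w), snd (fst w) * snd w))"
 proof (rule continuous_map_pairedI)
  show "continuous_map (prod_topology (prod_topology Z uI) uI) Z (%w. fst (fst w))"
   using continuous_map_compose[OF continuous_map_fst continuous_map_fst] by (simp add: o_def)
  have m: "continuous_map (prod_topology uI uI) uI (%w. fst w * snd w)"
   by (auto intro!: continuous_intros simp: mult_le_one)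
  have "continuous_map (prod_topology (prod_topology Z uI) uI) (prod_topology uI uI) (%w. (snd (fst w), snd w))"
   using continuous_map_compose[OF continuous_map_fst continuous_map_snd]
   by (intro continuous_map_pairedI continuous_map_snd) (simp add: o_def)
  from continuous_map_compose[OF this m]
  show "continuous_map (prod_topology (prod_topology Z uI) uI) uI (%w. snd (fst w) * snd w)" by (simp add: o_def)
 qed
 show fp': "(%t. K (z, r * t)) \<in> fiber_paths N s" if "z \<in> topspace Z" "r \<in> {0..1}" for z r
 proof -
  have "continuous_map uI uI (%t. r * t)" using that(2) by (auto intro!: continuous_intros simp: mult_le_one)
  from continuous_map_compose[OF this fp[OF that(1), unfolded fiber_paths_iff pathin_def]]
  have "pathin (Fib N s (s (K (z, 0)))) (%t. K (z, r * t))" by (simp add: pathin_def o_def)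
  from fiber_pathsI[OF this] show ?thesis by simp
 qed
 have "continuous_map (prod_topology (prod_topology Z uI) uI) (mtop N) (%w. K (fst (fst w), snd (fst w) * snd w))"
  using continuous_map_compose[OF c K] by (simp add: o_def)
 from continuous_map_arrow_of[OF this, of s]
 show "continuous_map (prod_topology Z uI) (Pi_top N s) (%z. arrow_of N s (%t. K (fst z, snd z * t)))"
  using fp' by auto
qed

text \<open>The classes of the initial segments form the lift of \<open>\<gamma>\<close> along the
  target map that begins at a constant arrow.\<close>

lemma truncation_path:
 assumes g: "\<gamma> \<in> fiber_paths N s"
 shows "pathin (subtopology (Pi_top N s) (source_fiber N s (\<gamma> 0))) (%r. arrow_of N s (%t. \<gamma> (r * t)))"
  "!!r. r \<in> {0..1} ==> (%t. \<gamma> (r * t)) \<in> fiber_paths N s"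
proof -
 have K: "continuous_map (prod_topology (top_of_set {0..1::real}) uI) (mtop N) (%z. \<gamma> (snd z))"
  using continuous_map_compose[OF continuous_map_snd fiber_paths_pathin[OF g, unfolded pathin_def]] by (simp only: o_def)
 note tr = continuous_truncated_arrows[OF K, of s]
 show fp: "(%t. \<gamma> (r * t)) \<in> fiber_paths N s" if "r \<in> {0..1}" for r
  using tr(2)[of 0 r] g that by simp
 have "continuous_map uI (prod_topology uI uI) (%r. (0, r))" by (auto intro!: continuous_intros)
 from continuous_map_compose[OF this tr(1)]
 have "continuous_map uI (Pi_top N s) (%r. arrow_of N s (%t. \<gamma> (r * t)))" using g by (simp add: o_def)
 then show "pathin (subtopology (Pi_top N s) (source_fiber N s (\<gamma> 0))) (%r. arrow_of N s (%t. \<gamma> (r * t)))"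
  unfolding pathin_subtopology using fp by (auto simp: pathin_def topspace_Pi_top)
qed

text \<open>By uniqueness of lifts, a loop at the constant arrow is the truncation path of its own
  target path \<open>\<gamma>\<close>. That it closes up says that \<open>\<gamma>\<close> is null
  homotopic, and truncating a null homotopy of \<open>\<gamma>\<close> contracts the loop. Other
  base points are reached by conjugation.\<close>

lemma source_fiber_simply_connected:
 assumes c: "covering_map (Pi_top N s) (subtopology (prod_topology (mtop N) (mtop N)) (fiber_product N s))
   (%g. (arrow_tgt g, arrow_src g))" and y: "y \<in> topspace (mtop N)"
 shows "simply_connected_top (subtopology (Pi_top N s) (source_fiber N s y))"
proof -
 let ?E = "subtopology (Pi_top N s) (source_fiber N s y)"
 note cov = source_fiber_covering[OF c y]
 have tE: "topspace ?E = source_fiber N s y" by auto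
 define c0 where "c0 = arrow_of N s (%_. y)"
 have const: "(%_. y) \<in> fiber_paths N s" using y by (simp add: fiber_paths_def)
 have c0E: "c0 \<in> topspace ?E" unfolding tE c0_def using const by (auto simp: topspace_Pi_top)
 have to: "\<exists>\<Delta>. pathin ?E \<Delta> & \<Delta> 0 = c0 & \<Delta> 1 = g" if g: "g \<in> topspace ?E" for g
 proof -
  obtain \<gamma> where \<gamma>: "\<gamma> \<in> fiber_paths N s" "g = arrow_of N s \<gamma>" "\<gamma> 0 = y"
   using g unfolding tE topspace_Pi_top by auto
  then show ?thesis
   using truncation_path(1)[OF \<gamma>(1)] by (intro exI[of _ "%r. arrow_of N s (%t. \<gamma> (r * t))"]) (simp add: c0_def)
 qed
 have pcE: "path_connected_space ?E"
 proof -
  have pc: "path_component_of ?E c0 g" if "g \<in> topspace ?E" for g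
   using to[OF that] unfolding path_component_of_def by blast
  then show ?thesis
   unfolding path_connected_space_iff_path_component
   by (intro ballI) (rule path_component_of_trans[OF path_component_of_sym[OF pc] pc])
 qed
 have "path_homotopic ?E \<Gamma> (%_. \<Gamma> 0)" if G: "pathin ?E \<Gamma>" "\<Gamma> 0 = \<Gamma> 1" for \<Gamma>
 proof -
  define g where "g = \<Gamma> 0"
  have gE: "g \<in> topspace ?E" using path_start_in_topspace[OF G(1)] g_def by simp
  obtain \<Delta> where D: "pathin ?E \<Delta>" "\<Delta> 0 = c0" "\<Delta> 1 = g" using to[OF gE] by blast
  \<comment> \<open>The conjugate loop at \<open>c0\<close>: \<open>\<Gamma>'\<close> follows
    \<open>\<Delta>\<close> on the first quarter, \<open>\<Gamma>\<close> on the second, and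
    \<open>\<Delta>\<close> backwards on the second half.\<close>
  define \<Gamma>1 where "\<Gamma>1 = (%t. if t \<le> 1/2 then \<Delta> (2 * t) else \<Gamma> (2 * t - 1))"
  define \<Gamma>' where "\<Gamma>' = (%t. if t \<le> 1/2 then \<Gamma>1 (2 * t) else \<Delta> (1 - (2 * t - 1)))"
  have \<Gamma>1: "pathin ?E \<Gamma>1" unfolding \<Gamma>1_def by (rule pathin_concat[OF D(1) G(1)]) (use D g_def in simp)
  have "continuous_map uI uI (%t. 1 - t)" by (auto intro!: continuous_intros)
  from continuous_map_compose[OF this D(1)[unfolded pathin_def]]
  have "pathin ?E (%t. \<Delta> (1 - t))" by (simp add: pathin_def o_def)
  then have \<Gamma>': "pathin ?E \<Gamma>'"
   unfolding \<Gamma>'_def by (rule pathin_concat[OF \<Gamma>1]) (use D G g_def in "simp add: \<Gamma>1_def")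
  have ends: "\<Gamma>' 0 = c0" "\<Gamma>' 1 = c0" using D by (auto simp: \<Gamma>'_def \<Gamma>1_def)
  have c\<pi>: "continuous_map ?E (Fib N s (s y)) arrow_tgt" using cov by (simp add: covering_map_def)
  define \<gamma> where "\<gamma> = (%t. arrow_tgt (\<Gamma>' t))"
  have "pathin (Fib N s (s y)) \<gamma>" using pathin_compose[OF \<Gamma>' c\<pi>] by (simp add: \<gamma>_def o_def)
  from fiber_pathsI[OF this] have fp: "\<gamma> \<in> fiber_paths N s" by simp
  have g0: "\<gamma> 0 = y" "\<gamma> 1 = y" using ends const by (auto simp: \<gamma>_def c0_def)
  \<comment> \<open>Both sides lift the target path \<open>\<gamma>\<close> and start at
    \<open>c0\<close>.\<close>
  have lift: "\<Gamma>' r = arrow_of N s (%t. \<gamma> (r * t))" if "0 \<le> r" "r \<le> 1" for r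
  proof (rule covering_path_lift_unique[OF cov \<Gamma>' _ _ _ that])
   show "pathin ?E (%r. arrow_of N s (%t. \<gamma> (r * t)))" using truncation_path(1)[OF fp] g0 by simp
   show "arrow_tgt (\<Gamma>' t) = arrow_tgt (arrow_of N s (%ta. \<gamma> (t * ta)))" if "0 \<le> t" "t \<le> 1" for t
    using truncation_path(2)[OF fp, of t] that by (simp add: \<gamma>_def)
   show "\<Gamma>' 0 = arrow_of N s (%t. \<gamma> (0 * t))" using ends g0 by (simp add: c0_def)
  qed
  have "arrow_of N s \<gamma> = arrow_of N s (%_. y)" using lift[of 1] ends by (simp add: c0_def)
  then have "path_homotopic (Fib N s (s y)) \<gamma> (%_. y)" using arrow_of_eq[OF fp const] g0 by simp
  then obtain K where K: "continuous_map (prod_topology uI uI) (Fib N s (s y)) K" "!!t. t \<in> {0..1} ==> K (0, t) = \<gamma> t"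
   "!!t. t \<in> {0..1} ==> K (1, t) = y" "!!a. a \<in> {0..1} ==> K (a, 0) = y & K (a, 1) = y"
   unfolding path_homotopic_mov mov_iff g0 by blast
  have KN: "continuous_map (prod_topology uI uI) (mtop N) K" using K(1) continuous_map_in_subtopology by blast
  have Kfp: "(%t. K (a, t)) \<in> fiber_paths N s" if "a \<in> topspace uI" for a
  proof -
   have "continuous_map uI (prod_topology uI uI) (%t. (a, t))" using that by (auto intro!: continuous_intros)
   from continuous_map_compose[OF this K(1)] have "pathin (Fib N s (s y)) (%t. K (a, t))" by (simp add: pathin_def o_def)
   from fiber_pathsI[OF this] show ?thesis by simp
  qed
  note tr = continuous_truncated_arrows[OF KN Kfp]
  let ?K = "%z. arrow_of N s (%t. K (fst z, snd z * t))"
  have trf: "(%t. K (a, r * t)) \<in> fiber_paths N s" if "a \<in> {0..1}" "r \<in> {0..1}" for a r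
   using tr(2)[of a r] that by simp
  have KE: "continuous_map (prod_topology uI uI) ?E ?K"
   unfolding continuous_map_in_subtopology
  proof
   show "?K \<in> topspace (prod_topology uI uI) \<rightarrow> source_fiber N s y"
    using trf K(4) by (auto simp: topspace_Pi_top)
  qed (rule tr(1))
  have KEpath: "pathin ?E (%a. ?K (1 - a, 1))"
  proof -
   have "continuous_map uI (prod_topology uI uI) (%a. (1 - a, 1))" by (auto intro!: continuous_intros)
   from continuous_map_compose[OF this KE] show ?thesis by (simp add: pathin_def o_def)
  qed
  have cong: "arrow_of N s p = arrow_of N s q"
   if "p \<in> fiber_paths N s" "q \<in> fiber_paths N s" "!!t. [|0 \<le> t; t \<le> 1|] ==> p t = q t" for p q
   unfolding arrow_of_eq[OF that(1,2)] path_homotopic_mov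
   by (rule mov_eq) (use that in "auto simp: fiber_paths_iff")
  have K0: "?K (0, r) = \<Gamma>' r" if "0 \<le> r" "r \<le> 1" for r
   unfolding lift[OF that] using trf[of 0 r] truncation_path(2)[OF fp, of r] that K(2)
   by (intro cong) (auto simp: mult_le_one)
  have K1: "?K (1, r) = c0" if "0 \<le> r" "r \<le> 1" for r
   unfolding c0_def using trf[of 1 r] const that K(3) by (intro cong) (auto simp: mult_le_one)
  have Ka0: "?K (a, 0) = c0" if "0 \<le> a" "a \<le> 1" for a
   unfolding c0_def using K(4)[of a] that by simp
  \<comment> \<open>On this side only the target is known to be \<open>y\<close>. The side is read
    backwards because its value is known at \<open>a = 1\<close>; uniqueness of lifts then makes it
    constant.\<close>
  have Ka1: "?K (a, 1) = c0" if "0 \<le> a" "a \<le> 1" for a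
  proof -
   have "?K (1 - (1 - a), 1) = c0"
   proof (rule covering_path_lift_unique[OF cov KEpath, of "%_. c0" "1 - a"])
    show "arrow_tgt (?K (1 - t, 1)) = arrow_tgt c0" if "0 \<le> t" "t \<le> 1" for t
     using trf[of "1 - t" 1] const K(4)[of "1 - t"] that by (simp add: c0_def)
   qed (use c0E that K1[of 1] in auto)
   then show ?thesis by simp
  qed
  \<comment> \<open>\<open>?u\<close> runs through the part of the loop that is
    \<open>\<Gamma>\<close>, between \<open>1/4\<close> and \<open>1/2\<close>. \<open>?v\<close>
    goes from the same starting point back along \<open>\<Delta>\<close> to the corner, round the
    three sides where the map is constantly \<open>c0\<close>, and again along
    \<open>\<Delta>\<close> to the same end point, one fifth of the time for each piece;
    \<open>?f\<close> is the parameter of \<open>\<Delta>\<close> on the way.\<close>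
  let ?u = "%t :: real. (0 :: real, (1 + t) / 4)"
  let ?a = "%t :: real. max 0 (min (min (5 * t - 1) 1) (4 - 5 * t))"
  let ?b = "%t :: real. max 0 ((1 - 5 * t) / 4) + max 0 (min 1 (5 * t - 2)) - max 0 ((5 * t - 4) / 2)"
  let ?f = "%t :: real. max 0 (max (1 - 5 * t) (5 * t - 4))"
  let ?v = "%t. (?a t, ?b t)"
  have cK: "continuous_map (top_of_set ({0..1} \<times> {0..1})) ?E ?K" using KE by simp
  have Ku: "?K (?u t) = \<Gamma> t" if "0 \<le> t" "t \<le> 1" for t
  proof -
   have "?K (?u t) = \<Gamma>' ((1 + t) / 4)" using K0[of "(1 + t) / 4"] that by simp
   also have "\<dots> = \<Gamma> t"
    using that D g_def by (cases "t = 0") (auto simp: \<Gamma>'_def \<Gamma>1_def field_simps)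
   finally show ?thesis .
  qed
  have Kv: "?K (?v t) = \<Delta> (?f t)" if t: "0 \<le> t" "t \<le> 1" for t
  proof -
   consider "t \<le> 1/5" | "1/5 \<le> t" "t \<le> 2/5" | "2/5 \<le> t" "t \<le> 3/5" | "3/5 \<le> t" "t \<le> 4/5" | "4/5 < t" by linarith
   then show ?thesis
   proof cases
    case 1
    then have e: "?a t = 0" "?b t = (1 - 5 * t) / 4" "?f t = 1 - 5 * t" using t by auto
    have i: "(1 - 5 * t) / 4 \<le> 1 / 2" "2 * ((1 - 5 * t) / 4) \<le> 1 / 2" "2 * (2 * ((1 - 5 * t) / 4)) = 1 - 5 * t"
     using t by simp_all
    have "\<Gamma>' ((1 - 5 * t) / 4) = \<Delta> (1 - 5 * t)" unfolding \<Gamma>'_def \<Gamma>1_def if_P[OF i(1)] if_P[OF i(2)] i(3) ..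
    then show ?thesis unfolding e using K0[of "(1 - 5 * t) / 4"] 1 t by simp
   next
    case 2
    then have e: "?b t = 0" "0 \<le> ?a t" "?a t \<le> 1" "?f t = 0" using t by auto
    show ?thesis unfolding e(1,4) using Ka0[OF e(2,3)] D(2) by simp
   next
    case 3
    then have e: "?a t = 1" "0 \<le> ?b t" "?b t \<le> 1" "?f t = 0" using t by auto
    show ?thesis unfolding e(1,4) using K1[OF e(2,3)] D(2) by simp
   next
    case 4
    then have e: "?b t = 1" "0 \<le> ?a t" "?a t \<le> 1" "?f t = 0" using t by auto
    show ?thesis unfolding e(1,4) using Ka1[OF e(2,3)] D(2) by simp
   next
    case 5
    then have e: "?a t = 0" "?b t = 1 - (5 * t - 4) / 2" "?f t = 5 * t - 4" using t by auto
    have "\<Gamma>' (1 - (5 * t - 4) / 2) = \<Delta> (5 * t - 4)"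
    proof (cases "t = 1")
     case True
     then show ?thesis using D(3) G(2) g_def by (simp add: \<Gamma>'_def \<Gamma>1_def)
    next
     case False
     then have "\<not> 1 - (5 * t - 4) / 2 \<le> 1/2" using t by simp
     moreover have "1 - (2 * (1 - (5 * t - 4) / 2) - 1) = 5 * t - 4" by (simp add: field_simps)
     ultimately show ?thesis by (simp only: \<Gamma>'_def if_False)
    qed
    then show ?thesis unfolding e using K0[of "1 - (5 * t - 4) / 2"] 5 t by simp
   qed
  qed
  let ?Q = "%u v. u = g & v = g"
  have "mov ?E ?Q (%t. ?K (?u t)) (%t. ?K (?v t))"
  proof (rule mov_convex[OF cK])
   show "continuous_on {0..1} ?u" by (intro continuous_intros) auto
   have "continuous_on {0..1} ?a" by (intro continuous_intros)
   moreover have "continuous_on {0..1} ?b" by (intro continuous_intros) auto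
   ultimately show "continuous_on {0..1} ?v" by (intro continuous_on_Pair)
   show "?v \<in> {0..1} \<rightarrow> {0..1} \<times> {0..1}" by (auto simp: max_def min_def)
   show "?Q (?K (?u 0)) (?K (?u 1))" using Ku[of 0] Ku[of 1] G(2) g_def by simp
  qed (auto intro: convex_Times)
  then have 1: "mov ?E ?Q \<Gamma> (%t. \<Delta> (?f t))" by (rule mov_cong) (use Ku Kv in auto)
  have cf: "continuous_on {0..1} ?f" by (intro continuous_intros)
  \<comment> \<open>The remaining path runs along \<open>\<Delta>\<close> back and forth; as
    \<open>?f\<close> is 1 at both ends it is contracted within the parameter interval.\<close>
  have "mov ?E ?Q (%t. \<Delta> (?f t)) (%t. \<Delta> ((%_. 1) t))"
   by (rule mov_reparam[OF D(1) cf]) (use D(3) in auto)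
  from mov_trans[OF 1 this] have "mov ?E ?Q \<Gamma> (%_. g)" using D(3) by simp
  then show ?thesis unfolding path_homotopic_mov using G(2) by (simp add: g_def)
 qed
 then show ?thesis using pcE unfolding simply_connected_top_def by blast
qed

section \<open>Leaf topologies under pull-back and restriction\<close>

lemma topspace_pullback_fol: "topspace (pullback_fol E F \<pi>) = topspace E"
 unfolding pullback_fol_def topology_generated_by_topspace using openin_subset by auto

text \<open>The universal property of the pull-back: its topology is the coarsest one for which the
  identity to \<open>E\<close> and \<open>\<pi>\<close> to \<open>F\<close> are continuous. This is
  the form in which pulled back foliations are used below.\<close>

lemma continuous_map_pullback_fol:
 assumes \<pi>: "!!e. e \<in> topspace E ==> \<pi> e \<in> topspace F"
 shows "continuous_map Z (pullback_fol E F \<pi>) f \<longleftrightarrow> continuous_map Z E f & continuous_map Z F (%z. \<pi> (f z))" (is "?L \<longleftrightarrow> ?R")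
proof
 assume L: ?L
 then have fE: "f z \<in> topspace E" if "z \<in> topspace Z" for z
  using that topspace_pullback_fol[of E F \<pi>] by (auto simp: continuous_map_def)
 have pre: "openin Z {z\<in>topspace Z. f z \<in> W}" if "openin (pullback_fol E F \<pi>) W" for W
  using openin_continuous_map_preimage[OF L that] .
 have 1: "openin (pullback_fol E F \<pi>) W" if "openin E W" for W
  unfolding pullback_fol_def by (rule topology_generated_by_Basis) (use that in simp)
 have 2: "openin (pullback_fol E F \<pi>) {e\<in>topspace E. \<pi> e \<in> V}" if "openin F V" for V
  unfolding pullback_fol_def by (rule topology_generated_by_Basis) (use that in blast)
 have "{z\<in>topspace Z. \<pi> (f z) \<in> V} = {z\<in>topspace Z. f z \<in> {e\<in>topspace E. \<pi> e \<in> V}}" for V using fE by auto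
 then show ?R using fE \<pi> pre[OF 1] pre[OF 2] by (auto simp: continuous_map_def)
next
 assume R: ?R
 then have fE: "f z \<in> topspace E" if "z \<in> topspace Z" for z using that by (auto simp: continuous_map_def)
 show ?L
  unfolding pullback_fol_def continuous_on_generated_topo_iff
 proof (intro conjI allI impI)
  fix U assume "U \<in> {W. openin E W} \<union> {{e\<in>topspace E. \<pi> e \<in> V} |V. openin F V}"
  then consider "openin E U" | V where "openin F V" "U = {e\<in>topspace E. \<pi> e \<in> V}" by blast
  then show "openin Z (f -` U \<inter> topspace Z)"
  proof cases
   case 1
   have "f -` U \<inter> topspace Z = {z\<in>topspace Z. f z \<in> U}" by blast
   then show ?thesis using openin_continuous_map_preimage[OF conjunct1[OF R] 1] by simp
  next
   case 2
   have "f -` U \<inter> topspace Z = {z\<in>topspace Z. \<pi> (f z) \<in> V}" using fE 2(2) by auto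
   then show ?thesis using openin_continuous_map_preimage[OF conjunct2[OF R] 2(1)] by simp
  qed
 next
  show "f ` topspace Z \<subseteq> \<Union>({W. openin E W} \<union> {{e\<in>topspace E. \<pi> e \<in> V} |V. openin F V})"
   using fE openin_topspace[of E] by blast
 qed
qed

lemma leaf_of_eq_iff:
 assumes "x \<in> topspace F" "y \<in> topspace F"
 shows "leaf_of F x = leaf_of F y \<longleftrightarrow> connected_component_of F x y"
 using connected_component_of_eq[of F x y] assms connected_component_of_refl by auto

text \<open>Leaves are connected components of the leaf topology, and continuous images of connected
  sets are connected. Comparing two foliations thus amounts to continuous maps in both
  directions.\<close>

lemma leaf_eq_continuous_map:
 assumes f: "continuous_map F F' f" and e: "x \<in> topspace F" "y \<in> topspace F" "leaf_of F x = leaf_of F y"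
 shows "leaf_of F' (f x) = leaf_of F' (f y)"
proof -
 obtain C where C: "connectedin F C" "x \<in> C" "y \<in> C"
  using e leaf_of_eq_iff[OF e(1,2)] unfolding connected_component_of_def by blast
 have "connectedin F' (f ` C)" using connectedin_continuous_map_image[OF f C(1)] .
 then have "connected_component_of F' (f x) (f y)" using C unfolding connected_component_of_def by blast
 moreover have "f x \<in> topspace F'" "f y \<in> topspace F'" using f e by (auto simp: continuous_map_def)
 ultimately show ?thesis using leaf_of_eq_iff by metis
qed

text \<open>\<open>S\<close> is a union of level sets of a locally constant function, so a connected
  set that meets \<open>S\<close> is contained in it.\<close>

lemma leaf_of_subtopology:
 assumes d: "continuous_map F (discrete_topology D) d" and S: "S = {x\<in>topspace F. d x \<in> A}"
  and xy: "x \<in> S" "y \<in> S"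
 shows "leaf_of (subtopology F S) x = leaf_of (subtopology F S) y \<longleftrightarrow> leaf_of F x = leaf_of F y"
proof -
 have ts: "x \<in> topspace F" "y \<in> topspace F" "x \<in> topspace (subtopology F S)" "y \<in> topspace (subtopology F S)"
  using xy S by auto
 have "C \<subseteq> S" if C: "connectedin F C" "x \<in> C" for C
 proof -
  have "connectedin (discrete_topology D) (d ` C)" by (rule connectedin_continuous_map_image[OF d C(1)])
  then obtain a where "d ` C \<subseteq> {a}" unfolding connectedin_discrete_topology by auto
  moreover have "C \<subseteq> topspace F" using C(1) connectedin_subset_topspace by blast
  moreover have "d x \<in> A" using xy(1) S by simp
  moreover have "d z = d x" if "z \<in> C" for z using \<open>d ` C \<subseteq> {a}\<close> C(2) that by blast
  ultimately have "z \<in> topspace F" "d z \<in> A" if "z \<in> C" for z using that by auto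
  then show ?thesis unfolding S by blast
 qed
 then have "connected_component_of (subtopology F S) x y \<longleftrightarrow> connected_component_of F x y"
  unfolding connected_component_of_def connectedin_subtopology by blast
 then show ?thesis using leaf_of_eq_iff ts by metis
qed

lemma Pi_fol_topspace: "topspace (Pi_fol N F s) = topspace (Pi_top N s)"
 by (simp add: Pi_fol_def topspace_pullback_fol)

lemma arrow_ends:
 assumes "g \<in> topspace (Pi_top N s)"
 shows "arrow_src g \<in> topspace (mtop N)" "arrow_tgt g \<in> topspace (mtop N)" "s (arrow_tgt g) = s (arrow_src g)"
 using arrow_fiber_product[OF assms] by (simp_all add: fiber_product_def)

text \<open>Unfolding the factor \<open>F \<times> 0\<close> of the pull-back: the target must be
  continuous for the leaf topology and the source locally constant.\<close>

lemma continuous_map_Pi_fol: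
 assumes F: "topspace F = topspace (mtop N)"
 shows "continuous_map Z (Pi_fol N F s) f \<longleftrightarrow> continuous_map Z (Pi_top N s) f &
   continuous_map Z F (%z. arrow_tgt (f z)) &
   continuous_map Z (discrete_topology (topspace (mtop N))) (%z. arrow_src (f z))"
proof -
 have t: "(arrow_tgt g, arrow_src g) \<in> topspace (fiber_product_fol N F s)" if "g \<in> topspace (Pi_top N s)" for g
  using arrow_fiber_product[OF that] F by (simp add: fiber_product_fol_def fiber_product_def)
 have "continuous_map Z (fiber_product_fol N F s) (%z. (arrow_tgt (f z), arrow_src (f z))) \<longleftrightarrow>
   continuous_map Z F (%z. arrow_tgt (f z)) &
   continuous_map Z (discrete_topology (topspace (mtop N))) (%z. arrow_src (f z))"
  if "continuous_map Z (Pi_top N s) f"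
 proof -
  have "f z \<in> topspace (Pi_top N s)" if "z \<in> topspace Z" for z
   using \<open>continuous_map Z (Pi_top N s) f\<close> that by (auto simp: continuous_map_def)
  then show ?thesis
   using arrow_fiber_product unfolding fiber_product_fol_def continuous_map_in_subtopology continuous_map_paired by blast
 qed
 then show ?thesis
  unfolding Pi_fol_def
  using continuous_map_pullback_fol[of "Pi_top N s" "%g. (arrow_tgt g, arrow_src g)" "fiber_product_fol N F s" Z f, OF t]
  by blast
qed

lemma Pi_fol_maps:
 assumes F: "topspace F = topspace (mtop N)"
 shows "continuous_map (Pi_fol N F s) (Pi_top N s) (%g. g)" "continuous_map (Pi_fol N F s) F arrow_tgt"
  "continuous_map (Pi_fol N F s) (discrete_topology (topspace (mtop N))) arrow_src"
 using continuous_map_Pi_fol[OF F, of "Pi_fol N F s" s "%g. g"] by auto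

text \<open>The source is continuous into a discrete space, hence constant on leaves.\<close>

lemma Pi_fol_leaf_src:
 assumes F: "topspace F = topspace (mtop N)" and g: "g \<in> topspace (Pi_top N s)" "g' \<in> topspace (Pi_top N s)"
  and l: "leaf_of (Pi_fol N F s) g = leaf_of (Pi_fol N F s) g'"
 shows "arrow_src g = arrow_src g'"
proof -
 let ?D = "discrete_topology (topspace (mtop N))"
 have "leaf_of ?D (arrow_src g) = leaf_of ?D (arrow_src g')"
  by (rule leaf_eq_continuous_map[OF Pi_fol_maps(3)[OF F]]) (use g l in "auto simp: Pi_fol_topspace")
 then have "connected_component_of ?D (arrow_src g) (arrow_src g')"
  using leaf_of_eq_iff[of "arrow_src g" ?D "arrow_src g'"] arrow_ends(1) g by auto
 then show ?thesis unfolding connected_component_of_def connectedin_discrete_topology by auto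
qed

section \<open>Developing the monodromy groupoid\<close>

text \<open>\<open>X0\<close> is the model fiber and \<open>E\<close> its universal covering. The
  patch \<open>W0\<close> with branch \<open>\<rho>0\<close> fixes where the lift of an arrow
  begins, continuously in its source; \<open>hF\<close> and \<open>kF\<close> express that the
  trivialization respects leaves.\<close>

locale developing = trivial_bundle N TM s X0 U h k
 for N :: "'a mfd" and TM :: "'b topology" and s :: "'a => 'b" and X0 :: "'a topology"
  and U :: "'b set" and h :: "'a => 'a \<times> 'b" and k :: "'a \<times> 'b => 'a" +
 fixes E :: "'e topology" and \<pi> :: "'e => 'a" and W0 :: "'e set" and \<rho>0 :: "'a => 'e"
  and F F0 :: "'a topology"
 assumes cov: "covering_map E X0 \<pi>" and sc: "simply_connected_top E" and W0: "homeo_patch E X0 \<pi> W0 \<rho>0"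
  and X0: "locally_good X0"
  and hF: "continuous_map (subtopology F (preim N s U)) F0 (%y. fst (h y))"
  and kF: "!!u. u \<in> U ==> continuous_map F0 F (%a. k (a, u))"
  and tF: "topspace F = topspace (mtop N)" and tF0: "topspace F0 = topspace X0"
begin

definition dom :: "(real => 'a) set set" where
 "dom = {g\<in>topspace (Pi_top N s). arrow_src g \<in> hbox (\<pi> ` W0)}"

definition lifts :: "(real => 'a) => (real => 'e) => bool" where
 "lifts \<gamma> L \<longleftrightarrow> pathin E L & L 0 = \<rho>0 (h1 (\<gamma> 0)) & (\<forall>t\<in>{0..1}. \<pi> (L t) = h1 (\<gamma> t))"

text \<open>The end point of the lift of an arrow. A function of a transversal to the developed foliation
 turns into one for the monodromy groupoid by composition with this map.\<close>

definition Phi :: "(real => 'a) set => 'e" where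
 "Phi g = (SOME e. \<exists>\<gamma> L. \<gamma> \<in> fiber_paths N s & g = arrow_of N s \<gamma> & lifts \<gamma> L & e = L 1)"

lemma c\<pi>: "continuous_map E X0 \<pi>" using cov by (simp add: covering_map_def)

lemma W0D: "openin E W0" "openin X0 (\<pi> ` W0)" "!!e. e \<in> W0 ==> \<rho>0 (\<pi> e) = e"
 using W0 by (auto simp: homeo_patch_def)

lemma \<rho>0_W0: "b \<in> \<pi> ` W0 ==> \<rho>0 b \<in> W0" "b \<in> \<pi> ` W0 ==> \<pi> (\<rho>0 b) = b" "b \<in> \<pi> ` W0 ==> \<rho>0 b \<in> topspace E"
 using W0D openin_subset[OF W0D(1)] by auto

lemma openin_dom: "openin (Pi_top N s) dom"
 unfolding dom_def by (rule openin_continuous_map_preimage[OF continuous_map_arrow_ends(1) openin_hbox[OF W0D(2)]])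

lemma hboxD: "y \<in> hbox A ==> h1 y \<in> A" "y \<in> hbox A ==> s y \<in> U" "y \<in> hbox A ==> y \<in> preim N s U"
 by (auto simp: hbox_def preim_def)

lemma lift_exists:
 assumes g: "\<gamma> \<in> fiber_paths N s" and 0: "\<gamma> 0 \<in> hbox (\<pi> ` W0)"
 obtains L where "lifts \<gamma> L"
proof -
 have "\<rho>0 (h1 (\<gamma> 0)) \<in> topspace E" "\<pi> (\<rho>0 (h1 (\<gamma> 0))) = h1 (\<gamma> 0)" using \<rho>0_W0 hboxD(1)[OF 0] by auto
 then obtain L where "pathin E L" "L 0 = \<rho>0 (h1 (\<gamma> 0))" "!!t. [|0 \<le> t; t \<le> 1|] ==> \<pi> (L t) = h1 (\<gamma> t)"
  using covering_path_lift[OF cov h1_path(1)[OF g hboxD(2)[OF 0]]] by blast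
 then show thesis using that[of L] by (simp add: lifts_def)
qed

text \<open>In a patch around the end of one lift, \<open>covering_movable_lift\<close> also finds
  the end of the other; both lie over the same point, and \<open>\<pi>\<close> is injective on the
  patch.\<close>

lemma lifts_end_unique:
 assumes "path_homotopic X0 (%t. h1 (\<gamma> t)) (%t. h1 (\<delta> t))" and 0: "h1 (\<gamma> 0) \<in> \<pi> ` W0"
  and L: "lifts \<gamma> L" "lifts \<delta> L'"
 shows "L 1 = L' 1"
proof -
 have e: "h1 (\<delta> 0) = h1 (\<gamma> 0)" "h1 (\<delta> 1) = h1 (\<gamma> 1)" using mov_ends(2)[OF assms(1)[unfolded path_homotopic_mov]] by auto
 have LE: "L 1 \<in> topspace E" using L(1) path_finish_in_topspace by (auto simp: lifts_def)
 then obtain W \<rho> where W: "L 1 \<in> W" "homeo_patch E X0 \<pi> W \<rho>"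
  using covering_imp_local_homeo[OF cov] unfolding local_homeo_def by blast
 have \<pi>L: "\<pi> (L 1) = h1 (\<gamma> 1)" "\<pi> (L' 1) = h1 (\<gamma> 1)" using L e by (auto simp: lifts_def)
 have "movable X0 (\<pi> ` W0) (\<pi> ` W) (%t. h1 (\<gamma> t)) (%t. h1 (\<delta> t))"
 proof (rule mov_mono[OF assms(1)[unfolded path_homotopic_mov]])
  fix u v assume "u = h1 (\<gamma> 0) & v = h1 (\<gamma> 1)"
  then show "u \<in> \<pi> ` W0 & v \<in> \<pi> ` W" using 0 W(1) \<pi>L(1) by force
 qed
 then have "L' 1 \<in> W"
  by (rule covering_movable_lift[OF cov W0 W(2)]) (use L W(1) \<rho>0_W0[OF 0] e in "auto simp: lifts_def")
 then show ?thesis using W \<pi>L unfolding homeo_patch_def by metis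
qed

lemma Phi_arrow_of:
 assumes g: "\<gamma> \<in> fiber_paths N s" and 0: "\<gamma> 0 \<in> hbox (\<pi> ` W0)" and L: "lifts \<gamma> L"
 shows "Phi (arrow_of N s \<gamma>) = L 1"
 unfolding Phi_def
proof (rule some_equality)
 show "\<exists>\<gamma>' L'. \<gamma>' \<in> fiber_paths N s & arrow_of N s \<gamma> = arrow_of N s \<gamma>' & lifts \<gamma>' L' & L 1 = L' 1" using g L by blast
 fix e assume "\<exists>\<gamma>' L'. \<gamma>' \<in> fiber_paths N s & arrow_of N s \<gamma> = arrow_of N s \<gamma>' & lifts \<gamma>' L' & e = L' 1"
 then obtain \<gamma>' L' where *: "\<gamma>' \<in> fiber_paths N s" "arrow_of N s \<gamma> = arrow_of N s \<gamma>'" "lifts \<gamma>' L'" "e = L' 1" by blast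
 have "path_homotopic X0 (%t. h1 (\<gamma> t)) (%t. h1 (\<gamma>' t))"
  by (rule path_homotopic_h1[OF _ hboxD(2)[OF 0]]) (use arrow_of_eq[OF g *(1)] *(2) in simp)
 then show "e = L 1" using lifts_end_unique[OF _ hboxD(1)[OF 0] L *(3)] *(4) by simp
qed

lemma Phi_cases:
 assumes "g \<in> dom"
 obtains \<gamma> L where "\<gamma> \<in> fiber_paths N s" "g = arrow_of N s \<gamma>" "\<gamma> 0 \<in> hbox (\<pi> ` W0)" "lifts \<gamma> L" "Phi g = L 1"
  "arrow_src g = \<gamma> 0" "arrow_tgt g = \<gamma> 1"
proof -
 have g: "g \<in> topspace (Pi_top N s)" "arrow_src g \<in> hbox (\<pi> ` W0)" using assms by (auto simp: dom_def)
 obtain \<gamma> where \<gamma>: "\<gamma> \<in> fiber_paths N s" "g = arrow_of N s \<gamma>" "arrow_src g = \<gamma> 0" "arrow_tgt g = \<gamma> 1"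
  using arrow_cases[OF g(1)] .
 have 0: "\<gamma> 0 \<in> hbox (\<pi> ` W0)" using g(2) \<gamma>(3) by simp
 obtain L where L: "lifts \<gamma> L" using lift_exists[OF \<gamma>(1) 0] .
 show thesis using that[OF \<gamma>(1,2) 0 L] Phi_arrow_of[OF \<gamma>(1) 0 L] \<gamma> by simp
qed

lemma Phi_mem:
 assumes "g \<in> dom"
 shows "Phi g \<in> topspace E" "\<pi> (Phi g) = h1 (arrow_tgt g)" "arrow_tgt g \<in> preim N s U"
proof -
 obtain \<gamma> L where *: "\<gamma> \<in> fiber_paths N s" "\<gamma> 0 \<in> hbox (\<pi> ` W0)" "lifts \<gamma> L" "Phi g = L 1" "arrow_tgt g = \<gamma> 1"
  using Phi_cases[OF assms] .
 show "Phi g \<in> topspace E" using *(3,4) path_finish_in_topspace by (auto simp: lifts_def)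
 show "\<pi> (Phi g) = h1 (arrow_tgt g)" using *(3-5) by (auto simp: lifts_def)
 show "arrow_tgt g \<in> preim N s U" using h1_path(2)[OF *(1) hboxD(2)[OF *(2)], of 1] *(5) by simp
qed

lemma good_patch:
 assumes "openin E Q" "e \<in> Q"
 obtains W \<rho> where "e \<in> W" "W \<subseteq> Q" "homeo_patch E X0 \<pi> W \<rho>" "good X0 (\<pi> ` W)"
proof -
 have "e \<in> topspace E" using assms openin_subset by blast
 then obtain W1 \<rho> where W1: "e \<in> W1" "homeo_patch E X0 \<pi> W1 \<rho>"
  using covering_imp_local_homeo[OF cov] unfolding local_homeo_def by blast
 have oW: "openin E (W1 \<inter> Q)" using W1(2) assms(1) by (auto simp: homeo_patch_def)
 have p: "homeo_patch E X0 \<pi> (W1 \<inter> Q) \<rho>" by (rule homeo_patch_subset[OF W1(2) oW]) blast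
 then have "openin X0 (\<pi> ` (W1 \<inter> Q))" "\<pi> e \<in> \<pi> ` (W1 \<inter> Q)" using W1(1) assms(2) by (auto simp: homeo_patch_def)
 then obtain C where C: "\<pi> e \<in> C" "C \<subseteq> \<pi> ` (W1 \<inter> Q)" "good X0 C" using X0 unfolding locally_good_def by blast
 let ?W = "{e\<in>W1 \<inter> Q. \<pi> e \<in> C}"
 have "openin E ?W"
 proof -
  have "openin E {e\<in>topspace E. \<pi> e \<in> C}" using openin_continuous_map_preimage[OF c\<pi>] C(3) by (simp add: good_def)
  moreover have "?W = (W1 \<inter> Q) \<inter> {e\<in>topspace E. \<pi> e \<in> C}" using openin_subset[OF oW] by blast
  ultimately show ?thesis using oW by auto
 qed
 then have "homeo_patch E X0 \<pi> ?W \<rho>" by (rule homeo_patch_subset[OF p]) blast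
 moreover have "\<pi> ` ?W = C" using C(2) by auto
 ultimately show thesis using that[of ?W \<rho>] C W1(1) assms(2) by auto
qed

text \<open>A sheet whose boxes come from a patch inside \<open>W0\<close> and a patch inside
  \<open>Q\<close> is a neighbourhood of \<open>g\<close> on which lifts start in the first patch
  and, by \<open>covering_movable_lift\<close>, end in the second.\<close>

lemma Phi_continuous: "continuous_map (subtopology (Pi_top N s) dom) E Phi"
 unfolding continuous_map_open_subtopology[OF openin_dom]
proof (intro conjI ballI allI impI)
 show "Phi g \<in> topspace E" if "g \<in> dom" for g using Phi_mem(1)[OF that] .
 fix Q assume Q: "openin E Q"
 show "openin (Pi_top N s) {g\<in>dom. Phi g \<in> Q}"
 proof (rule openin_locally)
  fix g assume "g \<in> {g\<in>dom. Phi g \<in> Q}"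
  then have g: "g \<in> dom" "Phi g \<in> Q" by auto
  obtain \<gamma> L where \<gamma>: "\<gamma> \<in> fiber_paths N s" "g = arrow_of N s \<gamma>" "\<gamma> 0 \<in> hbox (\<pi> ` W0)" "lifts \<gamma> L" "Phi g = L 1"
   using Phi_cases[OF g(1)] .
  obtain W1 \<rho>1 where W1: "L 1 \<in> W1" "W1 \<subseteq> Q" "homeo_patch E X0 \<pi> W1 \<rho>1" "good X0 (\<pi> ` W1)"
   using good_patch[OF Q] g(2) \<gamma>(5) by metis
  have "L 0 \<in> W0" using \<gamma>(3,4) \<rho>0_W0(1) hboxD(1) by (auto simp: lifts_def)
  then obtain W \<rho> where W: "L 0 \<in> W" "W \<subseteq> W0" "homeo_patch E X0 \<pi> W \<rho>" "good X0 (\<pi> ` W)"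
   using good_patch[OF W0D(1)] by metis
  have "\<forall>t\<in>{0..1}. \<pi> (L t) = h1 (\<gamma> t)" using \<gamma>(4) unfolding lifts_def by blast
  then have L0: "\<pi> (L 0) = h1 (\<gamma> 0)" "\<pi> (L 1) = h1 (\<gamma> 1)" by simp_all
  have ends: "\<gamma> 0 \<in> hbox (\<pi> ` W)" "\<gamma> 1 \<in> hbox (\<pi> ` W1)"
   using L0 W(1) W1(1) h1_path(2)[OF \<gamma>(1) hboxD(2)[OF \<gamma>(3)], of 0] h1_path(2)[OF \<gamma>(1) hboxD(2)[OF \<gamma>(3)], of 1]
   by (auto simp: hbox_def image_iff) metis+
  let ?S = "sheet (\<pi> ` W) (\<pi> ` W1) (%t. h1 (\<gamma> t))"
  have "g \<in> ?S"
   unfolding \<gamma>(2) sheet_mem[OF \<gamma>(1)]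
   using ends h1_path(1)[OF \<gamma>(1) hboxD(2)[OF \<gamma>(3)]] hboxD(1) by (auto intro!: mov_eq)
  moreover have "?S \<subseteq> {g\<in>dom. Phi g \<in> Q}"
  proof
   fix g' assume "g' \<in> ?S"
   then obtain \<delta> where d: "\<delta> \<in> fiber_paths N s" "g' = arrow_of N s \<delta>" "\<delta> 0 \<in> hbox (\<pi> ` W)"
    "movable X0 (\<pi> ` W) (\<pi> ` W1) (%t. h1 (\<gamma> t)) (%t. h1 (\<delta> t))" unfolding sheet_def by blast
   have d0: "\<delta> 0 \<in> hbox (\<pi> ` W0)" using d(3) W(2) by (auto simp: hbox_def)
   obtain L' where L': "lifts \<delta> L'" using lift_exists[OF d(1) d0] .
   have "L' 0 \<in> W"
   proof -
    obtain e where "e \<in> W" "h1 (\<delta> 0) = \<pi> e" using hboxD(1)[OF d(3)] by blast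
    then show ?thesis using L' W(2) W0D(3) by (auto simp: lifts_def)
   qed
   then have "L' 1 \<in> W1"
    using covering_movable_lift[OF cov W(3) W1(3) d(4), of L L'] \<gamma>(4) L' W(1) W1(1) by (auto simp: lifts_def)
   then show "g' \<in> {g\<in>dom. Phi g \<in> Q}"
    using Phi_arrow_of[OF d(1) d0 L'] d(1,2) d0 W1(2) by (auto simp: dom_def topspace_Pi_top)
  qed
  ultimately show "\<exists>T. openin (Pi_top N s) T & g \<in> T & T \<subseteq> {g\<in>dom. Phi g \<in> Q}"
   using openin_sheet[OF X0 W1(4) W(4)] by blast
 qed
qed

text \<open>The inverse of \<^term>\<open>Phi\<close> on the arrows with source \<open>y\<close>; it exists since \<open>E\<close> is simply connected.\<close>

definition Psi :: "'a => 'e => (real => 'a) set" where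
 "Psi y e = arrow_of N s (%t. k (\<pi> ((SOME L. pathin E L & L 0 = \<rho>0 (h1 y) & L 1 = e) t), s y))"

lemma Psi_cases:
 assumes y: "y \<in> hbox (\<pi> ` W0)" and e: "e \<in> topspace E"
 obtains L \<gamma> where "pathin E L" "L 0 = \<rho>0 (h1 y)" "L 1 = e" "\<gamma> \<in> fiber_paths N s" "Psi y e = arrow_of N s \<gamma>"
  "!!t. [|0 \<le> t; t \<le> 1|] ==> h1 (\<gamma> t) = \<pi> (L t)" "\<gamma> 0 = y" "\<gamma> 1 = k (\<pi> e, s y)" "\<gamma> 1 \<in> preim N s U"
proof -
 let ?P = "%L. pathin E L & L 0 = \<rho>0 (h1 y) & L 1 = e"
 have "path_connected_space E" using sc by (simp add: simply_connected_top_def)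
 then have "\<exists>L. ?P L" using e \<rho>0_W0(3)[OF hboxD(1)[OF y]] unfolding path_connected_space_def by blast
 then have L: "?P (SOME L. ?P L)" by (rule someI_ex)
 define L where "L = (SOME L. ?P L)"
 define \<gamma> where "\<gamma> = (%t. k (\<pi> (L t), s y))"
 have p: "pathin E L" "L 0 = \<rho>0 (h1 y)" "L 1 = e" using L by (auto simp: L_def)
 have \<pi>L: "pathin X0 (%t. \<pi> (L t))" using pathin_compose[OF p(1) c\<pi>] by (simp add: o_def)
 have X: "\<pi> (L t) \<in> topspace X0" if "0 \<le> t" "t \<le> 1" for t using path_image_subset_topspace[OF \<pi>L] that by auto
 have g0: "\<gamma> 0 = y"
  using \<rho>0_W0(2)[OF hboxD(1)[OF y]] trD(5)[OF hboxD(3)[OF y]] by (simp add: \<gamma>_def p)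
 show thesis
 proof (rule that[OF p])
  show "\<gamma> \<in> fiber_paths N s" unfolding \<gamma>_def by (rule k_path[OF \<pi>L hboxD(2)[OF y]])
  show "Psi y e = arrow_of N s \<gamma>" by (simp add: Psi_def \<gamma>_def L_def)
  show "h1 (\<gamma> t) = \<pi> (L t)" if "0 \<le> t" "t \<le> 1" for t
   unfolding \<gamma>_def by (rule trD(7)[OF X[OF that] hboxD(2)[OF y]])
  show "\<gamma> 1 = k (\<pi> e, s y)" by (simp add: \<gamma>_def p)
  show "\<gamma> 1 \<in> preim N s U" unfolding \<gamma>_def by (rule trD(6)[OF X hboxD(2)[OF y]]) auto
 qed (rule g0)
qed

lemma Psi_ends:
 assumes "y \<in> hbox (\<pi> ` W0)" "e \<in> topspace E"
 shows "arrow_src (Psi y e) = y" "arrow_tgt (Psi y e) = k (\<pi> e, s y)" "Psi y e \<in> topspace (Pi_top N s)"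
proof -
 obtain \<gamma> where g: "\<gamma> \<in> fiber_paths N s" "Psi y e = arrow_of N s \<gamma>" "\<gamma> 0 = y" "\<gamma> 1 = k (\<pi> e, s y)"
  using Psi_cases[OF assms] by metis
 show "arrow_src (Psi y e) = y" "arrow_tgt (Psi y e) = k (\<pi> e, s y)" "Psi y e \<in> topspace (Pi_top N s)"
  unfolding topspace_Pi_top g(2) using g(1,3,4) by simp_all
qed

text \<open>The lift of the arrow and the path chosen by \<open>Psi\<close> have the same ends in
  the simply connected space \<open>E\<close>; their homotopy projects to one between
  representatives of the two arrows.\<close>

lemma Psi_Phi:
 assumes "g \<in> dom"
 shows "Psi (arrow_src g) (Phi g) = g"
proof -
 obtain \<delta> L' where d: "\<delta> \<in> fiber_paths N s" "g = arrow_of N s \<delta>" "\<delta> 0 \<in> hbox (\<pi> ` W0)" "lifts \<delta> L'" "Phi g = L' 1"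
  "arrow_src g = \<delta> 0" using Phi_cases[OF assms] .
 have y: "arrow_src g \<in> hbox (\<pi> ` W0)" using d by simp
 obtain L \<gamma> where \<gamma>: "pathin E L" "L 0 = \<rho>0 (h1 (arrow_src g))" "L 1 = Phi g" "\<gamma> \<in> fiber_paths N s"
  "Psi (arrow_src g) (Phi g) = arrow_of N s \<gamma>" "!!t. [|0 \<le> t; t \<le> 1|] ==> h1 (\<gamma> t) = \<pi> (L t)" "\<gamma> 0 = arrow_src g"
  using Psi_cases[OF y Phi_mem(1)[OF assms]] by metis
 have L': "pathin E L'" "L' 0 = \<rho>0 (h1 (\<delta> 0))" "!!t. [|0 \<le> t; t \<le> 1|] ==> \<pi> (L' t) = h1 (\<delta> t)"
  using d(4) by (auto simp: lifts_def)
 have "path_homotopic E L L'" by (rule simply_connected_paths[OF sc \<gamma>(1) L'(1)]) (use \<gamma>(2,3) d(5,6) L'(2) in auto)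
 from mov_compose[OF this[unfolded path_homotopic_mov] c\<pi>, of "%u v. u = \<pi> (L 0) & v = \<pi> (L 1)"]
 have "mov X0 (%u v. u = \<pi> (L 0) & v = \<pi> (L 1)) (%t. \<pi> (L t)) (%t. \<pi> (L' t))" by blast
 then have "mov X0 (%u v. u = \<pi> (L 0) & v = \<pi> (L 1)) (%t. h1 (\<gamma> t)) (%t. h1 (\<delta> t))"
  by (rule mov_cong) (use \<gamma>(6) L'(3) in auto)
 then have "path_homotopic X0 (%t. h1 (\<gamma> t)) (%t. h1 (\<delta> t))"
  unfolding path_homotopic_mov using \<gamma>(6)[of 0] \<gamma>(6)[of 1] by simp
 then have "arrow_of N s \<gamma> = arrow_of N s \<delta>"
  by (intro arrow_of_eq_h1[OF \<gamma>(4) d(1) _ _ hboxD(2)[OF d(3)]]) (use \<gamma>(7) d(6) in auto)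
 then show ?thesis using \<gamma>(5) d(2) by simp
qed

text \<open>The paths entering \<open>Psi\<close> are arbitrary choices, so continuity is not
  visible from the definition. Near a point all values lie in one sheet, where an arrow is
  determined by its ends, and \<open>Psi y\<close> agrees with the continuous section of that
  sheet.\<close>

lemma Psi_continuous:
 assumes y: "y \<in> hbox (\<pi> ` W0)"
 shows "continuous_map E (Pi_top N s) (Psi y)"
 unfolding continuous_map_def
proof (intro conjI allI impI)
 show "Psi y \<in> topspace E \<rightarrow> topspace (Pi_top N s)" using Psi_ends(3)[OF y] by blast
 fix Q assume Q: "openin (Pi_top N s) Q"
 note sy = hboxD(2)[OF y]
 show "openin E {e\<in>topspace E. Psi y e \<in> Q}"
 proof (rule openin_locally)
  fix e assume "e \<in> {e\<in>topspace E. Psi y e \<in> Q}"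
  then have e: "e \<in> topspace E" "Psi y e \<in> Q" by auto
  obtain L \<gamma> where \<gamma>: "pathin E L" "L 0 = \<rho>0 (h1 y)" "L 1 = e" "\<gamma> \<in> fiber_paths N s" "Psi y e = arrow_of N s \<gamma>"
   "!!t. [|0 \<le> t; t \<le> 1|] ==> h1 (\<gamma> t) = \<pi> (L t)" "\<gamma> 0 = y" using Psi_cases[OF y e(1)] by metis
  obtain W \<rho> where W: "e \<in> W" "homeo_patch E X0 \<pi> W \<rho>" "good X0 (\<pi> ` W)"
   using good_patch[OF openin_topspace e(1)] by metis
  have oW: "openin E W" and inv: "!!e. e \<in> W ==> \<rho> (\<pi> e) = e" and c\<rho>: "continuous_map (subtopology X0 (\<pi> ` W)) E \<rho>"
   using W(2) by (auto simp: homeo_patch_def)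
  have b: "h1 y \<in> \<pi> ` W0" by (rule hboxD(1)[OF y])
  obtain B where B: "h1 y \<in> B" "good X0 B" using X0 W0D(2) b unfolding locally_good_def by blast
  have yB: "y \<in> hbox B" using B(1) hboxD(3)[OF y] by (simp add: hbox_def)
  let ?S = "sheet B (\<pi> ` W) (%t. \<pi> (L t))"
  have \<pi>L: "pathin X0 (%t. \<pi> (L t))" using pathin_compose[OF \<gamma>(1) c\<pi>] by (simp add: o_def)
  have L01: "\<pi> (L 0) \<in> B" "\<pi> (L 1) \<in> \<pi> ` W" using B(1) \<rho>0_W0(2)[OF b] \<gamma>(2,3) W(1) by auto
  \<comment> \<open>The branch \<open>\<rho>\<close> carries the canonical paths of the good set
    below up to \<open>W\<close>.\<close>
  have pcW: "path_connected_space (subtopology E W)"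
   unfolding path_connected_space_def
  proof (intro ballI)
   fix a c assume "a \<in> topspace (subtopology E W)" "c \<in> topspace (subtopology E W)"
   then have ac: "a \<in> W" "c \<in> W" by auto
   obtain kW where kW: "contr X0 (\<pi> ` W) kW" and o: "openin X0 (\<pi> ` W)" using W(3) by (auto simp: good_def)
   let ?p = "%t. kW (t, \<pi> a, \<pi> c)"
   have m: "?p t \<in> \<pi> ` W" if "0 \<le> t" "t \<le> 1" for t by (rule contr_mem[OF kW o _ _ that]) (use ac in auto)
   have "pathin (subtopology X0 (\<pi> ` W)) ?p"
    unfolding pathin_subtopology using pathin_contr[OF kW o] m ac by auto
   from pathin_compose[OF this c\<rho>] have "pathin E (%t. \<rho> (?p t))" by (simp add: o_def)
   moreover have "\<rho> (?p t) \<in> W" if "0 \<le> t" "t \<le> 1" for t using m[OF that] inv by auto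
   ultimately show "\<exists>g. pathin (subtopology E W) g & g 0 = a & g 1 = c"
    using contr_simps[OF kW] ac inv by (intro exI[of _ "%t. \<rho> (?p t)"]) (auto simp: pathin_subtopology)
  qed
  \<comment> \<open>In the simply connected space \<open>E\<close> the chosen paths to
    \<open>e\<close> and to \<open>e'\<close> can be moved into each other with their ends in
    \<open>W\<close>; projected to \<open>X0\<close> this puts both arrows in the same
    sheet.\<close>
  have inS: "Psi y e' \<in> ?S" if e': "e' \<in> W" for e'
  proof -
   have e'E: "e' \<in> topspace E" using e' oW openin_subset by blast
   obtain L' \<delta> where d: "pathin E L'" "L' 0 = \<rho>0 (h1 y)" "L' 1 = e'" "\<delta> \<in> fiber_paths N s" "Psi y e' = arrow_of N s \<delta>"
    "!!t. [|0 \<le> t; t \<le> 1|] ==> h1 (\<delta> t) = \<pi> (L' t)" "\<delta> 0 = y" "\<delta> 1 \<in> preim N s U" using Psi_cases[OF y e'E] by metis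
   have "movable E {\<rho>0 (h1 y)} W L L'"
    by (rule simply_connected_movable[OF sc \<gamma>(1) _ d(1) _ _ _ pcW]) (use \<gamma>(2,3) d(2,3) W(1) e' in auto)
   from mov_compose[OF this c\<pi>, of "%u v. u \<in> B & v \<in> \<pi> ` W"]
   have "movable X0 B (\<pi> ` W) (%t. \<pi> (L t)) (%t. \<pi> (L' t))" using B(1) \<rho>0_W0(2)[OF b] by auto
   then have "movable X0 B (\<pi> ` W) (%t. \<pi> (L t)) (%t. h1 (\<delta> t))" by (rule mov_cong) (use d(6) in auto)
   then show ?thesis
    unfolding d(5) sheet_mem[OF d(4)] using yB d(3,6-8) e' by (auto simp: hbox_def)
  qed
  obtain \<sigma> where \<sigma>: "continuous_map (subtopology (prod_topology (mtop N) (mtop N)) (fiber_product N s \<inter> hbox (\<pi> ` W) \<times> hbox B))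
    (Pi_top N s) \<sigma>"
   "!!y z. [|(y, z) \<in> fiber_product N s; y \<in> hbox (\<pi> ` W); z \<in> hbox B|] ==>
     \<sigma> (y, z) \<in> ?S & arrow_tgt (\<sigma> (y, z)) = y & arrow_src (\<sigma> (y, z)) = z"
   using sheet_section[OF W(3) B(2) \<pi>L L01] by blast
  let ?k = "%e. k (\<pi> e, s y)"
  have WE: "e' \<in> topspace E" if "e' \<in> W" for e' using that openin_subset[OF oW] by blast
  have \<pi>X: "\<pi> e' \<in> topspace X0" if "e' \<in> W" for e' using c\<pi> WE[OF that] by (auto simp: continuous_map_def)
  have kW: "?k e' \<in> hbox (\<pi> ` W)" "(?k e', y) \<in> fiber_product N s" if "e' \<in> W" for e'
   using trD(6)[OF \<pi>X[OF that] sy] trD(7)[OF \<pi>X[OF that] sy] trD(8)[OF \<pi>X[OF that] sy] hboxD(3)[OF y] that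
   by (auto simp: hbox_def fiber_product_def preim_def)
  have eq: "Psi y e' = \<sigma> (?k e', y)" if "e' \<in> W" for e'
   using sheet_inj[OF W(3) B(2) inS[OF that], of "\<sigma> (?k e', y)"] \<sigma>(2)[OF kW(2)[OF that] kW(1)[OF that] yB]
    Psi_ends[OF y WE[OF that]] by auto
  have "continuous_map E (mtop N) ?k"
   using continuous_map_compose[OF c\<pi> continuous_k_fiber[OF sy]] by (auto simp: continuous_map_in_subtopology o_def)
  then have "continuous_map (subtopology E W) (subtopology (prod_topology (mtop N) (mtop N)) (fiber_product N s \<inter> hbox (\<pi> ` W) \<times> hbox B))
    (%e. (?k e, y))"
   unfolding continuous_map_in_subtopology
   using kW yB hboxD(3)[OF y] continuous_map_from_subtopology by (auto simp: continuous_map_paired preim_def)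
  from continuous_map_compose[OF this \<sigma>(1)]
  have "continuous_map (subtopology E W) (Pi_top N s) (%e. \<sigma> (?k e, y))" by (simp add: o_def)
  then have "openin E {e\<in>W. \<sigma> (?k e, y) \<in> Q}" using Q unfolding continuous_map_open_subtopology[OF oW] by blast
  then show "\<exists>T. openin E T & e \<in> T & T \<subseteq> {e\<in>topspace E. Psi y e \<in> Q}"
   using eq W(1) e(2) WE by (intro exI[of _ "{e\<in>W. \<sigma> (?k e, y) \<in> Q}"]) auto
 qed
qed

lemma \<pi>_F0: "e \<in> topspace E ==> \<pi> e \<in> topspace F0"
 using c\<pi> tF0 by (auto simp: continuous_map_def)

text \<open>\<open>Phi\<close> and, for fixed source \<open>y\<close>, \<open>Psi y\<close> are
  continuous for the leaf topologies, and \<open>Psi y\<close> undoes \<open>Phi\<close>. For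
  \<open>Phi\<close> one restricts to \<open>dom\<close>, which does not cut leaves because it is
  described by the source.\<close>

lemma leaf_Phi_iff:
 assumes g: "g \<in> dom" and g': "g' \<in> dom"
 shows "leaf_of (Pi_fol N F s) g = leaf_of (Pi_fol N F s) g' \<longleftrightarrow>
   arrow_src g = arrow_src g' & leaf_of (pullback_fol E F0 \<pi>) (Phi g) = leaf_of (pullback_fol E F0 \<pi>) (Phi g')"
proof
 let ?P = "Pi_fol N F s" and ?E = "pullback_fol E F0 \<pi>"
 have gt: "g \<in> topspace (Pi_top N s)" "g' \<in> topspace (Pi_top N s)" using g g' by (auto simp: dom_def)
 {
  assume l: "leaf_of ?P g = leaf_of ?P g'"
  have D: "dom = {g\<in>topspace ?P. arrow_src g \<in> hbox (\<pi> ` W0)}" by (simp add: dom_def Pi_fol_topspace)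
  have "continuous_map (subtopology ?P dom) (subtopology (Pi_top N s) dom) (%g. g)"
   using continuous_map_from_subtopology[OF Pi_fol_maps(1)[OF tF]] by (auto simp: continuous_map_in_subtopology)
  from continuous_map_compose[OF this Phi_continuous]
  have 1: "continuous_map (subtopology ?P dom) E Phi" by (simp add: o_def)
  have "continuous_map (subtopology ?P dom) (subtopology F (preim N s U)) arrow_tgt"
   using continuous_map_from_subtopology[OF Pi_fol_maps(2)[OF tF]] Phi_mem(3) by (auto simp: continuous_map_in_subtopology)
  from continuous_map_compose[OF this hF]
  have "continuous_map (subtopology ?P dom) F0 (%g. h1 (arrow_tgt g))" by (simp add: o_def)
  then have 2: "continuous_map (subtopology ?P dom) F0 (%g. \<pi> (Phi g))"
   by (rule continuous_map_eq) (use Phi_mem(2) in auto)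
  have 3: "continuous_map (subtopology ?P dom) ?E Phi"
   using 1 2 continuous_map_pullback_fol[of E \<pi> F0 _ Phi, OF \<pi>_F0] by blast
  have "leaf_of (subtopology ?P dom) g = leaf_of (subtopology ?P dom) g'"
   using leaf_of_subtopology[OF Pi_fol_maps(3)[OF tF] D g g'] l by simp
  then have "leaf_of ?E (Phi g) = leaf_of ?E (Phi g')"
   by (intro leaf_eq_continuous_map[OF 3]) (use g g' gt in "auto simp: Pi_fol_topspace")
  then show "arrow_src g = arrow_src g' & leaf_of ?E (Phi g) = leaf_of ?E (Phi g')"
   using Pi_fol_leaf_src[OF tF gt l] by blast
 next
  assume r: "arrow_src g = arrow_src g' & leaf_of ?E (Phi g) = leaf_of ?E (Phi g')"
  define y where "y = arrow_src g"
  have y: "y \<in> hbox (\<pi> ` W0)" using g by (simp add: dom_def y_def)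
  have id: "continuous_map ?E E (%e. e)" "continuous_map ?E F0 \<pi>"
   using continuous_map_pullback_fol[of E \<pi> F0 ?E "%e. e", OF \<pi>_F0] by auto
  have "continuous_map ?E ?P (Psi y)"
   unfolding continuous_map_Pi_fol[OF tF]
  proof (intro conjI)
   show "continuous_map ?E (Pi_top N s) (Psi y)"
    using continuous_map_compose[OF id(1) Psi_continuous[OF y]] by (simp add: o_def)
   have "continuous_map ?E F (%e. k (\<pi> e, s y))"
    using continuous_map_compose[OF id(2) kF[OF hboxD(2)[OF y]]] by (simp add: o_def)
   then show "continuous_map ?E F (%e. arrow_tgt (Psi y e))"
    by (rule continuous_map_eq) (use Psi_ends[OF y] in "auto simp: topspace_pullback_fol")
   have "continuous_map ?E (discrete_topology (topspace (mtop N))) (%_. y)"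
    using hboxD(3)[OF y] by (auto simp: preim_def)
   then show "continuous_map ?E (discrete_topology (topspace (mtop N))) (%e. arrow_src (Psi y e))"
    by (rule continuous_map_eq) (use Psi_ends[OF y] in "auto simp: topspace_pullback_fol")
  qed
  from leaf_eq_continuous_map[OF this, of "Phi g" "Phi g'"]
  have "leaf_of ?P (Psi y (Phi g)) = leaf_of ?P (Psi y (Phi g'))"
   using r Phi_mem(1)[OF g] Phi_mem(1)[OF g'] by (simp add: topspace_pullback_fol)
  then show "leaf_of ?P g = leaf_of ?P g'"
   using Psi_Phi[OF g] Psi_Phi[OF g'] r by (simp add: y_def)
 }
qed

lemma openin_Phi: "openin E Q ==> openin (Pi_top N s) {g\<in>dom. Phi g \<in> Q}"
 using Phi_continuous unfolding continuous_map_open_subtopology[OF openin_dom] by blast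

text \<open>A leaf that meets \<open>dom\<close> stays in \<open>dom\<close>, since the source is
  constant along it; the rest is \<open>leaf_Phi_iff\<close>.\<close>

lemma saturated_Phi:
 assumes Q: "saturated E (leaf_of (pullback_fol E F0 \<pi>)) Q"
 shows "saturated (Pi_top N s) (leaf_of (Pi_fol N F s)) {g\<in>dom. Phi g \<in> Q}"
 unfolding saturated_def
proof (intro ballI impI)
 fix g g'
 assume g: "g \<in> {g\<in>dom. Phi g \<in> Q}" and g': "g' \<in> topspace (Pi_top N s)"
  and l: "leaf_of (Pi_fol N F s) g = leaf_of (Pi_fol N F s) g'"
 have d: "g \<in> dom" "Phi g \<in> Q" "g \<in> topspace (Pi_top N s)" using g by (auto simp: dom_def)
 have d': "g' \<in> dom" using d(1) Pi_fol_leaf_src[OF tF d(3) g' l] g' by (simp add: dom_def)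
 then show "g' \<in> {g\<in>dom. Phi g \<in> Q}"
  using leaf_Phi_iff[OF d(1) d'] l Q d(2) Phi_mem(1)[OF d'] unfolding saturated_def by blast
qed

end

section \<open>Bundles of foliations\<close>

text \<open>Moves a chosen value to zero, so that fibers become zero sets as \<open>cut_out\<close>
  asks; local sections are precomposed with the opposite translation.\<close>

lemma subm_translate:
 assumes X: "manifold X" and c: "subm X q B c" and a: "!!i. q \<le> i ==> a i = 0"
 shows "subm X q B (%y i. c y i - a i)"
 unfolding subm_def
proof (intro conjI ballI)
 have sc: "smooth_fn X q B c" using c by (simp add: subm_def)
 show "smooth_fn X q B (%y i. c y i - a i)"
  unfolding smooth_fn_def
 proof (intro conjI allI impI ballI)
  show "openin (mtop X) B" by (rule subm_openin[OF c])
  show "c x i - a i = 0" if "x \<in> B" "q \<le> i" for x i using smooth_fn_zero_tail[OF sc that] a[OF that(2)] by simp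
  fix k W \<sigma> assume p: "plot X k W \<sigma> & \<sigma> ` W \<subseteq> B"
  have "smooth_into k q W (%w. c (\<sigma> w))" using smooth_fn_plot[OF sc] p by blast
  then show "smooth_into k q W ((%y i. c y i - a i) \<circ> \<sigma>)"
   using p unfolding smooth_into_def o_def by (auto intro!: Ck_on_diff Ck_on_const dest: plot_openin)
 qed
 fix x assume "x \<in> B"
 then obtain W \<tau> where W: "plot X q W \<tau>" "c x \<in> W" "\<tau> ` W \<subseteq> B" "\<tau> (c x) = x" "!!w. w \<in> W ==> c (\<tau> w) = w"
  using c unfolding subm_def section_at_def by blast
 let ?g = "%w i. w i + a i" let ?W = "{w\<in>topspace (EN q). ?g w \<in> W}"
 have g: "smooth_into q q (topspace (EN q)) ?g"
  unfolding smooth_into_def by (auto intro!: Ck_on_add Ck_on_coordinate Ck_on_const)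
 have o: "openin (EN q) ?W"
  by (rule openin_smooth_preimage[OF openin_topspace plot_openin[OF W(1)] g]) (use a in "auto simp: topspace_Euclidean_space")
 have "plot X q ?W (%w. \<tau> (?g w))"
  by (rule plot_compose[OF X W(1) o]) (use smooth_into_subset[OF g] in auto)
 moreover have e: "?g (%i. c x i - a i) = c x" by simp
 moreover have "(%i. c x i - a i) \<in> topspace (EN q)"
  using smooth_fn_zero_tail[OF sc \<open>x \<in> B\<close>] a by (simp add: topspace_Euclidean_space)
 ultimately have "section_at X q B (%y i. c y i - a i) x ?W (%w. \<tau> (?g w))"
  unfolding section_at_def using W(2-5) by auto
 then show "\<exists>W \<tau>. section_at X q B (%y i. c y i - a i) x W \<tau>" by blast
qed

text \<open>Codimension zero: the map to \<open>EN 0\<close> is a submersion with constant sections,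
  so open submanifolds are covered by the results on \<open>cut_out\<close>.\<close>

lemma cut_out_open:
 assumes X: "manifold X" and A: "openin (mtop X) A"
 shows "cut_out X 0 A"
proof -
 have o: "openin (EN 0) (topspace (EN 0))" by simp
 have "subm X 0 A (%_ _. 0)"
  unfolding subm_def
 proof (intro conjI ballI)
  show "smooth_fn X 0 A (%_ _. 0)" using A by (simp add: smooth_fn_def smooth_into_def)
  fix x assume x: "x \<in> A"
  have "plot X 0 (topspace (EN 0)) (%_. x)" by (rule plot_const[OF o _ X]) (use x A openin_subset in blast)
  then have "section_at X 0 A (%_ _. 0) x (topspace (EN 0)) (%_. x)"
   using x by (auto simp: section_at_def topspace_Euclidean_space)
  then show "\<exists>W \<tau>. section_at X 0 A (%_ _. 0) x W \<tau>" by blast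
 qed
 then show ?thesis unfolding cut_out_def using A openin_subset by (auto intro!: exI[of _ A])
qed

lemma open_submfd:
 assumes "manifold X" "openin (mtop X) A"
 shows "manifold (submfd (mdim X) X A)"
  "plot (submfd (mdim X) X A) k W \<sigma> \<longleftrightarrow> plot X k W \<sigma> & \<sigma> ` W \<subseteq> A"
 using manifold_submfd[OF assms(1) cut_out_open[OF assms]] plot_submfd_iff[OF assms(1) cut_out_open[OF assms]] by auto

text \<open>Serves the empty bundle, which is kept apart because a point is what yields
  \<open>mdim M \<le> mdim N\<close> and a model fiber. The leaf space is the empty
  manifold.\<close>

lemma strictly_simple_empty:
 assumes "topspace (mtop X) = {}" "topspace F = {}"
 shows "strictly_simple X F"
proof -
 let ?Y = "\<lparr>mdim = 0, mtop = discrete_topology {}, atlas = {}\<rparr> :: 'a set mfd"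
 have "leaves F = {}" using assms(2) by (simp add: connected_components_of_def)
 moreover have "manifold ?Y" "Hausdorff_space (mtop ?Y)" by (simp_all add: manifold_def)
 moreover have "quotient_map (mtop X) (mtop ?Y) (leaf_of F)" using assms(1) by (auto simp: quotient_map_def)
 moreover have "submersion X ?Y (leaf_of F)"
  using assms(1) by (simp add: submersion_def smooth_map_def continuous_map_def)
 ultimately show ?thesis unfolding strictly_simple_def by (intro exI[of _ ?Y]) simp
qed

locale foliated_bundle =
 fixes N :: "'a mfd" and M :: "'b mfd" and F :: "'a topology" and s :: "'a => 'b"
 assumes lt: "locally_trivial_foliation_bundle N F M s"
  and con: "!!x. x \<in> topspace (mtop M) ==> connected_space (Fib N s x)"
  and ne: "topspace (mtop N) \<noteq> {}"
begin

lemma N: "manifold N" and HN: "Hausdorff_space (mtop N)" and M: "manifold M" and sub: "submersion N M s"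
 and surj: "s ` topspace (mtop N) = topspace (mtop M)" and tF: "topspace F = topspace (mtop N)"
 using lt unfolding locally_trivial_foliation_bundle_def foliation_def by simp_all

lemma sm: "smooth_map N M s" using sub by (simp add: submersion_def)

lemma cs: "continuous_map (mtop N) (mtop M) s" using sm by (simp add: smooth_map_def)

lemma s_top: "y \<in> topspace (mtop N) ==> s y \<in> topspace (mtop M)" using surj by blast

abbreviation "Bs V \<equiv> {y\<in>topspace (mtop N). s y \<in> V}"

lemma subm_s: "(V, \<psi>) \<in> atlas M ==> subm N (mdim M) (Bs V) (%y. \<psi> (s y))"
 using submersion_imp_subm[OF N M sub] by (simp add: o_def)

lemma chart_eqI:
 assumes V: "(V, \<psi>) \<in> atlas M" and "u \<in> V" "v \<in> V" "!!j. j < mdim M ==> \<psi> u j = \<psi> v j"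
 shows "u = v"
proof -
 note c = is_chartD[OF manifold_chart[OF M V]]
 have "\<psi> u j = \<psi> v j" for j using assms(4) c(7)[OF assms(2)] c(7)[OF assms(3)] by (cases "j < mdim M") auto
 then show ?thesis using c(4) assms(2,3) by (metis ext)
qed

lemma chart_tail: "[|(V, \<psi>) \<in> atlas M; u \<in> V; mdim M \<le> i|] ==> \<psi> u i = 0"
 using is_chartD(7)[OF manifold_chart[OF M]] by blast

text \<open>A chart straightened along \<open>s\<close> exists at any point of \<open>N\<close>. The
  inequality makes the truncated differences of dimensions genuine ones.\<close>

lemma m_le: "mdim M \<le> mdim N"
proof -
 obtain y where y: "y \<in> topspace (mtop N)" using ne by blast
 obtain V \<psi> where V: "(V, \<psi>) \<in> atlas M" "s y \<in> V" using manifold_cover[OF M s_top[OF y]] by blast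
 then show ?thesis using subm_straightened_chart[OF N subm_s[OF V(1)], of y] y by blast
qed

lemma cut_out_fiber: "cut_out N (mdim M) (fiber N s x)"
 unfolding cut_out_def
proof (intro conjI ballI)
 show "fiber N s x \<subseteq> topspace (mtop N)" by (auto simp: preim_def)
 fix y assume "y \<in> fiber N s x"
 then have y: "y \<in> topspace (mtop N)" "s y = x" by (auto simp: preim_def)
 obtain V \<psi> where V: "(V, \<psi>) \<in> atlas M" "x \<in> V" using manifold_cover[OF M s_top[OF y(1)]] y(2) by blast
 have "subm N (mdim M) (Bs V) (%y i. \<psi> (s y) i - \<psi> x i)"
  by (rule subm_translate[OF N subm_s[OF V(1)] chart_tail[OF V]])
 moreover have "fiber N s x \<inter> Bs V = {y\<in>Bs V. \<forall>j<mdim M. \<psi> (s y) j - \<psi> x j = 0}"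
  using chart_eqI[OF V(1) _ V(2)] V(2) by (auto simp: preim_def)
 ultimately show "\<exists>B \<kappa>. y \<in> B & subm N (mdim M) B \<kappa> & fiber N s x \<inter> B = {y\<in>B. \<forall>j<mdim M. \<kappa> y j = 0}"
  using y V(2) by (intro exI[of _ "Bs V"] exI[of _ "%y i. \<psi> (s y) i - \<psi> x i"]) simp
qed

abbreviation "NF x \<equiv> fiber_mfd N M s x"

lemma NF: "manifold (NF x)" "mtop (NF x) = Fib N s x"
 "plot (NF x) k W \<sigma> \<longleftrightarrow> plot N k W \<sigma> & \<sigma> ` W \<subseteq> fiber N s x"
 unfolding fiber_mfd_def using manifold_submfd[OF N cut_out_fiber] plot_submfd_iff[OF N cut_out_fiber] by simp_all

lemma tFib [simp]: "topspace (Fib N s x) = fiber N s x" by (auto simp: preim_def)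

lemma fiber_fol_top [simp]: "topspace (fiber_fol N F s x) = fiber N s x"
 by (auto simp: fiber_fol_def preim_def tF)

text \<open>Separates local triviality into its topological, smooth and leafwise content, the smooth
  part in terms of plots.\<close>

lemma trivialize:
 assumes x0: "x0 \<in> topspace (mtop M)" and x: "x \<in> topspace (mtop M)"
 obtains U h k where "x \<in> U" "trivialization N (mtop M) s (Fib N s x0) U h k"
  "!!l W \<sigma>. [|plot N l W \<sigma>; \<sigma> ` W \<subseteq> preim N s U|] ==> plot (NF x0) l W (%w. fst (h (\<sigma> w)))"
  "!!l W \<alpha> \<beta>. [|plot (NF x0) l W \<alpha>; plot M l W \<beta>; \<beta> ` W \<subseteq> U|] ==> plot N l W (%w. k (\<alpha> w, \<beta> w))"
  "continuous_map (subtopology F (preim N s U)) (fiber_fol N F s x0) (%y. fst (h y))"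
  "!!u. u \<in> U ==> continuous_map (fiber_fol N F s x0) F (%a. k (a, u))"
proof -
 obtain U h where U: "openin (mtop M) U" "x \<in> U"
  and d: "diffeomorphism (submfd (mdim N) N (preim N s U)) (prod_mfd (NF x0) (submfd (mdim M) M U)) h"
  and sn: "\<forall>y\<in>preim N s U. snd (h y) = s y"
  and hF: "homeomorphic_map (subtopology F (preim N s U)) (prod_topology (fiber_fol N F s x0) (discrete_topology U)) h"
  using lt x0 x unfolding locally_trivial_foliation_bundle_def by blast
 let ?A = "submfd (mdim N) N (preim N s U)" and ?U = "submfd (mdim M) M U" let ?P = "prod_mfd (NF x0) ?U"
 obtain k where hk: "homeomorphic_maps (mtop ?A) (mtop ?P) h k" and sk: "smooth_map ?P ?A k" and sh: "smooth_map ?A ?P h"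
  using d unfolding diffeomorphism_def by blast
 have oU: "openin (mtop N) (preim N s U)" using openin_continuous_map_preimage[OF cs U(1)] by (simp add: preim_def)
 note A = open_submfd[OF N oU] and MU = open_submfd[OF M U(1)]
 note P = manifold_prod[OF NF(1)[of x0] MU(1)] and pP = plot_prod_iff[OF NF(1)[of x0] MU(1)]
 have hk': "homeomorphic_maps (subtopology (mtop N) (preim N s U)) (prod_topology (Fib N s x0) (subtopology (mtop M) U)) h k"
  using hk by (simp add: NF(2))
 have tr: "trivialization N (mtop M) s (Fib N s x0) U h k"
  unfolding trivialization_def using U(1) hk' sn by blast
 have 1: "plot (NF x0) l W (%w. fst (h (\<sigma> w)))" if "plot N l W \<sigma>" "\<sigma> ` W \<subseteq> preim N s U" for l W \<sigma>
 proof -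
  have "plot ?P l W (%w. h (\<sigma> w))" by (rule smooth_map_plot[OF A(1) P sh]) (use A(2) that in blast)
  then show ?thesis unfolding pP by (simp add: o_def)
 qed
 have 2: "plot N l W (%w. k (\<alpha> w, \<beta> w))" if "plot (NF x0) l W \<alpha>" "plot M l W \<beta>" "\<beta> ` W \<subseteq> U" for l W \<alpha> \<beta>
 proof -
  have "plot ?P l W (%w. (\<alpha> w, \<beta> w))" unfolding pP MU(2) using that by (simp add: o_def)
  then have "plot ?A l W (%w. k (\<alpha> w, \<beta> w))" by (rule smooth_map_plot[OF P A(1) sk])
  then show ?thesis using A(2) by blast
 qed
 let ?PF = "prod_topology (fiber_fol N F s x0) (discrete_topology U)"
 have 3: "continuous_map (subtopology F (preim N s U)) (fiber_fol N F s x0) (%y. fst (h y))"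
  using continuous_map_compose[OF homeomorphic_imp_continuous_map[OF hF] continuous_map_fst] by (simp add: o_def)
 obtain k' where k': "homeomorphic_maps (subtopology F (preim N s U)) ?PF h k'"
  using hF unfolding homeomorphic_map_maps by blast
 have ck': "continuous_map ?PF F k'" using k' by (auto simp: homeomorphic_maps_def continuous_map_in_subtopology)
 \<comment> \<open>The inverse for the leaf topologies and the smooth inverse agree, as both invert
   the same \<open>h\<close> on the preimage of \<open>U\<close>.\<close>
 have kk: "k' (a, u) = k (a, u)" if "a \<in> fiber N s x0" "u \<in> U" for a u
 proof -
  have m: "(a, u) \<in> topspace ?PF" using that by simp
  have e: "h (k' (a, u)) = (a, u)" using k' m unfolding homeomorphic_maps_def by blast
  have "k' (a, u) \<in> topspace (subtopology F (preim N s U))" using k' m by (auto simp: homeomorphic_maps_def continuous_map_def)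
  then have "k' (a, u) \<in> topspace (subtopology (mtop N) (preim N s U))" by (simp add: tF)
  then have "k (h (k' (a, u))) = k' (a, u)" using hk' unfolding homeomorphic_maps_def by blast
  then show ?thesis using e by simp
 qed
 have 4: "continuous_map (fiber_fol N F s x0) F (%a. k (a, u))" if "u \<in> U" for u
 proof -
  have "continuous_map (fiber_fol N F s x0) ?PF (%a. (a, u))" using that by (simp add: continuous_map_paired)
  from continuous_map_compose[OF this ck'] have "continuous_map (fiber_fol N F s x0) F (%a. k' (a, u))" by (simp add: o_def)
  then show ?thesis by (rule continuous_map_eq) (use kk that in simp)
 qed
 show thesis by (rule that[OF U(2) tr 1 2 3 4])
qed

lemma locally_good_fiber: "locally_good (Fib N s x)"
 using manifold_locally_good[OF NF(1)[of x]] NF(2) by simp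

text \<open>Good sets are path connected by their canonical paths, so the fiber is locally path
  connected and connectedness is enough.\<close>

lemma path_connected_fiber:
 assumes "x \<in> topspace (mtop M)"
 shows "path_connected_space (Fib N s x)"
proof -
 have "locally_path_connected_space (Fib N s x)"
  unfolding locally_path_connected_space_def neighbourhood_base_of
 proof (intro allI impI)
  fix W y assume "openin (Fib N s x) W & y \<in> W"
  then obtain C where C: "y \<in> C" "C \<subseteq> W" "good (Fib N s x) C"
   using locally_good_fiber[of x] unfolding locally_good_def by blast
  obtain k where k: "contr (Fib N s x) C k" and o: "openin (Fib N s x) C" using C(3) unfolding good_def by blast
  have "path_connectedin (Fib N s x) C"
   unfolding path_connectedin
  proof (intro conjI ballI)
   show "C \<subseteq> topspace (Fib N s x)" by (rule openin_subset[OF o])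
   fix a b assume ab: "a \<in> C" "b \<in> C"
   then show "\<exists>g. pathin (Fib N s x) g & g \<in> {0..1} \<rightarrow> C & g 0 = a & g 1 = b"
    using pathin_contr[OF k o ab] contr_mem[OF k o ab] contr_simps[OF k]
    by (intro exI[of _ "%t. k (t, a, b)"]) (simp add: Pi_iff)
  qed
  then show "\<exists>U V. openin (Fib N s x) U & path_connectedin (Fib N s x) V & y \<in> U & U \<subseteq> V & V \<subseteq> W"
   using o C(1,2) by blast
 qed
 then show ?thesis using path_connected_eq_connected_space con[OF assms] by blast
qed

abbreviation "PT \<equiv> Pi_top N s"
abbreviation "FP \<equiv> subtopology (prod_topology (mtop N) (mtop N)) (fiber_product N s)"
abbreviation "ends \<equiv> %g :: (real => 'a) set. (arrow_tgt g, arrow_src g)"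

lemma covering_ends: "covering_map PT FP ends"
proof -
 obtain y where "y \<in> topspace (mtop N)" using ne by blast
 then have x0: "s y \<in> topspace (mtop M)" by (rule s_top)
 show ?thesis
 proof (rule covering_tgt_src[OF cs locally_good_fiber[of "s y"] _ path_connected_fiber])
  fix x assume "x \<in> topspace (mtop M)"
  then show "\<exists>U h k. x \<in> U & trivialization N (mtop M) s (Fib N s (s y)) U h k" using trivialize[OF x0] by metis
 qed
qed

text \<open>Locally the equation is the difference of the base coordinates of the two
  components.\<close>

lemma cut_out_fiber_product: "cut_out (prod_mfd N N) (mdim M) (fiber_product N s)"
 unfolding cut_out_def
proof (intro conjI ballI)
 show "fiber_product N s \<subseteq> topspace (mtop (prod_mfd N N))" by (auto simp: fiber_product_def)
 note pl = plot_prod_iff[OF N N]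
 fix p assume "p \<in> fiber_product N s"
 then obtain y z where p: "p = (y, z)" and yz: "y \<in> topspace (mtop N)" "z \<in> topspace (mtop N)" "s y = s z"
  by (auto simp: fiber_product_def)
 obtain V \<psi> where V: "(V, \<psi>) \<in> atlas M" "s z \<in> V" using manifold_cover[OF M s_top[OF yz(2)]] by blast
 let ?\<kappa> = "%p i. \<psi> (s (fst p)) i - \<psi> (s (snd p)) i" and ?B = "Bs V \<times> Bs V"
 note sV = subm_s[OF V(1)]
 have "subm (prod_mfd N N) (mdim M) ?B ?\<kappa>"
  unfolding subm_def
 proof (intro conjI ballI)
  show "smooth_fn (prod_mfd N N) (mdim M) ?B ?\<kappa>"
   unfolding smooth_fn_def
  proof (intro conjI allI impI ballI)
   show "openin (mtop (prod_mfd N N)) ?B" using subm_openin[OF sV] by (simp add: openin_prod_Times_iff)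
   show "?\<kappa> x i = 0" if "x \<in> ?B" "mdim M \<le> i" for x i using chart_tail[OF V(1)] that by auto
   fix k W \<sigma> assume p: "plot (prod_mfd N N) k W \<sigma> & \<sigma> ` W \<subseteq> ?B"
   have sf: "smooth_fn N (mdim M) (Bs V) (%y. \<psi> (s y))" using sV by (simp add: subm_def)
   have p': "plot N k W (fst \<circ> \<sigma>)" "plot N k W (snd \<circ> \<sigma>)" "!!w. w \<in> W ==> \<sigma> w \<in> ?B" using p pl by auto
   have 1: "smooth_into k (mdim M) W (%w. \<psi> (s ((fst \<circ> \<sigma>) w)))"
    by (rule smooth_fn_plot[OF sf p'(1)]) (use p'(3) in "auto simp: mem_Times_iff")
   have 2: "smooth_into k (mdim M) W (%w. \<psi> (s ((snd \<circ> \<sigma>) w)))"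
    by (rule smooth_fn_plot[OF sf p'(2)]) (use p'(3) in "auto simp: mem_Times_iff")
   show "smooth_into k (mdim M) W (?\<kappa> \<circ> \<sigma>)"
    using 1 2 p unfolding smooth_into_def by (auto intro!: Ck_on_diff dest: plot_openin)
  qed
  fix q assume q: "q \<in> ?B"
  then have "fst q \<in> Bs V" "s (snd q) \<in> V" by auto
  have "subm N (mdim M) (Bs V) (%y i. \<psi> (s y) i - \<psi> (s (snd q)) i)"
   by (rule subm_translate[OF N sV chart_tail[OF V(1) \<open>s (snd q) \<in> V\<close>]])
  then obtain W \<tau> where W: "section_at N (mdim M) (Bs V) (%y i. \<psi> (s y) i - \<psi> (s (snd q)) i) (fst q) W \<tau>"
   using \<open>fst q \<in> Bs V\<close> unfolding subm_def by blast
  \<comment> \<open>The section moves the first component along a section of the translated base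
    coordinates and keeps the second one fixed.\<close>
  have "plot (prod_mfd N N) (mdim M) W (%w. (\<tau> w, snd q))"
   unfolding pl using W plot_const[OF _ _ N, of "mdim M" W "snd q"] q
   by (auto simp: section_at_def o_def dest: plot_openin)
  then have "section_at (prod_mfd N N) (mdim M) ?B ?\<kappa> q W (%w. (\<tau> w, snd q))"
   using W q unfolding section_at_def by auto
  then show "\<exists>W \<tau>. section_at (prod_mfd N N) (mdim M) ?B ?\<kappa> q W \<tau>" by blast
 qed
 moreover have "fiber_product N s \<inter> ?B = {p\<in>?B. \<forall>j<mdim M. ?\<kappa> p j = 0}"
  using chart_eqI[OF V(1)] by (auto simp: fiber_product_def)
 ultimately show "\<exists>B \<kappa>. p \<in> B & subm (prod_mfd N N) (mdim M) B \<kappa> &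
   fiber_product N s \<inter> B = {p\<in>B. \<forall>j<mdim M. \<kappa> p j = 0}"
  using p yz V(2) by (intro exI[of _ ?B] exI[of _ ?\<kappa>]) simp
qed

abbreviation "PN \<equiv> Pi_mfd N M s"

lemma fiber_product_mfd: "manifold (fiber_product_mfd N M s)" "mtop (fiber_product_mfd N M s) = FP"
  "plot (fiber_product_mfd N M s) k W \<sigma> \<longleftrightarrow> plot N k W (fst \<circ> \<sigma>) & plot N k W (snd \<circ> \<sigma>) & \<sigma> ` W \<subseteq> fiber_product N s"
 unfolding fiber_product_mfd_def
 using manifold_submfd[OF manifold_prod[OF N N] cut_out_fiber_product]
  plot_submfd_iff[OF manifold_prod[OF N N] cut_out_fiber_product] plot_prod_iff[OF N N]
 by (simp_all add: mult_2 conj_assoc)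

lemma local_homeo_ends: "local_homeo PT (mtop (fiber_product_mfd N M s)) ends"
 unfolding fiber_product_mfd(2) by (rule covering_imp_local_homeo[OF covering_ends])

lemma PN: "manifold PN" "mtop PN = PT" "mdim PN = 2 * mdim N - mdim M"
 unfolding Pi_mfd_def using manifold_pullback[OF fiber_product_mfd(1) local_homeo_ends]
 by (simp_all add: fiber_product_mfd_def)

text \<open>A smooth family of arrows is a continuous family with smooth targets and sources; no
  coordinates on paths appear.\<close>

lemma plot_PN:
 "plot PN k W \<sigma> \<longleftrightarrow> continuous_map (subtopology (EN k) W) PT \<sigma> &
   plot N k W (%w. arrow_tgt (\<sigma> w)) & plot N k W (%w. arrow_src (\<sigma> w))" (is "?L \<longleftrightarrow> ?R")
proof -
 have "ends ` \<sigma> ` W \<subseteq> fiber_product N s" if "?R"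
 proof clarify
  fix w assume w: "w \<in> W"
  have "openin (EN k) W" using that plot_openin by blast
  then have "w \<in> topspace (subtopology (EN k) W)" using w openin_subset by auto
  then have "\<sigma> w \<in> topspace PT" using that unfolding continuous_map_def by blast
  then show "ends (\<sigma> w) \<in> fiber_product N s" by (rule arrow_fiber_product)
 qed
 then show ?thesis
  unfolding Pi_mfd_def plot_pullback_iff[OF fiber_product_mfd(1) local_homeo_ends] fiber_product_mfd(3)
  by (auto simp: o_def image_image)
qed

text \<open>Prescribed smooth motions of target and source over the same base points carry an arrow
  along, inside any given neighbourhood of it. All local sections into the groupoid are built in
  this way.\<close>

lemma PN_lift:
 assumes p: "plot N k V a" "plot N k V b" and ab: "!!v. v \<in> V ==> s (a v) = s (b v)"
  and g: "g \<in> B" "openin PT B" and v: "v \<in> V" "a v = arrow_tgt g" "b v = arrow_src g"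
 obtains V' \<theta> where "v \<in> V'" "V' \<subseteq> V" "plot PN k V' \<theta>" "\<theta> v = g" "\<theta> ` V' \<subseteq> B"
  "!!v. v \<in> V' ==> arrow_tgt (\<theta> v) = a v" "!!v. v \<in> V' ==> arrow_src (\<theta> v) = b v"
proof -
 have "plot (fiber_product_mfd N M s) k V (%v. (a v, b v))"
  unfolding fiber_product_mfd(3) using p ab plot_in_topspace[OF p(1)] plot_in_topspace[OF p(2)]
  by (auto simp: o_def fiber_product_def)
 from plot_lift[OF fiber_product_mfd(1) local_homeo_ends this g v(1)] v(2,3)
 obtain V' \<theta> where *: "v \<in> V'" "V' \<subseteq> V" "plot (pullback_mfd PT (fiber_product_mfd N M s) ends) k V' \<theta>"
  "\<theta> v = g" "\<theta> ` V' \<subseteq> B" "!!v. v \<in> V' ==> ends (\<theta> v) = (a v, b v)" by auto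
 show thesis by (rule that[OF *(1,2) *(3)[folded Pi_mfd_def] *(4,5)]) (use *(6) in auto)
qed

lemmas src_cont = continuous_map_arrow_ends(1)[of N s]

lemma openin_src: "openin (mtop N) A ==> openin PT {g\<in>topspace PT. arrow_src g \<in> A}"
 by (rule openin_continuous_map_preimage[OF src_cont])

lemma local_sectionD:
 assumes "local_section N M s U \<sigma>"
 shows "openin (mtop M) U" "continuous_map (subtopology (mtop M) U) (mtop N) \<sigma>"
  "!!u. u \<in> U ==> s (\<sigma> u) = u" "!!u. u \<in> U ==> \<sigma> u \<in> topspace (mtop N)"
  "!!k W \<alpha>. [|plot M k W \<alpha>; \<alpha> ` W \<subseteq> U|] ==> plot N k W (%w. \<sigma> (\<alpha> w))"
proof -
 show U: "openin (mtop M) U" and "!!u. u \<in> U ==> s (\<sigma> u) = u" using assms by (auto simp: local_section_def)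
 have sm: "smooth_map (submfd (mdim M) M U) N \<sigma>" using assms by (simp add: local_section_def)
 then show c: "continuous_map (subtopology (mtop M) U) (mtop N) \<sigma>" by (simp add: smooth_map_def)
 show "\<sigma> u \<in> topspace (mtop N)" if "u \<in> U" for u
  using c U that unfolding continuous_map_open_subtopology[OF U] by blast
 show "plot N k W (%w. \<sigma> (\<alpha> w))" if "plot M k W \<alpha>" "\<alpha> ` W \<subseteq> U" for k W \<alpha>
  by (rule smooth_map_plot[OF open_submfd(1)[OF M U] N sm]) (use open_submfd(2)[OF M U] that in blast)
qed

lemma Pi_sigma_iff:
 assumes "local_section N M s U \<sigma>"
 shows "g \<in> Pi_sigma N s U \<sigma> \<longleftrightarrow> g \<in> topspace PT & s (arrow_src g) \<in> U & arrow_src g = \<sigma> (s (arrow_src g))"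
 using local_sectionD(3)[OF assms] by (auto simp: Pi_sigma_def)

end

section \<open>Arrows starting on a section, and arrows starting at one point\<close>

context foliated_bundle
begin

abbreviation "lf \<equiv> leaf_of (Pi_fol N F s)"

lemma leaf_src: "[|g \<in> topspace PT; g' \<in> topspace PT; lf g = lf g'|] ==> arrow_src g = arrow_src g'"
 by (rule Pi_fol_leaf_src[OF tF])

lemma saturated_src: "saturated PT lf {g\<in>topspace PT. arrow_src g \<in> A}"
 unfolding saturated_def
proof (intro ballI impI)
 show "h \<in> {g\<in>topspace PT. arrow_src g \<in> A}"
  if "g \<in> {g\<in>topspace PT. arrow_src g \<in> A}" "h \<in> topspace PT" "lf g = lf h" for g h
  using leaf_src[OF _ that(2,3)] that(1,2) by simp
qed

text \<open>In coordinates whose last ones come from the base, the section is where the vertical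
 coordinates of \<open>y\<close> and \<open>\<sigma> (s y)\<close> agree.\<close>

lemma Pi_sigma_cut:
 assumes ls: "local_section N M s U \<sigma>" and g: "g \<in> Pi_sigma N s U \<sigma>"
 shows "\<exists>B \<kappa>. g \<in> B & subm PN (mdim N - mdim M) B \<kappa> & saturated PT lf B &
   (\<forall>y\<in>B. \<forall>z\<in>B. lf y = lf z --> \<kappa> y = \<kappa> z) &
   Pi_sigma N s U \<sigma> \<inter> B = {y\<in>B. \<forall>j<mdim N - mdim M. \<kappa> y j = 0}"
proof -
 let ?n = "mdim N" and ?m = "mdim M" let ?r = "?n - ?m"
 note \<sigma> = local_sectionD[OF ls]
 have g0: "g \<in> topspace PT" "s (arrow_src g) \<in> U" "arrow_src g = \<sigma> (s (arrow_src g))"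
  using g Pi_sigma_iff[OF ls] by auto
 define y0 where "y0 = arrow_src g"
 have y0: "y0 \<in> topspace (mtop N)" "s y0 \<in> U" "\<sigma> (s y0) = y0" using g0 arrow_ends(1)[OF g0(1)] by (auto simp: y0_def)
 obtain V \<psi> where V: "(V, \<psi>) \<in> atlas M" "s y0 \<in> V" using manifold_cover[OF M s_top[OF y0(1)]] by blast
 have "y0 \<in> Bs V" using y0(1) V(2) by simp
 then obtain A \<phi> where A: "(A, \<phi>) \<in> max_atlas N" "y0 \<in> A" "A \<subseteq> Bs V"
  and last: "!!y j. [|y \<in> A; j < ?m|] ==> \<phi> y (?r + j) = \<psi> (s y) j"
 proof (rule subm_straightened_chart[OF N subm_s[OF V(1)]])
  fix A \<phi> assume "(A, \<phi>) \<in> max_atlas N" "y0 \<in> A" "A \<subseteq> Bs V"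
   "!!y j. [|y \<in> A; j < mdim M|] ==> \<phi> y (mdim N - mdim M + j) = \<psi> (s y) j"
  then show thesis by (rule that)
 qed
 note cA = is_chartD[OF max_atlas_chart[OF A(1)]]
 have sV: "s y \<in> V" if "y \<in> A" for y using that A(3) by blast
 have last_eq: "\<phi> y i = \<phi> z i" if "y \<in> A" "z \<in> A" "s y = s z" "?r \<le> i" for y z i
 proof (cases "i < ?n")
  case True
  then have "i = ?r + (i - ?r)" "i - ?r < ?m" using that(4) m_le by auto
  then show ?thesis using last[OF that(1), of "i - ?r"] last[OF that(2), of "i - ?r"] that(3) by metis
 qed (use cA(7) that in simp)
 \<comment> \<open>Both a point and the point of the section over the same base point must lie in
   the chart domain.\<close>
 let ?U' = "{u\<in>U. \<sigma> u \<in> A}"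
 have "openin (mtop M) ?U'" using \<sigma>(2) cA(1) unfolding continuous_map_open_subtopology[OF \<sigma>(1)] by blast
 then have "openin (mtop N) (Bs ?U')" by (rule openin_continuous_map_preimage[OF cs])
 then have "openin (mtop N) (A \<inter> Bs ?U')" by (rule openin_Int[OF cA(1)])
 moreover define A' where "A' = {y\<in>A. s y \<in> U & \<sigma> (s y) \<in> A}"
 moreover have "A \<inter> Bs ?U' = A'" using A(3) by (auto simp: A'_def)
 ultimately have oA': "openin (mtop N) A'" by (simp only:)
 \<comment> \<open>The base coordinates of the two points agree by \<open>last_eq\<close>, so only
   the \<open>?r\<close> vertical ones are compared.\<close>
 define \<kappa>1 where "\<kappa>1 = (%y i. if i < ?r then \<phi> y i - \<phi> (\<sigma> (s y)) i else 0)"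
 define B where "B = {g\<in>topspace PT. arrow_src g \<in> A'}"
 let ?\<kappa> = "%g. \<kappa>1 (arrow_src g)"
 have oB: "openin PT B" unfolding B_def by (rule openin_src[OF oA'])
 note sf = chart_smooth_fn[OF N A(1)]
 have "smooth_fn PN ?r B ?\<kappa>"
  unfolding smooth_fn_def
 proof (intro conjI allI impI ballI)
  show "openin (mtop PN) B" using oB by (simp add: PN)
  show "\<kappa>1 (arrow_src g) i = 0" if "?r \<le> i" for g i using that by (simp add: \<kappa>1_def)
  fix k W \<theta> assume p: "plot PN k W \<theta> & \<theta> ` W \<subseteq> B"
  then have b: "plot N k W (%w. arrow_src (\<theta> w))" and bA: "!!w. w \<in> W ==> arrow_src (\<theta> w) \<in> A'"
   unfolding plot_PN B_def by auto
  have "plot N k W (%w. \<sigma> (s (arrow_src (\<theta> w))))"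
   by (rule \<sigma>(5)[OF smooth_map_plot[OF N M sm b]]) (use bA in "auto simp: A'_def")
  then have 1: "smooth_into k ?n W (%w. \<phi> (\<sigma> (s (arrow_src (\<theta> w)))))"
   by (rule smooth_fn_plot[OF sf]) (use bA in "auto simp: A'_def")
  have 2: "smooth_into k ?n W (%w. \<phi> (arrow_src (\<theta> w)))"
   by (rule smooth_fn_plot[OF sf b]) (use bA in "auto simp: A'_def")
  show "smooth_into k ?r W (?\<kappa> \<circ> \<theta>)"
   unfolding smooth_into_def
  proof (intro allI impI)
   fix i l assume i: "i < ?r"
   then have "i < ?n" by simp
   from Ck_on_diff[OF plot_openin[OF b] smooth_intoD[OF 2 this] smooth_intoD[OF 1 this]]
   show "Ck_on l k W (%w. (?\<kappa> \<circ> \<theta>) w i)" using i by (simp add: \<kappa>1_def)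
  qed
 qed
 moreover have "\<exists>W \<tau>. section_at PN ?r B ?\<kappa> g' W \<tau>" if g': "g' \<in> B" for g'
 proof -
  define y1 where "y1 = arrow_src g'"
  have gT: "g' \<in> topspace PT" and y1: "y1 \<in> A" "s y1 \<in> U" "\<sigma> (s y1) \<in> A" using g' by (auto simp: B_def A'_def y1_def)
  \<comment> \<open>Inverts \<open>\<kappa>1\<close> inside one fiber: the vertical coordinates are
    prescribed offsets from the point of the section, the base coordinates are those of
    \<open>y1\<close>. The source of the arrow thus moves in its fiber while the target is
    kept.\<close>
  define \<delta> where "\<delta> = (%u i. if i < ?r then u i + \<phi> (\<sigma> (s y1)) i else \<phi> y1 i)"
  let ?W = "{u\<in>topspace (EN ?r). \<delta> u \<in> \<phi> ` A}"
  let ?b = "%u. inv_into A \<phi> (\<delta> u)"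
  have sm\<delta>: "smooth_into ?r ?n (topspace (EN ?r)) \<delta>"
   unfolding smooth_into_def
  proof (intro allI impI)
   fix i k assume "i < ?n"
   show "Ck_on k ?r (topspace (EN ?r)) (%u. \<delta> u i)"
    by (cases "i < ?r") (auto simp: \<delta>_def intro!: Ck_on_add Ck_on_coordinate Ck_on_const)
  qed
  have oW: "openin (EN ?r) ?W"
   by (rule openin_smooth_preimage[OF openin_topspace cA(2) sm\<delta>]) (use cA(7)[OF y1(1)] in "auto simp: \<delta>_def")
  have pb: "plot N ?r ?W ?b"
   by (rule plot_compose[OF N inverse_chart_plot[OF N A(1)] oW]) (use smooth_into_subset[OF sm\<delta>] in auto)
  have b: "?b u \<in> A" "\<phi> (?b u) = \<delta> u" if "u \<in> ?W" for u using that by (auto simp: inv_into_into f_inv_into_f)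
  have sb: "s (?b u) = s y1" if u: "u \<in> ?W" for u
  proof (rule chart_eqI[OF V(1) sV[OF b(1)[OF u]] sV[OF y1(1)]])
   fix j assume j: "j < ?m"
   have "\<psi> (s (?b u)) j = \<delta> u (?r + j)" using last[OF b(1)[OF u] j] b(2)[OF u] by simp
   then show "\<psi> (s (?b u)) j = \<psi> (s y1) j" using last[OF y1(1) j] by (simp add: \<delta>_def)
  qed
  have \<delta>0: "\<delta> (\<kappa>1 y1) = \<phi> y1" by (auto simp: \<delta>_def \<kappa>1_def)
  then have w0: "\<kappa>1 y1 \<in> ?W" using y1(1) by (simp add: topspace_Euclidean_space) (simp add: \<kappa>1_def)
  have b0: "?b (\<kappa>1 y1) = y1" unfolding \<delta>0 by (rule cA(4)[OF y1(1)])
  obtain W' \<theta> where W': "\<kappa>1 y1 \<in> W'" "W' \<subseteq> ?W" "plot PN ?r W' \<theta>" "\<theta> (\<kappa>1 y1) = g'" "\<theta> ` W' \<subseteq> B"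
   "!!u. u \<in> W' ==> arrow_src (\<theta> u) = ?b u"
  proof (rule PN_lift[OF plot_const[OF oW arrow_ends(2)[OF gT] N] pb _ g' oB w0])
   show "s (arrow_tgt g') = s (?b u)" if "u \<in> ?W" for u
    using sb[OF that] arrow_ends(3)[OF gT] by (simp add: y1_def)
  qed (use b0 in "auto simp: y1_def")
  have "?\<kappa> (\<theta> u) = u" if u: "u \<in> W'" for u
  proof
   fix i
   have uW: "u \<in> ?W" using u W'(2) by blast
   have "?\<kappa> (\<theta> u) i = (if i < ?r then \<delta> u i - \<phi> (\<sigma> (s y1)) i else 0)"
    unfolding W'(6)[OF u] \<kappa>1_def sb[OF uW] b(2)[OF uW] ..
   then show "?\<kappa> (\<theta> u) i = u i" using uW by (simp add: \<delta>_def topspace_Euclidean_space)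
  qed
  then have "section_at PN ?r B ?\<kappa> g' W' \<theta>" using W' unfolding section_at_def by (simp add: y1_def)
  then show ?thesis by blast
 qed
 ultimately have "subm PN ?r B ?\<kappa>" unfolding subm_def by blast
 moreover have "\<forall>y\<in>B. \<forall>z\<in>B. lf y = lf z --> ?\<kappa> y = ?\<kappa> z"
 proof (intro ballI impI)
  show "?\<kappa> y = ?\<kappa> z" if "y \<in> B" "z \<in> B" "lf y = lf z" for y z
   using leaf_src[OF _ _ that(3)] that(1,2) by (simp add: B_def)
 qed
 moreover have "g' \<in> Pi_sigma N s U \<sigma> \<longleftrightarrow> (\<forall>j<?r. ?\<kappa> g' j = 0)" if "g' \<in> B" for g'
 proof -
  define y where "y = arrow_src g'"
  have y: "g' \<in> topspace PT" "y \<in> A" "s y \<in> U" "\<sigma> (s y) \<in> A" using that by (auto simp: B_def A'_def y_def)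
  have "(\<forall>j<?r. \<kappa>1 y j = 0) \<longleftrightarrow> (\<forall>j<?r. \<phi> y j = \<phi> (\<sigma> (s y)) j)" by (simp add: \<kappa>1_def)
  also have "\<dots> \<longleftrightarrow> \<phi> y = \<phi> (\<sigma> (s y))"
   using last_eq[OF y(2,4)] \<sigma>(3)[OF y(3)] by (metis ext not_le)
  also have "\<dots> \<longleftrightarrow> y = \<sigma> (s y)" using cA(3) y(2,4) by (auto dest: inj_onD)
  finally show ?thesis using Pi_sigma_iff[OF ls, of g'] y(1,3) unfolding y_def by blast
 qed
 then have "Pi_sigma N s U \<sigma> \<inter> B = {y\<in>B. \<forall>j<?r. ?\<kappa> y j = 0}" by blast
 moreover have "g \<in> B" using g0(1) y0 A(2) by (simp add: B_def A'_def flip: y0_def)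
 moreover have "saturated PT lf B" unfolding B_def by (rule saturated_src)
 ultimately show ?thesis by (intro exI[of _ B] exI[of _ ?\<kappa>] conjI)
qed

abbreviation "PS U \<sigma> \<equiv> Pi_sigma N s U \<sigma>"
abbreviation "PSN U \<sigma> \<equiv> Pi_sigma_mfd N M s U \<sigma>"
abbreviation "PSF U \<sigma> \<equiv> Pi_sigma_fol N F s U \<sigma>"

lemma PSN:
 assumes ls: "local_section N M s U \<sigma>"
 shows "manifold (PSN U \<sigma>)" "mtop (PSN U \<sigma>) = subtopology PT (PS U \<sigma>)"
  "plot (PSN U \<sigma>) k W \<theta> \<longleftrightarrow> plot PN k W \<theta> & \<theta> ` W \<subseteq> PS U \<sigma>"
proof -
 have c: "cut_out PN (mdim N - mdim M) (PS U \<sigma>)"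
  unfolding cut_out_def
 proof (intro conjI ballI)
  show "PS U \<sigma> \<subseteq> topspace (mtop PN)" unfolding PN by (auto simp: Pi_sigma_def)
  show "\<exists>B \<kappa>. g \<in> B & subm PN (mdim N - mdim M) B \<kappa> & PS U \<sigma> \<inter> B = {y\<in>B. \<forall>j<mdim N - mdim M. \<kappa> y j = 0}"
   if g: "g \<in> PS U \<sigma>" for g
  proof -
   obtain B \<kappa> where "g \<in> B" "subm PN (mdim N - mdim M) B \<kappa>"
    "PS U \<sigma> \<inter> B = {y\<in>B. \<forall>j<mdim N - mdim M. \<kappa> y j = 0}" using Pi_sigma_cut[OF ls g] by (elim exE conjE)
   then show ?thesis by (intro exI[of _ B] exI[of _ \<kappa>] conjI)
  qed
 qed
 \<comment> \<open>With \<open>n = mdim N\<close> and \<open>m = mdim M\<close> the dimension is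
   \<open>(2 * n - m) - (n - m) = n\<close>, by \<open>m_le\<close>.\<close>
 have e: "PSN U \<sigma> = submfd (mdim PN - (mdim N - mdim M)) PN (PS U \<sigma>)"
  unfolding Pi_sigma_mfd_def PN using m_le by simp
 show "manifold (PSN U \<sigma>)" "plot (PSN U \<sigma>) k W \<theta> \<longleftrightarrow> plot PN k W \<theta> & \<theta> ` W \<subseteq> PS U \<sigma>"
  unfolding e using manifold_submfd[OF PN(1) c] plot_submfd_iff[OF PN(1) c] by auto
 show "mtop (PSN U \<sigma>) = subtopology PT (PS U \<sigma>)" unfolding e by (simp add: PN)
qed

lemma PS_top: "PS U \<sigma> = {g\<in>topspace (Pi_fol N F s). arrow_src g \<in> \<sigma> ` U}"
 by (simp add: Pi_sigma_def Pi_fol_topspace)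

lemma PSN_top: "local_section N M s U \<sigma> ==> topspace (mtop (PSN U \<sigma>)) = PS U \<sigma>"
 and PSF_top: "topspace (PSF U \<sigma>) = PS U \<sigma>"
 by (auto simp: PSN(2) Pi_sigma_def Pi_sigma_fol_def Pi_fol_topspace)

lemma PSF_leaf: "[|g \<in> PS U \<sigma>; g' \<in> PS U \<sigma>|] ==> leaf_of (PSF U \<sigma>) g = leaf_of (PSF U \<sigma>) g' \<longleftrightarrow> lf g = lf g'"
 unfolding Pi_sigma_fol_def by (rule leaf_of_subtopology[OF Pi_fol_maps(3)[OF tF] PS_top])

lemma strictly_simple_Pi: "strictly_simple PN (Pi_fol N F s) \<longleftrightarrow> simple_quot PN lf"
 by (rule strictly_simple_iff_simple_quot[OF PN(1)]) (simp add: PN Pi_fol_topspace)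

lemma strictly_simple_Pi_sigma:
 assumes "local_section N M s U \<sigma>"
 shows "strictly_simple (PSN U \<sigma>) (PSF U \<sigma>) \<longleftrightarrow> simple_quot (PSN U \<sigma>) lf"
proof -
 have "strictly_simple (PSN U \<sigma>) (PSF U \<sigma>) \<longleftrightarrow> simple_quot (PSN U \<sigma>) (leaf_of (PSF U \<sigma>))"
  by (rule strictly_simple_iff_simple_quot[OF PSN(1)[OF assms]]) (simp only: PSN_top[OF assms] PSF_top)
 also have "\<dots> \<longleftrightarrow> simple_quot (PSN U \<sigma>) lf"
  using simple_quot_cong[of "PSN U \<sigma>" "leaf_of (PSF U \<sigma>)" lf] simple_quot_cong[of "PSN U \<sigma>" lf "leaf_of (PSF U \<sigma>)"]
   PSF_leaf unfolding PSN_top[OF assms] by blast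
 finally show ?thesis .
qed

lemma Pi_imp_Pi_sigma:
 assumes "strictly_simple PN (Pi_fol N F s)" and ls: "local_section N M s U \<sigma>"
 shows "strictly_simple (PSN U \<sigma>) (PSF U \<sigma>)"
 unfolding strictly_simple_Pi_sigma[OF ls]
proof (rule simple_quot_restrict[OF PN(1) PSN(1)[OF ls]])
 show "simple_quot PN lf" using assms(1) strictly_simple_Pi by blast
 show "mtop (PSN U \<sigma>) = subtopology (mtop PN) (PS U \<sigma>)" using PSN(2)[OF ls] PN(2) by simp
 show "PS U \<sigma> \<subseteq> topspace (mtop PN)" unfolding PN by (auto simp: Pi_sigma_def)
 show "plot (PSN U \<sigma>) k W \<theta> \<longleftrightarrow> plot PN k W \<theta> & \<theta> ` W \<subseteq> PS U \<sigma>" for k W \<theta> by (rule PSN(3)[OF ls])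
qed (unfold PN(2), rule Pi_sigma_cut[OF ls])

text \<open>A section of the base coordinates of \<open>s\<close>, composed with the chart of the
  base.\<close>

lemma local_section_at:
 assumes y: "y \<in> topspace (mtop N)"
 obtains U \<sigma> where "local_section N M s U \<sigma>" "s y \<in> U" "\<sigma> (s y) = y"
proof -
 obtain V \<psi> where V: "(V, \<psi>) \<in> atlas M" "s y \<in> V" using manifold_cover[OF M s_top[OF y]] by blast
 note V' = atlas_max_atlas[OF M V(1)]
 note cV = is_chartD[OF max_atlas_chart[OF V']]
 obtain W \<tau> where W: "plot N (mdim M) W \<tau>" "\<psi> (s y) \<in> W" "\<tau> ` W \<subseteq> Bs V" "\<tau> (\<psi> (s y)) = y"
  "!!w. w \<in> W ==> \<psi> (s (\<tau> w)) = w"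
  using subm_s[OF V(1)] y V(2) unfolding subm_def section_at_def by blast
 let ?U = "{u\<in>V. \<psi> u \<in> W}" and ?\<sigma> = "%u. \<tau> (\<psi> u)"
 have oU: "openin (mtop M) ?U" by (rule cV(5)[OF plot_openin[OF W(1)]])
 have pl: "plot N k A (%w. \<tau> (\<psi> (\<alpha> w)))" if "plot M k A \<alpha>" "\<alpha> ` A \<subseteq> ?U" for k A \<alpha>
 proof (rule plot_compose[OF N W(1) plot_openin[OF that(1)]])
  show "smooth_into k (mdim M) A (%w. \<psi> (\<alpha> w))"
   by (rule smooth_fn_plot[OF chart_smooth_fn[OF M V'] that(1)]) (use that(2) in auto)
 qed (use that(2) in auto)
 have "continuous_map (subtopology (mtop M) ?U) (mtop N) ?\<sigma>"
 proof -
  have "continuous_map (subtopology (mtop M) V) (EN (mdim M)) \<psi>"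
   by (rule smooth_fn_continuous[OF M chart_smooth_fn[OF M V']])
  then have "continuous_map (subtopology (mtop M) ?U) (subtopology (EN (mdim M)) W) \<psi>"
   using continuous_map_from_subtopology_mono[of "mtop M" V _ \<psi> ?U] by (auto simp: continuous_map_in_subtopology)
  from continuous_map_compose[OF this plot_continuous[OF W(1)]] show ?thesis by (simp add: o_def)
 qed
 then have "smooth_map (submfd (mdim M) M ?U) N ?\<sigma>"
 proof (intro smooth_mapI_plot[OF open_submfd(1)[OF M oU]])
  show "plot N k A (%w. \<tau> (\<psi> (\<alpha> w)))" if "plot (submfd (mdim M) M ?U) k A \<alpha>" for k A \<alpha>
   using pl open_submfd(2)[OF M oU] that by blast
 qed simp
 moreover have "s (?\<sigma> u) = u" if u: "u \<in> ?U" for u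
  by (rule chart_eqI[OF V(1)]) (use u W(3,5) in auto)
 ultimately have "local_section N M s ?U ?\<sigma>" using oU unfolding local_section_def by blast
 then show thesis by (rule that) (use V(2) W(2,4) in auto)
qed

abbreviation "SF y \<equiv> source_fiber N s y"

text \<open>On arrows starting on the section, the source is known from its base point, so the base
  coordinates cut out the source fiber. Local sections of these coordinates move the target along a
  section of \<open>s\<close> and drag the source along \<open>\<sigma>\<close>.\<close>

lemma source_fiber_cut:
 assumes ls: "local_section N M s U \<sigma>" and g: "g \<in> SF (\<sigma> x)" and x: "x \<in> U"
 shows "\<exists>B \<kappa>. g \<in> B & subm (PSN U \<sigma>) (mdim M) B \<kappa> & saturated (mtop (PSN U \<sigma>)) lf B &
   (\<forall>y\<in>B. \<forall>z\<in>B. lf y = lf z --> \<kappa> y = \<kappa> z) & SF (\<sigma> x) \<inter> B = {y\<in>B. \<forall>j<mdim M. \<kappa> y j = 0}"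
proof -
 note \<sigma> = local_sectionD[OF ls]
 let ?m = "mdim M"
 have gT: "g \<in> topspace PT" "arrow_src g = \<sigma> x" using g by auto
 obtain V \<psi> where V: "(V, \<psi>) \<in> atlas M" "x \<in> V" using manifold_cover[OF M] x openin_subset[OF \<sigma>(1)] by blast
 let ?B = "{g\<in>PS U \<sigma>. s (arrow_src g) \<in> V}" and ?\<kappa> = "%g i. \<psi> (s (arrow_src g)) i - \<psi> x i"
 note sV = subm_translate[OF N subm_s[OF V(1)], of "\<psi> x", OF chart_tail[OF V]]
 have sfV: "smooth_fn N ?m (Bs V) (%y i. \<psi> (s y) i - \<psi> x i)" using sV by (simp add: subm_def)
 have "openin PT {g\<in>topspace PT. arrow_src g \<in> Bs V}" by (rule openin_src[OF subm_openin[OF subm_s[OF V(1)]]])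
 then have oP: "openin PT {g\<in>topspace PT. s (arrow_src g) \<in> V}" (is "openin PT ?P")
  by (rule back_subst) (use arrow_ends(1) in auto)
 then have oB: "openin (mtop (PSN U \<sigma>)) ?B"
  unfolding PSN(2)[OF ls] openin_subtopology by (intro exI[of _ ?P]) (auto simp: Pi_sigma_def)
 have "subm (PSN U \<sigma>) ?m ?B ?\<kappa>"
  unfolding subm_def
 proof (intro conjI ballI)
  show "smooth_fn (PSN U \<sigma>) ?m ?B ?\<kappa>"
   unfolding smooth_fn_def
  proof (intro conjI allI impI ballI)
   show "?\<kappa> g i = 0" if "g \<in> ?B" "?m \<le> i" for g i using chart_tail[OF V that(2)] chart_tail[OF V(1) _ that(2)] that(1) by simp
   fix k W \<theta> assume p: "plot (PSN U \<sigma>) k W \<theta> & \<theta> ` W \<subseteq> ?B"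
   then have b: "plot N k W (%w. arrow_src (\<theta> w))" unfolding PSN(3)[OF ls] plot_PN by blast
   show "smooth_into k ?m W (?\<kappa> \<circ> \<theta>)"
    unfolding o_def by (rule smooth_fn_plot[OF sfV b]) (use p plot_in_topspace[OF b] in auto)
  qed (rule oB)
  fix g' assume g': "g' \<in> ?B"
  have g'T: "g' \<in> topspace PT" and g's: "s (arrow_src g') \<in> U" "arrow_src g' = \<sigma> (s (arrow_src g'))"
   using g' Pi_sigma_iff[OF ls] by auto
  define y where "y = arrow_tgt g'"
  have y: "y \<in> topspace (mtop N)" "s y = s (arrow_src g')" "y \<in> Bs V"
   using arrow_ends[OF g'T] g' by (auto simp: y_def)
  obtain W \<tau> where W: "plot N ?m W \<tau>" "(%i. \<psi> (s y) i - \<psi> x i) \<in> W" "\<tau> ` W \<subseteq> Bs V"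
   "\<tau> (%i. \<psi> (s y) i - \<psi> x i) = y" "!!w. w \<in> W ==> (%i. \<psi> (s (\<tau> w)) i - \<psi> x i) = w"
   using sV y(3) unfolding subm_def section_at_def by blast
  let ?W = "{w\<in>W. \<tau> w \<in> Bs U}"
  have oW: "openin (EN ?m) ?W"
   by (rule plot_preimage_open[OF W(1) openin_continuous_map_preimage[OF cs \<sigma>(1)]])
  have pa: "plot N ?m ?W \<tau>" by (rule plot_subset[OF W(1) oW]) auto
  have pb: "plot N ?m ?W (%w. \<sigma> (s (\<tau> w)))" by (rule \<sigma>(5)[OF smooth_map_plot[OF N M sm pa]]) auto
  have v: "?\<kappa> g' \<in> ?W" "\<tau> (?\<kappa> g') = y" using W(2,4) y g's(1) by auto
  obtain V' \<theta> where V': "?\<kappa> g' \<in> V'" "V' \<subseteq> ?W" "plot PN ?m V' \<theta>" "\<theta> (?\<kappa> g') = g'" "\<theta> ` V' \<subseteq> ?P"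
   "!!w. w \<in> V' ==> arrow_src (\<theta> w) = \<sigma> (s (\<tau> w))"
  proof (rule PN_lift[OF pa pb _ _ oP v(1)])
   show "s (\<tau> w) = s (\<sigma> (s (\<tau> w)))" if "w \<in> ?W" for w using that \<sigma>(3) by simp
   show "g' \<in> ?P" using g' g'T by simp
   show "\<tau> (?\<kappa> g') = arrow_tgt g'" using v(2) by (simp add: y_def)
   show "\<sigma> (s (\<tau> (?\<kappa> g'))) = arrow_src g'" unfolding v(2) y(2) using g's(2) by simp
  qed blast
  have \<theta>: "\<theta> w \<in> ?B" "?\<kappa> (\<theta> w) = w" if w: "w \<in> V'" for w
  proof -
   have wW: "w \<in> W" "s (\<tau> w) \<in> U" using w V'(2) by auto
   have "\<theta> w \<in> ?P" using V'(5) w by blast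
   then show "\<theta> w \<in> ?B" using V'(6)[OF w] wW(2) by (simp add: Pi_sigma_def)
   show "?\<kappa> (\<theta> w) = w" unfolding V'(6)[OF w] \<sigma>(3)[OF wW(2)] by (rule W(5)[OF wW(1)])
  qed
  then have "section_at (PSN U \<sigma>) ?m ?B ?\<kappa> g' V' \<theta>"
   unfolding section_at_def PSN(3)[OF ls] using V'(1,3,4) by blast
  then show "\<exists>W \<tau>. section_at (PSN U \<sigma>) ?m ?B ?\<kappa> g' W \<tau>" by blast
 qed
 moreover have "saturated (mtop (PSN U \<sigma>)) lf ?B"
  unfolding saturated_def PSN_top[OF ls]
 proof (intro ballI impI)
  show "g2 \<in> ?B" if "g1 \<in> ?B" "g2 \<in> PS U \<sigma>" "lf g1 = lf g2" for g1 g2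
   using leaf_src[OF _ _ that(3)] that(1,2) by (simp add: Pi_sigma_def)
 qed
 moreover have "\<forall>y\<in>?B. \<forall>z\<in>?B. lf y = lf z --> ?\<kappa> y = ?\<kappa> z"
 proof (intro ballI impI)
  show "?\<kappa> y = ?\<kappa> z" if "y \<in> ?B" "z \<in> ?B" "lf y = lf z" for y z
   using leaf_src[OF _ _ that(3)] that(1,2) by (simp add: Pi_sigma_def)
 qed
 moreover have "g' \<in> SF (\<sigma> x) \<longleftrightarrow> (\<forall>j<?m. ?\<kappa> g' j = 0)" if g': "g' \<in> ?B" for g'
 proof -
  have i: "g' \<in> topspace PT" "s (arrow_src g') \<in> V" "arrow_src g' = \<sigma> (s (arrow_src g'))"
   using g' Pi_sigma_iff[OF ls] by auto
  have "(\<forall>j<?m. ?\<kappa> g' j = 0) \<longleftrightarrow> s (arrow_src g') = x"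
   using chart_eqI[OF V(1) i(2) V(2)] by auto
  also have "\<dots> \<longleftrightarrow> arrow_src g' = \<sigma> x" using i(3) \<sigma>(3)[OF x] by metis
  finally show ?thesis using i(1) by simp
 qed
 then have "SF (\<sigma> x) \<inter> ?B = {y\<in>?B. \<forall>j<?m. ?\<kappa> y j = 0}" by blast
 moreover have "g \<in> ?B" using gT x V(2) \<sigma>(3)[OF x] by (simp add: Pi_sigma_def)
 ultimately show ?thesis by (intro exI[of _ ?B] exI[of _ ?\<kappa>] conjI)
qed

lemma Pi_sigma_imp_developable:
 assumes iii: "!!U \<sigma>. local_section N M s U \<sigma> ==> strictly_simple (PSN U \<sigma>) (PSF U \<sigma>)"
 shows "developable_bundle N F M s"
 unfolding developable_bundle_def
proof
 fix x assume "x \<in> topspace (mtop M)"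
 then have "x \<in> s ` topspace (mtop N)" by (simp only: surj)
 then obtain y where y: "y \<in> topspace (mtop N)" "s y = x" by blast
 obtain U \<sigma> where ls: "local_section N M s U \<sigma>" and U: "x \<in> U" "\<sigma> x = y" using local_section_at[OF y(1)] y(2) by metis
 let ?E = "subtopology PT (SF y)" and ?F = "fiber_fol N F s x"
 note cov = source_fiber_covering[OF covering_ends y(1), unfolded y(2)]
 have lh: "local_homeo ?E (mtop (NF x)) arrow_tgt" unfolding NF(2) by (rule covering_imp_local_homeo[OF cov])
 let ?X = "pullback_mfd ?E (NF x) arrow_tgt"
 note X = manifold_pullback[OF NF(1) lh]
 have tE: "topspace ?E = SF y" by auto
 have SFPS: "SF y \<subseteq> PS U \<sigma>" using U by (auto simp: Pi_sigma_def)
 have tgt: "arrow_tgt g \<in> fiber N s x" if "g \<in> SF y" for g using arrow_ends[of g N s] that y(2) by (simp add: preim_def)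
 \<comment> \<open>The structure pulled back from the fiber and the one induced from the groupoid
   are compared by plots: as the source is constant, both ask for continuity and a smooth
   target.\<close>
 have pX: "plot ?X k W \<theta> \<longleftrightarrow> plot (PSN U \<sigma>) k W \<theta> & \<theta> ` W \<subseteq> SF y" for k W \<theta>
 proof
  assume "plot ?X k W \<theta>"
  then have c: "continuous_map (subtopology (EN k) W) ?E \<theta>" and t: "plot N k W (%w. arrow_tgt (\<theta> w))"
   unfolding plot_pullback_iff[OF NF(1) lh] NF(3) by (simp_all add: o_def)
  note oW = plot_openin[OF t]
  have im: "\<theta> ` W \<subseteq> SF y" using c openin_subset[OF oW] unfolding continuous_map_in_subtopology by auto
  have "plot N k W (%w. arrow_src (\<theta> w))"
   by (rule plot_cong[OF plot_const[OF oW y(1) N] _ N]) (use im in auto)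
  then show "plot (PSN U \<sigma>) k W \<theta> & \<theta> ` W \<subseteq> SF y"
   unfolding PSN(3)[OF ls] plot_PN using c t im SFPS by (auto simp: continuous_map_in_subtopology)
 next
  assume R: "plot (PSN U \<sigma>) k W \<theta> & \<theta> ` W \<subseteq> SF y"
  then have "continuous_map (subtopology (EN k) W) PT \<theta>" "plot N k W (%w. arrow_tgt (\<theta> w))"
   unfolding PSN(3)[OF ls] plot_PN by auto
  then show "plot ?X k W \<theta>"
   unfolding plot_pullback_iff[OF NF(1) lh] NF(3) using R tgt by (auto simp: continuous_map_in_subtopology o_def)
 qed
 have "simple_quot ?X lf"
 proof (rule simple_quot_restrict[OF PSN(1)[OF ls] X _ _ _ pX])
  show "simple_quot (PSN U \<sigma>) lf" using iii[OF ls] strictly_simple_Pi_sigma[OF ls] by blast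
  have "PS U \<sigma> \<inter> SF y = SF y" using SFPS by blast
  then show "mtop ?X = subtopology (mtop (PSN U \<sigma>)) (SF y)"
   unfolding PSN(2)[OF ls] by (simp add: subtopology_subtopology)
  show "SF y \<subseteq> topspace (mtop (PSN U \<sigma>))" using SFPS by (simp add: PSN_top[OF ls])
 qed (rule source_fiber_cut[OF ls _ U(1), unfolded U(2)])
 \<comment> \<open>The identity is continuous both ways between the pulled back leaf topology and
   the restricted one, so the leaves coincide.\<close>
 moreover have "leaf_of (pullback_fol ?E ?F arrow_tgt) g = leaf_of (pullback_fol ?E ?F arrow_tgt) g' \<longleftrightarrow> lf g = lf g'"
  if g: "g \<in> SF y" "g' \<in> SF y" for g g'
 proof -
  let ?P = "pullback_fol ?E ?F arrow_tgt" and ?Q = "subtopology (Pi_fol N F s) (SF y)"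
  have tF': "arrow_tgt e \<in> topspace ?F" if "e \<in> topspace ?E" for e using tgt that by auto
  note cP = continuous_map_pullback_fol[of ?E arrow_tgt ?F, OF tF']
  have id: "continuous_map ?P ?E (%g. g)" "continuous_map ?P ?F arrow_tgt" using cP[of ?P "%g. g"] by auto
  have tP: "topspace ?P = SF y" unfolding topspace_pullback_fol by (rule tE)
  have tQ: "topspace ?Q = SF y" by (auto simp: Pi_fol_topspace)
  have "continuous_map ?P (discrete_topology (topspace (mtop N))) (%_. y)" using y(1) by simp
  then have "continuous_map ?P (discrete_topology (topspace (mtop N))) arrow_src"
   by (rule continuous_map_eq) (use tP in auto)
  moreover have "continuous_map ?P PT (%g. g)" using id(1) by (simp add: continuous_map_in_subtopology)
  moreover have "continuous_map ?P F arrow_tgt"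
   using id(2) unfolding fiber_fol_def by (simp add: continuous_map_in_subtopology)
  ultimately have "continuous_map ?P (Pi_fol N F s) (%g. g)" unfolding continuous_map_Pi_fol[OF tF] by blast
  then have 1: "continuous_map ?P ?Q (%g. g)" using tP by (simp add: continuous_map_in_subtopology)
  have "continuous_map ?Q PT (%g. g)" "continuous_map ?Q F arrow_tgt"
   using Pi_fol_maps(1,2)[OF tF] continuous_map_from_subtopology by blast+
  then have "continuous_map ?Q ?E (%g. g)" "continuous_map ?Q ?F arrow_tgt"
   unfolding fiber_fol_def continuous_map_in_subtopology using tQ tgt by auto
  then have 2: "continuous_map ?Q ?P (%g. g)" using cP[of ?Q "%g. g"] by blast
  have "leaf_of ?P g = leaf_of ?P g' \<longleftrightarrow> leaf_of ?Q g = leaf_of ?Q g'"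
   using leaf_eq_continuous_map[OF 1, of g g'] leaf_eq_continuous_map[OF 2, of g g'] g unfolding tP tQ by blast
  also have "\<dots> \<longleftrightarrow> lf g = lf g'"
   by (rule leaf_of_subtopology[OF Pi_fol_maps(3)[OF tF], where A = "{y}"]) (use g in "auto simp: Pi_fol_topspace")
  finally show ?thesis .
 qed
 ultimately have "simple_quot ?X (leaf_of (pullback_fol ?E ?F arrow_tgt))"
  using simple_quot_cong[of ?X lf "leaf_of (pullback_fol ?E ?F arrow_tgt)"] tE by simp
 then have "strictly_simple ?X (pullback_fol ?E ?F arrow_tgt)"
  using strictly_simple_iff_simple_quot[OF X] by (simp add: topspace_pullback_fol)
 moreover have "universal_covering ?E (mtop (NF x)) arrow_tgt"
  unfolding universal_covering_def NF(2) using cov source_fiber_simply_connected[OF covering_ends y(1)] by blast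
 ultimately show "developable (NF x) ?F" unfolding developable_def by blast
qed

section \<open>From the development of one fiber to the foliation of arrows\<close>

lemma developing_at:
 assumes x0: "x0 \<in> topspace (mtop M)" and uc: "universal_covering E (Fib N s x0) \<pi>" and y: "y \<in> topspace (mtop N)"
 obtains U h k W0 \<rho>0 where
  "developing N (mtop M) s (Fib N s x0) U h k E \<pi> W0 \<rho>0 F (fiber_fol N F s x0)"
  "y \<in> preim N s U" "fst (h y) \<in> \<pi> ` W0"
  "!!l W \<sigma>. [|plot N l W \<sigma>; \<sigma> ` W \<subseteq> preim N s U|] ==> plot (NF x0) l W (%w. fst (h (\<sigma> w)))"
  "!!l W \<alpha> \<beta>. [|plot (NF x0) l W \<alpha>; plot M l W \<beta>; \<beta> ` W \<subseteq> U|] ==> plot N l W (%w. k (\<alpha> w, \<beta> w))"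
proof (rule trivialize[OF x0 s_top[OF y]])
 fix U h k
 assume U: "s y \<in> U" "trivialization N (mtop M) s (Fib N s x0) U h k"
  and p1: "!!l W \<sigma>. [|plot N l W \<sigma>; \<sigma> ` W \<subseteq> preim N s U|] ==> plot (NF x0) l W (%w. fst (h (\<sigma> w)))"
  and p2: "!!l W \<alpha> \<beta>. [|plot (NF x0) l W \<alpha>; plot M l W \<beta>; \<beta> ` W \<subseteq> U|] ==> plot N l W (%w. k (\<alpha> w, \<beta> w))"
  and hk: "continuous_map (subtopology F (preim N s U)) (fiber_fol N F s x0) (%y. fst (h y))"
  "!!u. u \<in> U ==> continuous_map (fiber_fol N F s x0) F (%a. k (a, u))"
 have yU: "y \<in> preim N s U" using y U(1) by (simp add: preim_def)
 have cov: "covering_map E (Fib N s x0) \<pi>" "simply_connected_top E" using uc by (auto simp: universal_covering_def)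
 have "fst (h y) \<in> topspace (Fib N s x0)" by (rule trivializationD(4)[OF U(2) yU])
 moreover have "\<pi> ` topspace E = topspace (Fib N s x0)" using cov(1) unfolding covering_map_def by (elim conjE)
 ultimately have "fst (h y) \<in> \<pi> ` topspace E" by (simp only:)
 then obtain e where e: "fst (h y) = \<pi> e" "e \<in> topspace E" by (elim imageE)
 obtain W0 \<rho>0 where W0: "e \<in> W0" "homeo_patch E (Fib N s x0) \<pi> W0 \<rho>0"
  using covering_imp_local_homeo[OF cov(1)] e(2) unfolding local_homeo_def by blast
 have D: "developing N (mtop M) s (Fib N s x0) U h k E \<pi> W0 \<rho>0 F (fiber_fol N F s x0)"
  by unfold_locales (use U(2) cs cov W0(2) locally_good_fiber hk tF in "auto simp: mem_fiber")
 have D': "fst (h y) \<in> \<pi> ` W0" unfolding e(1) by (rule imageI[OF W0(1)])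
 show thesis using D yU D' p1 p2 by (rule that)
qed

lemma developable_imp_Pi:
 assumes dev: "developable_bundle N F M s"
 shows "strictly_simple PN (Pi_fol N F s)"
proof -
 obtain y0 where "y0 \<in> topspace (mtop N)" using ne by blast
 define x0 where "x0 = s y0"
 have x0: "x0 \<in> topspace (mtop M)" using s_top \<open>y0 \<in> _\<close> by (simp add: x0_def)
 obtain E :: "(real => 'a) set topology" and \<pi> where uc: "universal_covering E (Fib N s x0) \<pi>"
  and ss: "strictly_simple (pullback_mfd E (NF x0) \<pi>) (pullback_fol E (fiber_fol N F s x0) \<pi>)"
  using dev x0 unfolding developable_bundle_def developable_def NF(2) by blast
 let ?X = "pullback_mfd E (NF x0) \<pi>" and ?le = "leaf_of (pullback_fol E (fiber_fol N F s x0) \<pi>)"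
 have lh: "local_homeo E (mtop (NF x0)) \<pi>"
  unfolding NF(2) using uc by (auto intro: covering_imp_local_homeo simp: universal_covering_def)
 note X = manifold_pullback[OF NF(1) lh] and pX = plot_pullback_iff[OF NF(1) lh]
 have "simple_quot ?X ?le" using ss strictly_simple_iff_simple_quot[OF X] by (simp add: topspace_pullback_fol)
 then obtain q where q: "!!e. e \<in> topspace E ==> \<exists>B c. e \<in> B & leaf_chart ?X ?le q B c"
  and sep: "separated_quot E ?le" unfolding simple_quot_def by auto
 have "\<exists>B c. g \<in> B & leaf_chart PN lf (q + mdim N) B c" if gT: "g \<in> topspace PT" for g
 proof -
  let ?n = "mdim N"
  define y where "y = arrow_src g"
  have y: "y \<in> topspace (mtop N)" using arrow_ends(1)[OF gT] by (simp add: y_def)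
  show ?thesis
  proof (rule developing_at[OF x0 uc y])
   fix U h k W0 \<rho>0
   assume D: "developing N (mtop M) s (Fib N s x0) U h k E \<pi> W0 \<rho>0 F (fiber_fol N F s x0)"
    and yU: "y \<in> preim N s U" "fst (h y) \<in> \<pi> ` W0"
    and p1: "!!l W \<sigma>. [|plot N l W \<sigma>; \<sigma> ` W \<subseteq> preim N s U|] ==> plot (NF x0) l W (%w. fst (h (\<sigma> w)))"
    and p2: "!!l W \<alpha> \<beta>. [|plot (NF x0) l W \<alpha>; plot M l W \<beta>; \<beta> ` W \<subseteq> U|] ==> plot N l W (%w. k (\<alpha> w, \<beta> w))"
   interpret D: developing N "mtop M" s "Fib N s x0" U h k E \<pi> W0 \<rho>0 F "fiber_fol N F s x0" by (rule D)
   have gd: "g \<in> D.dom" using gT yU by (simp add: D.dom_def D.hbox_def y_def)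
   obtain O1 c where O1: "D.Phi g \<in> O1" "leaf_chart ?X ?le q O1 c" using q[OF D.Phi_mem(1)[OF gd]] by blast
   have sub: "subm ?X q O1 c" and sat: "saturated E ?le O1"
    and cl: "!!e e'. [|e \<in> O1; e' \<in> O1|] ==> c e = c e' \<longleftrightarrow> ?le e = ?le e'"
    using O1(2) unfolding leaf_chart_def by simp_all
   have sfc: "smooth_fn ?X q O1 c" using sub by (simp add: subm_def)
   obtain A \<phi> where A0: "(A, \<phi>) \<in> atlas N" "y \<in> A" using manifold_cover[OF N y] by blast
   note A = atlas_max_atlas[OF N A0(1)]
   note cA = is_chartD[OF max_atlas_chart[OF A]]
   have tail: "c e i = 0" if "e \<in> O1" "q \<le> i" for e i by (rule smooth_fn_zero_tail[OF sfc that])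
   define B where "B = {g\<in>D.dom. D.Phi g \<in> O1 & arrow_src g \<in> A}"
   \<comment> \<open>Leaves of arrows are classified by the developed leaf of \<open>Phi\<close>
     together with the source, whence \<open>q + ?n\<close> coordinates.\<close>
   define c' where "c' = (%g. pjoin q (c (D.Phi g)) (\<phi> (arrow_src g)))"
   have oO: "openin E O1" using subm_openin[OF sub] by simp
   have oB: "openin PT B"
   proof -
    have "B = {g\<in>D.dom. D.Phi g \<in> O1} \<inter> {g\<in>topspace PT. arrow_src g \<in> A}" by (auto simp: B_def D.dom_def)
    then show ?thesis using D.openin_Phi[OF oO] openin_src[OF cA(1)] by auto
  qed
  have BT: "B \<subseteq> topspace PT" using openin_subset[OF oB] .
  have "smooth_fn PN (q + ?n) B c'"
   unfolding smooth_fn_def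
  proof (intro conjI allI impI ballI)
   show "openin (mtop PN) B" using oB by (simp add: PN)
   show "c' g i = 0" if "g \<in> B" "q + ?n \<le> i" for g i using that cA(7) by (simp add: c'_def pjoin_def B_def)
   fix l W \<theta> assume "plot PN l W \<theta> & \<theta> ` W \<subseteq> B"
   then have ct: "continuous_map (subtopology (EN l) W) PT \<theta>" and ta: "plot N l W (%w. arrow_tgt (\<theta> w))"
    and sr: "plot N l W (%w. arrow_src (\<theta> w))" and im: "!!w. w \<in> W ==> \<theta> w \<in> B" unfolding plot_PN by auto
   have imD: "\<theta> w \<in> D.dom" if "w \<in> W" for w using im[OF that] by (simp add: B_def)
   have "continuous_map (subtopology (EN l) W) (subtopology PT D.dom) \<theta>"
    using ct imD by (auto simp: continuous_map_in_subtopology)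
   from continuous_map_compose[OF this D.Phi_continuous]
   have 1: "continuous_map (subtopology (EN l) W) E (%w. D.Phi (\<theta> w))" by (simp add: o_def)
   \<comment> \<open>A plot of the covering is a continuous map with smooth projection; here the
     projection is the model coordinate of the target.\<close>
   have "plot (NF x0) l W (%w. fst (h (arrow_tgt (\<theta> w))))"
    by (rule p1[OF ta]) (use D.Phi_mem(3)[OF imD] in blast)
   then have "plot (NF x0) l W (%w. \<pi> (D.Phi (\<theta> w)))"
    by (rule plot_cong[OF _ _ NF(1)]) (use D.Phi_mem(2)[OF imD] in simp)
   then have "plot ?X l W (%w. D.Phi (\<theta> w))" unfolding pX using 1 by (simp add: o_def)
   then have 2: "smooth_into l q W (%w. c (D.Phi (\<theta> w)))"
    by (rule smooth_fn_plot[OF sfc]) (use im in "auto simp: B_def")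
   have 3: "smooth_into l ?n W (%w. \<phi> (arrow_src (\<theta> w)))"
    by (rule smooth_fn_plot[OF chart_smooth_fn[OF N A] sr]) (use im in "auto simp: B_def")
   show "smooth_into l (q + ?n) W (c' \<circ> \<theta>)" unfolding c'_def o_def by (rule smooth_pjoin[OF 2 3])
  qed
  moreover have "\<exists>W \<tau>. section_at PN (q + ?n) B c' g' W \<tau>" if g': "g' \<in> B" for g'
  proof -
   define e where "e = D.Phi g'"
   have d: "g' \<in> D.dom" "e \<in> O1" "arrow_src g' \<in> A" using g' by (auto simp: B_def e_def)
   note Pm = D.Phi_mem[OF d(1)]
   have eE: "e \<in> topspace E" using Pm(1) by (simp add: e_def)
   have g'T: "g' \<in> topspace PT" using g' BT by blast
   note en = arrow_ends[OF g'T]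
   have "\<forall>e\<in>O1. \<exists>W \<tau>. section_at ?X q O1 c e W \<tau>" using sub by (simp add: subm_def)
   then obtain W \<tau> where "section_at ?X q O1 c e W \<tau>" using d(2) by blast
   then have W: "plot ?X q W \<tau>" "c e \<in> W" "\<tau> ` W \<subseteq> O1" "\<tau> (c e) = e" "!!w. w \<in> W ==> c (\<tau> w) = w"
    by (simp_all add: section_at_def)
   obtain We \<rho>e where We: "e \<in> We" "homeo_patch E (Fib N s x0) \<pi> We \<rho>e"
    using lh eE unfolding local_homeo_def NF(2) by blast
   have oWe: "openin E We" and We_inj: "!!e. e \<in> We ==> \<rho>e (\<pi> e) = e" using We(2) by (auto simp: homeo_patch_def)
   let ?T = "topspace (EN (q + ?n))"
   \<comment> \<open>The prescribed coordinates determine a point of \<open>E\<close>, by a section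
     of \<open>c\<close>, and a source, by the inverse chart.\<close>
   let ?a0 = "%z. \<tau> (pfst q z)" and ?b = "%z. inv_into A \<phi> (psnd q z)"
   define Z0 where "Z0 = {z\<in>?T. pfst q z \<in> W & psnd q z \<in> \<phi> ` A}"
   have oZ0: "openin (EN (q + ?n)) Z0" unfolding Z0_def by (rule openin_pjoin[OF plot_openin[OF W(1)] cA(2)])
   have pa0: "plot ?X (q + ?n) Z0 ?a0"
    by (rule plot_compose[OF X W(1) oZ0 smooth_pfst[OF oZ0]]) (simp add: Z0_def)
   have pb0: "plot N (q + ?n) Z0 ?b"
    by (rule plot_compose[OF N inverse_chart_plot[OF N A] oZ0 smooth_psnd[OF oZ0]]) (simp add: Z0_def)
   let ?H = "D.hbox (\<pi> ` W0)"
   \<comment> \<open>Two open conditions: the point of \<open>E\<close> stays in the patch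
     \<open>We\<close>, on which \<open>\<pi>\<close> is injective, and the source stays where
     \<open>Phi\<close> is defined.\<close>
   define Z where "Z = {z\<in>Z0. ?a0 z \<in> We} \<inter> {z\<in>Z0. ?b z \<in> ?H}"
   have oZ: "openin (EN (q + ?n)) Z"
    unfolding Z_def using plot_preimage_open[OF pa0, of We] plot_preimage_open[OF pb0 D.openin_hbox[OF D.W0D(2)]] oWe by auto
   have ZZ: "Z \<subseteq> Z0" by (auto simp: Z_def)
   have pa: "plot ?X (q + ?n) Z ?a0" and pb: "plot N (q + ?n) Z ?b"
    using plot_subset[OF pa0 oZ ZZ] plot_subset[OF pb0 oZ ZZ] by blast+
   have bH: "?b z \<in> ?H" if "z \<in> Z" for z using that by (simp add: Z_def)
   have ps: "plot M (q + ?n) Z (%z. s (?b z))" by (rule smooth_map_plot[OF N M sm pb])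
   have p\<pi>: "plot (NF x0) (q + ?n) Z (%z. \<pi> (?a0 z))" using pa unfolding pX by (simp add: o_def)
   \<comment> \<open>The target is now forced: its model coordinate is the projection of
     \<open>?a0 z\<close>, and it lies over the base point of the source.\<close>
   have pA: "plot N (q + ?n) Z (%z. k (\<pi> (?a0 z), s (?b z)))"
    by (rule p2[OF p\<pi> ps]) (use D.hboxD(2)[OF bH] in blast)
   have \<pi>T: "\<pi> (?a0 z) \<in> topspace (Fib N s x0)" if "z \<in> Z" for z using plot_in_topspace[OF p\<pi> that] by (simp only: NF(2))
   have z0: "c' g' \<in> Z0" "?a0 (c' g') = e" "?b (c' g') = arrow_src g'"
   proof -
    have pf: "pfst q (c' g') = c e" unfolding c'_def e_def[symmetric] by (rule pfst_pjoin) (rule tail[OF d(2)])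
    have "c' g' \<in> ?T" using cA(7)[OF d(3)] by (simp add: topspace_Euclidean_space c'_def pjoin_def)
    then show "c' g' \<in> Z0" unfolding Z0_def using pf W(2) d(3) by (simp add: c'_def)
    show "?a0 (c' g') = e" unfolding pf by (rule W(4))
    show "?b (c' g') = arrow_src g'" using cA(4)[OF d(3)] by (simp add: c'_def)
   qed
   have z0Z: "c' g' \<in> Z" using z0 We(1) d(1) by (simp add: Z_def D.dom_def)
   \<comment> \<open>The lifted arrows are kept where \<open>Phi\<close> takes values in
     \<open>We\<close>, so that \<open>Phi\<close> can be identified from its projection
     alone.\<close>
   have oC: "openin PT (B \<inter> {g\<in>D.dom. D.Phi g \<in> We})" using oB D.openin_Phi[OF oWe] by blast
   obtain V \<theta> where V: "c' g' \<in> V" "V \<subseteq> Z" "plot PN (q + ?n) V \<theta>" "\<theta> (c' g') = g'"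
    "\<theta> ` V \<subseteq> B \<inter> {g\<in>D.dom. D.Phi g \<in> We}"
    "!!z. z \<in> V ==> arrow_tgt (\<theta> z) = k (\<pi> (?a0 z), s (?b z))" "!!z. z \<in> V ==> arrow_src (\<theta> z) = ?b z"
   proof (rule PN_lift[OF pA pb _ _ oC z0Z])
    show "s (k (\<pi> (?a0 z), s (?b z))) = s (?b z)" if "z \<in> Z" for z
     by (rule D.trD(8)[OF \<pi>T[OF that] D.hboxD(2)[OF bH[OF that]]])
    show "g' \<in> B \<inter> {g\<in>D.dom. D.Phi g \<in> We}" using g' d(1) We(1) by (simp add: e_def)
    show "k (\<pi> (?a0 (c' g')), s (?b (c' g'))) = arrow_tgt g'"
     unfolding z0 using Pm(2) D.trD(5)[OF Pm(3)] en(3) by (simp add: e_def)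
    show "?b (c' g') = arrow_src g'" by (rule z0(3))
   qed blast
   \<comment> \<open>\<open>Phi (\<theta> z)\<close> and \<open>?a0 z\<close> lie in
     \<open>We\<close> over the same point, hence are equal.\<close>
   have "c' (\<theta> z) = z" if z: "z \<in> V" for z
   proof -
    have zZ: "z \<in> Z" using z V(2) by blast
    have \<theta>z: "\<theta> z \<in> D.dom" "D.Phi (\<theta> z) \<in> We" using V(5) z by auto
    have "\<pi> (D.Phi (\<theta> z)) = \<pi> (?a0 z)"
     unfolding D.Phi_mem(2)[OF \<theta>z(1)] V(6)[OF z] by (rule D.trD(7)[OF \<pi>T[OF zZ] D.hboxD(2)[OF bH[OF zZ]]])
    then have "D.Phi (\<theta> z) = ?a0 z" using We_inj[OF \<theta>z(2)] We_inj[of "?a0 z"] zZ by (simp add: Z_def)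
    moreover have "c (?a0 z) = pfst q z" by (rule W(5)) (use zZ in "simp add: Z_def Z0_def")
    moreover have "\<phi> (?b z) = psnd q z" by (rule f_inv_into_f) (use zZ in "simp add: Z_def Z0_def")
    ultimately show ?thesis by (simp add: c'_def V(7)[OF z])
   qed
   then have "section_at PN (q + ?n) B c' g' V \<theta>" using V(1,3-5) unfolding section_at_def by blast
   then show ?thesis by blast
  qed
  ultimately have "subm PN (q + ?n) B c'" unfolding subm_def by blast
  moreover have "saturated PT lf B"
  proof -
   have "B = {g\<in>D.dom. D.Phi g \<in> O1} \<inter> {g\<in>topspace PT. arrow_src g \<in> A}" by (auto simp: B_def D.dom_def)
   then show ?thesis using D.saturated_Phi[OF sat] saturated_src[of A] unfolding saturated_def by blast
  qed
  moreover have "\<forall>g1\<in>B. \<forall>g2\<in>B. c' g1 = c' g2 \<longleftrightarrow> lf g1 = lf g2"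
  proof (intro ballI)
   fix g1 g2 assume "g1 \<in> B" "g2 \<in> B"
   then have d: "g1 \<in> D.dom" "D.Phi g1 \<in> O1" "arrow_src g1 \<in> A" "g2 \<in> D.dom" "D.Phi g2 \<in> O1" "arrow_src g2 \<in> A"
    by (auto simp: B_def)
   have "c' g1 = c' g2 \<longleftrightarrow> c (D.Phi g1) = c (D.Phi g2) & \<phi> (arrow_src g1) = \<phi> (arrow_src g2)"
   proof (intro iffI conjI)
    have p: "pfst q (c' g1) = c (D.Phi g1)" "pfst q (c' g2) = c (D.Phi g2)"
     "psnd q (c' g1) = \<phi> (arrow_src g1)" "psnd q (c' g2) = \<phi> (arrow_src g2)"
     unfolding c'_def using tail[OF d(2)] tail[OF d(5)] by (simp_all add: pfst_pjoin)
    assume "c' g1 = c' g2"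
    then show "c (D.Phi g1) = c (D.Phi g2)" "\<phi> (arrow_src g1) = \<phi> (arrow_src g2)" using p by simp_all
   qed (simp add: c'_def)
   also have "\<dots> \<longleftrightarrow> arrow_src g1 = arrow_src g2 & ?le (D.Phi g1) = ?le (D.Phi g2)"
    using cl[OF d(2,5)] cA(3) d(3,6) by (auto dest: inj_onD)
   also have "\<dots> \<longleftrightarrow> lf g1 = lf g2" using D.leaf_Phi_iff[OF d(1,4)] by simp
   finally show "c' g1 = c' g2 \<longleftrightarrow> lf g1 = lf g2" .
  qed
  moreover have "g \<in> B" using gd O1(1) A0(2) by (simp add: B_def flip: y_def)
  ultimately show ?thesis unfolding leaf_chart_def PN(2) by (intro exI[of _ B] exI[of _ c'] conjI)
  qed
 qed
 moreover have "separated_quot PT lf"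
  unfolding separated_quot_def
 proof (intro ballI impI)
  fix g g' assume gT: "g \<in> topspace PT" "g' \<in> topspace PT" "lf g \<noteq> lf g'"
  \<comment> \<open>Leaves with different sources are separated by the Hausdorff property of
    \<open>N\<close>. With equal sources both arrows lie in one domain of \<open>Phi\<close>, and
    separating sets are pulled back from \<open>E\<close>.\<close>
  show "\<exists>A B. openin PT A & openin PT B & saturated PT lf A & saturated PT lf B & g \<in> A & g' \<in> B & A \<inter> B = {}"
  proof (cases "arrow_src g = arrow_src g'")
   case False
   then obtain A B where AB: "openin (mtop N) A" "openin (mtop N) B" "arrow_src g \<in> A" "arrow_src g' \<in> B" "disjnt A B"
    using HN arrow_ends(1)[OF gT(1)] arrow_ends(1)[OF gT(2)] unfolding Hausdorff_space_def by metis
   let ?p = "%A. {g\<in>topspace PT. arrow_src g \<in> A}"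
   have "?p A \<inter> ?p B = {}" "g \<in> ?p A" "g' \<in> ?p B" using AB gT by (auto simp: disjnt_iff)
   then show ?thesis
    using openin_src[OF AB(1)] openin_src[OF AB(2)] saturated_src[of A] saturated_src[of B]
    by (intro exI[of _ "?p A"] exI[of _ "?p B"] conjI)
  next
   case True
   define y where "y = arrow_src g"
   have y: "y \<in> topspace (mtop N)" using arrow_ends(1)[OF gT(1)] by (simp add: y_def)
   show ?thesis
   proof (rule developing_at[OF x0 uc y])
    fix U h k W0 \<rho>0
    assume D: "developing N (mtop M) s (Fib N s x0) U h k E \<pi> W0 \<rho>0 F (fiber_fol N F s x0)"
     and yU: "y \<in> preim N s U" "fst (h y) \<in> \<pi> ` W0"
    interpret D: developing N "mtop M" s "Fib N s x0" U h k E \<pi> W0 \<rho>0 F "fiber_fol N F s x0" by (rule D)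
    have d: "g \<in> D.dom" "g' \<in> D.dom" using gT yU True by (auto simp: D.dom_def D.hbox_def y_def)
    have "?le (D.Phi g) \<noteq> ?le (D.Phi g')" using D.leaf_Phi_iff[OF d] gT(3) True by blast
    from sep[unfolded separated_quot_def, rule_format, OF D.Phi_mem(1)[OF d(1)] D.Phi_mem(1)[OF d(2)] this]
    obtain A B where AB: "openin E A" "openin E B" "saturated E ?le A" "saturated E ?le B"
     "D.Phi g \<in> A" "D.Phi g' \<in> B" "A \<inter> B = {}" by (elim exE conjE)
    let ?p = "%A. {g\<in>D.dom. D.Phi g \<in> A}"
    have "?p A \<inter> ?p B = {}" "g \<in> ?p A" "g' \<in> ?p B" using AB d by auto
    then show ?thesis using D.openin_Phi[OF AB(1)] D.openin_Phi[OF AB(2)] D.saturated_Phi[OF AB(3)] D.saturated_Phi[OF AB(4)]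
     by (intro exI[of _ "?p A"] exI[of _ "?p B"] conjI)
   qed
  qed
 qed
 ultimately have "simple_quot PN lf" unfolding simple_quot_def PN(2) by blast
 then show ?thesis using strictly_simple_Pi by blast
qed

end

theorem theorem3p3:
  fixes N :: "'a mfd" and M :: "'b mfd" and F :: "'a topology" and s :: "'a \<Rightarrow> 'b"
  assumes "locally_trivial_foliation_bundle N F M s"
    and "\<And>x. x \<in> topspace (mtop M) \<Longrightarrow> connected_space (subtopology (mtop N) (fiber N s x))"
  shows "(developable_bundle N F M s \<longleftrightarrow> strictly_simple (Pi_mfd N M s) (Pi_fol N F s)) \<and>
         (strictly_simple (Pi_mfd N M s) (Pi_fol N F s) \<longleftrightarrow>
           (\<forall>U \<sigma>. local_section N M s U \<sigma> \<longrightarrow>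
              strictly_simple (Pi_sigma_mfd N M s U \<sigma>) (Pi_sigma_fol N F s U \<sigma>)))"
proof (cases "topspace (mtop N) = {}")
 case True
 \<comment> \<open>Without points there are no fibers and no arrows, and all three conditions
   hold.\<close>
 have "topspace (mtop M) = {}" using assms(1) True unfolding locally_trivial_foliation_bundle_def by auto
 then have "developable_bundle N F M s" by (simp add: developable_bundle_def)
 moreover have P: "topspace (Pi_top N s) = {}" using arrow_ends(1)[of _ N s] True by blast
 then have "strictly_simple (Pi_mfd N M s) (Pi_fol N F s)"
  by (intro strictly_simple_empty) (simp_all add: Pi_mfd_def Pi_fol_topspace)
 moreover have "strictly_simple (Pi_sigma_mfd N M s U \<sigma>) (Pi_sigma_fol N F s U \<sigma>)" for U \<sigma>
  by (intro strictly_simple_empty)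
   (simp_all add: Pi_sigma_mfd_def Pi_sigma_fol_def Pi_mfd_def Pi_fol_topspace P)
 ultimately show ?thesis by blast
next
 case False
 interpret foliated_bundle N M F s by unfold_locales (use assms False in auto)
 show ?thesis using developable_imp_Pi Pi_imp_Pi_sigma Pi_sigma_imp_developable by blast
qed


end
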